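(* (Stability on advancing fronts.) For all $w\in L^2(C_j)^L$ and $i>j$, the semidiscrete global propagators satisfy $$\|R_h^{i,j}w\|_{C_i}\le\|w\|_{C_j}.$$
   Context: **Coefficients.** $\Omega\subset\mathbb R^N$ is open and bounded, with a conforming simplicial mesh $\Omega_h$. $\mathcal L^{(j)}$ ($1\le j\le N$) and $\mathcal G$ are bounded symmetric $\mathbb R^{L\times L}$-valued functions on $\Omega$, constant on each mesh element, $\mathcal G$ uniformly positive definite, and $\sum_j\partial_j\mathcal L^{(j)}=0$ in the sense of distributions. $g(u)=\mathcal Gu$; $f(u)$ is the $L\times N$ matrix with columns $\mathcal L^{(j)}u$. $\mathcal D^{(\nu)}=\sum_j\nu_j\mathcal L^{(j)}$, and $\mathcal D=\mathcal D^{(n)}$ with $n$ the outward unit normal on the boundary considered. $c$ is the largest $|\lambda|$ with $\mathcal D^{(\nu)}(x)e=\lambda\mathcal G(x)e$, $e\ne0$, over all $x$ and unit $\nu$; $\hat c>c$ is fixed. **Layers and tents.** There are continuous functions $0\equiv\varphi_0\le\varphi_1\le\dots\le\varphi_m\equiv T$ on $\Omega$, piecewise linear with respect to $\Omega_h$, all satisfying the causality condition $\|\operatorname{grad}_x\varphi_i\|_2\le1/\hat c$. $C_i=\{(x,\varphi_i(x)):x\in\Omega\}$; functions on $C_i$ are identified with functions of $x\in\Omega$. For each $i\ge1$, $V_i$ is a set of mesh vertices whose vertex patches pairwise share no element, and $\varphi_i=\varphi_{i-1}$ at all mesh vertices not in $V_i$. For $\mathtt v\in V_i$, $\Omega^{\mathtt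 v}$ is the vertex patch, $\Omega_h^{\mathtt v}$ its set of elements, and the tent pitched at $\mathtt v$ in layer $i$ has $\varphi_{\rm bot}=\varphi_{i-1}|_{\Omega^{\mathtt v}}$, $\varphi_{\rm top}=\varphi_i|_{\Omega^{\mathtt v}}$, $\delta=\varphi_{\rm top}-\varphi_{\rm bot}$ (vanishing on $\partial\Omega^{\mathtt v}\setminus\partial\Omega$). **Front norm.** $\|w\|_{C_i}^2=\int_\Omega\big[g(w(x,\varphi_i(x)))-f(w(x,\varphi_i(x)))\operatorname{grad}_x\varphi_i(x)\big]\cdot w(x,\varphi_i(x))\,dx$. **Tent operators.** $(\cdot,\cdot)_{\mathtt v}$ is the $L^2(\Omega^{\mathtt v})^L$ inner product; $V_h^{\mathtt v}=\{v:v|_K\in P_p(K)^L,\ K\in\Omega_h^{\mathtt v}\}$, $p\ge0$; $P_h$ is the $L^2$-orthogonal projection onto $V_h^{\mathtt v}$. $M_0w=\mathcal Gw-\sum_j(\partial_j\varphi_{\rm bot})\mathcal L^{(j)}w$, $M_1w=\sum_j(\partial_j\delta)\mathcal L^{(j)}w$, $M(\tau)=M_0-\tau M_1$. With $S$ bounded and single-valued on interior facets, $B$ bounded on $\partial\Omega$ ($\mathbb R^{L\times L}$-valued), $S+S^t\ge0$, $B+B^t\ge0$, $a(w,v)=\sum_{K\in\Omega_h^{\mathtt v}}\big[\sum_j(\delta\mathcal L^{(j)}w,\partial_jv)_K-(\delta\hat F^n_w,v)_{\partial K}\big]$, where $\hat F_w^n=\mathcal D\,\frac12(w+w_o)+S(w-w_o)$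 on $\partial K\setminus\partial\Omega$ ($w_o$ the trace from the neighboring element; facets in $\partial\Omega^{\mathtt v}\setminus\partial\Omega$ contribute nothing) and $\hat F_w^n=\frac12(\mathcal D+B)w$ on $\partial K\cap\partial\Omega$. For $v_h^0\in V_h^{\mathtt v}$, let $v_h\in C^1([0,1],V_h^{\mathtt v})$ solve $(\partial_{\hat t}[M(\hat t)v_h],w)_{\mathtt v}=a(v_h(\hat t),w)$ for all $w\in V_h^{\mathtt v}$, $0<\hat t\le1$, $v_h(0)=v_h^0$; $R^{\rm sem}_h(\tau)v_h^0=v_h(\tau)$. **Propagators.** $R_h^{i,i-1}:L^2(C_{i-1})^L\to L^2(C_i)^L$ is $(R_h^{i,i-1}w)(x)=w(x)$ where $\varphi_i(x)=\varphi_{i-1}(x)$ outside the patches of $V_i$, and $R_h^{i,i-1}w|_{\Omega^{\mathtt v}}=R^{\rm sem}_h(1)P_h(w|_{\Omega^{\mathtt v}})$ for $\mathtt v\in V_i$; $R_h^{i,j}=R_h^{i,i-1}\circ\cdots\circ R_h^{j+1,j}$ for $i>j\ge0$. *)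

theory Defs
  imports "HOL-Analysis.Analysis"
begin

definition partial :: "'n::finite \<Rightarrow> (real^'n \<Rightarrow> 'b::real_normed_vector) \<Rightarrow> real^'n \<Rightarrow> 'b" where
  "partial j f x = frechet_derivative f (at x) (axis j 1)"

definition grad :: "(real^'n::finite \<Rightarrow> real) \<Rightarrow> real^'n \<Rightarrow> real^'n" where
  "grad f x = (\<chi> j. partial j f x)"

text \<open>Infinitely differentiable: every iterated partial derivative is itself differentiable.\<close>

definition smooth :: "(real^'n::finite \<Rightarrow> real) \<Rightarrow> bool" where
  "smooth \<psi> \<longleftrightarrow> (\<forall>js x. foldr partial js \<psi> differentiable (at x))"

definition test_function :: "(real^'n::finite) set \<Rightarrow> (real^'n \<Rightarrow> real) \<Rightarrow> bool" where
  "test_function \<Omega> \<psi> \<longleftrightarrow> smooth \<psi> \<and>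
     compact (closure {x. \<psi> x \<noteq> 0}) \<and> closure {x. \<psi> x \<noteq> 0} \<subseteq> \<Omega>"

definition divergence_free ::
    "(real^'n::finite) set \<Rightarrow> ('n \<Rightarrow> real^'n \<Rightarrow> real^'l^'l::finite) \<Rightarrow> bool" where
  "divergence_free \<Omega> \<L> \<longleftrightarrow>
     (\<forall>\<psi>. test_function \<Omega> \<psi> \<longrightarrow> (\<Sum>j\<in>UNIV. LINT x:\<Omega>|lebesgue. partial j \<psi> x *\<^sub>R \<L> j x) = 0)"

definition square_integrable :: "(real^'n::finite) set \<Rightarrow> (real^'n \<Rightarrow> real^'l::finite) \<Rightarrow> bool" where
  "square_integrable \<Omega> w \<longleftrightarrow>
     w \<in> borel_measurable (lebesgue_on \<Omega>) \<and> integrable (lebesgue_on \<Omega>) (\<lambda>x. (norm (w x))\<^sup>2)"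

definition positive_semidef :: "real^'l^'l::finite \<Rightarrow> bool" where
  "positive_semidef A \<longleftrightarrow> (\<forall>e. 0 \<le> (A *v e) \<bullet> e)"

text \<open>
  Elements are closed simplices, and \<open>\<Omega>\<close> may differ from the union of their interiors by a subset
  of the (null) element boundaries.  Data that are only determined almost everywhere, such as
  elementwise constant coefficients, are constrained on \<open>open_elements\<close> only, and elementwise
  volume integrals run over the element interiors.
\<close>

definition conforming_mesh :: "(real^'n::finite) set \<Rightarrow> (real^'n) set set \<Rightarrow> bool" where
  "conforming_mesh \<Omega> \<T> \<longleftrightarrow>
     triangulation \<T> \<and> (\<forall>K\<in>\<T>. int CARD('n) simplex K \<and> interior K \<subseteq> \<Omega>) \<and> closure \<Omega> = \<Union>\<T>"

definition open_elements :: "(real^'n::finite) set set \<Rightarrow> (real^'n) set" where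
  "open_elements \<K> = (\<Union>K\<in>\<K>. interior K)"

definition skeleton :: "(real^'n::finite) set set \<Rightarrow> (real^'n) set" where
  "skeleton \<K> = (\<Union>K\<in>\<K>. frontier K)"

definition elementwise_constant :: "(real^'n::finite) set set \<Rightarrow> (real^'n \<Rightarrow> 'b) \<Rightarrow> bool" where
  "elementwise_constant \<T> f \<longleftrightarrow> (\<forall>K\<in>\<T>. \<exists>a. \<forall>x\<in>interior K. f x = a)"

definition piecewise_linear :: "(real^'n::finite) set set \<Rightarrow> (real^'n \<Rightarrow> real) \<Rightarrow> bool" where
  "piecewise_linear \<T> \<phi> \<longleftrightarrow> (\<forall>K\<in>\<T>. \<exists>b a. \<forall>x\<in>K. \<phi> x = b \<bullet> x + a)"

definition mesh_vertices :: "(real^'n::finite) set set \<Rightarrow> (real^'n) set" where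
  "mesh_vertices \<T> = {v. \<exists>K\<in>\<T>. v extreme_point_of K}"

definition patch :: "(real^'n::finite) set set \<Rightarrow> real^'n \<Rightarrow> (real^'n) set set" where
  "patch \<T> v = {K\<in>\<T>. v extreme_point_of K}"

definition outward_normal :: "(real^'n::finite) set \<Rightarrow> (real^'n) set \<Rightarrow> real^'n" where
  "outward_normal K F = (THE n. norm n = 1 \<and> (\<forall>x\<in>F. \<forall>y\<in>K. n \<bullet> (y - x) \<le> 0))"

text \<open>
  The (N-1)-dimensional Lebesgue measure on a hyperplane \<open>H\<close>: the slab of thickness 1 around \<open>H\<close>
  is projected orthogonally onto \<open>H\<close>, so that by Fubini the measure of \<open>A \<subseteq> H\<close> is the volume of
  the prism of height 1 over \<open>A\<close>.
\<close>

definition hyperplane_measure :: "(real^'n::finite) set \<Rightarrow> (real^'n) measure" where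
  "hyperplane_measure H =
     distr (restrict_space lborel {x. dist x (closest_point H x) \<le> 1/2}) borel (closest_point H)"

definition facet_integral :: "(real^'n::finite) set \<Rightarrow> (real^'n \<Rightarrow> real) \<Rightarrow> real" where
  "facet_integral F f = (LINT x:F|hyperplane_measure (affine hull F). f x)"

definition trace_from :: "(real^'n::finite) set \<Rightarrow> (real^'n \<Rightarrow> 'b::t2_space) \<Rightarrow> real^'n \<Rightarrow> 'b" where
  "trace_from K w x = Lim (at x within interior K) w"

definition normal_matrix ::
    "('n::finite \<Rightarrow> real^'n \<Rightarrow> real^'l^'l::finite) \<Rightarrow> real^'n \<Rightarrow> real^'n \<Rightarrow> real^'l^'l" where
  "normal_matrix \<L> \<nu> x = (\<Sum>j\<in>UNIV. (\<nu> $ j) *\<^sub>R \<L> j x)"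

text \<open>
  The supremum is attained: coefficients take finitely many values and the unit sphere is compact.
\<close>

definition max_wave_speed ::
    "(real^'n::finite) set set \<Rightarrow> (real^'n \<Rightarrow> real^'l^'l::finite) \<Rightarrow> ('n \<Rightarrow> real^'n \<Rightarrow> real^'l^'l) \<Rightarrow> real" where
  "max_wave_speed \<T> \<G> \<L> =
     Sup {\<bar>\<mu>\<bar> | \<mu> x \<nu> e. x \<in> open_elements \<T> \<and> norm \<nu> = 1 \<and> e \<noteq> 0 \<and>
                     normal_matrix \<L> \<nu> x *v e = \<mu> *\<^sub>R (\<G> x *v e)}"

definition flux ::
    "('n::finite \<Rightarrow> real^'n \<Rightarrow> real^'l^'l::finite) \<Rightarrow> real^'n \<Rightarrow> real^'l \<Rightarrow> real^'n^'l" where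
  "flux \<L> x u = (\<chi> l j. (\<L> j x *v u) $ l)"

definition front_norm ::
    "(real^'n::finite) set \<Rightarrow> (real^'n \<Rightarrow> real^'l^'l::finite) \<Rightarrow> ('n \<Rightarrow> real^'n \<Rightarrow> real^'l^'l)
     \<Rightarrow> (real^'n \<Rightarrow> real) \<Rightarrow> (real^'n \<Rightarrow> real^'l) \<Rightarrow> real" where
  "front_norm \<Omega> \<G> \<L> \<phi> w =
     sqrt (LINT x:\<Omega>|lebesgue. (\<G> x *v w x - flux \<L> x (w x) *v grad \<phi> x) \<bullet> w x)"

definition polynomial_le :: "nat \<Rightarrow> (real^'n::finite \<Rightarrow> 'b::real_vector) \<Rightarrow> bool" where
  "polynomial_le p q \<longleftrightarrow>
     (\<exists>c. \<forall>x. q x = (\<Sum>\<alpha> | (\<Sum>i\<in>UNIV. \<alpha> i) \<le> p. (\<Prod>i\<in>UNIV. (x $ i) ^ \<alpha> i) *\<^sub>R c (\<alpha> :: 'n \<Rightarrow> nat)))"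

text \<open>
  The broken polynomial space on a set \<open>\<K>\<close> of elements.  Requiring the value 0 off the open
  elements selects one representative from each almost-everywhere class.
\<close>

definition dg_space :: "(real^'n::finite) set set \<Rightarrow> nat \<Rightarrow> (real^'n \<Rightarrow> real^'l::finite) set" where
  "dg_space \<K> p =
     {v. (\<forall>K\<in>\<K>. \<exists>q. polynomial_le p q \<and> (\<forall>x\<in>interior K. v x = q x)) \<and>
         (\<forall>x. x \<notin> open_elements \<K> \<longrightarrow> v x = 0)}"

definition l2_inner ::
    "(real^'n::finite) set set \<Rightarrow> (real^'n \<Rightarrow> real^'l::finite) \<Rightarrow> (real^'n \<Rightarrow> real^'l) \<Rightarrow> real" where
  "l2_inner \<K> v w = (LINT x:open_elements \<K>|lebesgue. v x \<bullet> w x)"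

definition l2_projection ::
    "(real^'n::finite) set set \<Rightarrow> nat \<Rightarrow> (real^'n \<Rightarrow> real^'l::finite) \<Rightarrow> real^'n \<Rightarrow> real^'l" where
  "l2_projection \<K> p w =
     (THE u. u \<in> dg_space \<K> p \<and> (\<forall>z\<in>dg_space \<K> p. l2_inner \<K> (\<lambda>x. w x - u x) z = 0))"

definition M0 ::
    "(real^'n::finite \<Rightarrow> real^'l^'l::finite) \<Rightarrow> ('n \<Rightarrow> real^'n \<Rightarrow> real^'l^'l) \<Rightarrow> (real^'n \<Rightarrow> real)
     \<Rightarrow> real^'n \<Rightarrow> real^'l^'l" where
  "M0 \<G> \<L> \<phi>bot x = \<G> x - (\<Sum>j\<in>UNIV. partial j \<phi>bot x *\<^sub>R \<L> j x)"

definition M1 ::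
    "('n::finite \<Rightarrow> real^'n \<Rightarrow> real^'l^'l::finite) \<Rightarrow> (real^'n \<Rightarrow> real) \<Rightarrow> real^'n \<Rightarrow> real^'l^'l" where
  "M1 \<L> \<delta> x = (\<Sum>j\<in>UNIV. partial j \<delta> x *\<^sub>R \<L> j x)"

definition M_op ::
    "(real^'n::finite \<Rightarrow> real^'l^'l::finite) \<Rightarrow> ('n \<Rightarrow> real^'n \<Rightarrow> real^'l^'l)
     \<Rightarrow> (real^'n \<Rightarrow> real) \<Rightarrow> (real^'n \<Rightarrow> real) \<Rightarrow> real \<Rightarrow> real^'n \<Rightarrow> real^'l^'l" where
  "M_op \<G> \<L> \<phi>bot \<phi>top \<tau> x = M0 \<G> \<L> \<phi>bot x - \<tau> *\<^sub>R M1 \<L> (\<lambda>y. \<phi>top y - \<phi>bot y) x"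

text \<open>
  The numerical flux at \<open>x\<close> on the facet \<open>F\<close> of \<open>K\<close>, for the patch \<open>\<K>\<close>.  The last branch concerns
  the facets on the boundary of the patch that are not on the boundary of \<open>\<Omega>\<close>.
\<close>

definition neighbor :: "(real^'n::finite) set set \<Rightarrow> (real^'n) set \<Rightarrow> (real^'n) set \<Rightarrow> (real^'n) set" where
  "neighbor \<K> K F = (THE K'. K' \<in> \<K> \<and> K' \<noteq> K \<and> F facet_of K')"

definition numerical_flux ::
    "(real^'n::finite) set \<Rightarrow> (real^'n) set set \<Rightarrow> ('n \<Rightarrow> real^'n \<Rightarrow> real^'l^'l::finite)
     \<Rightarrow> (real^'n \<Rightarrow> real^'l^'l) \<Rightarrow> (real^'n \<Rightarrow> real^'l^'l)
     \<Rightarrow> (real^'n) set \<Rightarrow> (real^'n) set \<Rightarrow> (real^'n \<Rightarrow> real^'l) \<Rightarrow> real^'n \<Rightarrow> real^'l" where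
  "numerical_flux \<Omega> \<K> \<L> S B K F w x =
     (let D = trace_from K (normal_matrix \<L> (outward_normal K F)) x;
          wi = trace_from K w x;
          wo = trace_from (neighbor \<K> K F) w x
      in if x \<in> frontier \<Omega> then (1/2) *\<^sub>R ((D + B x) *v wi)
         else if \<exists>K'\<in>\<K>. K' \<noteq> K \<and> F facet_of K'
              then D *v ((1/2) *\<^sub>R (wi + wo)) + S x *v (wi - wo)
              else 0)"

definition dg_form ::
    "(real^'n::finite) set \<Rightarrow> (real^'n) set set \<Rightarrow> ('n \<Rightarrow> real^'n \<Rightarrow> real^'l^'l::finite)
     \<Rightarrow> (real^'n \<Rightarrow> real^'l^'l) \<Rightarrow> (real^'n \<Rightarrow> real^'l^'l) \<Rightarrow> (real^'n \<Rightarrow> real)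
     \<Rightarrow> (real^'n \<Rightarrow> real^'l) \<Rightarrow> (real^'n \<Rightarrow> real^'l) \<Rightarrow> real" where
  "dg_form \<Omega> \<K> \<L> S B \<delta> w v =
     (\<Sum>K\<in>\<K>. (\<Sum>j\<in>UNIV. LINT x:interior K|lebesgue. (\<delta> x *\<^sub>R (\<L> j x *v w x)) \<bullet> partial j v x)
           - (\<Sum>F | F facet_of K. facet_integral F
                (\<lambda>x. (\<delta> x *\<^sub>R numerical_flux \<Omega> \<K> \<L> S B K F w x) \<bullet> trace_from K v x)))"

text \<open>
  Continuous differentiability in the finite-dimensional space \<open>dg_space \<K> p\<close> is expressed
  pointwise in \<open>x\<close>; since all norms on that space are equivalent and point evaluations separate
  it, this is the same as continuous differentiability in norm.
\<close>

definition C1_curve :: "(real^'n::finite \<Rightarrow> real^'l::finite) set \<Rightarrow> (real \<Rightarrow> real^'n \<Rightarrow> real^'l) \<Rightarrow> bool" where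
  "C1_curve V v \<longleftrightarrow>
     (\<exists>v'. (\<forall>t\<in>{0..1}. v t \<in> V \<and> v' t \<in> V) \<and>
           (\<forall>x. (\<forall>t\<in>{0..1}. ((\<lambda>s. v s x) has_vector_derivative v' t x) (at t within {0..1})) \<and>
                continuous_on {0..1} (\<lambda>t. v' t x)))"

definition semidiscrete_solution ::
    "(real^'n::finite) set \<Rightarrow> (real^'n) set set \<Rightarrow> nat \<Rightarrow> (real^'n \<Rightarrow> real^'l^'l::finite)
     \<Rightarrow> ('n \<Rightarrow> real^'n \<Rightarrow> real^'l^'l) \<Rightarrow> (real^'n \<Rightarrow> real^'l^'l) \<Rightarrow> (real^'n \<Rightarrow> real^'l^'l)
     \<Rightarrow> (real^'n \<Rightarrow> real) \<Rightarrow> (real^'n \<Rightarrow> real) \<Rightarrow> (real^'n \<Rightarrow> real^'l)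
     \<Rightarrow> (real \<Rightarrow> real^'n \<Rightarrow> real^'l) \<Rightarrow> bool" where
  "semidiscrete_solution \<Omega> \<K> p \<G> \<L> S B \<phi>bot \<phi>top v0 v \<longleftrightarrow>
     C1_curve (dg_space \<K> p) v \<and> v 0 = v0 \<and>
     (\<forall>t\<in>{0<..1}. \<forall>w\<in>dg_space \<K> p.
        l2_inner \<K> (\<lambda>x. vector_derivative (\<lambda>s. M_op \<G> \<L> \<phi>bot \<phi>top s x *v v s x) (at t within {0..1})) w
        = dg_form \<Omega> \<K> \<L> S B (\<lambda>x. \<phi>top x - \<phi>bot x) (v t) w)"

text \<open>
  The solution exists and is unique when the fronts satisfy the causality condition, so the choice
  operator merely names it.
\<close>

definition R_sem ::
    "(real^'n::finite) set \<Rightarrow> (real^'n) set set \<Rightarrow> nat \<Rightarrow> (real^'n \<Rightarrow> real^'l^'l::finite)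
     \<Rightarrow> ('n \<Rightarrow> real^'n \<Rightarrow> real^'l^'l) \<Rightarrow> (real^'n \<Rightarrow> real^'l^'l) \<Rightarrow> (real^'n \<Rightarrow> real^'l^'l)
     \<Rightarrow> (real^'n \<Rightarrow> real) \<Rightarrow> (real^'n \<Rightarrow> real) \<Rightarrow> real \<Rightarrow> (real^'n \<Rightarrow> real^'l)
     \<Rightarrow> real^'n \<Rightarrow> real^'l" where
  "R_sem \<Omega> \<K> p \<G> \<L> S B \<phi>bot \<phi>top \<tau> v0 =
     (SOME v. semidiscrete_solution \<Omega> \<K> p \<G> \<L> S B \<phi>bot \<phi>top v0 v) \<tau>"

text \<open>
  \<open>V\<close> is the set of pitching vertices of the layer between the fronts \<open>\<phi>bot\<close> and \<open>\<phi>top\<close>.  Open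
  elements of different patches are disjoint, so the vertex is determined by \<open>x\<close>.
\<close>

definition layer_propagator ::
    "(real^'n::finite) set \<Rightarrow> (real^'n) set set \<Rightarrow> nat \<Rightarrow> (real^'n \<Rightarrow> real^'l^'l::finite)
     \<Rightarrow> ('n \<Rightarrow> real^'n \<Rightarrow> real^'l^'l) \<Rightarrow> (real^'n \<Rightarrow> real^'l^'l) \<Rightarrow> (real^'n \<Rightarrow> real^'l^'l)
     \<Rightarrow> (real^'n \<Rightarrow> real) \<Rightarrow> (real^'n \<Rightarrow> real) \<Rightarrow> (real^'n) set \<Rightarrow> (real^'n \<Rightarrow> real^'l)
     \<Rightarrow> real^'n \<Rightarrow> real^'l" where
  "layer_propagator \<Omega> \<T> p \<G> \<L> S B \<phi>bot \<phi>top V w x =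
     (if \<exists>v\<in>V. x \<in> open_elements (patch \<T> v)
      then let v = (THE v. v \<in> V \<and> x \<in> open_elements (patch \<T> v))
           in R_sem \<Omega> (patch \<T> v) p \<G> \<L> S B \<phi>bot \<phi>top 1 (l2_projection (patch \<T> v) p w) x
      else w x)"

definition propagator ::
    "(real^'n::finite) set \<Rightarrow> (real^'n) set set \<Rightarrow> nat \<Rightarrow> (real^'n \<Rightarrow> real^'l^'l::finite)
     \<Rightarrow> ('n \<Rightarrow> real^'n \<Rightarrow> real^'l^'l) \<Rightarrow> (real^'n \<Rightarrow> real^'l^'l) \<Rightarrow> (real^'n \<Rightarrow> real^'l^'l)
     \<Rightarrow> (nat \<Rightarrow> real^'n \<Rightarrow> real) \<Rightarrow> (nat \<Rightarrow> (real^'n) set) \<Rightarrow> nat \<Rightarrow> nat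
     \<Rightarrow> (real^'n \<Rightarrow> real^'l) \<Rightarrow> real^'n \<Rightarrow> real^'l" where
  "propagator \<Omega> \<T> p \<G> \<L> S B \<phi> V i j w =
     fold (\<lambda>k. layer_propagator \<Omega> \<T> p \<G> \<L> S B (\<phi> (k - 1)) (\<phi> k) (V k)) [j + 1..<i + 1] w"

end

theory Submission
  imports Defs
begin

text \<open>
  On one tent write \<open>M t\<close> for the front matrix, \<open>v\<close> for the semidiscrete solution and \<open>a\<close> for the
  spatial form. Since the coefficients are constant and symmetric on each element, the divergence
  theorem on a simplex gives \<open>2 a v v = - (M1 v, v) - (jump and boundary terms)\<close>. Here the
  centred fluxes cancel in pairs because a piecewise constant divergence-free field has continuous
  normal component across facets, and what remains is nonpositive as \<open>S + S^t \<ge> 0\<close> and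
  \<open>B + B^t \<ge> 0\<close>; no facet on the rim of the tent contributes because \<open>\<delta>\<close> vanishes there. As
  \<open>M' = - M1\<close>, the energy \<open>E t = (M t v, v)\<close> satisfies \<open>E' = 2 (\<partial>(M v), v) + (M1 v, v) = 2 a v v + (M1 v, v) \<le> 0\<close>.
  The initial projection does not increase the energy since \<open>M 0\<close> is constant on elements, hence maps
  the broken polynomial space to itself, and is positive definite by causality. At \<open>t = 0\<close> and
  \<open>t = 1\<close> the matrix \<open>M t\<close> is the one defining the norms on the two fronts, so summing over the tents
  of a layer and iterating over layers gives the claim.
\<close>

section \<open>Slabs, prisms and cones over a hyperplane\<close>

text \<open>The surface measure is given through slabs, so the divergence theorem is built from
  translations and dilations of Lebesgue measure: a simplex is a cone over each of its facets, and
  along a ray the formula is the fundamental theorem of calculus. \<open>divergence_free\<close> is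
  a distributional condition; it becomes a statement on single facets by testing with a small radial
  bump, whose half-space integrals follow from reflections. \<open>R_sem\<close> is defined by
  choice and \<open>l2_projection\<close> by unique description, so existence of the evolution, and
  existence and uniqueness of the projection, come before any estimate. The evolution is solved for
  \<open>u = M v\<close>: this removes the derivative of \<open>M\<close> from the equation and
  leaves a linear system with continuous coefficients. The energy is expanded in an orthonormal
  basis of the broken polynomial space, so that time derivatives fall on finite sums and never pass
  under an integral. Strict positivity of \<open>M t\<close> comes from the gap between
  \<open>max_wave_speed\<close> and \<open>chat\<close>; it serves both the inverse of
  \<open>M t\<close> and the projection estimate.\<close>

definition hyperplane_proj :: "'a::euclidean_space \<Rightarrow> real \<Rightarrow> 'a \<Rightarrow> 'a" where
  "hyperplane_proj n c x = x - (n \<bullet> x - c) *\<^sub>R n"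

lemma hyperplane_proj_inner: "norm n = 1 \<Longrightarrow> n \<bullet> hyperplane_proj n c x = c"
  by (simp add: hyperplane_proj_def inner_diff_right dot_square_norm)

lemma borel_measurable_hyperplane_proj [measurable]: "hyperplane_proj n c \<in> borel_measurable borel"
  unfolding hyperplane_proj_def by measurable

lemma closest_point_hyperplane:
  fixes n :: "'a::euclidean_space"
  assumes n: "norm n = 1"
  shows "closest_point {y. n \<bullet> y = c} x = hyperplane_proj n c x"
proof -
  have "hyperplane_proj n c x = closest_point {y. n \<bullet> y = c} x"
  proof (rule closest_point_unique)
    show "convex {y. n \<bullet> y = c}" by (rule convex_hyperplane)
    show "closed {y. n \<bullet> y = c}" by (rule closed_hyperplane)
    show "hyperplane_proj n c x \<in> {y. n \<bullet> y = c}" using hyperplane_proj_inner[OF n] by simp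
    show "\<forall>z\<in>{y. n \<bullet> y = c}. dist x (hyperplane_proj n c x) \<le> dist x z"
    proof
      fix z assume "z \<in> {y. n \<bullet> y = c}"
      then have "n \<bullet> x - c = n \<bullet> (x - z)" by (simp add: inner_diff_right)
      then have "\<bar>n \<bullet> x - c\<bar> \<le> norm (x - z)"
        using Cauchy_Schwarz_ineq2[of n "x - z"] n by simp
      then show "dist x (hyperplane_proj n c x) \<le> dist x z"
        by (simp add: dist_norm hyperplane_proj_def n)
    qed
  qed
  then show ?thesis by simp
qed

lemma sets_hyperplane_measure [simp, measurable_cong]: "sets (hyperplane_measure H) = sets borel"
  by (simp add: hyperplane_measure_def)

text \<open>With a unit normal the distance to the closest point is
  \<open>\<bar>n \<bullet> x - c\<bar>\<close>, so the slab definition of the surface measure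
  becomes a plain volume integral. The later facts on the measure are reduced through this identity
  to facts on Lebesgue measure.\<close>

lemma nn_integral_hyperplane_measure:
  fixes n :: "real^'n::finite"
  assumes n: "norm n = 1" and g [measurable]: "g \<in> borel_measurable borel"
  shows "(\<integral>\<^sup>+ y. g y \<partial>hyperplane_measure {y. n \<bullet> y = c}) =
    (\<integral>\<^sup>+ x. g (hyperplane_proj n c x) * indicator {x. \<bar>n \<bullet> x - c\<bar> \<le> 1/2} x \<partial>lborel)"
proof -
  let ?A = "{x. dist x (closest_point {y. n \<bullet> y = c} x) \<le> 1/2}"
  have A: "?A = {x. \<bar>n \<bullet> x - c\<bar> \<le> 1/2}"
    using n by (simp add: closest_point_hyperplane dist_norm hyperplane_proj_def)
  have mA [measurable]: "?A \<in> sets borel" unfolding A by measurable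
  have cp: "closest_point {y. n \<bullet> y = c} = hyperplane_proj n c"
    using n by (auto simp: closest_point_hyperplane)
  have "(\<integral>\<^sup>+ y. g y \<partial>hyperplane_measure {y. n \<bullet> y = c}) =
    (\<integral>\<^sup>+ x. g (hyperplane_proj n c x) \<partial>restrict_space lborel ?A)"
    unfolding hyperplane_measure_def cp
    by (rule nn_integral_distr) (auto intro!: measurable_restrict_space1)
  also have "\<dots> = (\<integral>\<^sup>+ x. g (hyperplane_proj n c x) * indicator ?A x \<partial>lborel)"
    by (rule nn_integral_restrict_space) (use mA in auto)
  finally show ?thesis unfolding A .
qed

lemma nn_integral_translate:
  fixes f :: "'a::euclidean_space \<Rightarrow> ennreal"
  assumes [measurable]: "f \<in> borel_measurable borel"
  shows "(\<integral>\<^sup>+ x. f (x + t) \<partial>lborel) = (\<integral>\<^sup>+ x. f x \<partial>lborel)"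
proof -
  have *: "(lborel::'a measure) = distr lborel borel ((+) t)"
    using lborel_affine[of 1 t] by (simp add: density_1)
  show ?thesis by (subst (2) *) (simp add: nn_integral_distr add.commute)
qed

lemma nn_integral_scale:
  fixes f :: "real^'n::finite \<Rightarrow> ennreal"
  assumes [measurable]: "f \<in> borel_measurable borel" and r: "r > 0"
  shows "ennreal (r ^ CARD('n)) * (\<integral>\<^sup>+ x. f (r *\<^sub>R x) \<partial>lborel) = (\<integral>\<^sup>+ x. f x \<partial>lborel)"
proof -
  have *: "(lborel::(real^'n) measure) = density (distr lborel borel (\<lambda>x. r *\<^sub>R x)) (\<lambda>_. ennreal (r ^ CARD('n)))"
    using lborel_affine[of r "0::real^'n"] r by simp
  show ?thesis by (subst (2) *) (simp add: nn_integral_density nn_integral_distr nn_integral_cmult)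
qed

text \<open>
  After the substitution \<open>s \<mapsto> s + (n \<bullet> x - c)\<close> the projection disappears and only the
  translation invariance of Lebesgue measure is used; no rotation is needed.
\<close>

lemma nn_integral_slices:
  fixes n :: "real^'n::finite"
  assumes n: "norm n = 1" and f [measurable]: "f \<in> borel_measurable borel"
  shows "(\<integral>\<^sup>+ x. f x \<partial>lborel) =
    (\<integral>\<^sup>+ s. \<integral>\<^sup>+ y. f (y + s *\<^sub>R n) \<partial>hyperplane_measure {y. n \<bullet> y = c} \<partial>lborel)" (is ?A)
    and "(\<integral>\<^sup>+ x. f x \<partial>lborel) =
    (\<integral>\<^sup>+ y. \<integral>\<^sup>+ s. f (y + s *\<^sub>R n) \<partial>lborel \<partial>hyperplane_measure {y. n \<bullet> y = c})" (is ?B)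
proof -
  let ?S = "{x::real^'n. \<bar>n \<bullet> x - c\<bar> \<le> 1/2}"
  have "(\<integral>\<^sup>+ y. \<integral>\<^sup>+ s. f (y + s *\<^sub>R n) \<partial>lborel \<partial>hyperplane_measure {y. n \<bullet> y = c})
    = (\<integral>\<^sup>+ x. (\<integral>\<^sup>+ s. f (hyperplane_proj n c x + s *\<^sub>R n) \<partial>lborel) * indicator ?S x \<partial>lborel)"
    by (rule nn_integral_hyperplane_measure[OF n]) measurable
  also have "\<dots> = (\<integral>\<^sup>+ x. (\<integral>\<^sup>+ s. f (x + s *\<^sub>R n) \<partial>lborel) * indicator ?S x \<partial>lborel)"
  proof (rule nn_integral_cong)
    fix x :: "real^'n"
    have "(\<integral>\<^sup>+ s. f (x + s *\<^sub>R n) \<partial>lborel) = (\<integral>\<^sup>+ s. f (x + (s + (c - n \<bullet> x)) *\<^sub>R n) \<partial>lborel)"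
      by (rule nn_integral_translate[symmetric]) measurable
    also have "\<dots> = (\<integral>\<^sup>+ s. f (hyperplane_proj n c x + s *\<^sub>R n) \<partial>lborel)"
      by (rule nn_integral_cong) (simp add: hyperplane_proj_def algebra_simps)
    finally show "(\<integral>\<^sup>+ s. f (hyperplane_proj n c x + s *\<^sub>R n) \<partial>lborel) * indicator ?S x =
      (\<integral>\<^sup>+ s. f (x + s *\<^sub>R n) \<partial>lborel) * indicator ?S x" by simp
  qed
  also have "\<dots> = (\<integral>\<^sup>+ x. \<integral>\<^sup>+ s. f (x + s *\<^sub>R n) * indicator ?S x \<partial>lborel \<partial>lborel)"
    by (rule nn_integral_cong) (simp add: nn_integral_multc)
  also have "\<dots> = (\<integral>\<^sup>+ s. \<integral>\<^sup>+ x. f (x + s *\<^sub>R n) * indicator ?S x \<partial>lborel \<partial>lborel)"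
    by (rule lborel_pair.Fubini'[symmetric]) measurable
  also have "\<dots> = (\<integral>\<^sup>+ s. \<integral>\<^sup>+ x. f x * indicator ?S (x - s *\<^sub>R n) \<partial>lborel \<partial>lborel)"
  proof (rule nn_integral_cong)
    fix s :: real
    have "(\<integral>\<^sup>+ x. f (x + s *\<^sub>R n) * indicator ?S (x + s *\<^sub>R n - s *\<^sub>R n) \<partial>lborel) =
       (\<integral>\<^sup>+ x. f x * indicator ?S (x - s *\<^sub>R n) \<partial>lborel)"
      by (rule nn_integral_translate[of "\<lambda>x. f x * indicator ?S (x - s *\<^sub>R n)"]) measurable
    then show "(\<integral>\<^sup>+ x. f (x + s *\<^sub>R n) * indicator ?S x \<partial>lborel) =
       (\<integral>\<^sup>+ x. f x * indicator ?S (x - s *\<^sub>R n) \<partial>lborel)" by simp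
  qed
  also have "\<dots> = (\<integral>\<^sup>+ x. \<integral>\<^sup>+ s. f x * indicator ?S (x - s *\<^sub>R n) \<partial>lborel \<partial>lborel)"
    by (rule lborel_pair.Fubini') measurable
  also have "\<dots> = (\<integral>\<^sup>+ x. f x \<partial>lborel)"
  proof (rule nn_integral_cong)
    fix x :: "real^'n"
    \<comment> \<open>For fixed \<open>x\<close> the shifts \<open>s\<close> that leave
      \<open>x - s n\<close> in the slab form an interval of length 1; this is where the thickness 1
      of the slab enters.\<close>
    have "(\<integral>\<^sup>+ s. f x * indicator ?S (x - s *\<^sub>R n) \<partial>lborel) =
      (\<integral>\<^sup>+ s. f x * indicator {n \<bullet> x - c - 1/2 .. n \<bullet> x - c + 1/2} s \<partial>lborel)"
    proof (rule nn_integral_cong)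
      fix s :: real
      have "n \<bullet> (x - s *\<^sub>R n) = n \<bullet> x - s"
        by (simp add: inner_diff_right dot_square_norm n)
      then have "\<bar>n \<bullet> (x - s *\<^sub>R n) - c\<bar> \<le> 1/2 \<longleftrightarrow> n \<bullet> x - c - 1/2 \<le> s \<and> s \<le> n \<bullet> x - c + 1/2"
        by arith
      then show "f x * indicator ?S (x - s *\<^sub>R n) =
        f x * indicator {n \<bullet> x - c - 1/2 .. n \<bullet> x - c + 1/2} s"
        by (simp add: indicator_def)
    qed
    also have "\<dots> = f x" by (simp add: nn_integral_cmult)
    finally show "(\<integral>\<^sup>+ s. f x * indicator ?S (x - s *\<^sub>R n) \<partial>lborel) = f x" .
  qed
  finally show ?B by simp
  have "(\<integral>\<^sup>+ s. \<integral>\<^sup>+ y. f (y + s *\<^sub>R n) \<partial>hyperplane_measure {y. n \<bullet> y = c} \<partial>lborel)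
     = (\<integral>\<^sup>+ s. \<integral>\<^sup>+ x. f (hyperplane_proj n c x + s *\<^sub>R n) * indicator ?S x \<partial>lborel \<partial>lborel)"
    by (rule nn_integral_cong, rule nn_integral_hyperplane_measure[OF n]) measurable
  also have "\<dots> = (\<integral>\<^sup>+ x. \<integral>\<^sup>+ s. f (hyperplane_proj n c x + s *\<^sub>R n) * indicator ?S x \<partial>lborel \<partial>lborel)"
    by (rule lborel_pair.Fubini') measurable
  also have "\<dots> = (\<integral>\<^sup>+ x. (\<integral>\<^sup>+ s. f (hyperplane_proj n c x + s *\<^sub>R n) \<partial>lborel) * indicator ?S x \<partial>lborel)"
    by (rule nn_integral_cong) (simp add: nn_integral_multc)
  also have "\<dots> = (\<integral>\<^sup>+ y. \<integral>\<^sup>+ s. f (y + s *\<^sub>R n) \<partial>lborel \<partial>hyperplane_measure {y. n \<bullet> y = c})"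
    by (rule nn_integral_hyperplane_measure[OF n, symmetric]) measurable
  finally show ?A using \<open>?B\<close> by simp
qed

text \<open>The projection is constant along \<open>n\<close>, so the thickness enters only as a
  factor. Other thicknesses than 1 arise when a slab is dilated.\<close>

lemma nn_integral_slab:
  fixes n :: "real^'n::finite"
  assumes n: "norm n = 1" and g [measurable]: "g \<in> borel_measurable borel" and t: "t > 0"
  shows "(\<integral>\<^sup>+ x. g (hyperplane_proj n c x) * indicator {x. \<bar>n \<bullet> x - c\<bar> \<le> t/2} x \<partial>lborel) =
    ennreal t * (\<integral>\<^sup>+ y. g y \<partial>hyperplane_measure {y. n \<bullet> y = c})" (is "?L = _")
proof -
  have "?L = (\<integral>\<^sup>+ s. \<integral>\<^sup>+ y. g (hyperplane_proj n c (y + s *\<^sub>R n)) *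
      indicator {x. \<bar>n \<bullet> x - c\<bar> \<le> t/2} (y + s *\<^sub>R n) \<partial>hyperplane_measure {y. n \<bullet> y = c} \<partial>lborel)"
    by (rule nn_integral_slices(1)[OF n]) measurable
  also have "\<dots> = (\<integral>\<^sup>+ s. (\<integral>\<^sup>+ y. g y \<partial>hyperplane_measure {y. n \<bullet> y = c}) * indicator {-t/2 .. t/2} s \<partial>lborel)"
  proof (rule nn_integral_cong)
    fix s :: real
    let ?f = "\<lambda>y. g (hyperplane_proj n c (y + s *\<^sub>R n)) * indicator {x. \<bar>n \<bullet> x - c\<bar> \<le> t/2} (y + s *\<^sub>R n)"
    have eq: "?f (hyperplane_proj n c x) = g (hyperplane_proj n c x) * indicator {-t/2..t/2} s" for x
    proof -
      have 1: "n \<bullet> (hyperplane_proj n c x + s *\<^sub>R n) = c + s"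
        by (simp add: inner_add_right hyperplane_proj_inner[OF n] dot_square_norm n)
      have 2: "hyperplane_proj n c (hyperplane_proj n c x + s *\<^sub>R n) = hyperplane_proj n c x"
        by (subst hyperplane_proj_def) (simp add: 1)
      show ?thesis unfolding 2 using 1 by (auto simp: indicator_def)
    qed
    have "(\<integral>\<^sup>+ y. ?f y \<partial>hyperplane_measure {y. n \<bullet> y = c}) =
       (\<integral>\<^sup>+ x. ?f (hyperplane_proj n c x) * indicator {x. \<bar>n \<bullet> x - c\<bar> \<le> 1/2} x \<partial>lborel)"
      by (rule nn_integral_hyperplane_measure[OF n]) measurable
    also have "\<dots> = (\<integral>\<^sup>+ y. g y * indicator {-t/2..t/2} s \<partial>hyperplane_measure {y. n \<bullet> y = c})"
      unfolding eq by (rule nn_integral_hyperplane_measure[OF n, symmetric]) measurable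
    also have "\<dots> = (\<integral>\<^sup>+ y. g y \<partial>hyperplane_measure {y. n \<bullet> y = c}) * indicator {-t/2..t/2} s"
      by (simp add: nn_integral_multc)
    finally show "(\<integral>\<^sup>+ y. ?f y \<partial>hyperplane_measure {y. n \<bullet> y = c}) =
       (\<integral>\<^sup>+ y. g y \<partial>hyperplane_measure {y. n \<bullet> y = c}) * indicator {-t/2..t/2} s" .
  qed
  also have "\<dots> = ennreal t * (\<integral>\<^sup>+ y. g y \<partial>hyperplane_measure {y. n \<bullet> y = c})"
    using t by (simp add: nn_integral_cmult mult.commute)
  finally show ?thesis .
qed

text \<open>The left side integrates \<open>g\<close> over the parallel hyperplane at level
  \<open>r * c\<close>. Dilating space contributes the power \<open>CARD('n)\<close> of
  \<open>r\<close>, and the slab pulled back by the dilation has thickness \<open>1 / r\<close>,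
  which lowers the exponent by one.\<close>

lemma nn_integral_hyperplane_scale:
  fixes n :: "real^'n::finite"
  assumes n: "norm n = 1" and g [measurable]: "g \<in> borel_measurable borel" and r: "r > 0"
  shows "(\<integral>\<^sup>+ y. g (y + ((r - 1) * c) *\<^sub>R n) \<partial>hyperplane_measure {y. n \<bullet> y = c}) =
    ennreal (r ^ (CARD('n) - 1)) * (\<integral>\<^sup>+ y. g (r *\<^sub>R y) \<partial>hyperplane_measure {y. n \<bullet> y = c})" (is "?L = ?R")
proof -
  let ?h = "\<lambda>x. g (hyperplane_proj n (r * c) x) * indicator {x. \<bar>n \<bullet> x - r * c\<bar> \<le> 1/2} x"
  have eq1: "hyperplane_proj n c x + ((r - 1) * c) *\<^sub>R n = hyperplane_proj n (r * c) (x + ((r - 1) * c) *\<^sub>R n)"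
    for x by (simp add: hyperplane_proj_def inner_add_right dot_square_norm n algebra_simps)
  have eq2: "n \<bullet> (x + ((r - 1) * c) *\<^sub>R n) - r * c = n \<bullet> x - c" for x
    by (simp add: inner_add_right dot_square_norm n algebra_simps)
  have "?L = (\<integral>\<^sup>+ x. g (hyperplane_proj n c x + ((r - 1) * c) *\<^sub>R n) * indicator {x. \<bar>n \<bullet> x - c\<bar> \<le> 1/2} x \<partial>lborel)"
    by (rule nn_integral_hyperplane_measure[OF n]) measurable
  also have "\<dots> = (\<integral>\<^sup>+ x. ?h (x + ((r - 1) * c) *\<^sub>R n) \<partial>lborel)"
    unfolding eq1 by (rule nn_integral_cong) (simp add: indicator_def eq2)
  also have "\<dots> = (\<integral>\<^sup>+ x. ?h x \<partial>lborel)"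
    by (rule nn_integral_translate) measurable
  also have "\<dots> = ennreal (r ^ CARD('n)) * (\<integral>\<^sup>+ x. ?h (r *\<^sub>R x) \<partial>lborel)"
    by (rule nn_integral_scale[OF _ r, symmetric]) measurable
  also have "(\<integral>\<^sup>+ x. ?h (r *\<^sub>R x) \<partial>lborel) =
      (\<integral>\<^sup>+ x. g (r *\<^sub>R hyperplane_proj n c x) * indicator {x. \<bar>n \<bullet> x - c\<bar> \<le> (1/r)/2} x \<partial>lborel)"
  proof (rule nn_integral_cong)
    fix x :: "real^'n"
    have 1: "hyperplane_proj n (r * c) (r *\<^sub>R x) = r *\<^sub>R hyperplane_proj n c x"
      by (simp add: hyperplane_proj_def algebra_simps)
    have "\<bar>n \<bullet> (r *\<^sub>R x) - r * c\<bar> = r * \<bar>n \<bullet> x - c\<bar>"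
      using r by (simp add: abs_mult flip: right_diff_distrib)
    then have "\<bar>n \<bullet> (r *\<^sub>R x) - r * c\<bar> \<le> 1/2 \<longleftrightarrow> \<bar>n \<bullet> x - c\<bar> \<le> (1/r)/2"
      using r by (simp add: field_simps)
    then show "?h (r *\<^sub>R x) = g (r *\<^sub>R hyperplane_proj n c x) * indicator {x. \<bar>n \<bullet> x - c\<bar> \<le> (1/r)/2} x"
      by (simp add: 1 indicator_def)
  qed
  also have "\<dots> = ennreal (1/r) * (\<integral>\<^sup>+ y. g (r *\<^sub>R y) \<partial>hyperplane_measure {y. n \<bullet> y = c})"
    by (rule nn_integral_slab[OF n]) (use r in \<open>auto intro: measurable_compose[OF _ g]\<close>)
  finally have "?L = ennreal (r ^ CARD('n)) * ennreal (1/r) * (\<integral>\<^sup>+ y. g (r *\<^sub>R y) \<partial>hyperplane_measure {y. n \<bullet> y = c})"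
    by (simp add: mult.assoc)
  moreover have "r ^ CARD('n) * (1/r) = r ^ (CARD('n) - 1)"
    using r by (cases "CARD('n)") auto
  ultimately show ?thesis using r by (simp flip: ennreal_mult)
qed

text \<open>Polar coordinates with a hyperplane in place of the sphere: the half space is sliced by
  level, the level is written as \<open>r * c\<close>, and the slice at that level is the base
  hyperplane dilated by \<open>r\<close>. The Jacobian is \<open>c\<close> times the scaling factor
  of the slice.\<close>

lemma nn_integral_cone:
  fixes n :: "real^'n::finite"
  assumes n: "norm n = 1" and c: "c > 0" and f [measurable]: "f \<in> borel_measurable borel"
  shows "(\<integral>\<^sup>+ x. f x * indicator {x. n \<bullet> x > 0} x \<partial>lborel) =
    ennreal c * (\<integral>\<^sup>+ y. \<integral>\<^sup>+ r. ennreal (r ^ (CARD('n) - 1)) * f (r *\<^sub>R y) * indicator {0<..} r \<partial>lborel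
       \<partial>hyperplane_measure {y. n \<bullet> y = c})" (is "?L = _")
proof -
  let ?H = "hyperplane_measure {y. n \<bullet> y = c}"
  let ?f = "\<lambda>x. f x * indicator {x. n \<bullet> x > 0} x"
  define G where "G s = (\<integral>\<^sup>+ y. ?f (y + s *\<^sub>R n) \<partial>?H)" for s
  have G: "G s = (\<integral>\<^sup>+ x. ?f (hyperplane_proj n c x + s *\<^sub>R n) * indicator {x. \<bar>n \<bullet> x - c\<bar> \<le> 1/2} x \<partial>lborel)" for s
    unfolding G_def by (rule nn_integral_hyperplane_measure[OF n]) measurable
  have [measurable]: "G \<in> borel_measurable borel" unfolding G by measurable
  have "?L = (\<integral>\<^sup>+ s. G s \<partial>lborel)"
    unfolding G_def by (rule nn_integral_slices(1)[OF n]) measurable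
  also have "\<dots> = ennreal c * (\<integral>\<^sup>+ r. G (- c + c * r) \<partial>lborel)"
    using nn_integral_real_affine[of G c "-c"] c by simp
  also have "(\<integral>\<^sup>+ r. G (- c + c * r) \<partial>lborel) =
    (\<integral>\<^sup>+ r. \<integral>\<^sup>+ y. ennreal (r ^ (CARD('n) - 1)) * f (r *\<^sub>R y) * indicator {0<..} r \<partial>?H \<partial>lborel)"
  proof (rule nn_integral_cong)
    fix r :: real
    \<comment> \<open>Slices are indexed by the offset from the base at level \<open>c\<close>, so
      level \<open>r * c\<close> has offset \<open>(r - 1) * c\<close>.\<close>
    have rc: "- c + c * r = (r - 1) * c" by (simp add: algebra_simps)
    show "G (- c + c * r) = (\<integral>\<^sup>+ y. ennreal (r ^ (CARD('n) - 1)) * f (r *\<^sub>R y) * indicator {0<..} r \<partial>?H)"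
    proof (cases "r > 0")
      case True
      have "G (- c + c * r) = ennreal (r ^ (CARD('n) - 1)) * (\<integral>\<^sup>+ y. ?f (r *\<^sub>R y) \<partial>?H)"
        unfolding G_def rc by (rule nn_integral_hyperplane_scale[OF n _ True]) measurable
      also have "(\<integral>\<^sup>+ y. ?f (r *\<^sub>R y) \<partial>?H) = (\<integral>\<^sup>+ y. f (r *\<^sub>R y) \<partial>?H)"
        using True c by (subst (1 2) nn_integral_hyperplane_measure[OF n])
          (auto intro!: nn_integral_cong simp: hyperplane_proj_inner[OF n])
      finally show ?thesis using True by (simp add: nn_integral_cmult)
    next
      case False
      have "n \<bullet> (hyperplane_proj n c x + ((r - 1) * c) *\<^sub>R n) = r * c" for x
        by (simp add: inner_add_right hyperplane_proj_inner[OF n] dot_square_norm n algebra_simps)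
      then have "G (- c + c * r) = 0"
        unfolding G rc using False c by (simp add: indicator_def mult_pos_pos zero_less_mult_iff)
      then show ?thesis using False by simp
    qed
  qed
  \<comment> \<open>The surface measure is unfolded to its slab form before the order of integration
    is exchanged, so that both factors are Lebesgue measures.\<close>
  also have "\<dots> = (\<integral>\<^sup>+ r. \<integral>\<^sup>+ x. (ennreal (r ^ (CARD('n) - 1)) * f (r *\<^sub>R hyperplane_proj n c x) * indicator {0<..} r)
       * indicator {x. \<bar>n \<bullet> x - c\<bar> \<le> 1/2} x \<partial>lborel \<partial>lborel)"
    by (rule nn_integral_cong, rule nn_integral_hyperplane_measure[OF n]) measurable
  also have "\<dots> = (\<integral>\<^sup>+ x. \<integral>\<^sup>+ r. (ennreal (r ^ (CARD('n) - 1)) * f (r *\<^sub>R hyperplane_proj n c x) * indicator {0<..} r)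
       * indicator {x. \<bar>n \<bullet> x - c\<bar> \<le> 1/2} x \<partial>lborel \<partial>lborel)"
    by (rule lborel_pair.Fubini') measurable
  also have "\<dots> = (\<integral>\<^sup>+ x. (\<integral>\<^sup>+ r. ennreal (r ^ (CARD('n) - 1)) * f (r *\<^sub>R hyperplane_proj n c x) * indicator {0<..} r \<partial>lborel)
       * indicator {x. \<bar>n \<bullet> x - c\<bar> \<le> 1/2} x \<partial>lborel)"
    by (rule nn_integral_cong) (simp add: nn_integral_multc)
  also have "\<dots> = (\<integral>\<^sup>+ y. \<integral>\<^sup>+ r. ennreal (r ^ (CARD('n) - 1)) * f (r *\<^sub>R y) * indicator {0<..} r \<partial>lborel \<partial>?H)"
    by (rule nn_integral_hyperplane_measure[OF n, symmetric]) measurable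
  finally show ?thesis .
qed

section \<open>Facets of a simplex\<close>

text \<open>\<open>g u\<close> is the gradient and \<open>\<alpha> u\<close> the constant term of
  the barycentric coordinate of the vertex \<open>u\<close>. The facet opposite to \<open>u\<close>
  lies in the zero set of that coordinate, so \<open>g u\<close> is an inward normal there and all
  facet geometry can be read off from \<open>g\<close>.\<close>

locale simplex_coords =
  fixes C :: "(real^'n::finite) set" and g :: "real^'n \<Rightarrow> real^'n" and \<alpha> :: "real^'n \<Rightarrow> real"
  assumes indep: "\<not> affine_dependent C"
    and full: "affine hull C = UNIV"
    and dual: "u \<in> C \<Longrightarrow> v \<in> C \<Longrightarrow> g u \<bullet> v + \<alpha> u = of_bool (u = v)"
begin

definition lam :: "real^'n \<Rightarrow> real^'n \<Rightarrow> real" where "lam u x = g u \<bullet> x + \<alpha> u"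

lemma fin: "finite C" using indep by (rule aff_independent_finite)

lemma lam_vertex: "u \<in> C \<Longrightarrow> v \<in> C \<Longrightarrow> lam u v = of_bool (u = v)"
  by (simp add: lam_def dual)

lemma lam_combination:
  assumes "sum w C = 1" "u \<in> C"
  shows "lam u (\<Sum>v\<in>C. w v *\<^sub>R v) = w u"
proof -
  have "lam u (\<Sum>v\<in>C. w v *\<^sub>R v) = (\<Sum>v\<in>C. w v * (g u \<bullet> v)) + \<alpha> u * sum w C"
    by (simp add: lam_def inner_sum_right assms)
  also have "\<dots> = (\<Sum>v\<in>C. w v * lam u v)"
    by (simp add: lam_def algebra_simps sum.distrib sum_distrib_left)
  also have "\<dots> = (\<Sum>v\<in>C. if v = u then w v else 0)"
    using assms by (intro sum.cong) (auto simp: lam_vertex)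
  finally show ?thesis using fin assms by simp
qed

lemma lam_sum: "(\<Sum>u\<in>C. lam u x) = 1"
  and lam_bary: "(\<Sum>u\<in>C. lam u x *\<^sub>R u) = x"
proof -
  have "x \<in> affine hull C" by (simp add: full)
  then have "\<exists>w. sum w C = 1 \<and> (\<Sum>v\<in>C. w v *\<^sub>R v) = x"
    unfolding affine_hull_finite[OF fin] by (simp only: mem_Collect_eq)
  then obtain w where w: "sum w C = 1" "(\<Sum>v\<in>C. w v *\<^sub>R v) = x" by blast
  have "lam u x = w u" if "u \<in> C" for u using lam_combination[OF w(1) that] w(2) by simp
  then show "(\<Sum>u\<in>C. lam u x) = 1" "(\<Sum>u\<in>C. lam u x *\<^sub>R u) = x" using w by auto
qed

lemma lam_diff: "lam u (x + a) = lam u x + g u \<bullet> a"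
  by (simp add: lam_def inner_add_right)

text \<open>Linear part of \<open>lam_sum\<close>: the coordinates add up to 1 everywhere, so their
  gradients cancel.\<close>

lemma grad_sum: "(\<Sum>u\<in>C. g u) = 0"
proof -
  have "(\<Sum>u\<in>C. g u) \<bullet> a = 0" for a
  proof -
    have "(\<Sum>u\<in>C. lam u (0 + a)) = (\<Sum>u\<in>C. lam u 0) + (\<Sum>u\<in>C. g u) \<bullet> a"
      by (simp only: lam_diff sum.distrib inner_sum_left)
    then show ?thesis by (simp add: lam_sum)
  qed
  from this[of "\<Sum>u\<in>C. g u"] show ?thesis by simp
qed

text \<open>Linear part of \<open>lam_bary\<close>. Together with \<open>grad_sum\<close> it lets a
  sum over vertices, and hence over facets, collapse to a directional derivative.\<close>

lemma grad_bary: "(\<Sum>u\<in>C. (g u \<bullet> a) *\<^sub>R u) = a"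
proof -
  have "(\<Sum>u\<in>C. lam u (0 + a) *\<^sub>R u) = (\<Sum>u\<in>C. lam u 0 *\<^sub>R u) + (\<Sum>u\<in>C. (g u \<bullet> a) *\<^sub>R u)"
    by (simp only: lam_diff scaleR_add_left sum.distrib)
  then show ?thesis by (simp add: lam_bary)
qed

lemma hull_coords: "convex hull C = {x. \<forall>u\<in>C. lam u x \<ge> 0}"
proof (intro equalityI subsetI)
  fix x assume "x \<in> convex hull C"
  then have "\<exists>w. (\<forall>v\<in>C. 0 \<le> w v) \<and> sum w C = 1 \<and> (\<Sum>v\<in>C. w v *\<^sub>R v) = x"
    unfolding convex_hull_finite[OF fin] by (simp only: mem_Collect_eq)
  then obtain w where w: "\<forall>v\<in>C. 0 \<le> w v" "sum w C = 1" "(\<Sum>v\<in>C. w v *\<^sub>R v) = x"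
    by blast
  have "lam u x = w u" if "u \<in> C" for u using lam_combination[OF w(2) that] w(3) by simp
  then show "x \<in> {x. \<forall>u\<in>C. lam u x \<ge> 0}" using w(1) by simp
next
  fix x assume "x \<in> {x. \<forall>u\<in>C. lam u x \<ge> 0}"
  then have "\<forall>u\<in>C. lam u x \<ge> 0" by simp
  then show "x \<in> convex hull C"
    unfolding convex_hull_finite[OF fin] mem_Collect_eq
    by (intro exI[of _ "\<lambda>u. lam u x"] conjI lam_sum lam_bary)
qed

lemma ex_other: assumes "u \<in> C" shows "\<exists>v\<in>C. v \<noteq> u"
proof (rule ccontr)
  assume "\<not> ?thesis"
  then have "C = {u}" using assms by blast
  then have "affine hull {u} = (UNIV :: (real^'n) set)" using full by metis
  then have "u + axis undefined 1 \<in> {u}" by simp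
  then show False by (simp add: axis_eq_0_iff)
qed

lemma grad_nonzero: assumes "u \<in> C" shows "g u \<noteq> 0"
proof
  assume "g u = 0"
  obtain v where v: "v \<in> C" "v \<noteq> u" using ex_other[OF assms] by auto
  show False using lam_vertex[OF assms assms] lam_vertex[OF assms v(1)] v(2) \<open>g u = 0\<close>
    by (simp add: lam_def)
qed

lemma continuous_lam [continuous_intros]: "continuous_on S (lam u)"
  unfolding lam_def by (intro continuous_intros)

lemma interior_coords: "interior (convex hull C) = {x. \<forall>u\<in>C. lam u x > 0}"
proof (intro equalityI subsetI)
  fix x assume x: "x \<in> interior (convex hull C)"
  have "lam u x > 0" if u: "u \<in> C" for u
  proof -
    obtain e where e: "e > 0" "ball x e \<subseteq> convex hull C" using x mem_interior by blast
    \<comment> \<open>The displacement has length \<open>e / 2\<close> and stays in the ball, while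
      the coordinate drops by a positive amount and must remain nonnegative.\<close>
    define t where "t = e / (2 * norm (g u))"
    have t: "t > 0" using e grad_nonzero[OF u] by (simp add: t_def)
    have "norm (t *\<^sub>R g u) < e" using t e grad_nonzero[OF u] by (simp add: t_def)
    then have "x + - (t *\<^sub>R g u) \<in> ball x e" by (simp add: dist_norm)
    then have "x + - (t *\<^sub>R g u) \<in> convex hull C" using e(2) by blast
    then have "lam u (x + - (t *\<^sub>R g u)) \<ge> 0" using u by (simp add: hull_coords)
    moreover have "t * (g u \<bullet> g u) > 0" using t grad_nonzero[OF u] by simp
    ultimately show ?thesis unfolding lam_diff by simp
  qed
  then show "x \<in> {x. \<forall>u\<in>C. lam u x > 0}" by auto
next
  fix x assume x: "x \<in> {x. \<forall>u\<in>C. lam u x > 0}"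
  have "open {x. \<forall>u\<in>C. lam u x > 0}"
  proof -
    have "{x. \<forall>u\<in>C. lam u x > 0} = (\<Inter>u\<in>C. {x. 0 < lam u x})" by auto
    then show ?thesis using fin by (auto intro!: open_INT open_Collect_less continuous_intros)
  qed
  moreover have "{x. \<forall>u\<in>C. lam u x > 0} \<subseteq> convex hull C" using hull_coords by (auto intro: less_imp_le)
  ultimately show "x \<in> interior (convex hull C)" using x interior_maximal by blast
qed

lemma interior_nonempty: "interior (convex hull C) \<noteq> {}"
proof -
  have "C \<noteq> {}" using full affine_hull_eq_empty[of C] UNIV_not_empty by metis
  then have c: "card C > 0" using fin by (simp add: card_gt_0_iff)
  define x where "x = (\<Sum>v\<in>C. (1 / card C) *\<^sub>R v)"
  have "lam u x = 1 / card C" if "u \<in> C" for u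
    unfolding x_def by (rule lam_combination[OF _ that]) (use c in simp)
  then have "x \<in> interior (convex hull C)" using c by (simp add: interior_coords)
  then show ?thesis by auto
qed

abbreviation facet :: "real^'n \<Rightarrow> (real^'n) set" where "facet u \<equiv> convex hull (C - {u})"

lemma facet_affine: assumes u: "u \<in> C" shows "affine hull (facet u) = {x. lam u x = 0}"
proof -
  have "affine hull (C - {u}) = {x. lam u x = 0}"
  proof
    have "affine {x. lam u x = 0}"
    proof -
      have "{x. lam u x = 0} = {x. g u \<bullet> x = - \<alpha> u}" by (auto simp: lam_def)
      then show ?thesis by (simp add: affine_hyperplane)
    qed
    moreover have "C - {u} \<subseteq> {x. lam u x = 0}" using u by (auto simp: lam_vertex)
    ultimately show "affine hull (C - {u}) \<subseteq> {x. lam u x = 0}" by (rule hull_minimal[rotated])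
  next
    show "{x. lam u x = 0} \<subseteq> affine hull (C - {u})"
    proof
      fix x assume "x \<in> {x. lam u x = 0}"
      then have 0: "lam u x = 0" by simp
      have "sum (\<lambda>v. lam v x) (C - {u}) = 1" using lam_sum[of x] 0 fin u by (simp add: sum_diff1)
      moreover have "(\<Sum>v\<in>C - {u}. lam v x *\<^sub>R v) = x" using lam_bary[of x] 0 fin u by (simp add: sum_diff1)
      ultimately show "x \<in> affine hull (C - {u})"
        unfolding affine_hull_finite[OF finite_Diff[OF fin]] mem_Collect_eq
        by (intro exI[of _ "\<lambda>v. lam v x"] conjI)
    qed
  qed
  then show ?thesis by simp
qed

lemma facet_coords: assumes u: "u \<in> C" shows "facet u = {x \<in> convex hull C. lam u x = 0}"
proof (intro equalityI subsetI)
  fix x assume x: "x \<in> facet u"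
  then have "x \<in> convex hull C" using hull_mono[of "C - {u}" C convex] by blast
  moreover have "x \<in> affine hull (facet u)" by (rule hull_inc[OF x])
  ultimately show "x \<in> {x \<in> convex hull C. lam u x = 0}" using facet_affine[OF u] by blast
next
  fix x assume x: "x \<in> {x \<in> convex hull C. lam u x = 0}"
  then have 0: "lam u x = 0" by simp
  have "sum (\<lambda>v. lam v x) (C - {u}) = 1" using lam_sum[of x] 0 fin u by (simp add: sum_diff1)
  moreover have "(\<Sum>v\<in>C - {u}. lam v x *\<^sub>R v) = x" using lam_bary[of x] 0 fin u by (simp add: sum_diff1)
  moreover have "\<forall>v\<in>C - {u}. lam v x \<ge> 0" using x by (simp add: hull_coords)
  ultimately show "x \<in> facet u"
    unfolding convex_hull_finite[OF finite_Diff[OF fin]] mem_Collect_eq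
    by (intro exI[of _ "\<lambda>v. lam v x"] conjI)
qed

lemma facets: "{F. F facet_of convex hull C} = facet ` C"
proof -
  have "facet u \<noteq> {}" if "u \<in> C" for u using ex_other[OF that] by auto
  then show ?thesis unfolding facet_of_convex_hull_affine_independent[OF indep] by blast
qed

lemma facet_inj: "inj_on facet C"
proof (rule inj_onI)
  fix u v assume *: "u \<in> C" "v \<in> C" "facet u = facet v"
  show "u = v"
  proof (rule ccontr)
    assume "u \<noteq> v"
    then have "u \<in> facet v" using * by (simp add: hull_inc)
    then have "u \<in> facet u" using * by simp
    then show False using facet_coords[OF *(1)] lam_vertex[OF *(1) *(1)] by simp
  qed
qed

text \<open>The coordinate of \<open>u\<close> vanishes on the facet and is nonnegative on the
  simplex, so minus its gradient points outward. Conversely an admissible \<open>n\<close> takes one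
  value on all vertices of the facet; expanding a direction by \<open>grad_bary\<close> makes it a
  multiple of \<open>g u\<close>, and norm and sign fix the factor.\<close>

lemma outward_normal_facet:
  assumes u: "u \<in> C"
  shows "outward_normal (convex hull C) (facet u) = - (g u /\<^sub>R norm (g u))"
  unfolding outward_normal_def
proof (rule the_equality)
  have nz: "norm (g u) > 0" using grad_nonzero[OF u] by simp
  show "norm (- (g u /\<^sub>R norm (g u))) = 1 \<and>
     (\<forall>x\<in>facet u. \<forall>y\<in>convex hull C. - (g u /\<^sub>R norm (g u)) \<bullet> (y - x) \<le> 0)"
  proof (intro conjI ballI)
    show "norm (- (g u /\<^sub>R norm (g u))) = 1" using nz by simp
    fix x y assume "x \<in> facet u" "y \<in> convex hull C"
    then have "lam u x = 0" "lam u y \<ge> 0" using facet_coords[OF u] u by (simp_all add: hull_coords)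
    then have "g u \<bullet> (y - x) \<ge> 0" by (simp add: lam_def inner_diff_right)
    then show "- (g u /\<^sub>R norm (g u)) \<bullet> (y - x) \<le> 0" using nz by simp
  qed
next
  fix n assume n: "norm n = 1 \<and> (\<forall>x\<in>facet u. \<forall>y\<in>convex hull C. n \<bullet> (y - x) \<le> 0)"
  have nz: "norm (g u) > 0" using grad_nonzero[OF u] by simp
  obtain v where v: "v \<in> C" "v \<noteq> u" using ex_other[OF u] by auto
  have le: "n \<bullet> (y - x) \<le> 0" if "x \<in> C - {u}" "y \<in> C" for x y
    using n that by (meson hull_inc)
  have c: "n \<bullet> x = n \<bullet> v" if "x \<in> C - {u}" for x
    using le[of x v] le[of v x] that v by (simp add: inner_diff_right)
  have nform: "n = (n \<bullet> u - n \<bullet> v) *\<^sub>R g u"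
  proof -
    have "n \<bullet> a = ((n \<bullet> u - n \<bullet> v) *\<^sub>R g u) \<bullet> a" for a
    proof -
      have "n \<bullet> a = n \<bullet> (\<Sum>w\<in>C. (g w \<bullet> a) *\<^sub>R w)" by (simp add: grad_bary)
      also have "\<dots> = (\<Sum>w\<in>C. (g w \<bullet> a) * (n \<bullet> w))" by (simp add: inner_sum_right)
      also have "\<dots> = (\<Sum>w\<in>C. (g w \<bullet> a) * (n \<bullet> v) + (if w = u then (g u \<bullet> a) * (n \<bullet> u - n \<bullet> v) else 0))"
        using c by (intro sum.cong) (auto simp: algebra_simps)
      also have "\<dots> = (\<Sum>w\<in>C. g w) \<bullet> a * (n \<bullet> v) + (g u \<bullet> a) * (n \<bullet> u - n \<bullet> v)"
        using u fin by (simp add: sum.distrib inner_sum_left sum_distrib_right)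
      finally show ?thesis by (simp add: grad_sum)
    qed
    then show ?thesis using vector_eq_rdot[of n "(n \<bullet> u - n \<bullet> v) *\<^sub>R g u"] by blast
  qed
  have "n \<bullet> (u - v) \<le> 0" by (rule le) (use u v in blast)+
  then have l: "n \<bullet> u - n \<bullet> v \<le> 0" by (simp only: inner_diff_right)
  define k where "k = n \<bullet> v - n \<bullet> u"
  have k: "n \<bullet> u - n \<bullet> v = - k" "k \<ge> 0" using l by (simp_all add: k_def)
  have nk: "n = (- k) *\<^sub>R g u" using nform unfolding k .
  have "norm n = k * norm (g u)" unfolding nk using k(2) by simp
  then have "k = inverse (norm (g u))" using n nz by (simp add: field_simps)
  then show "n = - (g u /\<^sub>R norm (g u))" unfolding nk by simp
qed

end

text \<open>The vertices other than \<open>u\<close> span a hyperplane, which misses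
  \<open>u\<close> by affine independence. Dividing its defining affine function by the value at
  \<open>u\<close> gives the barycentric coordinate.\<close>

lemma simplex_coords_exists:
  fixes K :: "(real^'n::finite) set"
  assumes "int CARD('n) simplex K"
  obtains C g \<alpha> where "simplex_coords C g \<alpha>" "K = convex hull C"
proof -
  obtain C where C: "\<not> affine_dependent C" "int (card C) = int CARD('n) + 1" "K = convex hull C"
    using assms by (auto simp: simplex_def)
  have "aff_dim C = int CARD('n)" using C aff_dim_affine_independent[OF C(1)] by simp
  then have full: "affine hull C = UNIV" using aff_dim_eq_full[of C] by simp
  have "\<exists>a b. \<forall>v\<in>C. a \<bullet> v + b = of_bool (u = v)" if u: "u \<in> C" for u
  proof -
    have i: "\<not> affine_dependent (C - {u})" using C(1) affine_independent_subset by blast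
    have f: "finite C" using C(1) aff_independent_finite by blast
    have "card C = Suc (card (C - {u}))" by (rule card.remove[OF f u])
    then have "aff_dim (C - {u}) = int CARD('n) - 1"
      using aff_dim_affine_independent[OF i] C(2) by linarith
    then have "aff_dim (C - {u}) = DIM(real^'n) - 1" by simp
    from iffD1[OF aff_dim_eq_hyperplane this]
    obtain a b where ab: "a \<noteq> 0" "affine hull (C - {u}) = {x. a \<bullet> x = b}" by blast
    have "u \<notin> affine hull (C - {u})" using C(1) u unfolding affine_dependent_def by blast
    then have nb: "a \<bullet> u \<noteq> b" using ab(2) by blast
    have v: "a \<bullet> v = b" if "v \<in> C" "v \<noteq> u" for v
    proof -
      have "v \<in> affine hull (C - {u})" by (rule hull_inc) (use that in blast)
      then show ?thesis using ab(2) by blast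
    qed
    have "(a /\<^sub>R (a \<bullet> u - b)) \<bullet> v + (- b / (a \<bullet> u - b)) = of_bool (u = v)" if "v \<in> C" for v
    proof -
      have "(a /\<^sub>R (a \<bullet> u - b)) \<bullet> v + (- b / (a \<bullet> u - b)) = (a \<bullet> v - b) / (a \<bullet> u - b)"
        by (simp add: divide_inverse algebra_simps)
      then show ?thesis using v[OF that] nb by (cases "v = u") auto
    qed
    then show ?thesis by blast
  qed
  then have "\<forall>u\<in>C. \<exists>a b. \<forall>v\<in>C. a \<bullet> v + b = of_bool (u = v)" by blast
  then obtain g \<alpha> where d: "\<forall>u\<in>C. \<forall>v\<in>C. g u \<bullet> v + \<alpha> u = of_bool (u = v)"
    unfolding bchoice_iff by blast
  have "simplex_coords C g \<alpha>"
    using C(1) full d by (intro simplex_coords.intro) blast+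
  then show thesis using that C(3) by blast
qed

section \<open>The divergence theorem on a simplex\<close>

lemma emeasure_hyperplane_measure_bounded:
  fixes n :: "real^'n::finite"
  assumes n: "norm n = 1" and A: "bounded A" "A \<in> sets borel"
  shows "emeasure (hyperplane_measure {y. n \<bullet> y = c}) A < \<infinity>"
proof -
  obtain r where r: "\<And>x. x \<in> A \<Longrightarrow> norm x \<le> r" using A(1) by (auto simp: bounded_iff)
  have [measurable]: "A \<in> sets borel" by (rule A(2))
  have "emeasure (hyperplane_measure {y. n \<bullet> y = c}) A =
     (\<integral>\<^sup>+ y. indicator A y \<partial>hyperplane_measure {y. n \<bullet> y = c})" by simp
  also have "\<dots> = (\<integral>\<^sup>+ x. indicator A (hyperplane_proj n c x) * indicator {x. \<bar>n \<bullet> x - c\<bar> \<le> 1/2} x \<partial>lborel)"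
    by (rule nn_integral_hyperplane_measure[OF n]) measurable
  also have "\<dots> \<le> (\<integral>\<^sup>+ x. indicator (cball 0 (r + 1/2)) x \<partial>(lborel :: (real^'n) measure))"
  proof (rule nn_integral_mono)
    fix x :: "real^'n"
    have "norm x \<le> r + 1/2" if "hyperplane_proj n c x \<in> A" "\<bar>n \<bullet> x - c\<bar> \<le> 1/2"
    proof -
      have "x = hyperplane_proj n c x + (n \<bullet> x - c) *\<^sub>R n" by (simp add: hyperplane_proj_def)
      then have "norm x \<le> norm (hyperplane_proj n c x) + norm ((n \<bullet> x - c) *\<^sub>R n)"
        by (metis norm_triangle_ineq)
      then show ?thesis using r[OF that(1)] that(2) n by simp
    qed
    then show "indicator A (hyperplane_proj n c x) * indicator {x. \<bar>n \<bullet> x - c\<bar> \<le> 1/2} x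
      \<le> (indicator (cball 0 (r + 1/2)) x :: ennreal)" by (auto simp: indicator_def)
  qed
  also have "\<dots> < \<infinity>" using emeasure_lborel_cball_finite by simp
  finally show ?thesis .
qed

text \<open>\<open>hyperplane_measure\<close> is formally a measure on the whole space; as an image
  under the projection it puts no mass off the hyperplane.\<close>

lemma AE_hyperplane_measure:
  fixes n :: "real^'n::finite"
  assumes n: "norm n = 1"
  shows "AE y in hyperplane_measure {y. n \<bullet> y = c}. n \<bullet> y = c"
proof -
  have "(\<integral>\<^sup>+ y. indicator {y. n \<bullet> y \<noteq> c} y \<partial>hyperplane_measure {y. n \<bullet> y = c}) =
    (\<integral>\<^sup>+ x. indicator {y. n \<bullet> y \<noteq> c} (hyperplane_proj n c x) * indicator {x. \<bar>n \<bullet> x - c\<bar> \<le> 1/2} x \<partial>lborel)"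
    by (rule nn_integral_hyperplane_measure[OF n]) measurable
  also have "\<dots> = 0" by (simp add: hyperplane_proj_inner[OF n])
  finally show ?thesis by (intro AE_I[where N="{y. n \<bullet> y \<noteq> c}"]) auto
qed

lemma set_integrable_hyperplane:
  fixes n :: "real^'n::finite" and f :: "real^'n \<Rightarrow> real"
  assumes n: "norm n = 1" and A: "bounded A" "A \<in> sets borel"
    and f: "(\<lambda>x. indicator A x *\<^sub>R f x) \<in> borel_measurable borel" and b: "\<And>x. x \<in> A \<Longrightarrow> \<bar>f x\<bar> \<le> b"
  shows "set_integrable (hyperplane_measure {y. n \<bullet> y = c}) A f"
  unfolding set_integrable_def
proof (rule integrableI_bounded_set[where A=A and B=b])
  show "emeasure (hyperplane_measure {y. n \<bullet> y = c}) A < \<infinity>"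
    by (rule emeasure_hyperplane_measure_bounded[OF n A])
qed (use A f b in \<open>auto simp: measurable_cong_sets[OF sets_hyperplane_measure refl]\<close>)

lemma nn_integral_cone_at:
  fixes n z :: "real^'n::finite"
  assumes n: "norm n = 1" and c: "c > 0" and f [measurable]: "f \<in> borel_measurable borel"
  shows "(\<integral>\<^sup>+ x. f x * indicator {x. n \<bullet> x > n \<bullet> z} x \<partial>lborel) =
    ennreal c * (\<integral>\<^sup>+ y. \<integral>\<^sup>+ r. ennreal (r ^ (CARD('n) - 1)) * f (z + r *\<^sub>R (y - z)) * indicator {0<..} r \<partial>lborel
       \<partial>hyperplane_measure {y. n \<bullet> y = c + n \<bullet> z})" (is "?L = _")
proof -
  define I where "I y = (\<integral>\<^sup>+ r. ennreal (r ^ (CARD('n) - 1)) * f (z + r *\<^sub>R (y - z)) * indicator {0<..} r \<partial>lborel)" for y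
  have [measurable]: "I \<in> borel_measurable borel" unfolding I_def by measurable
  have "?L = (\<integral>\<^sup>+ x. f (x + z) * indicator {x. n \<bullet> x > n \<bullet> z} (x + z) \<partial>lborel)"
    by (rule nn_integral_translate[symmetric]) measurable
  also have "\<dots> = (\<integral>\<^sup>+ x. f (x + z) * indicator {x. n \<bullet> x > 0} x \<partial>lborel)"
    by (rule nn_integral_cong) (simp add: inner_add_right indicator_def)
  also have "\<dots> = ennreal c * (\<integral>\<^sup>+ y. \<integral>\<^sup>+ r. ennreal (r ^ (CARD('n) - 1)) * f (r *\<^sub>R y + z) * indicator {0<..} r \<partial>lborel
       \<partial>hyperplane_measure {y. n \<bullet> y = c})"
    by (rule nn_integral_cone[OF n c]) measurable
  also have "(\<integral>\<^sup>+ y. \<integral>\<^sup>+ r. ennreal (r ^ (CARD('n) - 1)) * f (r *\<^sub>R y + z) * indicator {0<..} r \<partial>lborel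
       \<partial>hyperplane_measure {y. n \<bullet> y = c}) = (\<integral>\<^sup>+ y. I (y + z) \<partial>hyperplane_measure {y. n \<bullet> y = c})"
    by (simp add: I_def add.commute)
  also have "\<dots> = (\<integral>\<^sup>+ x. I (hyperplane_proj n c x + z) * indicator {x. \<bar>n \<bullet> x - c\<bar> \<le> 1/2} x \<partial>lborel)"
    by (rule nn_integral_hyperplane_measure[OF n]) measurable
  also have "\<dots> = (\<integral>\<^sup>+ x. I (hyperplane_proj n (c + n \<bullet> z) (x + z)) *
      indicator {x. \<bar>n \<bullet> x - (c + n \<bullet> z)\<bar> \<le> 1/2} (x + z) \<partial>lborel)"
    by (rule nn_integral_cong) (simp add: hyperplane_proj_def inner_add_right indicator_def algebra_simps)
  also have "\<dots> = (\<integral>\<^sup>+ x. I (hyperplane_proj n (c + n \<bullet> z) x) *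
      indicator {x. \<bar>n \<bullet> x - (c + n \<bullet> z)\<bar> \<le> 1/2} x \<partial>lborel)"
    by (rule nn_integral_translate) measurable
  also have "\<dots> = (\<integral>\<^sup>+ y. I y \<partial>hyperplane_measure {y. n \<bullet> y = c + n \<bullet> z})"
    by (rule nn_integral_hyperplane_measure[OF n, symmetric]) measurable
  finally show ?thesis by (simp add: I_def)
qed

text \<open>\<open>K\<close> is the cone with apex \<open>z\<close> and height \<open>c\<close> over
  \<open>F\<close>. On the ray \<open>x = z + r (y - z)\<close> the integrand times the Jacobian
  power of \<open>r\<close> is the derivative of \<open>r ^ N * q x\<close>, where \<open>N\<close>
  is the dimension, because \<open>x - z = r (y - z)\<close>. Each ray thus contributes
  \<open>q y\<close>. Nonnegativity permits the computation with nonnegative integrals.\<close>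

lemma cone_divergence_nonneg:
  fixes n z :: "real^'n::finite" and q :: "real^'n \<Rightarrow> real" and dq :: "real^'n \<Rightarrow> real^'n"
  assumes n: "norm n = 1" and c: "c > 0"
    and K: "compact K" "\<And>x. x \<in> K \<Longrightarrow> n \<bullet> z \<le> n \<bullet> x" and F: "compact F"
    and KF: "\<And>y r. n \<bullet> y = c + n \<bullet> z \<Longrightarrow> r > 0 \<Longrightarrow> z + r *\<^sub>R (y - z) \<in> K \<longleftrightarrow> r \<le> 1 \<and> y \<in> F"
    and dq: "\<And>x. (q has_derivative (\<lambda>h. dq x \<bullet> h)) (at x)" "continuous_on UNIV dq"
    and nonneg: "\<And>x. x \<in> K \<Longrightarrow> 0 \<le> CARD('n) * q x + dq x \<bullet> (x - z)"
  shows "(LINT x:K|lborel. CARD('n) * q x + dq x \<bullet> (x - z)) =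
    c * (LINT y:F|hyperplane_measure {y. n \<bullet> y = c + n \<bullet> z}. q y)"
proof -
  let ?N = "CARD('n)" and ?H = "{y. n \<bullet> y = c + n \<bullet> z}"
  let ?f = "\<lambda>x. ?N * q x + dq x \<bullet> (x - z)"
  have cq: "continuous_on UNIV q"
    using dq(1) by (meson continuous_at_imp_continuous_on has_derivative_continuous)
  have mq [measurable]: "q \<in> borel_measurable borel" by (rule borel_measurable_continuous_onI[OF cq])
  have [measurable]: "dq \<in> borel_measurable borel" by (rule borel_measurable_continuous_onI[OF dq(2)])
  have mK [measurable]: "K \<in> sets borel" and mF [measurable]: "F \<in> sets borel"
    using K F by (auto intro: borel_compact)
  have N: "?N > 0" by simp
  have line: "\<exists>v. (\<forall>r\<in>{0..1}. 0 \<le> v r \<and> (r > 0 \<longrightarrow> v r = r ^ (?N - 1) * ?f (z + r *\<^sub>R (y - z))) \<and>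
      ((\<lambda>r. r ^ ?N * q (z + r *\<^sub>R (y - z))) has_real_derivative v r) (at r)) \<and> v \<in> borel_measurable borel"
    if y: "y \<in> F" "y \<in> ?H" for y
  proof (intro exI[of _ "\<lambda>r. r ^ (?N - 1) * ?f (z + r *\<^sub>R (y - z))"] conjI ballI)
    have zK: "z + r *\<^sub>R (y - z) \<in> K" if "r > 0" "r \<le> 1" for r
      using KF[of y r] y that by auto
    \<comment> \<open>The description of \<open>K\<close> along rays covers \<open>r > 0\<close>
      only; the apex follows by closedness, which extends the sign of the integrand to
      \<open>r = 0\<close>.\<close>
    have zK0: "z \<in> K"
    proof -
      have "((\<lambda>r. z + r *\<^sub>R (y - z)) \<longlongrightarrow> z + 0 *\<^sub>R (y - z)) (at_right 0)"
        by (intro tendsto_intros)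
      moreover have "\<forall>\<^sub>F r in at_right (0::real). z + r *\<^sub>R (y - z) \<in> K"
        using zK by (intro eventually_at_rightI[of 0 1]) auto
      ultimately have "z + 0 *\<^sub>R (y - z) \<in> K"
        by (intro Lim_in_closed_set[OF compact_imp_closed[OF K(1)]]) auto
      then show ?thesis by simp
    qed
    fix r :: real assume r: "r \<in> {0..1}"
    have "z + r *\<^sub>R (y - z) \<in> K" using zK[of r] zK0 r by (cases "r = 0") auto
    then show "0 \<le> r ^ (?N - 1) * ?f (z + r *\<^sub>R (y - z))"
      using r by (intro mult_nonneg_nonneg nonneg) auto
    have "((\<lambda>r. q (z + r *\<^sub>R (y - z))) has_derivative (\<lambda>h. dq (z + r *\<^sub>R (y - z)) \<bullet> (h *\<^sub>R (y - z)))) (at r)"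
      by (rule has_derivative_compose[OF _ dq(1)]) (auto intro!: derivative_eq_intros)
    then have "((\<lambda>r. q (z + r *\<^sub>R (y - z))) has_real_derivative dq (z + r *\<^sub>R (y - z)) \<bullet> (y - z)) (at r)"
      unfolding has_field_derivative_def by (simp add: mult.commute[of _ "_ \<bullet> _"])
    then have "((\<lambda>r. r ^ ?N * q (z + r *\<^sub>R (y - z))) has_real_derivative
       r ^ ?N * (dq (z + r *\<^sub>R (y - z)) \<bullet> (y - z)) + ?N * r ^ (?N - 1) * q (z + r *\<^sub>R (y - z))) (at r)"
      by (auto intro!: derivative_eq_intros)
    moreover have "r ^ ?N = r ^ (?N - 1) * r" using N by (metis power_minus_mult)
    ultimately show "((\<lambda>r. r ^ ?N * q (z + r *\<^sub>R (y - z))) has_real_derivative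
       r ^ (?N - 1) * ?f (z + r *\<^sub>R (y - z))) (at r)"
      by (simp add: algebra_simps)
  qed measurable
  \<comment> \<open>The sign of the integrand passes to \<open>q\<close> on the base:
    \<open>r ^ N * q\<close> is zero at the apex and nondecreasing along the ray.\<close>
  have qF: "0 \<le> q y" if y: "y \<in> F" "y \<in> ?H" for y
  proof -
    obtain v where v: "\<And>r. r \<in> {0..1} \<Longrightarrow> 0 \<le> v r"
      "\<And>r. r \<in> {0..1} \<Longrightarrow> ((\<lambda>r. r ^ ?N * q (z + r *\<^sub>R (y - z))) has_real_derivative v r) (at r)"
      using line[OF y] by blast
    have "0 ^ ?N * q (z + 0 *\<^sub>R (y - z)) \<le> 1 ^ ?N * q (z + 1 *\<^sub>R (y - z))"
      by (rule DERIV_nonneg_imp_nondecreasing[of 0 1]) (use v in \<open>auto\<close>)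
    then show ?thesis by (simp add: zero_power)
  qed
  have int: "integrable lborel (\<lambda>x. indicator K x *\<^sub>R ?f x)"
    using K(1) by (intro borel_integrable_compact continuous_intros continuous_on_subset[OF cq]
        continuous_on_subset[OF dq(2)]) auto
  have "ennreal (LINT x:K|lborel. ?f x) = (\<integral>\<^sup>+ x. ennreal (indicator K x *\<^sub>R ?f x) \<partial>lborel)"
    unfolding set_lebesgue_integral_def
    by (rule nn_integral_eq_integral[symmetric, OF int]) (use nonneg in \<open>auto simp: indicator_def\<close>)
  also have "\<dots> = (\<integral>\<^sup>+ x. (ennreal (?f x) * indicator K x) * indicator {x. n \<bullet> x > n \<bullet> z} x \<partial>lborel)"
  proof (rule nn_integral_cong_AE)
    \<comment> \<open>The cone formula sees only the open half space beyond the apex, so the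
      parallel hyperplane through \<open>z\<close> has to be discarded as a null set.\<close>
    have "negligible {x. n \<bullet> x = n \<bullet> z}" using n by (intro negligible_hyperplane) auto
    then have "AE x in lebesgue. n \<bullet> x \<noteq> n \<bullet> z"
      unfolding negligible_iff_null_sets by (drule_tac AE_not_in) simp
    then have "AE x in lborel. n \<bullet> x \<noteq> n \<bullet> z"
      by (simp only: AE_completion_iff)
    then show "AE x in lborel. ennreal (indicator K x *\<^sub>R ?f x) =
        (ennreal (?f x) * indicator K x) * indicator {x. n \<bullet> x > n \<bullet> z} x"
      by eventually_elim (use K(2) in \<open>force simp: indicator_def\<close>)
  qed
  also have "\<dots> = ennreal c * (\<integral>\<^sup>+ y. \<integral>\<^sup>+ r. ennreal (r ^ (?N - 1)) *
      (ennreal (?f (z + r *\<^sub>R (y - z))) * indicator K (z + r *\<^sub>R (y - z))) * indicator {0<..} r \<partial>lborel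
      \<partial>hyperplane_measure ?H)"
    by (rule nn_integral_cone_at[OF n c]) measurable
  also have "(\<integral>\<^sup>+ y. \<integral>\<^sup>+ r. ennreal (r ^ (?N - 1)) *
      (ennreal (?f (z + r *\<^sub>R (y - z))) * indicator K (z + r *\<^sub>R (y - z))) * indicator {0<..} r \<partial>lborel
      \<partial>hyperplane_measure ?H) = (\<integral>\<^sup>+ y. ennreal (indicator F y *\<^sub>R q y) \<partial>hyperplane_measure ?H)"
  proof (rule nn_integral_cong_AE)
    show "AE y in hyperplane_measure ?H. (\<integral>\<^sup>+ r. ennreal (r ^ (?N - 1)) *
      (ennreal (?f (z + r *\<^sub>R (y - z))) * indicator K (z + r *\<^sub>R (y - z))) * indicator {0<..} r \<partial>lborel) =
      ennreal (indicator F y *\<^sub>R q y)"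
      using AE_hyperplane_measure[OF n, of "c + n \<bullet> z"]
    proof eventually_elim
      fix y assume y: "n \<bullet> y = c + n \<bullet> z"
      show "(\<integral>\<^sup>+ r. ennreal (r ^ (?N - 1)) *
        (ennreal (?f (z + r *\<^sub>R (y - z))) * indicator K (z + r *\<^sub>R (y - z))) * indicator {0<..} r \<partial>lborel) =
        ennreal (indicator F y *\<^sub>R q y)"
      proof (cases "y \<in> F")
        case False
        then have "(\<integral>\<^sup>+ r. ennreal (r ^ (?N - 1)) *
          (ennreal (?f (z + r *\<^sub>R (y - z))) * indicator K (z + r *\<^sub>R (y - z))) * indicator {0<..} r \<partial>lborel) =
          (\<integral>\<^sup>+ (r::real). 0 \<partial>lborel)"
          using KF[OF y] by (intro nn_integral_cong) (auto simp: indicator_def)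
        then show ?thesis using False by simp
      next
        case True
        obtain v where v: "\<And>r. r \<in> {0..1} \<Longrightarrow> 0 \<le> v r" 
          "\<And>r. r \<in> {0..1} \<Longrightarrow> r > 0 \<Longrightarrow> v r = r ^ (?N - 1) * ?f (z + r *\<^sub>R (y - z))"
          "\<And>r. r \<in> {0..1} \<Longrightarrow> ((\<lambda>r. r ^ ?N * q (z + r *\<^sub>R (y - z))) has_real_derivative v r) (at r)"
          "v \<in> borel_measurable borel"
          using line[OF True] y by blast
        have "(\<integral>\<^sup>+ r. ennreal (r ^ (?N - 1)) *
          (ennreal (?f (z + r *\<^sub>R (y - z))) * indicator K (z + r *\<^sub>R (y - z))) * indicator {0<..} r \<partial>lborel) =
          (\<integral>\<^sup>+ r. ennreal (v r) * indicator {0..1} r \<partial>lborel)"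
        proof (rule nn_integral_cong_AE)
          have "AE r in lborel. r \<noteq> (0::real)" by (rule AE_lborel_singleton)
          then show "AE r in lborel. ennreal (r ^ (?N - 1)) *
            (ennreal (?f (z + r *\<^sub>R (y - z))) * indicator K (z + r *\<^sub>R (y - z))) * indicator {0<..} r =
            ennreal (v r) * indicator {0..1} r"
          proof eventually_elim
            fix r :: real assume "r \<noteq> 0"
            consider "r < 0" | "r > 0" "r \<le> 1" | "r > 1" using \<open>r \<noteq> 0\<close> by linarith
            then show "ennreal (r ^ (?N - 1)) *
              (ennreal (?f (z + r *\<^sub>R (y - z))) * indicator K (z + r *\<^sub>R (y - z))) * indicator {0<..} r =
              ennreal (v r) * indicator {0..1} r"
            proof cases
              case 1 then show ?thesis by simp
            next
              case 2
              then have "z + r *\<^sub>R (y - z) \<in> K" using KF[OF y] True by blast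
              moreover have "ennreal (r ^ (?N - 1)) * ennreal (?f (z + r *\<^sub>R (y - z))) = ennreal (v r)"
                using 2 by (subst v(2)) (auto simp: ennreal_mult')
              ultimately show ?thesis using 2 by simp
            next
              case 3
              then have "z + r *\<^sub>R (y - z) \<notin> K" using KF[OF y, of r] by auto
              then show ?thesis using 3 by simp
            qed
          qed
        qed
        also have "\<dots> = ennreal (1 ^ ?N * q (z + 1 *\<^sub>R (y - z)) - 0 ^ ?N * q (z + 0 *\<^sub>R (y - z)))"
          using v by (intro nn_integral_FTC_Icc) auto
        finally show ?thesis using True by (simp add: zero_power)
      qed
    qed
  qed
  also have "\<dots> = ennreal (LINT y:F|hyperplane_measure ?H. q y)"
    unfolding set_lebesgue_integral_def
  proof (rule nn_integral_eq_integral)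
    have "compact (q ` F)" using F continuous_on_subset[OF cq] by (intro compact_continuous_image) auto
    then obtain b where "\<And>x. x \<in> F \<Longrightarrow> norm (q x) \<le> b"
      by (meson compact_imp_bounded bounded_iff imageI)
    then show "integrable (hyperplane_measure ?H) (\<lambda>x. indicator F x *\<^sub>R q x)"
      using set_integrable_hyperplane[OF n compact_imp_bounded[OF F] mF, of q b] unfolding set_integrable_def by simp
    show "AE y in hyperplane_measure ?H. 0 \<le> indicator F y *\<^sub>R q y"
      using AE_hyperplane_measure[OF n, of "c + n \<bullet> z"] by eventually_elim (use qF in \<open>auto simp: indicator_def\<close>)
  qed
  finally have "ennreal (LINT x:K|lborel. ?f x) = ennreal (c * (LINT y:F|hyperplane_measure ?H. q y))"
    using c by (simp add: ennreal_mult')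
  moreover have "0 \<le> (LINT x:K|lborel. ?f x)"
    unfolding set_lebesgue_integral_def by (rule Bochner_Integration.integral_nonneg) (use nonneg in \<open>auto simp: indicator_def\<close>)
  moreover have "0 \<le> (LINT y:F|hyperplane_measure ?H. q y)"
    unfolding set_lebesgue_integral_def
    by (rule integral_nonneg_AE) (use AE_hyperplane_measure[OF n, of "c + n \<bullet> z"] in \<open>eventually_elim, use qF in \<open>auto simp: indicator_def\<close>\<close>)
  ultimately show ?thesis using c by (simp add: ennreal_inj)
qed

text \<open>Adding the constant \<open>\<bar>b\<bar>\<close>, where \<open>b\<close> bounds the
  integrand on \<open>K\<close>, reduces to the nonnegative case: the constant enters the integrand
  multiplied by the dimension, which is at least 1. The formula for the constant alone is then
  subtracted.\<close>

lemma cone_divergence: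
  fixes n z :: "real^'n::finite" and q :: "real^'n \<Rightarrow> real" and dq :: "real^'n \<Rightarrow> real^'n"
  assumes n: "norm n = 1" and c: "c > 0"
    and K: "compact K" "\<And>x. x \<in> K \<Longrightarrow> n \<bullet> z \<le> n \<bullet> x" and F: "compact F"
    and KF: "\<And>y r. n \<bullet> y = c + n \<bullet> z \<Longrightarrow> r > 0 \<Longrightarrow> z + r *\<^sub>R (y - z) \<in> K \<longleftrightarrow> r \<le> 1 \<and> y \<in> F"
    and dq: "\<And>x. (q has_derivative (\<lambda>h. dq x \<bullet> h)) (at x)" "continuous_on UNIV dq"
  shows "(LINT x:K|lborel. CARD('n) * q x + dq x \<bullet> (x - z)) =
    c * (LINT y:F|hyperplane_measure {y. n \<bullet> y = c + n \<bullet> z}. q y)"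
proof -
  let ?N = "CARD('n)" and ?H = "hyperplane_measure {y. n \<bullet> y = c + n \<bullet> z}"
  let ?f = "\<lambda>x. ?N * q x + dq x \<bullet> (x - z)"
  have cq: "continuous_on S q" for S
    using dq(1) by (meson continuous_at_imp_continuous_on has_derivative_continuous)
  have cdq: "continuous_on S dq" for S using continuous_on_subset[OF dq(2)] by auto
  have cf: "continuous_on K ?f" by (intro continuous_intros cq cdq)
  then obtain b where b: "\<And>x. x \<in> K \<Longrightarrow> norm (?f x) \<le> b"
    using compact_imp_bounded[OF compact_continuous_image[OF cf K(1)]] by (auto simp: bounded_iff)
  have mK [measurable]: "K \<in> sets borel" and mF [measurable]: "F \<in> sets borel"
    using K F by (auto intro: borel_compact)
  have const: "(LINT x:K|lborel. ?N * \<bar>b\<bar>) = c * (LINT y:F|?H. \<bar>b\<bar>)"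
    using cone_divergence_nonneg[OF n c K F KF, where q="\<lambda>_. \<bar>b\<bar>" and dq="\<lambda>_. 0"] by simp
  have "(LINT x:K|lborel. ?N * (q x + \<bar>b\<bar>) + dq x \<bullet> (x - z)) = c * (LINT y:F|?H. q y + \<bar>b\<bar>)"
  proof (rule cone_divergence_nonneg[OF n c K F KF])
    show "((\<lambda>x. q x + \<bar>b\<bar>) has_derivative (\<bullet>) (dq x)) (at x)" for x
      by (auto intro!: derivative_eq_intros dq(1))
    fix x assume "x \<in> K"
    then have "- \<bar>b\<bar> \<le> ?f x" using b[of x] by auto
    moreover have "\<bar>b\<bar> \<le> ?N * \<bar>b\<bar>" using mult_right_mono[of 1 "real ?N" "\<bar>b\<bar>"] by (simp add: Suc_leI)
    ultimately show "0 \<le> ?N * (q x + \<bar>b\<bar>) + dq x \<bullet> (x - z)" by (simp add: algebra_simps)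
  qed (use dq in auto)
  also have "(LINT x:K|lborel. ?N * (q x + \<bar>b\<bar>) + dq x \<bullet> (x - z)) = (LINT x:K|lborel. ?f x + ?N * \<bar>b\<bar>)"
    by (simp add: algebra_simps)
  also have "\<dots> = (LINT x:K|lborel. ?f x) + (LINT x:K|lborel. ?N * \<bar>b\<bar>)"
  proof (rule set_integral_add)
    show "set_integrable lborel K ?f" unfolding set_integrable_def by (rule borel_integrable_compact[OF K(1) cf])
    show "set_integrable lborel K (\<lambda>x. ?N * \<bar>b\<bar>)" unfolding set_integrable_def
      by (rule borel_integrable_compact[OF K(1)]) simp
  qed
  also have "(LINT y:F|?H. q y + \<bar>b\<bar>) = (LINT y:F|?H. q y) + (LINT y:F|?H. \<bar>b\<bar>)"
  proof (rule set_integral_add)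
    obtain b' where "\<And>x. x \<in> F \<Longrightarrow> norm (q x) \<le> b'"
      using compact_imp_bounded[OF compact_continuous_image[OF cq F]] by (auto simp: bounded_iff)
    moreover have [measurable]: "q \<in> borel_measurable borel" by (rule borel_measurable_continuous_onI[OF cq])
    ultimately show "set_integrable ?H F q"
      by (intro set_integrable_hyperplane[OF n compact_imp_bounded[OF F] mF]) auto
    show "set_integrable ?H F (\<lambda>x. \<bar>b\<bar>)"
      by (intro set_integrable_hyperplane[OF n compact_imp_bounded[OF F] mF]) auto
  qed
  finally show ?thesis using const by (simp add: algebra_simps)
qed


section \<open>The cone formula applied to a simplex\<close>

context simplex_coords
begin

lemma lam_le_1: "x \<in> convex hull C \<Longrightarrow> u \<in> C \<Longrightarrow> lam u x \<le> 1"
  using lam_sum[of x] member_le_sum[of u C "\<lambda>u. lam u x"] fin by (simp add: hull_coords)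

lemma compact_hull: "compact (convex hull C)"
  using finite_imp_compact_convex_hull fin by blast

lemma compact_facet: "compact (facet u)"
  using finite_imp_compact_convex_hull fin by blast

text \<open>The simplex is the cone with apex \<open>u\<close> over the opposite facet. Its height
  is \<open>1 / norm (g u)\<close>, since the coordinate of \<open>u\<close> falls from 1 to 0 with
  slope \<open>norm (g u)\<close>.\<close>

lemma facet_cone:
  fixes q :: "real^'n \<Rightarrow> real"
  assumes u: "u \<in> C"
    and dq: "\<And>x. (q has_derivative (\<lambda>h. dq x \<bullet> h)) (at x)" "continuous_on UNIV dq"
  shows "(LINT x:convex hull C|lborel. CARD('n) * q x + dq x \<bullet> (x - u)) =
    (1 / norm (g u)) * facet_integral (facet u) q"
proof -
  define n where "n = - (g u /\<^sub>R norm (g u))"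
  have nz: "norm (g u) > 0" using grad_nonzero[OF u] by simp
  have n1: "norm n = 1" using nz by (simp add: n_def)
  have nx: "n \<bullet> x = - (lam u x - \<alpha> u) / norm (g u)" for x
    by (simp add: n_def lam_def divide_inverse)
  have nu: "n \<bullet> u = - (1 - \<alpha> u) / norm (g u)" using nx[of u] lam_vertex[OF u u] by simp
  have lam0: "n \<bullet> y = 1 / norm (g u) + n \<bullet> u \<longleftrightarrow> lam u y = 0" for y
    using nz unfolding nx[of y] nu by (auto simp: field_simps)
  have H: "affine hull (facet u) = {y. n \<bullet> y = 1 / norm (g u) + n \<bullet> u}"
    unfolding lam0 by (rule facet_affine[OF u])
  show ?thesis unfolding facet_integral_def H
  proof (rule cone_divergence[OF n1 _ compact_hull _ compact_facet _ dq])
    show "1 / norm (g u) > 0" using nz by simp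
    show "n \<bullet> u \<le> n \<bullet> x" if "x \<in> convex hull C" for x
      using lam_le_1[OF that u] nz unfolding nx[of x] nu by (simp add: divide_right_mono)
    fix y and r :: real
    assume "n \<bullet> y = 1 / norm (g u) + n \<bullet> u" and r: "r > 0"
    then have y: "lam u y = 0" by (simp only: lam0)
    have lu: "lam u (u + r *\<^sub>R (y - u)) = 1 - r"
    proof -
      have "g u \<bullet> (r *\<^sub>R (y - u)) = r * (lam u y - lam u u)" by (simp add: lam_def inner_diff_right)
      then show ?thesis using y lam_vertex[OF u u] by (simp add: lam_diff)
    qed
    have lv: "lam v (u + r *\<^sub>R (y - u)) = r * lam v y" if "v \<in> C" "v \<noteq> u" for v
    proof -
      have "g v \<bullet> (r *\<^sub>R (y - u)) = r * (lam v y - lam v u)" by (simp add: lam_def inner_diff_right)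
      then show ?thesis using lam_vertex[OF that(1) u] that by (simp add: lam_diff)
    qed
    have "u + r *\<^sub>R (y - u) \<in> convex hull C \<longleftrightarrow> 1 - r \<ge> 0 \<and> (\<forall>v\<in>C - {u}. r * lam v y \<ge> 0)"
      unfolding hull_coords mem_Collect_eq using lu lv u by (metis DiffD1 DiffD2 DiffI singletonD singletonI)
    also have "\<dots> \<longleftrightarrow> r \<le> 1 \<and> (\<forall>v\<in>C - {u}. lam v y \<ge> 0)"
      using r by (simp add: zero_le_mult_iff)
    also have "\<dots> \<longleftrightarrow> r \<le> 1 \<and> y \<in> facet u"
      unfolding facet_coords[OF u] hull_coords using y by auto
    finally show "u + r *\<^sub>R (y - u) \<in> convex hull C \<longleftrightarrow> r \<le> 1 \<and> y \<in> facet u" .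
  qed
qed

text \<open>
  Weighting the cone formula with apex \<open>u\<close> by the component of \<open>g u\<close> and summing over the
  vertices leaves only the gradient term, because the \<open>g u\<close> sum to \<open>0\<close> and reproduce directions.
\<close>

lemma divergence_hull:
  fixes q :: "real^'n \<Rightarrow> real"
  assumes dq: "\<And>x. (q has_derivative (\<lambda>h. dq x \<bullet> h)) (at x)" "continuous_on UNIV dq"
  shows "(\<Sum>F | F facet_of convex hull C. (outward_normal (convex hull C) F \<bullet> a) * facet_integral F q) =
    (LINT x:convex hull C|lborel. dq x \<bullet> a)"
proof -
  let ?K = "convex hull C"
  let ?f = "\<lambda>u x. CARD('n) * q x + dq x \<bullet> (x - u)"
  have cq: "continuous_on S q" for S
    using dq(1) by (meson continuous_at_imp_continuous_on has_derivative_continuous)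
  have cdq: "continuous_on S dq" for S using continuous_on_subset[OF dq(2)] by auto
  have "(\<Sum>F | F facet_of ?K. (outward_normal ?K F \<bullet> a) * facet_integral F q) =
    (\<Sum>u\<in>C. (outward_normal ?K (facet u) \<bullet> a) * facet_integral (facet u) q)"
    unfolding facets by (rule sum.reindex_cong[OF facet_inj]) auto
  also have "\<dots> = (\<Sum>u\<in>C. LINT x:?K|lborel. - (g u \<bullet> a) * ?f u x)"
  proof (rule sum.cong[OF refl])
    fix u assume u: "u \<in> C"
    have "(outward_normal ?K (facet u) \<bullet> a) * facet_integral (facet u) q =
       - (g u \<bullet> a) * ((1 / norm (g u)) * facet_integral (facet u) q)"
      by (simp add: outward_normal_facet[OF u] divide_inverse)
    also have "\<dots> = - (g u \<bullet> a) * (LINT x:?K|lborel. ?f u x)"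
      by (simp only: facet_cone[OF u dq])
    also have "\<dots> = (LINT x:?K|lborel. - (g u \<bullet> a) * ?f u x)"
      by (rule set_integral_mult_right[symmetric])
    finally show "(outward_normal ?K (facet u) \<bullet> a) * facet_integral (facet u) q =
      (LINT x:?K|lborel. - (g u \<bullet> a) * ?f u x)" .
  qed
  also have "\<dots> = (LINT x:?K|lborel. (\<Sum>u\<in>C. - (g u \<bullet> a) * ?f u x))"
  proof -
    have "integrable lborel (\<lambda>x. indicator ?K x *\<^sub>R (- (g u \<bullet> a) * ?f u x))" for u
      by (intro borel_integrable_compact[OF compact_hull] continuous_intros cq cdq)
    then show ?thesis
      unfolding set_lebesgue_integral_def scaleR_sum_right by (intro Bochner_Integration.integral_sum[symmetric])
  qed
  also have "\<dots> = (LINT x:?K|lborel. dq x \<bullet> a)"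
  proof -
    have "(\<Sum>u\<in>C. - (g u \<bullet> a) * ?f u x) = dq x \<bullet> a" for x
    proof -
      have "(\<Sum>u\<in>C. - (g u \<bullet> a) * ?f u x) =
        (\<Sum>u\<in>C. - (g u \<bullet> a) * (CARD('n) * q x + dq x \<bullet> x) + dq x \<bullet> ((g u \<bullet> a) *\<^sub>R u))"
        by (rule sum.cong) (simp_all add: algebra_simps inner_diff_right)
      also have "\<dots> = - ((\<Sum>u\<in>C. g u) \<bullet> a) * (CARD('n) * q x + dq x \<bullet> x) + dq x \<bullet> (\<Sum>u\<in>C. (g u \<bullet> a) *\<^sub>R u)"
        by (simp add: sum.distrib sum_subtractf inner_sum_left inner_sum_right sum_distrib_right sum_negf)
      finally show ?thesis by (simp add: grad_sum grad_bary)
    qed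
    then show ?thesis by simp
  qed
  finally show ?thesis .
qed

end

lemma simplex_divergence:
  fixes q :: "real^'n::finite \<Rightarrow> real"
  assumes K: "int CARD('n) simplex K"
    and dq: "\<And>x. (q has_derivative (\<lambda>h. dq x \<bullet> h)) (at x)" "continuous_on UNIV dq"
  shows "(\<Sum>F | F facet_of K. (outward_normal K F \<bullet> a) * facet_integral F q) = (LINT x:K|lborel. dq x \<bullet> a)"
proof -
  obtain C g \<alpha> where C: "simplex_coords C g \<alpha>" "K = convex hull C" by (rule simplex_coords_exists[OF K])
  show ?thesis unfolding C(2) by (rule simplex_coords.divergence_hull[OF C(1) dq])
qed

section \<open>Smooth bumps and polynomials\<close>

text \<open>For \<open>k = 0\<close> this is the classical smooth function that vanishes to infinite
  order at 0. The powers in the denominator make the family closed under differentiation up to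
  linear combinations.\<close>

definition flat :: "nat \<Rightarrow> real \<Rightarrow> real" where
  "flat k s = (if s > 0 then exp (- 1 / s) / s ^ k else 0)"

lemma flat_tendsto_0: "(flat k \<longlongrightarrow> 0) (at 0)"
proof (rule filterlim_split_at)
  have "((\<lambda>s. inverse s ^ k / exp (inverse s)) \<longlongrightarrow> (0::real)) (at_right 0)"
    by (rule filterlim_compose[OF tendsto_power_div_exp_0 filterlim_inverse_at_top_right])
  then show "(flat k \<longlongrightarrow> 0) (at_right 0)"
  proof (rule Lim_transform_eventually)
    show "\<forall>\<^sub>F s in at_right 0. inverse s ^ k / exp (inverse s) = flat k s"
      using eventually_at_right_less[of 0]
      by eventually_elim (simp add: flat_def exp_minus divide_inverse power_inverse)
  qed
  show "(flat k \<longlongrightarrow> 0) (at_left 0)"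
    by (rule Lim_transform_eventually[OF tendsto_const]) (simp add: eventually_at_filter flat_def)
qed

lemma flat_derivative: "(flat k has_real_derivative flat (k + 2) s - k * flat (k + 1) s) (at s)"
proof -
  consider "s > 0" | "s < 0" | "s = 0" by linarith
  then show ?thesis
  proof cases
    case 1
    have "((\<lambda>s. exp (- 1 / s) / s ^ k) has_real_derivative flat (k + 2) s - k * flat (k + 1) s) (at s)"
    proof -
      have "((\<lambda>s. exp (- 1 / s) / s ^ k) has_real_derivative
          ((exp (- 1 / s) * (1 / s\<^sup>2)) * s ^ k - exp (- 1 / s) * (k * s ^ (k - 1))) / (s ^ k * s ^ k)) (at s)"
        using 1 by (intro DERIV_divide) (auto intro!: derivative_eq_intros DERIV_pow simp: power2_eq_square)
      moreover have "((exp (- 1 / s) * (1 / s\<^sup>2)) * s ^ k - exp (- 1 / s) * (k * s ^ (k - 1))) / (s ^ k * s ^ k) =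
          flat (k + 2) s - k * flat (k + 1) s"
        using 1 by (cases k) (simp_all add: flat_def field_simps power2_eq_square)
      ultimately show ?thesis by simp
    qed
    then show ?thesis
      by (rule has_field_derivative_transform_within_open[where S="{0<..}"]) (use 1 in \<open>auto simp: flat_def\<close>)
  next
    case 2
    have "((\<lambda>_. 0) has_real_derivative flat (k + 2) s - k * flat (k + 1) s) (at s)"
      using 2 by (auto simp: flat_def)
    then show ?thesis
      by (rule has_field_derivative_transform_within_open[where S="{..<0}"]) (use 2 in \<open>auto simp: flat_def\<close>)
  next
    case 3
    \<comment> \<open>At the origin the difference quotient of \<open>flat k\<close> is exactly
      \<open>flat (Suc k)\<close>, which tends to 0.\<close>
    have "((\<lambda>h. (flat k (0 + h) - flat k 0) / h) \<longlongrightarrow> 0) (at 0)"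
    proof (rule Lim_transform_eventually[OF flat_tendsto_0[of "Suc k"]])
      show "\<forall>\<^sub>F h in at 0. flat (Suc k) h = (flat k (0 + h) - flat k 0) / h"
        by (simp add: eventually_at_filter flat_def)
    qed
    then show ?thesis using 3 by (simp add: DERIV_def flat_def)
  qed
qed

text \<open>
  An inductive class closed under partial derivatives: it contains the polynomials and the bump
  functions needed for testing the divergence condition.
\<close>

inductive smooth_fun :: "(real^'n::finite \<Rightarrow> real) \<Rightarrow> bool" where
  smooth_const: "smooth_fun (\<lambda>x. c)"
| smooth_nth: "smooth_fun (\<lambda>x. x $ i)"
| smooth_add: "smooth_fun f \<Longrightarrow> smooth_fun g \<Longrightarrow> smooth_fun (\<lambda>x. f x + g x)"
| smooth_mult: "smooth_fun f \<Longrightarrow> smooth_fun g \<Longrightarrow> smooth_fun (\<lambda>x. f x * g x)"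
| smooth_flat: "smooth_fun f \<Longrightarrow> smooth_fun (\<lambda>x. flat k (f x))"

lemma smooth_sum: "(\<And>i. i \<in> I \<Longrightarrow> smooth_fun (f i)) \<Longrightarrow> smooth_fun (\<lambda>x. \<Sum>i\<in>I. f i x)"
  by (induction I rule: infinite_finite_induct) (auto intro: smooth_fun.intros)

lemma smooth_prod: "(\<And>i. i \<in> I \<Longrightarrow> smooth_fun (f i)) \<Longrightarrow> smooth_fun (\<lambda>x. \<Prod>i\<in>I. f i x)"
  by (induction I rule: infinite_finite_induct) (auto intro: smooth_fun.intros)

lemma smooth_power: "smooth_fun f \<Longrightarrow> smooth_fun (\<lambda>x. f x ^ k)"
  by (induction k) (auto intro: smooth_fun.intros)

lemma smooth_diff: "smooth_fun f \<Longrightarrow> smooth_fun g \<Longrightarrow> smooth_fun (\<lambda>x. f x - g x)"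
  using smooth_add[of f "\<lambda>x. (- 1) * g x"] smooth_mult[OF smooth_const[of "-1"], of g] by simp

text \<open>Recording that the components of the gradient stay in the class is what later gives
  differentiability of all iterated partial derivatives by induction on the list of indices.\<close>

lemma smooth_fun_has_gradient:
  fixes f :: "real^'n::finite \<Rightarrow> real"
  assumes "smooth_fun f"
  shows "\<exists>D. (\<forall>x. (f has_derivative (\<lambda>h. D x \<bullet> h)) (at x)) \<and> (\<forall>j. smooth_fun (\<lambda>x. D x $ j))"
  using assms
proof induction
  case (smooth_const c)
  show ?case by (rule exI[of _ "\<lambda>x. 0"]) (auto intro: smooth_fun.intros)
next
  case (smooth_nth i)
  show ?case
  proof (rule exI[of _ "\<lambda>x. axis i 1"], intro conjI allI)
    fix x :: "real^'n"
    show "((\<lambda>x. x $ i) has_derivative (\<bullet>) (axis i 1)) (at x)"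
      by (rule has_derivative_eq_rhs[OF bounded_linear_imp_has_derivative[OF bounded_linear_vec_nth]])
        (auto simp: inner_axis')
    show "smooth_fun (\<lambda>x. axis i 1 $ j)" for j by (rule smooth_fun.smooth_const)
  qed
next
  case (smooth_add f g)
  then obtain D E where D: "\<And>x. (f has_derivative (\<lambda>h. D x \<bullet> h)) (at x)" "\<And>j. smooth_fun (\<lambda>x. D x $ j)"
    and E: "\<And>x. (g has_derivative (\<lambda>h. E x \<bullet> h)) (at x)" "\<And>j. smooth_fun (\<lambda>x. E x $ j)" by auto
  show ?case
  proof (rule exI[of _ "\<lambda>x. D x + E x"], intro conjI allI)
    show "((\<lambda>x. f x + g x) has_derivative (\<bullet>) (D x + E x)) (at x)" for x
      using has_derivative_add[OF D(1) E(1), of x] by (simp add: inner_add_left[abs_def])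
    show "smooth_fun (\<lambda>x. (D x + E x) $ j)" for j by (simp add: smooth_fun.smooth_add D E)
  qed
next
  case (smooth_mult f g)
  then obtain D E where D: "\<And>x. (f has_derivative (\<lambda>h. D x \<bullet> h)) (at x)" "\<And>j. smooth_fun (\<lambda>x. D x $ j)"
    and E: "\<And>x. (g has_derivative (\<lambda>h. E x \<bullet> h)) (at x)" "\<And>j. smooth_fun (\<lambda>x. E x $ j)" by auto
  show ?case
  proof (rule exI[of _ "\<lambda>x. f x *\<^sub>R E x + g x *\<^sub>R D x"], intro conjI allI)
    show "((\<lambda>x. f x * g x) has_derivative (\<bullet>) (f x *\<^sub>R E x + g x *\<^sub>R D x)) (at x)" for x
      using has_derivative_mult[OF D(1) E(1), of x]
      by (rule has_derivative_eq_rhs) (auto simp: inner_add_left)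
    show "smooth_fun (\<lambda>x. (f x *\<^sub>R E x + g x *\<^sub>R D x) $ j)" for j
      using smooth_mult.hyps by (simp add: smooth_fun.smooth_add smooth_fun.smooth_mult D E)
  qed
next
  case (smooth_flat f k)
  then obtain D where D: "\<And>x. (f has_derivative (\<lambda>h. D x \<bullet> h)) (at x)" "\<And>j. smooth_fun (\<lambda>x. D x $ j)" by auto
  let ?d = "\<lambda>x. flat (k + 2) (f x) - k * flat (k + 1) (f x)"
  show ?case
  proof (rule exI[of _ "\<lambda>x. ?d x *\<^sub>R D x"], intro conjI allI)
    fix x
    show "((\<lambda>x. flat k (f x)) has_derivative (\<bullet>) (?d x *\<^sub>R D x)) (at x)"
      using has_derivative_compose[OF D(1) flat_derivative[of k "f x", unfolded has_field_derivative_def]]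
      by (rule has_derivative_eq_rhs) auto
    have "smooth_fun ?d"
      by (intro smooth_diff smooth_fun.smooth_mult smooth_fun.smooth_const smooth_fun.smooth_flat smooth_flat.hyps)
    then show "smooth_fun (\<lambda>x. (?d x *\<^sub>R D x) $ j)" for j
      using smooth_fun.smooth_mult[of ?d "\<lambda>x. D x $ j"] D(2) by simp
  qed
qed

lemma partial_has_derivative:
  assumes "(f has_derivative f') (at x)"
  shows "partial j f x = f' (axis j 1)"
  using frechet_derivative_at[OF assms] by (simp add: partial_def)

lemma grad_has_derivative:
  assumes "(f has_derivative (\<lambda>h. D \<bullet> h)) (at x)"
  shows "grad f x = D"
  using partial_has_derivative[OF assms] by (simp add: grad_def vec_eq_iff inner_axis)

lemma smooth_fun_grad:
  fixes f :: "real^'n::finite \<Rightarrow> real"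
  assumes "smooth_fun f"
  shows "(f has_derivative (\<lambda>h. grad f x \<bullet> h)) (at x)" and "smooth_fun (partial j f)"
    and "continuous_on UNIV f" and "continuous_on UNIV (grad f)"
proof -
  have 1: "(f has_derivative (\<lambda>h. grad f x \<bullet> h)) (at x) \<and> smooth_fun (partial j f) \<and> continuous_on UNIV f"
    if sf: "smooth_fun f" for f :: "real^'n \<Rightarrow> real" and x j
  proof -
    obtain D where D: "\<And>x. (f has_derivative (\<lambda>h. D x \<bullet> h)) (at x)" "\<And>j. smooth_fun (\<lambda>x. D x $ j)"
      using smooth_fun_has_gradient[OF sf] by auto
    have "partial j f = (\<lambda>x. D x $ j)" using partial_has_derivative[OF D(1)] by (auto simp: inner_axis)
    moreover have "continuous_on UNIV f"
      using D(1) by (meson continuous_at_imp_continuous_on has_derivative_continuous)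
    ultimately show ?thesis using D grad_has_derivative[OF D(1)] by auto
  qed
  show "(f has_derivative (\<lambda>h. grad f x \<bullet> h)) (at x)" "smooth_fun (partial j f)" "continuous_on UNIV f"
    using 1[OF assms] by auto
  have "continuous_on UNIV (partial j f)" for j using 1[of "partial j f"] 1[OF assms] by blast
  then show "continuous_on UNIV (grad f)" unfolding grad_def by (intro continuous_intros)
qed

lemma smooth_fun_smooth: assumes "smooth_fun f" shows "smooth f"
  unfolding smooth_def
proof (intro allI)
  fix js x
  have "smooth_fun (foldr partial js f)"
    by (induction js) (auto intro: assms smooth_fun_grad(2))
  then show "foldr partial js f differentiable (at x)"
    using smooth_fun_grad(1) differentiable_def by blast
qed

text \<open>The classical mollifier shape, positive exactly in the open ball. Its invariance under
  reflections through the centre is what determines the integrals of its gradient over half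
  balls.\<close>

definition radial_bump :: "real^'n::finite \<Rightarrow> real \<Rightarrow> real^'n \<Rightarrow> real" where
  "radial_bump a r x = flat 0 (r\<^sup>2 - (x - a) \<bullet> (x - a))"

lemma smooth_radial_bump: "smooth_fun (radial_bump a r)"
proof -
  have "smooth_fun (\<lambda>x. flat 0 (r\<^sup>2 - (\<Sum>i\<in>UNIV. (x $ i - a $ i) * (x $ i - a $ i))))"
    by (intro smooth_flat smooth_diff smooth_sum smooth_mult smooth_const smooth_nth)
  then show ?thesis by (simp add: radial_bump_def[abs_def] inner_vec_def)
qed

lemma radial_bump_eq_0: assumes "r > 0" shows "radial_bump a r x = 0 \<longleftrightarrow> \<not> dist a x < r"
proof -
  have "dist a x < r \<longleftrightarrow> (x - a) \<bullet> (x - a) < r\<^sup>2"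
    using assms by (simp add: dist_norm norm_minus_commute dot_square_norm)
      (smt (verit) norm_ge_zero power2_less_imp_less power_strict_mono zero_less_numeral)
  then show ?thesis by (simp add: radial_bump_def flat_def)
qed

lemma test_function_radial_bump:
  assumes "r > 0" "cball a r \<subseteq> \<Omega>"
  shows "test_function \<Omega> (radial_bump a r)"
proof -
  have "{x. radial_bump a r x \<noteq> 0} = ball a r" by (auto simp: radial_bump_eq_0[OF assms(1)])
  then show ?thesis
    unfolding test_function_def using assms smooth_fun_smooth[OF smooth_radial_bump] by simp
qed

lemma partial_radial_bump:
  "partial j (radial_bump a r) x = - 2 * flat 2 (r\<^sup>2 - (x - a) \<bullet> (x - a)) * ((x - a) $ j)"
proof -
  have "((\<lambda>x. r\<^sup>2 - (x - a) \<bullet> (x - a)) has_derivative (\<lambda>h. - 2 * ((x - a) \<bullet> h))) (at x)"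
    by (auto intro!: derivative_eq_intros simp: inner_commute)
  from has_derivative_compose[OF this flat_derivative[of 0, unfolded has_field_derivative_def]]
  have "(radial_bump a r has_derivative
      (\<lambda>h. flat 2 (r\<^sup>2 - (x - a) \<bullet> (x - a)) * (- 2 * ((x - a) \<bullet> h)))) (at x)"
    by (simp add: radial_bump_def[abs_def] numeral_2_eq_2)
  from partial_has_derivative[OF this, of j] show ?thesis
    by (simp add: inner_axis mult_ac del: vector_minus_component)
qed

section \<open>Polynomials of bounded degree\<close>

lemma finite_multi_indices: "finite {\<alpha> :: 'n::finite \<Rightarrow> nat. (\<Sum>i\<in>UNIV. \<alpha> i) \<le> p}"
proof (rule finite_subset)
  show "{\<alpha> :: 'n \<Rightarrow> nat. (\<Sum>i\<in>UNIV. \<alpha> i) \<le> p} \<subseteq> PiE UNIV (\<lambda>_. {..p})"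
  proof
    fix \<alpha> :: "'n \<Rightarrow> nat" assume "\<alpha> \<in> {\<alpha>. (\<Sum>i\<in>UNIV. \<alpha> i) \<le> p}"
    moreover have "\<alpha> i \<le> (\<Sum>i\<in>UNIV. \<alpha> i)" for i by (rule member_le_sum) auto
    ultimately have "\<alpha> i \<le> p" for i using order_trans by blast
    then show "\<alpha> \<in> PiE UNIV (\<lambda>_. {..p})" by (simp add: PiE_iff)
  qed
  show "finite (PiE (UNIV :: 'n set) (\<lambda>_. {..p}))" by (intro finite_PiE) auto
qed

lemma polynomial_le_linear:
  assumes "polynomial_le p q" "linear f"
  shows "polynomial_le p (\<lambda>x. f (q x))"
proof -
  obtain c where "\<And>x. q x = (\<Sum>\<alpha> | (\<Sum>i\<in>UNIV. \<alpha> i) \<le> p. (\<Prod>i\<in>UNIV. (x $ i) ^ \<alpha> i) *\<^sub>R c \<alpha>)"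
    using assms(1) unfolding polynomial_le_def by blast
  then have "\<forall>x. f (q x) = (\<Sum>\<alpha> | (\<Sum>i\<in>UNIV. \<alpha> i) \<le> p. (\<Prod>i\<in>UNIV. (x $ i) ^ \<alpha> i) *\<^sub>R f (c \<alpha>))"
    by (simp add: linear_sum[OF assms(2)] linear_scale[OF assms(2)])
  then show ?thesis unfolding polynomial_le_def by (intro exI[of _ "\<lambda>\<alpha>. f (c \<alpha>)"])
qed

lemma polynomial_le_add:
  assumes "polynomial_le p q" "polynomial_le p r"
  shows "polynomial_le p (\<lambda>x. q x + r x)"
proof -
  obtain c d where "\<And>x. q x = (\<Sum>\<alpha> | (\<Sum>i\<in>UNIV. \<alpha> i) \<le> p. (\<Prod>i\<in>UNIV. (x $ i) ^ \<alpha> i) *\<^sub>R c \<alpha>)"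
    "\<And>x. r x = (\<Sum>\<alpha> | (\<Sum>i\<in>UNIV. \<alpha> i) \<le> p. (\<Prod>i\<in>UNIV. (x $ i) ^ \<alpha> i) *\<^sub>R d \<alpha>)"
    using assms unfolding polynomial_le_def by blast
  then have "\<forall>x. q x + r x = (\<Sum>\<alpha> | (\<Sum>i\<in>UNIV. \<alpha> i) \<le> p. (\<Prod>i\<in>UNIV. (x $ i) ^ \<alpha> i) *\<^sub>R (c \<alpha> + d \<alpha>))"
    by (simp add: scaleR_add_right sum.distrib)
  then show ?thesis unfolding polynomial_le_def by (intro exI[of _ "\<lambda>\<alpha>. c \<alpha> + d \<alpha>"])
qed

lemma polynomial_le_zero: "polynomial_le p (\<lambda>x. 0)"
  unfolding polynomial_le_def by (rule exI[of _ "\<lambda>_. 0"]) simp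

lemma smooth_polynomial:
  fixes q :: "real^'n::finite \<Rightarrow> real^'l::finite"
  assumes "polynomial_le p q"
  shows "smooth_fun (\<lambda>x. q x $ l)"
proof -
  obtain c where c: "\<And>x. q x = (\<Sum>\<alpha> | (\<Sum>i\<in>UNIV. \<alpha> i) \<le> p. (\<Prod>i\<in>UNIV. (x $ i) ^ \<alpha> i) *\<^sub>R c \<alpha>)"
    using assms unfolding polynomial_le_def by blast
  have "smooth_fun (\<lambda>x. \<Sum>\<alpha> | (\<Sum>i\<in>UNIV. \<alpha> i) \<le> p. (\<Prod>i\<in>UNIV. (x $ i) ^ \<alpha> i) * c \<alpha> $ l)"
    by (intro smooth_sum smooth_mult smooth_prod smooth_power smooth_const smooth_nth)
  then show ?thesis by (simp add: c)
qed

lemma smooth_vec: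
  fixes q :: "real^'n::finite \<Rightarrow> real^'l::finite"
  assumes q: "\<And>l. smooth_fun (\<lambda>x. q x $ l)"
  shows "continuous_on S q" and "q differentiable (at x)" and "partial j q x $ l = partial j (\<lambda>x. q x $ l) x"
    and "smooth_fun (\<lambda>x. partial j q x $ l)"
proof -
  have d: "(q has_derivative (\<lambda>h. \<chi> l. grad (\<lambda>x. q x $ l) x \<bullet> h)) (at x)" for x
    unfolding has_derivative_componentwise_within[of q]
  proof
    fix b :: "real^'l" assume "b \<in> Basis"
    then obtain k where b: "b = axis k 1" by (auto simp: Basis_vec_def)
    show "((\<lambda>x. q x \<bullet> b) has_derivative (\<lambda>h. (\<chi> l. grad (\<lambda>x. q x $ l) x \<bullet> h) \<bullet> b)) (at x)"
      using smooth_fun_grad(1)[OF q[of k], of x] by (simp add: b inner_axis)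
  qed
  show "q differentiable (at x)" using d differentiable_def by blast
  show "continuous_on S q"
    using d by (meson continuous_at_imp_continuous_on has_derivative_continuous)
  have p: "partial j q x $ l = partial j (\<lambda>x. q x $ l) x" for x
    using partial_has_derivative[OF d] partial_has_derivative[OF smooth_fun_grad(1)[OF q[of l]]] by simp
  then show "partial j q x $ l = partial j (\<lambda>x. q x $ l) x" by blast
  show "smooth_fun (\<lambda>x. partial j q x $ l)" unfolding p using smooth_fun_grad(2)[OF q[of l], of j] by simp
qed

section \<open>Linear differential equations\<close>

text \<open>
  The substitution \<open>y(t) = exp(L t) z(t)\<close> makes the Picard map a contraction on the whole interval.
\<close>

lemma linear_ode_exists:
  fixes A :: "real \<Rightarrow> 'b::banach \<Rightarrow>\<^sub>L 'b"
  assumes A: "continuous_on {0..1} A"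
  obtains y where "y 0 = y0" "\<And>t. t \<in> {0..1} \<Longrightarrow> (y has_vector_derivative A t (y t)) (at t within {0..1})"
proof -
  obtain c where c: "\<And>t. t \<in> {0..1} \<Longrightarrow> norm (A t) \<le> c"
    using compact_imp_bounded[OF compact_continuous_image[OF A compact_Icc]] unfolding bounded_iff by blast
  have c0: "c \<ge> 0" using c[of 0] norm_ge_zero[of "A 0"] by (meson atLeastAtMost_iff order_refl order_trans zero_le_one)
  \<comment> \<open>Any \<open>L > c\<close> would serve: the contraction factor turns out to be
    \<open>c / L\<close>.\<close>
  define L where "L = 2 * c + 1"
  have L: "L > 0" using c0 by (simp add: L_def)
  \<comment> \<open>Clamping time to the unit interval extends the Picard image to a bounded
    continuous function on the line, so that Banach's fixed point theorem applies in that function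
    space.\<close>
  define cl where "cl t = max 0 (min 1 t)" for t :: real
  have cl: "cl t \<in> {0..1}" for t by (simp add: cl_def)
  have cl_id: "cl t = t" if "t \<in> {0..1}" for t using that by (simp add: cl_def)
  have ccl: "continuous_on UNIV cl" unfolding cl_def by (intro continuous_intros)
  define G where "G z s = exp (L * s) *\<^sub>R A s (z s)" for z :: "real \<Rightarrow> 'b" and s
  have cG: "continuous_on {0..1} (G z)" if "continuous_on {0..1} z" for z
    unfolding G_def by (intro continuous_intros blinfun.continuous_on A that)
  define P where "P z t = exp (- L * t) *\<^sub>R (y0 + integral {0..t} (G z))" for z t
  have cP: "continuous_on {0..1} (P z)" if "continuous_on {0..1} z" for z
    unfolding P_def
    by (intro continuous_intros indefinite_integral_continuous_1 integrable_continuous_real cG that)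
  have conb: "(\<lambda>t. P z (cl t)) \<in> bcontfun" if z: "continuous_on {0..1} z" for z
  proof -
    have "continuous_on UNIV (\<lambda>t. P z (cl t))"
      by (rule continuous_on_compose2[OF cP[OF z] ccl]) (use cl in auto)
    moreover have "bounded (P z ` {0..1})"
      by (intro compact_imp_bounded compact_continuous_image cP z) auto
    then have "bounded (range (\<lambda>t. P z (cl t)))"
      by (rule bounded_subset) (use cl in auto)
    ultimately show ?thesis by (simp add: bcontfun_def)
  qed
  have zc: "continuous_on S (apply_bcontfun z)" for S and z :: "real \<Rightarrow>\<^sub>C 'b"
    by (rule continuous_on_apply_bcontfun)
  define \<Phi> where "\<Phi> z = Bcontfun (\<lambda>t. P (apply_bcontfun z) (cl t))" for z :: "real \<Rightarrow>\<^sub>C 'b"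
  have \<Phi>: "apply_bcontfun (\<Phi> z) t = P z (cl t)" for z t
    unfolding \<Phi>_def by (subst Bcontfun_inverse[OF conb[OF zc]]) simp
  have "\<exists>!z. \<Phi> z = z"
  proof (rule banach_fix_type)
    show "0 \<le> c / L" "c / L < 1" using c0 by (simp_all add: L_def)
    show "\<forall>x y. dist (\<Phi> x) (\<Phi> y) \<le> c / L * dist x y"
    proof (intro allI)
      fix z z' :: "real \<Rightarrow>\<^sub>C 'b"
      show "dist (\<Phi> z) (\<Phi> z') \<le> c / L * dist z z'"
      proof (rule dist_bound)
        fix t0 :: real
        define t where "t = cl t0"
        have t: "0 \<le> t" "t \<le> 1" using cl[of t0] by (auto simp: t_def)
        have iG: "G z integrable_on {0..t}" for z :: "real \<Rightarrow>\<^sub>C 'b"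
          by (rule integrable_continuous_real, rule continuous_on_subset[OF cG[OF zc]]) (use t in auto)
        have a1: "P z t - P z' t = exp (- L * t) *\<^sub>R integral {0..t} (\<lambda>s. G z s - G z' s)"
          by (simp add: P_def Henstock_Kurzweil_Integration.integral_diff[OF iG iG] flip: scaleR_diff_right)
        have a2: "norm (integral {0..t} (\<lambda>s. G z s - G z' s)) \<le> integral {0..t} (\<lambda>s. c * dist z z' * exp (L * s))"
        proof (rule integral_norm_bound_integral)
          show "(\<lambda>s. G z s - G z' s) integrable_on {0..t}" by (intro integrable_diff iG)
          show "(\<lambda>s. c * dist z z' * exp (L * s)) integrable_on {0..t}"
            by (intro integrable_continuous_real continuous_intros)
          fix s assume s: "s \<in> {0..t}"
          have "G z s - G z' s = exp (L * s) *\<^sub>R A s (z s - z' s)"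
            by (simp add: G_def blinfun.diff_right scaleR_diff_right)
          moreover have "norm (A s (z s - z' s)) \<le> c * dist z z'"
          proof -
            have "norm (A s (z s - z' s)) \<le> norm (A s) * norm (z s - z' s)" by (rule norm_blinfun)
            also have "\<dots> \<le> c * dist z z'"
              using c[of s] s t c0 dist_bounded[of z s z'] by (intro mult_mono) (auto simp: dist_norm)
            finally show ?thesis .
          qed
          ultimately show "norm (G z s - G z' s) \<le> c * dist z z' * exp (L * s)"
            by (simp add: mult.commute)
        qed
        \<comment> \<open>The weight integrates to \<open>(exp (L * t) - 1) / L\<close>; the
          prefactor \<open>exp (- L * t)\<close> of the Picard map cancels the growth and leaves at
          most \<open>c / L\<close>.\<close>
        have "((\<lambda>s. c * dist z z' * exp (L * s)) has_integral
            (c * dist z z' * exp (L * t) / L - c * dist z z' * exp (L * 0) / L)) {0..t}"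
          using t L by (intro fundamental_theorem_of_calculus)
            (auto intro!: derivative_eq_intros simp: field_simps simp flip: has_real_derivative_iff_has_vector_derivative)
        then have a3: "integral {0..t} (\<lambda>s. c * dist z z' * exp (L * s)) = c / L * dist z z' * (exp (L * t) - 1)"
          by (simp only: integral_unique) (simp add: diff_divide_distrib algebra_simps)
        have "norm (P z t - P z' t) \<le> exp (- L * t) * (c / L * dist z z' * (exp (L * t) - 1))"
          unfolding a1 norm_scaleR abs_exp_cancel using a2 unfolding a3 by (rule mult_left_mono) simp
        also have "\<dots> = c / L * dist z z' * (1 - exp (- L * t))"
          by (simp add: algebra_simps exp_minus field_simps)
        also have "\<dots> \<le> c / L * dist z z' * 1"
          using c0 L by (intro mult_left_mono) auto
        finally show "dist (\<Phi> z t0) (\<Phi> z' t0) \<le> c / L * dist z z'"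
          by (simp add: \<Phi> dist_norm t_def)
      qed
    qed
  qed
  then obtain z where z: "\<Phi> z = z" by blast
  have zP: "z t = P z t" if "t \<in> {0..1}" for t
    using \<Phi>[of z t] cl_id[OF that] by (simp add: z)
  define y where "y t = y0 + integral {0..t} (G z)" for t
  have yz: "y t = exp (L * t) *\<^sub>R z t" if "t \<in> {0..1}" for t
    using zP[OF that] by (simp add: P_def y_def flip: exp_add)
  show thesis
  proof (rule that)
    show "y 0 = y0" by (simp add: y_def)
    fix t :: real assume t: "t \<in> {0..1}"
    have "(y has_vector_derivative G z t) (at t within {0..1})"
      unfolding y_def using integral_has_vector_derivative[OF cG[OF zc] t]
      by (auto intro!: derivative_eq_intros)
    moreover have "G z t = A t (y t)" by (simp add: G_def yz[OF t] blinfun.scaleR_right)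
    ultimately show "(y has_vector_derivative A t (y t)) (at t within {0..1})" by simp
  qed
qed

text \<open>
  The number of equations is not fixed by a type, so the system is posed in the Banach space of
  bounded continuous functions on the line; hat functions at the naturals serve as unit vectors.
\<close>

instance bcontfun :: (metric_space, banach) banach ..

lemma linear_ode_system_exists:
  fixes a :: "nat \<Rightarrow> nat \<Rightarrow> real \<Rightarrow> real"
  assumes a: "\<And>i j. i < d \<Longrightarrow> j < d \<Longrightarrow> continuous_on {0..1} (a i j)"
  obtains u where "\<And>i. i < d \<Longrightarrow> u i 0 = u0 i"
    "\<And>i t. i < d \<Longrightarrow> t \<in> {0..1} \<Longrightarrow>
       (u i has_real_derivative (\<Sum>j<d. a i j t * u j t)) (at t within {0..1})"
proof -
  have bc: "(\<lambda>x. max 0 (1 - \<bar>x - real i\<bar>)) \<in> bcontfun" for i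
    by (auto simp: bcontfun_def bounded_iff intro!: continuous_intros exI[of _ 1])
  define e :: "nat \<Rightarrow> real \<Rightarrow>\<^sub>C real" where "e i = Bcontfun (\<lambda>x. max 0 (1 - \<bar>x - real i\<bar>))" for i
  have e: "e i (real k) = of_bool (k = i)" for i k
  proof -
    have "e i (real k) = max 0 (1 - \<bar>real k - real i\<bar>)" unfolding e_def by (subst Bcontfun_inverse[OF bc]) simp
    also have "\<dots> = of_bool (k = i)"
    proof (cases "k = i")
      case False
      then have "\<bar>real k - real i\<bar> \<ge> 1" by linarith
      then show ?thesis using False by simp
    qed simp
    finally show ?thesis .
  qed
  have ev: "bounded_linear (\<lambda>y :: real \<Rightarrow>\<^sub>C real. y (real j))" for j
  proof (rule bounded_linear_intro[where K=1])
    show "norm (y (real j)) \<le> norm y * 1" for y :: "real \<Rightarrow>\<^sub>C real" using norm_bounded[of y "real j"] by simp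
  qed simp_all
  \<comment> \<open>The analogue of a matrix unit: evaluation at the natural number \<open>j\<close>
    reads a coordinate, which is put along the hat function at \<open>i\<close>.\<close>
  define E where "E i j = Blinfun (\<lambda>y :: real \<Rightarrow>\<^sub>C real. y (real j) *\<^sub>R e i)" for i j
  have E: "E i j y = y (real j) *\<^sub>R e i" for i j y
    unfolding E_def by (simp add: bounded_linear_Blinfun_apply bounded_linear_compose[OF bounded_linear_scaleR_left ev])
  define A where "A t = (\<Sum>i<d. \<Sum>j<d. a i j t *\<^sub>R E i j)" for t
  have cA: "continuous_on {0..1} A" unfolding A_def by (intro continuous_intros a) auto
  obtain y where y: "y 0 = (\<Sum>i<d. u0 i *\<^sub>R e i)"
    "\<And>t. t \<in> {0..1} \<Longrightarrow> (y has_vector_derivative A t (y t)) (at t within {0..1})"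
    by (rule linear_ode_exists[OF cA, of "\<Sum>i<d. u0 i *\<^sub>R e i"]) blast
  have sum_ev: "apply_bcontfun (sum f S) (real k) = (\<Sum>i\<in>S. f i (real k))" for f :: "nat \<Rightarrow> real \<Rightarrow>\<^sub>C real" and S k
    using bounded_linear.linear[OF ev[of k]] by (rule linear_sum)
  show thesis
  proof (rule that[of "\<lambda>i t. y t (real i)"])
    show "y 0 (real i) = u0 i" if "i < d" for i
      using that by (simp add: y(1) sum_ev e if_distrib cong: if_cong)
    fix i t assume i: "i < d" and t: "t \<in> {0..(1::real)}"
    have "((\<lambda>t. y t (real i)) has_vector_derivative (A t (y t)) (real i)) (at t within {0..1})"
      by (rule bounded_linear.has_vector_derivative[OF ev y(2)[OF t]])
    moreover have "(A t (y t)) (real i) = (\<Sum>j<d. a i j t * y t (real j))"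
    proof -
      have "A t (y t) = (\<Sum>k<d. \<Sum>j<d. a k j t *\<^sub>R (y t (real j) *\<^sub>R e k))"
        by (simp add: A_def blinfun.sum_left blinfun.scaleR_left E)
      then have "(A t (y t)) (real i) = (\<Sum>k<d. \<Sum>j<d. a k j t * (y t (real j) * e k (real i)))"
        by (simp add: sum_ev mult.assoc)
      also have "\<dots> = (\<Sum>k<d. if k = i then (\<Sum>j<d. a i j t * y t (real j)) else 0)"
        by (intro sum.cong) (auto simp: e)
      also have "\<dots> = (\<Sum>j<d. a i j t * y t (real j))" using i by simp
      finally show ?thesis .
    qed
    ultimately show "((\<lambda>t. y t (real i)) has_real_derivative (\<Sum>j<d. a i j t * y t (real j))) (at t within {0..1})"
      by (simp add: has_real_derivative_iff_has_vector_derivative)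
  qed
qed

section \<open>The wave speed bound\<close>

lemma symmetric_matrix_inner:
  fixes A :: "real^'l^'l::finite"
  assumes "transpose A = A"
  shows "(A *v x) \<bullet> y = x \<bullet> (A *v y)"
  using dot_lmul_matrix[of x A y] assms by (metis inner_commute matrix_vector_mul_linear transpose_matrix_vector)

text \<open>The quadratic form has a minimum at \<open>e\<close>, so its derivative there, a
  multiple of \<open>A *v e\<close>, must vanish: otherwise a small step from \<open>e\<close>
  against \<open>A *v e\<close> would make the form negative.\<close>

lemma psd_null_vector:
  fixes A :: "real^'l^'l::finite"
  assumes sym: "transpose A = A" and psd: "\<And>e. 0 \<le> (A *v e) \<bullet> e" and 0: "(A *v e) \<bullet> e = 0"
  shows "A *v e = 0"
proof -
  define y where "y = A *v e"
  define b where "b = (A *v y) \<bullet> y"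
  have q: "0 \<le> 2 * t * (y \<bullet> y) + t\<^sup>2 * b" for t
  proof -
    have "0 \<le> (A *v (e + t *\<^sub>R y)) \<bullet> (e + t *\<^sub>R y)" by (rule psd)
    also have "\<dots> = (A *v e) \<bullet> e + t * ((A *v e) \<bullet> y) + t * ((A *v y) \<bullet> e) + t * t * b"
      by (simp add: b_def matrix_vector_right_distrib matrix_vector_mult_scaleR inner_add_left inner_add_right algebra_simps)
    also have "(A *v y) \<bullet> e = y \<bullet> y" using symmetric_matrix_inner[OF sym, of y e] by (simp add: y_def)
    finally show ?thesis using 0 by (simp add: y_def power2_eq_square)
  qed
  have b: "b \<ge> 0" using psd by (simp add: b_def)
  have "y \<bullet> y = 0"
  proof (rule ccontr)
    assume "y \<bullet> y \<noteq> 0"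
    then have yy: "y \<bullet> y > 0" by simp
    \<comment> \<open>The step \<open>t = - (y \<bullet> y) * s\<close> is short enough for the
      linear term to dominate the quadratic one, because \<open>s * b < 1\<close>.\<close>
    define s where "s = inverse (b + 1)"
    have s: "s > 0" "s * b < 1" using b by (simp_all add: s_def field_simps)
    have "2 * (- ((y \<bullet> y) * s)) * (y \<bullet> y) + (- ((y \<bullet> y) * s))\<^sup>2 * b = - ((y \<bullet> y)\<^sup>2 * s * (2 - s * b))"
      by (simp add: algebra_simps power2_eq_square)
    moreover have "(y \<bullet> y)\<^sup>2 * s * (2 - s * b) > 0" using yy s by (intro mult_pos_pos) auto
    ultimately have "2 * (- ((y \<bullet> y) * s)) * (y \<bullet> y) + (- ((y \<bullet> y) * s))\<^sup>2 * b < 0" by simp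
    then show False using q[of "- ((y \<bullet> y) * s)"] by simp
  qed
  then show ?thesis by (simp add: y_def)
qed

text \<open>\<open>\<mu>\<close> is the maximum of the Rayleigh quotient on the unit sphere. At a
  maximizer the matrix \<open>\<mu> G - D\<close> is positive semidefinite with vanishing form, so
  \<open>psd_null_vector\<close> yields the eigenvalue equation. This links the wave speed, defined
  by eigenvalues, to an inequality between quadratic forms.\<close>

lemma generalized_rayleigh:
  fixes D G :: "real^'l^'l::finite"
  assumes D: "transpose D = D" and G: "transpose G = G"
    and \<gamma>: "\<gamma> > 0" "\<And>e. \<gamma> * (norm e)\<^sup>2 \<le> (G *v e) \<bullet> e"
  obtains \<mu> e where "e \<noteq> 0" "D *v e = \<mu> *\<^sub>R (G *v e)" "\<And>e. (D *v e) \<bullet> e \<le> \<mu> * ((G *v e) \<bullet> e)"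
proof -
  let ?r = "\<lambda>e. ((D *v e) \<bullet> e) / ((G *v e) \<bullet> e)"
  have Gpos: "(G *v e) \<bullet> e > 0" if "e \<noteq> 0" for e
  proof -
    have "0 < \<gamma> * (norm e)\<^sup>2" using \<gamma>(1) that by simp
    then show ?thesis using \<gamma>(2)[of e] by linarith
  qed
  have "\<exists>e\<in>sphere 0 1. \<forall>y\<in>sphere 0 1. ?r y \<le> ?r e"
  proof (rule continuous_attains_sup)
    show "compact (sphere (0::real^'l) 1)" by simp
    show "sphere (0::real^'l) 1 \<noteq> {}" by simp
    have nz: "(G *v e) \<bullet> e \<noteq> 0" if "e \<in> sphere 0 1" for e using Gpos[of e] that by force
    show "continuous_on (sphere 0 1) ?r"
      by (intro continuous_intros matrix_vector_mult_linear_continuous_on) (use nz in auto)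
  qed
  then obtain e where e: "norm e = 1" "\<And>y. norm y = 1 \<Longrightarrow> ?r y \<le> ?r e" by auto
  define \<mu> where "\<mu> = ?r e"
  have le: "(D *v y) \<bullet> y \<le> \<mu> * ((G *v y) \<bullet> y)" for y
  proof (cases "y = 0")
    case False
    define z where "z = y /\<^sub>R norm y"
    have z: "norm z = 1" "y = norm y *\<^sub>R z" using False by (simp_all add: z_def)
    have "?r z \<le> \<mu>" using e(2)[OF z(1)] by (simp add: \<mu>_def)
    moreover have "(G *v z) \<bullet> z > 0" using z(1) by (intro Gpos) auto
    ultimately have "(D *v z) \<bullet> z \<le> \<mu> * ((G *v z) \<bullet> z)" by (simp add: field_simps)
    then have "(norm y)\<^sup>2 * ((D *v z) \<bullet> z) \<le> (norm y)\<^sup>2 * (\<mu> * ((G *v z) \<bullet> z))"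
      by (intro mult_left_mono) auto
    moreover have "(M *v y) \<bullet> y = (norm y)\<^sup>2 * ((M *v z) \<bullet> z)" for M :: "real^'l^'l"
    proof -
      have "(M *v (k *\<^sub>R z)) \<bullet> (k *\<^sub>R z) = k\<^sup>2 * ((M *v z) \<bullet> z)" for k
        by (simp add: matrix_vector_mult_scaleR power2_eq_square)
      from this[of "norm y"] show ?thesis using z(2) by simp
    qed
    ultimately show ?thesis by (simp add: algebra_simps)
  qed simp
  define A where "A = \<mu> *\<^sub>R G - D"
  have Av: "A *v y = \<mu> *\<^sub>R (G *v y) - D *v y" for y
    by (simp add: A_def matrix_vector_mult_diff_rdistrib scaleR_matrix_vector_assoc)
  have "A *v e = 0"
  proof (rule psd_null_vector)
    show "transpose A = A" using D G unfolding A_def by (simp add: transpose_def vec_eq_iff)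
    show "0 \<le> (A *v y) \<bullet> y" for y using le[of y] by (simp add: Av inner_diff_left)
    have "(G *v e) \<bullet> e \<noteq> 0" using Gpos[of e] e(1) by force
    then show "(A *v e) \<bullet> e = 0" by (simp add: Av inner_diff_left \<mu>_def)
  qed
  then have "D *v e = \<mu> *\<^sub>R (G *v e)" by (simp add: Av)
  moreover have "e \<noteq> 0" using e(1) by auto
  ultimately show thesis using that le by blast
qed

lemma transpose_normal_matrix:
  assumes "\<And>k. transpose (\<L> k x) = \<L> k x"
  shows "transpose (normal_matrix \<L> \<nu> x) = normal_matrix \<L> \<nu> x"
  using assms by (simp add: normal_matrix_def transpose_def vec_eq_iff)

lemma matrix_vector_bound:
  fixes A :: "real^'l^'m::finite"
  shows "norm (A *v x) \<le> real CARD('m) * norm A * norm x"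
proof -
  have "norm (A *v x) \<le> (\<Sum>i\<in>UNIV. \<bar>(A *v x) $ i\<bar>)" by (rule norm_le_l1_cart)
  also have "\<dots> \<le> (\<Sum>i\<in>(UNIV::'m set). norm A * norm x)"
  proof (rule sum_mono)
    fix i
    have "\<bar>(A *v x) $ i\<bar> \<le> norm (A $ i) * norm x"
      by (simp add: matrix_vector_mul_component Cauchy_Schwarz_ineq2)
    also have "\<dots> \<le> norm A * norm x" by (intro mult_right_mono Finite_Cartesian_Product.norm_nth_le) auto
    finally show "\<bar>(A *v x) $ i\<bar> \<le> norm A * norm x" .
  qed
  finally show ?thesis by simp
qed

text \<open>For a unit direction the top eigenvalue from \<open>generalized_rayleigh\<close> is, up
  to modulus, one of the numbers under the supremum; other directions follow by homogeneity. A real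
  \<open>Sup\<close> dominates its members only if the set is bounded above, which is derived from
  the bounds on \<open>\<L>\<close> and the coercivity of \<open>\<G>\<close>.\<close>

lemma wave_speed_bound:
  fixes \<T> :: "(real^'n::finite) set set" and \<G> :: "real^'n \<Rightarrow> real^'l^'l::finite"
  assumes L_bounded: "\<And>k. bounded (\<L> k ` open_elements \<T>)"
    and L_symmetric: "\<And>k x. x \<in> open_elements \<T> \<Longrightarrow> transpose (\<L> k x) = \<L> k x"
    and G_symmetric: "\<And>x. x \<in> open_elements \<T> \<Longrightarrow> transpose (\<G> x) = \<G> x"
    and \<gamma>: "\<gamma> > 0" "\<And>x e. x \<in> open_elements \<T> \<Longrightarrow> \<gamma> * (norm e)\<^sup>2 \<le> (\<G> x *v e) \<bullet> e"
    and x: "x \<in> open_elements \<T>"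
  shows "0 \<le> max_wave_speed \<T> \<G> \<L>"
    and "(normal_matrix \<L> v x *v e) \<bullet> e \<le> norm v * max_wave_speed \<T> \<G> \<L> * ((\<G> x *v e) \<bullet> e)"
proof -
  let ?S = "{\<bar>\<mu>\<bar> | \<mu> x \<nu> e. x \<in> open_elements \<T> \<and> norm \<nu> = 1 \<and> e \<noteq> 0 \<and>
                     normal_matrix \<L> \<nu> x *v e = \<mu> *\<^sub>R (\<G> x *v e)}"
  have "\<exists>b. \<forall>k. \<forall>x\<in>open_elements \<T>. norm (\<L> k x) \<le> b"
  proof -
    have "\<forall>k. \<exists>b. \<forall>x\<in>open_elements \<T>. norm (\<L> k x) \<le> b" using L_bounded by (simp add: bounded_iff)
    then obtain b where b: "\<And>k x. x \<in> open_elements \<T> \<Longrightarrow> norm (\<L> k x) \<le> b k" by metis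
    have "norm (\<L> k x) \<le> Max (range b)" if "x \<in> open_elements \<T>" for k x
      by (rule order_trans[OF b[OF that, of k] Max_ge]) auto
    then show ?thesis by blast
  qed
  then obtain b where b: "\<And>k x. x \<in> open_elements \<T> \<Longrightarrow> norm (\<L> k x) \<le> b" by blast
  have b0: "b \<ge> 0" using b[OF x] norm_ge_zero order_trans by blast
  have nm: "norm (normal_matrix \<L> \<nu> y) \<le> CARD('n) * b" if "y \<in> open_elements \<T>" "norm \<nu> = 1" for y \<nu>
  proof -
    have "norm (normal_matrix \<L> \<nu> y) \<le> (\<Sum>j\<in>(UNIV::'n set). b)"
      unfolding normal_matrix_def
    proof (rule sum_norm_le)
      fix j
      have "\<bar>\<nu> $ j\<bar> \<le> 1" using component_le_norm_cart[of \<nu> j] that by simp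
      then have "\<bar>\<nu> $ j\<bar> * norm (\<L> j y) \<le> 1 * b" using b[OF that(1), of j] by (intro mult_mono) auto
      then show "norm ((\<nu> $ j) *\<^sub>R \<L> j y) \<le> b" by simp
    qed
    then show ?thesis by simp
  qed
  have bdd: "bdd_above ?S"
  proof (rule bdd_aboveI)
    fix m assume "m \<in> ?S"
    then obtain \<mu> y \<nu> e where *: "m = \<bar>\<mu>\<bar>" "y \<in> open_elements \<T>" "norm \<nu> = 1" "e \<noteq> 0"
      "normal_matrix \<L> \<nu> y *v e = \<mu> *\<^sub>R (\<G> y *v e)" by blast
    let ?C = "real CARD('l) * (real CARD('n) * b)"
    have "\<bar>\<mu>\<bar> * (\<gamma> * (norm e)\<^sup>2) \<le> \<bar>\<mu>\<bar> * ((\<G> y *v e) \<bullet> e)"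
      using \<gamma>(2)[OF *(2)] by (intro mult_left_mono) auto
    also have "\<dots> \<le> \<bar>\<mu> * ((\<G> y *v e) \<bullet> e)\<bar>" by (simp add: abs_mult mult_left_mono)
    also have "\<dots> = \<bar>(normal_matrix \<L> \<nu> y *v e) \<bullet> e\<bar>" by (simp add: *(5))
    also have "\<dots> \<le> norm (normal_matrix \<L> \<nu> y *v e) * norm e" by (rule Cauchy_Schwarz_ineq2)
    also have "\<dots> \<le> (real CARD('l) * norm (normal_matrix \<L> \<nu> y) * norm e) * norm e"
      by (intro mult_right_mono matrix_vector_bound) auto
    also have "\<dots> \<le> (?C * norm e) * norm e"
      using nm[OF *(2,3)] by (intro mult_right_mono mult_left_mono) auto
    finally have "(\<bar>\<mu>\<bar> * \<gamma>) * (norm e)\<^sup>2 \<le> ?C * (norm e)\<^sup>2" by (simp add: power2_eq_square algebra_simps)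
    then have "\<bar>\<mu>\<bar> * \<gamma> \<le> ?C" using *(4) by (simp add: mult_le_cancel_right)
    then show "m \<le> ?C / \<gamma>" using \<gamma>(1) *(1) by (simp add: field_simps)
  qed
  have unit: "\<exists>\<mu>. \<bar>\<mu>\<bar> \<in> ?S \<and> (\<forall>e. (normal_matrix \<L> \<nu> x *v e) \<bullet> e \<le> \<mu> * ((\<G> x *v e) \<bullet> e))"
    if "norm \<nu> = 1" for \<nu>
  proof -
    have tD: "transpose (normal_matrix \<L> \<nu> x) = normal_matrix \<L> \<nu> x"
      by (rule transpose_normal_matrix) (rule L_symmetric[OF x])
    obtain \<mu> e where "e \<noteq> 0" "normal_matrix \<L> \<nu> x *v e = \<mu> *\<^sub>R (\<G> x *v e)"
      "\<And>e. (normal_matrix \<L> \<nu> x *v e) \<bullet> e \<le> \<mu> * ((\<G> x *v e) \<bullet> e)"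
      by (rule generalized_rayleigh[OF tD G_symmetric[OF x] \<gamma>(1) \<gamma>(2)[OF x]]) blast
    then show ?thesis using x that by blast
  qed
  have le: "m \<le> max_wave_speed \<T> \<G> \<L>" if "m \<in> ?S" for m
    unfolding max_wave_speed_def using bdd that by (rule cSup_upper[rotated])
  show c0: "0 \<le> max_wave_speed \<T> \<G> \<L>"
  proof -
    have "norm (axis undefined 1 :: real^'n) = 1" by (simp add: norm_axis_1)
    from unit[OF this] show ?thesis using le by (meson abs_ge_zero order_trans)
  qed
  have Gpos: "0 \<le> (\<G> x *v e) \<bullet> e" using \<gamma>(2)[OF x, of e] \<gamma>(1) by (smt (verit) mult_nonneg_nonneg zero_le_power2)
  show "(normal_matrix \<L> v x *v e) \<bullet> e \<le> norm v * max_wave_speed \<T> \<G> \<L> * ((\<G> x *v e) \<bullet> e)"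
  proof (cases "v = 0")
    case False
    define \<nu> where "\<nu> = v /\<^sub>R norm v"
    have \<nu>: "norm \<nu> = 1" "v = norm v *\<^sub>R \<nu>" using False by (simp_all add: \<nu>_def)
    obtain \<mu> where \<mu>: "\<bar>\<mu>\<bar> \<in> ?S" "(normal_matrix \<L> \<nu> x *v e) \<bullet> e \<le> \<mu> * ((\<G> x *v e) \<bullet> e)"
      using unit[OF \<nu>(1)] by blast
    have "\<mu> \<le> max_wave_speed \<T> \<G> \<L>" using le[OF \<mu>(1)] by simp
    then have "(normal_matrix \<L> \<nu> x *v e) \<bullet> e \<le> max_wave_speed \<T> \<G> \<L> * ((\<G> x *v e) \<bullet> e)"
      using \<mu>(2) Gpos by (meson mult_right_mono order_trans)
    then have "norm v * ((normal_matrix \<L> \<nu> x *v e) \<bullet> e) \<le> norm v * (max_wave_speed \<T> \<G> \<L> * ((\<G> x *v e) \<bullet> e))"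
      by (intro mult_left_mono) auto
    moreover have "normal_matrix \<L> v x = norm v *\<^sub>R normal_matrix \<L> \<nu> x"
      using \<nu>(2) by (simp add: normal_matrix_def scaleR_sum_right) (metis vector_scaleR_component real_scaleR_def)
    ultimately show ?thesis by (simp add: mult.assoc flip: scaleR_matrix_vector_assoc)
  qed (simp add: normal_matrix_def)
qed

section \<open>Conforming simplicial meshes\<close>

context simplex_coords
begin

lemma rel_interior_facet:
  assumes u: "u \<in> C" and x: "x \<in> rel_interior (facet u)"
  shows "lam u x = 0" and "v \<in> C \<Longrightarrow> v \<noteq> u \<Longrightarrow> lam v x > 0"
proof -
  have xf: "x \<in> facet u" using x rel_interior_subset by blast
  then show "lam u x = 0" using facet_coords[OF u] by blast
  have i: "\<not> affine_dependent (C - {u})" using indep affine_independent_subset by blast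
  obtain w where w: "\<forall>y\<in>C - {u}. 0 < w y" "sum w (C - {u}) = 1" "(\<Sum>y\<in>C - {u}. w y *\<^sub>R y) = x"
    using x unfolding rel_interior_convex_hull_explicit[OF i] by blast
  define w' where "w' = w(u := 0)"
  have 1: "sum w' C = 1" using w(2) u fin by (simp add: w'_def sum.remove[of C u])
  have 2: "(\<Sum>y\<in>C. w' y *\<^sub>R y) = x" using w(3) u fin by (simp add: w'_def sum.remove[of C u])
  show "lam v x > 0" if "v \<in> C" "v \<noteq> u" for v
    using lam_combination[OF 1 that(1)] w(1) that unfolding 2 by (simp add: w'_def)
qed

text \<open>At a relative interior point of a facet all other coordinates are positive, hence also
  nearby. Only the coordinate of \<open>u\<close> then decides membership, and the simplex looks
  locally like a half space.\<close>

lemma facet_local: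
  assumes u: "u \<in> C" and x: "x \<in> rel_interior (facet u)"
  shows "\<exists>e>0. \<forall>y\<in>ball x e. g u \<bullet> (y - x) > 0 \<longrightarrow> y \<in> interior (convex hull C)"
proof -
  have "open (\<Inter>v\<in>C - {u}. {y. 0 < lam v y})"
    using fin by (auto intro!: open_INT open_Collect_less continuous_intros)
  moreover have "x \<in> (\<Inter>v\<in>C - {u}. {y. 0 < lam v y})" using rel_interior_facet[OF u x] by blast
  ultimately obtain e where e: "e > 0" "ball x e \<subseteq> (\<Inter>v\<in>C - {u}. {y. 0 < lam v y})"
    using open_contains_ball by meson
  have "y \<in> interior (convex hull C)" if "y \<in> ball x e" "g u \<bullet> (y - x) > 0" for y
  proof -
    have "lam u y > 0" using that(2) rel_interior_facet(1)[OF u x] by (simp add: lam_def inner_diff_right)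
    then show ?thesis using that(1) e(2) unfolding interior_coords by blast
  qed
  then show ?thesis using e(1) by blast
qed

lemma constant_on_facet:
  assumes u: "u \<in> C" and m: "\<And>x y. x \<in> facet u \<Longrightarrow> y \<in> facet u \<Longrightarrow> m \<bullet> (y - x) = 0"
  shows "\<exists>k. m = k *\<^sub>R g u"
proof -
  obtain v where v: "v \<in> C" "v \<noteq> u" using ex_other[OF u] by auto
  have c: "m \<bullet> x = m \<bullet> v" if "x \<in> C - {u}" for x
  proof -
    have "x \<in> facet u" "v \<in> facet u" using that v by (auto intro: hull_inc)
    then show ?thesis using m[of v x] by (simp add: inner_diff_right)
  qed
  have "m \<bullet> a = ((m \<bullet> u - m \<bullet> v) *\<^sub>R g u) \<bullet> a" for a
  proof -
    have "m \<bullet> a = m \<bullet> (\<Sum>w\<in>C. (g w \<bullet> a) *\<^sub>R w)" by (simp add: grad_bary)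
    also have "\<dots> = (\<Sum>w\<in>C. (g w \<bullet> a) * (m \<bullet> w))" by (simp add: inner_sum_right)
    also have "\<dots> = (\<Sum>w\<in>C. (g w \<bullet> a) * (m \<bullet> v) + (if w = u then (g u \<bullet> a) * (m \<bullet> u - m \<bullet> v) else 0))"
      using c by (intro sum.cong) (auto simp: algebra_simps)
    also have "\<dots> = (\<Sum>w\<in>C. g w) \<bullet> a * (m \<bullet> v) + (g u \<bullet> a) * (m \<bullet> u - m \<bullet> v)"
      using u fin by (simp add: sum.distrib inner_sum_left sum_distrib_right)
    finally show ?thesis by (simp add: grad_sum)
  qed
  then show ?thesis using vector_eq_rdot[of m "(m \<bullet> u - m \<bullet> v) *\<^sub>R g u"] by blast
qed

end

text \<open>Translates the facts on barycentric coordinates into statements about the outward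
  normal, the form in which mesh arguments use them.\<close>

lemma simplex_facet:
  fixes K :: "(real^'n::finite) set"
  assumes K: "int CARD('n) simplex K" and F: "F facet_of K"
  shows "norm (outward_normal K F) = 1"
    and "x \<in> F \<Longrightarrow> y \<in> K \<Longrightarrow> outward_normal K F \<bullet> (y - x) \<le> 0"
    and "x \<in> F \<Longrightarrow> affine hull F = {y. outward_normal K F \<bullet> y = outward_normal K F \<bullet> x}"
    and "compact F" and "rel_interior F \<noteq> {}"
    and "x \<in> rel_interior F \<Longrightarrow> \<exists>e>0. \<forall>y\<in>ball x e. outward_normal K F \<bullet> (y - x) < 0 \<longrightarrow> y \<in> interior K"
    and "(\<And>x y. x \<in> F \<Longrightarrow> y \<in> F \<Longrightarrow> m \<bullet> (y - x) = 0) \<Longrightarrow> \<exists>k. m = k *\<^sub>R outward_normal K F"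
proof -
  obtain C g \<alpha> where C: "simplex_coords C g \<alpha>" "K = convex hull C" by (rule simplex_coords_exists[OF K])
  interpret simplex_coords C g \<alpha> by (rule C(1))
  obtain u where u: "u \<in> C" "F = facet u" using F facets unfolding C(2) by blast
  have nz: "norm (g u) > 0" using grad_nonzero[OF u(1)] by simp
  have n: "outward_normal K F = - (g u /\<^sub>R norm (g u))"
    unfolding C(2) u(2) by (rule outward_normal_facet[OF u(1)])
  have sgn: "outward_normal K F \<bullet> y = - (g u \<bullet> y) / norm (g u)" for y
    by (simp add: n divide_inverse mult.commute)
  show "norm (outward_normal K F) = 1" using nz by (simp add: n)
  have lamF: "lam u x = 0" if "x \<in> F" for x using that facet_coords[OF u(1)] u(2) by blast
  show "outward_normal K F \<bullet> (y - x) \<le> 0" if "x \<in> F" "y \<in> K"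
  proof -
    have "lam u y \<ge> 0" using that(2) u(1) C(2) hull_coords by blast
    then have "g u \<bullet> (y - x) \<ge> 0" using lamF[OF that(1)] by (simp add: lam_def inner_diff_right)
    then show ?thesis using nz unfolding sgn by simp
  qed
  show "affine hull F = {y. outward_normal K F \<bullet> y = outward_normal K F \<bullet> x}" if "x \<in> F"
  proof -
    have "outward_normal K F \<bullet> y = outward_normal K F \<bullet> x \<longleftrightarrow> lam u y = 0" for y
      using nz lamF[OF that] unfolding sgn by (auto simp: lam_def)
    then show ?thesis using facet_affine[OF u(1)] unfolding u(2) by simp
  qed
  show "compact F" unfolding u(2) by (rule compact_facet)
  show "rel_interior F \<noteq> {}"
    using F unfolding u(2) by (simp add: rel_interior_eq_empty facet_of_def)
  show "\<exists>e>0. \<forall>y\<in>ball x e. outward_normal K F \<bullet> (y - x) < 0 \<longrightarrow> y \<in> interior K"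
    if x: "x \<in> rel_interior F"
  proof -
    have "outward_normal K F \<bullet> (y - x) < 0 \<longleftrightarrow> g u \<bullet> (y - x) > 0" for y
      using nz unfolding sgn by (simp add: zero_less_divide_iff)
    then show ?thesis using facet_local[OF u(1)] x u(2) C(2) by simp
  qed
  show "\<exists>k. m = k *\<^sub>R outward_normal K F" if m: "\<And>x y. x \<in> F \<Longrightarrow> y \<in> F \<Longrightarrow> m \<bullet> (y - x) = 0"
  proof -
    obtain k where k: "m = k *\<^sub>R g u" using constant_on_facet[OF u(1), of m] m u(2) by blast
    have "m = (- k * norm (g u)) *\<^sub>R outward_normal K F" using nz by (simp add: n k)
    then show ?thesis by blast
  qed
qed

section \<open>Elements, facets and neighbors in a mesh\<close>

locale mesh =
  fixes \<Omega> :: "(real^'n::finite) set" and \<T> :: "(real^'n) set set"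
  assumes open_dom: "open \<Omega>" and conforming: "conforming_mesh \<Omega> \<T>"
begin

lemma finite_mesh: "finite \<T>"
  using conforming by (simp add: conforming_mesh_def triangulation_def)

lemma element:
  assumes "K \<in> \<T>"
  shows "int CARD('n) simplex K" and "convex K" and "compact K" and "interior K \<subseteq> \<Omega>"
    and "K \<subseteq> closure \<Omega>" and "interior K \<noteq> {}" and "closure (interior K) = K"
    and "aff_dim K = int CARD('n)"
proof -
  show s: "int CARD('n) simplex K" and "interior K \<subseteq> \<Omega>" and "K \<subseteq> closure \<Omega>"
    using conforming assms by (auto simp: conforming_mesh_def)
  show c: "convex K" and cK: "compact K" and "aff_dim K = int CARD('n)"
    using s convex_simplex compact_simplex aff_dim_simplex by blast+
  obtain C g \<alpha> where C: "simplex_coords C g \<alpha>" "K = convex hull C" by (rule simplex_coords_exists[OF s])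
  show i: "interior K \<noteq> {}" unfolding C(2) by (rule simplex_coords.interior_nonempty[OF C(1)])
  show "closure (interior K) = K"
    using convex_closure_interior[OF c i] cK by (simp add: compact_imp_closed)
qed

lemma face_of_inter:
  assumes "K \<in> \<T>" "K' \<in> \<T>" shows "K \<inter> K' face_of K" and "K \<inter> K' face_of K'"
proof -
  have "K \<inter> K' face_of K" if "K \<in> \<T>" "K' \<in> \<T>" for K K'
    using conforming that by (simp add: conforming_mesh_def triangulation_def)
  from this[of K K'] this[of K' K] show "K \<inter> K' face_of K" "K \<inter> K' face_of K'"
    using assms by (simp_all add: Int_commute)
qed

lemma mesh_cover: "x \<in> \<Omega> \<Longrightarrow> \<exists>K\<in>\<T>. x \<in> K"
  using conforming closure_subset[of \<Omega>] by (auto simp: conforming_mesh_def)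

text \<open>\<open>K \<inter> K'\<close> is a face of \<open>K\<close>, and a face that meets the
  interior is all of \<open>K\<close>.\<close>

lemma element_subset_eq:
  assumes "K \<in> \<T>" "K' \<in> \<T>" "x \<in> interior K" "x \<in> K'"
  shows "K \<subseteq> K'"
proof -
  have "rel_interior K = interior K" using rel_interior_nonempty_interior element(6)[OF assms(1)] by blast
  then have "K \<subseteq> K \<inter> K'"
    using subset_of_face_of[OF face_of_inter(1)[OF assms(1,2)], of K] assms(3,4) interior_subset by blast
  then show ?thesis by blast
qed

lemma interiors_disjoint:
  assumes "K \<in> \<T>" "K' \<in> \<T>" "K \<noteq> K'"
  shows "interior K \<inter> interior K' = {}"
  using element_subset_eq[OF assms(1,2)] element_subset_eq[OF assms(2,1)] assms(3) interior_subset by blast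

lemma interior_unique: "K \<in> \<T> \<Longrightarrow> K' \<in> \<T> \<Longrightarrow> x \<in> interior K \<Longrightarrow> x \<in> interior K' \<Longrightarrow> K' = K"
  using interiors_disjoint by blast

lemma frontier_dom: "x \<in> K \<Longrightarrow> K \<in> \<T> \<Longrightarrow> x \<in> frontier \<Omega> \<longleftrightarrow> x \<notin> \<Omega>"
  using element(5) open_dom by (auto simp: frontier_def interior_open)

lemma facet_subset: "F facet_of K \<Longrightarrow> F \<subseteq> K"
  by (meson facet_of_imp_face_of face_of_imp_subset)

lemma negligible_skeleton: "negligible (skeleton \<T>)"
  unfolding skeleton_def
  by (intro negligible_Union finite_imageI finite_mesh) (auto intro: negligible_convex_frontier element(2))

lemma dom_minus_open_elements: "\<Omega> - open_elements \<T> \<subseteq> skeleton \<T>"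
proof
  fix x assume x: "x \<in> \<Omega> - open_elements \<T>"
  then obtain K where K: "K \<in> \<T>" "x \<in> K" using mesh_cover by blast
  then have "x \<notin> interior K" using x by (auto simp: open_elements_def)
  then have "x \<in> frontier K" using K(2) closure_subset by (auto simp: frontier_def)
  then show "x \<in> skeleton \<T>" using K(1) by (auto simp: skeleton_def)
qed

lemma facet_in_skeleton:
  assumes "K \<in> \<T>" "F facet_of K"
  shows "F \<subseteq> skeleton \<T>"
proof -
  have "x \<notin> interior K" if "x \<in> F" for x
  proof
    assume "x \<in> interior K"
    then obtain e where e: "e > 0" "ball x e \<subseteq> K" using mem_interior by blast
    let ?n = "outward_normal K F"
    have n: "norm ?n = 1" by (rule simplex_facet(1)[OF element(1)[OF assms(1)] assms(2)])
    have "x + (e/2) *\<^sub>R ?n \<in> K" using e n by (intro subsetD[OF e(2)]) (simp add: dist_norm)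
    then have "?n \<bullet> ((x + (e/2) *\<^sub>R ?n) - x) \<le> 0"
      by (rule simplex_facet(2)[OF element(1)[OF assms(1)] assms(2) that])
    then show False using e n by (simp add: dot_square_norm)
  qed
  then have "F \<subseteq> frontier K"
    using facet_subset[OF assms(2)] closure_subset by (auto simp: frontier_def)
  then show ?thesis using assms(1) by (auto simp: skeleton_def)
qed

text \<open>Both normals are orthogonal to \<open>F\<close>, hence equal up to sign. If they were
  equal, a point slightly below a relative interior point of \<open>F\<close> would lie in the
  interior of both elements.\<close>

lemma opposite_normal:
  assumes K: "K \<in> \<T>" "K' \<in> \<T>" "K \<noteq> K'" and F: "F facet_of K" "F facet_of K'"
  shows "outward_normal K' F = - outward_normal K F"
proof -
  let ?n = "outward_normal K F" and ?n' = "outward_normal K' F"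
  note s = simplex_facet[OF element(1)[OF K(1)] F(1)] and s' = simplex_facet[OF element(1)[OF K(2)] F(2)]
  have "?n' \<bullet> (y - x) = 0" if "x \<in> F" "y \<in> F" for x y
  proof -
    have "?n' \<bullet> (y - x) \<le> 0" "?n' \<bullet> (x - y) \<le> 0"
      using s'(2) that facet_subset[OF F(2)] by blast+
    then show ?thesis by (simp add: inner_diff_right)
  qed
  then obtain k where k: "?n' = k *\<^sub>R ?n" using s(7) by blast
  have "\<bar>k\<bar> = 1" using s(1) s'(1) unfolding k by simp
  moreover have "k \<noteq> 1"
  proof
    assume "k = 1"
    then have eq: "?n' = ?n" using k by simp
    obtain x where x: "x \<in> rel_interior F" using s(5) by blast
    obtain e where e: "e > 0" "\<forall>y\<in>ball x e. ?n \<bullet> (y - x) < 0 \<longrightarrow> y \<in> interior K" using s(6)[OF x] by blast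
    obtain e' where e': "e' > 0" "\<forall>y\<in>ball x e'. ?n' \<bullet> (y - x) < 0 \<longrightarrow> y \<in> interior K'" using s'(6)[OF x] by blast
    define d where "d = min e e' / 2"
    have d: "d > 0" "d < e" "d < e'" using e(1) e'(1) by (auto simp: d_def min_def)
    let ?y = "x - d *\<^sub>R ?n"
    have "?y \<in> ball x e" "?y \<in> ball x e'" using d s(1) by (auto simp: dist_norm)
    moreover have "?n \<bullet> (?y - x) < 0" using d s(1) by (simp add: dot_square_norm)
    ultimately have "?y \<in> interior K \<inter> interior K'" using e(2) e'(2) unfolding eq by blast
    then show False using interiors_disjoint[OF K] by blast
  qed
  ultimately have "k = -1" by linarith
  then show ?thesis using k by simp
qed

text \<open>Three elements on one facet would have pairwise opposite normals, which is impossible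
  for unit vectors.\<close>

lemma neighbor_unique:
  assumes K: "K \<in> \<T>" "K' \<in> \<T>" "K'' \<in> \<T>" "K' \<noteq> K" "K'' \<noteq> K"
    and F: "F facet_of K" "F facet_of K'" "F facet_of K''"
  shows "K'' = K'"
proof (rule ccontr)
  assume ne: "K'' \<noteq> K'"
  have "outward_normal K' F = - outward_normal K F" using opposite_normal K F by metis
  moreover have "outward_normal K'' F = - outward_normal K F" using opposite_normal K F by metis
  moreover have "outward_normal K'' F = - outward_normal K' F" using opposite_normal K F ne by metis
  ultimately have "outward_normal K F = - outward_normal K F" by simp
  then have "outward_normal K F + outward_normal K F = 0" by (simp add: eq_neg_iff_add_eq_0)
  then have "2 *\<^sub>R outward_normal K F = 0" by (simp add: scaleR_2)
  then have "outward_normal K F = 0" by simp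
  then show False using simplex_facet(1)[OF element(1)[OF K(1)] F(1)] by simp
qed

lemma neighbor_eq:
  assumes "\<K> \<subseteq> \<T>" "K \<in> \<T>" "K' \<in> \<K>" "K' \<noteq> K" "F facet_of K" "F facet_of K'"
  shows "neighbor \<K> K F = K'"
  unfolding neighbor_def using assms neighbor_unique[of K K'] by (intro the_equality) blast+

text \<open>Points just outside \<open>K\<close> along the normal lie in other elements, whose
  finite union is closed, so \<open>x\<close> itself lies in some \<open>K' \<noteq> K\<close>. The
  intersection \<open>K \<inter> K'\<close> is a proper face of \<open>K\<close> containing
  \<open>F\<close>, and \<open>F\<close> is already only one dimension below \<open>K\<close>; hence
  the two coincide.\<close>

lemma shared_facet:
  assumes K: "K \<in> \<T>" and F: "F facet_of K" and x: "x \<in> rel_interior F" "x \<in> \<Omega>"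
  shows "\<exists>K'\<in>\<T>. K' \<noteq> K \<and> F facet_of K'"
proof -
  let ?n = "outward_normal K F"
  note s = simplex_facet[OF element(1)[OF K] F]
  have xF: "x \<in> F" using x(1) rel_interior_subset by blast
  obtain e where e: "e > 0" "ball x e \<subseteq> \<Omega>" using open_dom x(2) open_contains_ball by blast
  \<comment> \<open>The shift by 2 keeps every point, including the first, strictly inside the ball
    of radius \<open>e\<close>.\<close>
  define y where "y k = x + (e / real (k + 2)) *\<^sub>R ?n" for k
  have "y k \<in> \<Union>(\<T> - {K})" for k
  proof -
    have "e * 1 < e * real (k + 2)" using e(1) by (intro mult_strict_left_mono) auto
    then have p: "e / real (k + 2) > 0" "e / real (k + 2) < e" using e(1) by (simp_all add: divide_less_eq)
    then have "y k \<in> ball x e" using s(1) by (simp add: y_def dist_norm)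
    then obtain K' where "K' \<in> \<T>" "y k \<in> K'" using e(2) mesh_cover by blast
    moreover have "y k \<notin> K"
    proof
      assume "y k \<in> K"
      then have "?n \<bullet> (y k - x) \<le> 0" by (rule s(2)[OF xF])
      then show False using p(1) s(1) by (simp add: y_def dot_square_norm)
    qed
    ultimately show ?thesis by blast
  qed
  moreover have "y \<longlonglongrightarrow> x"
  proof -
    have "(\<lambda>k. e / real (k + 2)) \<longlonglongrightarrow> 0"
      by (rule LIMSEQ_ignore_initial_segment[of "\<lambda>k. e / real k" 0 2])
        (rule tendsto_divide_0[OF tendsto_const filterlim_at_top_imp_at_infinity[OF filterlim_real_sequentially]])
    then have "(\<lambda>k. x + (e / real (k + 2)) *\<^sub>R ?n) \<longlonglongrightarrow> x + 0 *\<^sub>R ?n" by (intro tendsto_intros)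
    then show ?thesis by (simp add: y_def[abs_def])
  qed
  moreover have "closed (\<Union>(\<T> - {K}))"
    using finite_mesh element(3) by (intro closed_Union) (auto intro: compact_imp_closed)
  ultimately have "x \<in> \<Union>(\<T> - {K})" using closed_sequentially by blast
  then obtain K' where K': "K' \<in> \<T>" "K' \<noteq> K" "x \<in> K'" by blast
  have FK: "F face_of K" using F facet_of_imp_face_of by blast
  have sub: "F \<subseteq> K \<inter> K'"
    using subset_of_face_of[OF face_of_inter(1)[OF K K'(1)], of F] facet_subset[OF F] xF x(1) K'(3) by blast
  have "K \<inter> K' \<noteq> K"
  proof
    assume "K \<inter> K' = K"
    then have "interior K \<subseteq> interior K'" by (intro interior_mono) blast
    then show False using interiors_disjoint[OF K K'(1)] K'(2) element(6)[OF K] by blast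
  qed
  then have lt: "aff_dim (K \<inter> K') < aff_dim K"
    using face_of_aff_dim_lt[OF element(2)[OF K] face_of_inter(1)[OF K K'(1)]] by blast
  have aF: "aff_dim F = aff_dim K - 1" "F \<noteq> {}" using F by (auto simp: facet_of_def)
  have "F = K \<inter> K'"
  proof (rule ccontr)
    assume ne: "F \<noteq> K \<inter> K'"
    have "F face_of K \<inter> K'" using face_of_subset[OF FK sub] by blast
    then have "aff_dim F < aff_dim (K \<inter> K')"
      using face_of_aff_dim_lt[OF _ _ ne] convex_Int[OF element(2)[OF K] element(2)[OF K'(1)]] by blast
    then show False using lt aF by linarith
  qed
  then have "F face_of K'" using face_of_inter(2)[OF K K'(1)] by simp
  then have "F facet_of K'"
    using aF element(8)[OF K] element(8)[OF K'(1)] by (simp add: facet_of_def)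
  then show ?thesis using K' by blast
qed

text \<open>Facet integrals involve arbitrary points of \<open>F\<close>, whereas the local
  half-space picture needs a relative interior point. Such points are dense in \<open>F\<close>, and
  the domain is open.\<close>

lemma rel_interior_in_dom:
  assumes "K \<in> \<T>" "F facet_of K" "x \<in> F" "x \<in> \<Omega>"
  shows "\<exists>y\<in>rel_interior F. y \<in> \<Omega>"
proof -
  have "convex F" using assms(1,2) element(2) face_of_imp_convex facet_of_imp_face_of by blast
  then have "x \<in> closure (rel_interior F)" using assms(3) closure_subset by (auto simp: convex_closure_rel_interior)
  then have "\<Omega> \<inter> rel_interior F \<noteq> {}" using open_dom assms(4) closure_iff_nhds_not_empty by blast
  then show ?thesis by blast
qed

text \<open>\<open>v\<close> is an extreme point of the facet and therefore also a vertex of the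
  neighbor across it. Consequently an unshared facet of the patch that reaches into the domain must
  miss \<open>v\<close>, where the height of the tent vanishes.\<close>

lemma shared_facet_patch:
  assumes K: "K \<in> patch \<T> v" and F: "F facet_of K" and v: "v \<in> F" and x: "x \<in> F" "x \<in> \<Omega>"
  shows "\<exists>K'\<in>patch \<T> v. K' \<noteq> K \<and> F facet_of K'"
proof -
  have K': "K \<in> \<T>" "v extreme_point_of K" using K by (auto simp: patch_def)
  obtain y where "y \<in> rel_interior F" "y \<in> \<Omega>" using rel_interior_in_dom[OF K'(1) F x] by blast
  then obtain L where L: "L \<in> \<T>" "L \<noteq> K" "F facet_of L" using shared_facet[OF K'(1) F] by blast
  have "v extreme_point_of F"
    using K'(2) v F extreme_point_of_face facet_of_imp_face_of by blast
  then have "v extreme_point_of L" using L(3) extreme_point_of_face facet_of_imp_face_of by blast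
  then show ?thesis using L by (auto simp: patch_def)
qed

end

section \<open>Continuity of the normal flux\<close>

text \<open>Bridge from the completed measure, used for elementwise integrals, to
  \<open>lborel\<close>, on which the slicing and divergence formulas are stated.\<close>

lemma lebesgue_integral_eq_lborel:
  fixes f g :: "'a::euclidean_space \<Rightarrow> 'b::euclidean_space"
  assumes g: "integrable lborel g" and ae: "AE x in lebesgue. g x = f x"
  shows "integrable lebesgue f" and "integral\<^sup>L lebesgue f = integral\<^sup>L lborel g"
proof -
  have g': "integrable lebesgue g" "integral\<^sup>L lebesgue g = integral\<^sup>L lborel g"
    using g by (auto simp: integrable_completion integral_completion)
  have f: "f \<in> borel_measurable lebesgue"
    using borel_measurable_integrable[OF g'(1)] ae by (rule borel_measurable_AE)
  show "integrable lebesgue f" using integrable_cong_AE_imp[OF g'(1) f] ae by (auto simp: eq_commute)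
  show "integral\<^sup>L lebesgue f = integral\<^sup>L lborel g"
    using integral_cong_AE[OF borel_measurable_integrable[OF g'(1)] f ae] g'(2) by simp
qed

lemma AE_not_negligible: "negligible N \<Longrightarrow> AE x in lebesgue. x \<notin> N"
  by (simp add: negligible_iff_null_sets AE_not_in)

lemma AE_open_empty:
  fixes U :: "'a::euclidean_space set"
  assumes "open U" "AE x in lebesgue. x \<notin> U"
  shows "U = {}"
proof -
  have "negligible U"
    using assms by (simp add: negligible_iff_null_sets AE_iff_null_sets lmeasurable_iff_integrable_on)
  then show ?thesis using assms(1) open_not_negligible by blast
qed

text \<open>The boundary of a convex set is null, so a function known only on the open element may
  be replaced by a continuous representative on the closed one.\<close>

lemma interior_integral:
  fixes f g :: "'a::euclidean_space \<Rightarrow> 'b::euclidean_space"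
  assumes K: "convex K" "compact K" and g: "continuous_on K g" and eq: "\<And>x. x \<in> interior K \<Longrightarrow> f x = g x"
  shows "set_integrable lebesgue (interior K) f"
    and "(LINT x:interior K|lebesgue. f x) = (LINT x:K|lborel. g x)"
proof -
  have "AE x in lebesgue. x \<notin> frontier K"
    by (rule AE_not_negligible[OF negligible_convex_frontier[OF K(1)]])
  then have "AE x in lebesgue. indicator K x *\<^sub>R g x = indicator (interior K) x *\<^sub>R f x"
    by eventually_elim (use eq interior_subset[of K] compact_imp_closed[OF K(2)] in
      \<open>auto simp: indicator_def frontier_def split: if_splits\<close>)
  from lebesgue_integral_eq_lborel[OF borel_integrable_compact[OF K(2) g] this]
  show "set_integrable lebesgue (interior K) f"
    "(LINT x:interior K|lebesgue. f x) = (LINT x:K|lborel. g x)"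
    unfolding set_integrable_def set_lebesgue_integral_def by blast+
qed

text \<open>On each line \<open>y + t s\<close> with \<open>y\<close> in the mirror the reflection
  is \<open>t \<mapsto> - t\<close>. The slicing formula therefore reduces invariance to that of
  one-dimensional Lebesgue measure.\<close>

lemma distr_reflection_lborel:
  fixes s :: "real^'n::finite"
  assumes s: "norm s = 1"
  shows "distr lborel borel (\<lambda>x. x - (2 * (s \<bullet> x - c)) *\<^sub>R s) = lborel" (is "?M = _")
proof (rule measure_eqI)
  let ?R = "\<lambda>x. x - (2 * (s \<bullet> x - c)) *\<^sub>R s"
  let ?H = "hyperplane_measure {y. s \<bullet> y = c}"
  show "sets ?M = sets lborel" by simp
  fix A assume "A \<in> sets ?M"
  then have [measurable]: "A \<in> sets borel" by simp
  have [measurable]: "?R \<in> borel_measurable borel" by measurable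
  have "emeasure ?M A = (\<integral>\<^sup>+ x. indicator A x \<partial>?M)" by simp
  also have "\<dots> = (\<integral>\<^sup>+ x. indicator A (?R x) \<partial>lborel)"
    by (rule nn_integral_distr) measurable
  also have "\<dots> = (\<integral>\<^sup>+ y. \<integral>\<^sup>+ t. indicator A (?R (y + t *\<^sub>R s)) \<partial>lborel \<partial>?H)"
    by (rule nn_integral_slices(2)[OF s]) measurable
  also have "\<dots> = (\<integral>\<^sup>+ y. \<integral>\<^sup>+ t. indicator A (y + t *\<^sub>R s) \<partial>lborel \<partial>?H)"
  proof (rule nn_integral_cong_AE)
    show "AE y in ?H. (\<integral>\<^sup>+ t. indicator A (?R (y + t *\<^sub>R s)) \<partial>lborel) = (\<integral>\<^sup>+ t. indicator A (y + t *\<^sub>R s) \<partial>lborel)"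
      using AE_hyperplane_measure[OF s, of c]
    proof eventually_elim
      fix y assume y: "s \<bullet> y = c"
      have R: "?R (y + t *\<^sub>R s) = y + (- t) *\<^sub>R s" for t
      proof -
        have 1: "s \<bullet> (y + t *\<^sub>R s) - c = t" by (simp add: inner_add_right y dot_square_norm s)
        have 2: "(2 * t) *\<^sub>R s = t *\<^sub>R s + t *\<^sub>R s" by (simp flip: scaleR_left_distrib)
        show ?thesis unfolding 1 2 by simp
      qed
      have "(\<integral>\<^sup>+ t. indicator A (?R (y + t *\<^sub>R s)) \<partial>lborel) = (\<integral>\<^sup>+ t. indicator A (y + (- t) *\<^sub>R s) \<partial>lborel)"
        by (simp only: R)
      also have "\<dots> = (\<integral>\<^sup>+ t. indicator A (y + t *\<^sub>R s) \<partial>lborel)"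
        using nn_integral_real_affine[of "\<lambda>t. indicator A (y + t *\<^sub>R s)" "-1" 0] by simp
      finally show "(\<integral>\<^sup>+ t. indicator A (?R (y + t *\<^sub>R s)) \<partial>lborel) = (\<integral>\<^sup>+ t. indicator A (y + t *\<^sub>R s) \<partial>lborel)" .
    qed
  qed
  also have "\<dots> = (\<integral>\<^sup>+ x. indicator A x \<partial>lborel)"
    by (rule nn_integral_slices(2)[OF s, symmetric]) measurable
  finally show "emeasure ?M A = emeasure lborel A" by simp
qed

lemma integral_reflection:
  fixes f :: "real^'n::finite \<Rightarrow> 'b::euclidean_space"
  assumes s: "norm s = 1" and f: "f \<in> borel_measurable borel"
  shows "(LINT x|lborel. f (x - (2 * (s \<bullet> x - c)) *\<^sub>R s)) = (LINT x|lborel. f x)"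
proof -
  have "(LINT x|lborel. f x) = (LINT x|distr lborel borel (\<lambda>x. x - (2 * (s \<bullet> x - c)) *\<^sub>R s). f x)"
    by (simp only: distr_reflection_lborel[OF s])
  also have "\<dots> = (LINT x|lborel. f (x - (2 * (s \<bullet> x - c)) *\<^sub>R s))"
    by (rule integral_distr) (use f in measurable)
  finally show ?thesis by simp
qed

text \<open>
  For a radial bump centred on a hyperplane with normal \<open>n\<close>, reflections show that the integral of
  its gradient over either side is a multiple of \<open>n\<close>, with opposite factors for the two sides.
\<close>

lemma radial_bump_half_integral:
  fixes n x0 :: "real^'n::finite"
  assumes n: "norm n = 1" and r: "r > 0"
  defines "w \<equiv> \<lambda>x. - 2 * flat 2 (r\<^sup>2 - (x - x0) \<bullet> (x - x0))"
  obtains \<kappa> where "\<kappa> > 0"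
    "\<And>j. integrable lborel (\<lambda>x. indicator {x. n \<bullet> (x - x0) < 0} x * (w x * (x - x0) $ j))"
    "\<And>j. integrable lborel (\<lambda>x. indicator {x. n \<bullet> (x - x0) > 0} x * (w x * (x - x0) $ j))"
    "\<And>j. (LINT x|lborel. indicator {x. n \<bullet> (x - x0) < 0} x * (w x * (x - x0) $ j)) = \<kappa> * n $ j"
    "\<And>j. (LINT x|lborel. indicator {x. n \<bullet> (x - x0) > 0} x * (w x * (x - x0) $ j)) = - \<kappa> * n $ j"
proof -
  have w_supp: "w x = 0" if "x \<notin> cball x0 r" for x
  proof -
    have "r < norm (x - x0)" using that by (simp add: dist_norm norm_minus_commute)
    then have "r\<^sup>2 < (x - x0) \<bullet> (x - x0)" using r by (simp add: dot_square_norm power_strict_mono)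
    then show ?thesis by (simp add: w_def flat_def)
  qed
  have w_le: "w x \<le> 0" for x by (simp add: w_def flat_def)
  have cflat: "continuous_on UNIV (flat k)" for k
    using flat_derivative by (meson DERIV_isCont continuous_at_imp_continuous_on)
  have cw: "continuous_on UNIV w"
    unfolding w_def by (intro continuous_intros continuous_on_compose2[OF cflat]) auto
  define G where "G x = w x *\<^sub>R (x - x0)" for x
  have cG: "continuous_on S G" for S
    unfolding G_def by (intro continuous_intros continuous_on_subset[OF cw]) auto
  have mG [measurable]: "G \<in> borel_measurable borel" by (rule borel_measurable_continuous_onI[OF cG])
  have iG: "integrable lborel G"
  proof -
    have "integrable lborel (\<lambda>x. indicator (cball x0 r) x *\<^sub>R G x)"
      by (intro borel_integrable_compact cG) simp
    moreover have "indicator (cball x0 r) x *\<^sub>R G x = G x" for x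
      using w_supp[of x] by (cases "x \<in> cball x0 r") (auto simp: G_def)
    ultimately show ?thesis by simp
  qed
  define hm where "hm x = indicator {x. n \<bullet> (x - x0) < 0} x *\<^sub>R G x" for x
  define hp where "hp x = indicator {x. n \<bullet> (x - x0) > 0} x *\<^sub>R G x" for x
  have [measurable]: "{x. n \<bullet> (x - x0) < 0} \<in> sets borel" "{x. n \<bullet> (x - x0) > 0} \<in> sets borel" by measurable
  have [measurable]: "hm \<in> borel_measurable borel" "hp \<in> borel_measurable borel"
    unfolding hm_def hp_def by measurable
  have im: "integrable lborel hm" and ip: "integrable lborel hp"
    unfolding hm_def hp_def by (intro integrable_mult_indicator iG; simp)+
  define a where "a = integral\<^sup>L lborel hm"
  define a' where "a' = integral\<^sup>L lborel hp"
  have R0: "(x - (2 * (s \<bullet> x - s \<bullet> x0)) *\<^sub>R s) - x0 = (x - x0) - (2 * (s \<bullet> (x - x0))) *\<^sub>R s" for s x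
    by (simp add: inner_diff_right algebra_simps)
  have GR: "s \<bullet> G (x - (2 * (s \<bullet> x - s \<bullet> x0)) *\<^sub>R s) = - (s \<bullet> G x)"
    and wR: "w (x - (2 * (s \<bullet> x - s \<bullet> x0)) *\<^sub>R s) = w x" if s: "norm s = 1" for s x
  proof -
    have ss: "s \<bullet> s = 1" using s by (simp add: norm_eq_1)
    have "(z - (2 * (s \<bullet> z)) *\<^sub>R s) \<bullet> (z - (2 * (s \<bullet> z)) *\<^sub>R s) = z \<bullet> z" for z
      by (simp add: inner_diff_left inner_diff_right ss inner_commute[of z s])
    from this[of "x - x0"] show 1: "w (x - (2 * (s \<bullet> x - s \<bullet> x0)) *\<^sub>R s) = w x" unfolding w_def R0 by simp
    have "s \<bullet> ((x - x0) - (2 * (s \<bullet> (x - x0))) *\<^sub>R s) = - (s \<bullet> (x - x0))"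
      using s by (simp only: inner_diff_right[of s "x - x0"] inner_scaleR_right dot_square_norm) simp
    then show "s \<bullet> G (x - (2 * (s \<bullet> x - s \<bullet> x0)) *\<^sub>R s) = - (s \<bullet> G x)"
      unfolding G_def 1 R0 by simp
  qed
  \<comment> \<open>With \<open>h' = h\<close> and a reflection that preserves the sides, this
    forces the component to vanish; with the functions of the two sides and the reflection in the
    hyperplane itself, it relates the two integrals.\<close>
  have odd: "s \<bullet> integral\<^sup>L lborel h' = - (s \<bullet> integral\<^sup>L lborel h)"
    if s: "norm s = 1" and h: "h \<in> borel_measurable borel" "integrable lborel h" "integrable lborel h'"
      and eq: "\<And>x. s \<bullet> h' (x - (2 * (s \<bullet> x - s \<bullet> x0)) *\<^sub>R s) = - (s \<bullet> h x)" and h': "h' \<in> borel_measurable borel" for s h h'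
  proof -
    have "s \<bullet> integral\<^sup>L lborel h' = (LINT x|lborel. s \<bullet> h' x)"
      using h(3) by (simp add: integral_inner_right)
    also have "\<dots> = (LINT x|lborel. s \<bullet> h' (x - (2 * (s \<bullet> x - s \<bullet> x0)) *\<^sub>R s))"
      by (rule integral_reflection[OF s, symmetric]) (use h' in measurable)
    also have "\<dots> = - (s \<bullet> integral\<^sup>L lborel h)"
      unfolding eq using h(2) by (simp add: integral_inner_right)
    finally show ?thesis .
  qed
  have perp: "s \<bullet> a = 0 \<and> s \<bullet> a' = 0" if s: "norm s = 1" "n \<bullet> s = 0" for s
  proof -
    have side: "n \<bullet> ((x - (2 * (s \<bullet> x - s \<bullet> x0)) *\<^sub>R s) - x0) = n \<bullet> (x - x0)" for x
      unfolding R0 by (simp add: inner_diff_right[of n "x - x0"] s(2))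
    have "s \<bullet> hm (x - (2 * (s \<bullet> x - s \<bullet> x0)) *\<^sub>R s) = - (s \<bullet> hm x)" for x
      unfolding hm_def indicator_def mem_Collect_eq side using GR[OF s(1), of x] by simp
    from odd[OF s(1) _ im im this] have "s \<bullet> a = - (s \<bullet> a)" by (simp add: a_def)
    moreover have "s \<bullet> hp (x - (2 * (s \<bullet> x - s \<bullet> x0)) *\<^sub>R s) = - (s \<bullet> hp x)" for x
      unfolding hp_def indicator_def mem_Collect_eq side using GR[OF s(1), of x] by simp
    from odd[OF s(1) _ ip ip this] have "s \<bullet> a' = - (s \<bullet> a')" by (simp add: a'_def)
    ultimately show ?thesis by simp
  qed
  have along: "b = (n \<bullet> b) *\<^sub>R n" if b: "\<And>s. norm s = 1 \<Longrightarrow> n \<bullet> s = 0 \<Longrightarrow> s \<bullet> b = 0" for b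
  proof (rule ccontr)
    assume ne: "b \<noteq> (n \<bullet> b) *\<^sub>R n"
    define t where "t = b - (n \<bullet> b) *\<^sub>R n"
    have nt: "n \<bullet> t = 0" by (simp add: t_def inner_diff_right dot_square_norm n)
    have t0: "norm t > 0" using ne by (simp add: t_def)
    have "(t /\<^sub>R norm t) \<bullet> b = 0" by (rule b) (use t0 nt in auto)
    then have "t \<bullet> b = 0" using t0 by simp
    moreover have "t \<bullet> t = t \<bullet> b" using nt by (subst (2) t_def) (simp add: inner_diff_right inner_commute[of t n])
    ultimately show False using t0 by simp
  qed
  have nn: "n \<bullet> a' = - (n \<bullet> a)"
    unfolding a_def a'_def
  proof (rule odd[OF n _ im ip])
    fix x
    have side: "n \<bullet> ((x - (2 * (n \<bullet> x - n \<bullet> x0)) *\<^sub>R n) - x0) = - (n \<bullet> (x - x0))"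
      unfolding R0 using n by (simp only: inner_diff_right[of n "x - x0"] inner_scaleR_right dot_square_norm) simp
    show "n \<bullet> hp (x - (2 * (n \<bullet> x - n \<bullet> x0)) *\<^sub>R n) = - (n \<bullet> hm x)"
      unfolding hp_def hm_def indicator_def mem_Collect_eq side using GR[OF n, of x] by simp
  qed measurable
  \<comment> \<open>On the lower side both the weight and \<open>n \<bullet> (x - x0)\<close> are
    nonpositive, so the integrand is nonnegative, and it is nonzero on an open half ball. This makes
    it legitimate to divide by the factor later.\<close>
  have pos: "n \<bullet> a > 0"
  proof -
    have na: "n \<bullet> a = (LINT x|lborel. n \<bullet> hm x)" unfolding a_def using im by (simp add: integral_inner_right)
    have nonneg: "0 \<le> n \<bullet> hm x" for x
      using w_le[of x] by (auto simp: hm_def G_def indicator_def intro: mult_nonpos_nonpos)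
    have inm: "integrable lborel (\<lambda>x. n \<bullet> hm x)" using im by simp
    have "n \<bullet> a \<noteq> 0"
    proof
      assume "n \<bullet> a = 0"
      then have "AE x in lborel. n \<bullet> hm x = 0"
        using integral_nonneg_eq_0_iff_AE[OF inm] nonneg na by simp
      then have ae: "AE x in lebesgue. n \<bullet> hm x = 0" by (simp only: AE_completion_iff)
      define U where "U = {x. n \<bullet> (x - x0) < 0} \<inter> ball x0 r"
      have "n \<bullet> hm x \<noteq> 0" if "x \<in> U" for x
      proof -
        have "norm (x - x0) < r" using that by (simp add: U_def dist_norm norm_minus_commute)
        then have "(x - x0) \<bullet> (x - x0) < r\<^sup>2" by (simp add: dot_square_norm power_strict_mono)
        then have "w x \<noteq> 0" by (simp add: w_def flat_def)
        then show ?thesis using that by (simp add: hm_def G_def U_def)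
      qed
      then have "AE x in lebesgue. x \<notin> U" using ae by (auto elim: eventually_mono)
      moreover have "open U" unfolding U_def by (intro open_Int open_ball open_Collect_less continuous_intros)
      ultimately have "U = {}" by (rule AE_open_empty[rotated])
      moreover have "x0 - (r/2) *\<^sub>R n \<in> U" using r n by (simp add: U_def dist_norm dot_square_norm)
      ultimately show False by blast
    qed
    moreover have "0 \<le> n \<bullet> a" unfolding na by (rule Bochner_Integration.integral_nonneg) (rule nonneg)
    ultimately show ?thesis by simp
  qed
  have a: "a = (n \<bullet> a) *\<^sub>R n" and a': "a' = (n \<bullet> a') *\<^sub>R n" using along perp by blast+
  have cm: "hm x $ j = indicator {x. n \<bullet> (x - x0) < 0} x * (w x * (x - x0) $ j)"
    and cp: "hp x $ j = indicator {x. n \<bullet> (x - x0) > 0} x * (w x * (x - x0) $ j)" for x j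
    by (simp_all add: hm_def hp_def G_def)
  show thesis
  proof (rule that[OF pos])
    fix j
    show "integrable lborel (\<lambda>x. indicator {x. n \<bullet> (x - x0) < 0} x * (w x * (x - x0) $ j))"
      using integrable_bounded_linear[OF bounded_linear_vec_nth im, of j] unfolding cm .
    show "integrable lborel (\<lambda>x. indicator {x. n \<bullet> (x - x0) > 0} x * (w x * (x - x0) $ j))"
      using integrable_bounded_linear[OF bounded_linear_vec_nth ip, of j] unfolding cp .
    have "(LINT x|lborel. hm x $ j) = a $ j"
      unfolding a_def by (rule integral_bounded_linear[OF bounded_linear_vec_nth im])
    also have "\<dots> = (n \<bullet> a) * n $ j" using arg_cong[OF a, of "\<lambda>v. v $ j"] by simp
    finally show "(LINT x|lborel. indicator {x. n \<bullet> (x - x0) < 0} x * (w x * (x - x0) $ j)) = (n \<bullet> a) * n $ j"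
      unfolding cm .
    have "(LINT x|lborel. hp x $ j) = a' $ j"
      unfolding a'_def by (rule integral_bounded_linear[OF bounded_linear_vec_nth ip])
    also have "\<dots> = - (n \<bullet> a) * n $ j" using arg_cong[OF a', of "\<lambda>v. v $ j"] by (simp add: nn)
    finally show "(LINT x|lborel. indicator {x. n \<bullet> (x - x0) > 0} x * (w x * (x - x0) $ j)) = - (n \<bullet> a) * n $ j"
      unfolding cp .
  qed
qed

text \<open>The divergence condition is tested with a radial bump at a point of the facet, with
  radius so small that off the hyperplane its ball lies in the two open elements. The two half-space
  integrals are \<open>\<kappa>\<close> and \<open>- \<kappa>\<close> times the normal, so the
  condition is \<open>\<kappa>\<close> times the jump of the normal flux, with
  \<open>\<kappa> > 0\<close>.\<close>

lemma (in mesh) normal_flux_continuous: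
  fixes \<L> :: "'n \<Rightarrow> real^'n \<Rightarrow> real^'l^'l::finite"
  assumes div: "divergence_free \<Omega> \<L>"
    and K: "K \<in> \<T>" "K' \<in> \<T>" "K \<noteq> K'" and F: "F facet_of K" "F facet_of K'"
    and A: "\<And>j x. x \<in> interior K \<Longrightarrow> \<L> j x = A j" and A': "\<And>j x. x \<in> interior K' \<Longrightarrow> \<L> j x = A' j"
    and x0: "x0 \<in> rel_interior F" "x0 \<in> \<Omega>"
  shows "(\<Sum>j\<in>UNIV. (outward_normal K F $ j) *\<^sub>R A j) = (\<Sum>j\<in>UNIV. (outward_normal K F $ j) *\<^sub>R A' j)"
proof -
  define n where "n = outward_normal K F"
  have n': "outward_normal K' F = - n" unfolding n_def by (rule opposite_normal[OF K F])
  have n: "norm n = 1" unfolding n_def by (rule simplex_facet(1)[OF element(1)[OF K(1)] F(1)])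
  obtain e1 where e1: "e1 > 0" "ball x0 e1 \<subseteq> \<Omega>" using open_dom x0(2) open_contains_ball by blast
  obtain e2 where e2: "e2 > 0" "\<forall>y\<in>ball x0 e2. n \<bullet> (y - x0) < 0 \<longrightarrow> y \<in> interior K"
    using simplex_facet(6)[OF element(1)[OF K(1)] F(1) x0(1)] unfolding n_def by blast
  obtain e3 where e3: "e3 > 0" "\<forall>y\<in>ball x0 e3. - n \<bullet> (y - x0) < 0 \<longrightarrow> y \<in> interior K'"
    using simplex_facet(6)[OF element(1)[OF K(2)] F(2) x0(1)] unfolding n' by blast
  define r where "r = min e1 (min e2 e3) / 2"
  have r: "r > 0" "r < e1" "r < e2" "r < e3" using e1(1) e2(1) e3(1) by (auto simp: r_def min_def)
  define w where "w x = - 2 * flat 2 (r\<^sup>2 - (x - x0) \<bullet> (x - x0))" for x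
  obtain \<kappa> where \<kappa>: "\<kappa> > 0"
    "\<And>j. integrable lborel (\<lambda>x. indicator {x. n \<bullet> (x - x0) < 0} x * (w x * (x - x0) $ j))"
    "\<And>j. integrable lborel (\<lambda>x. indicator {x. n \<bullet> (x - x0) > 0} x * (w x * (x - x0) $ j))"
    "\<And>j. (LINT x|lborel. indicator {x. n \<bullet> (x - x0) < 0} x * (w x * (x - x0) $ j)) = \<kappa> * n $ j"
    "\<And>j. (LINT x|lborel. indicator {x. n \<bullet> (x - x0) > 0} x * (w x * (x - x0) $ j)) = - \<kappa> * n $ j"
    unfolding w_def by (rule radial_bump_half_integral[OF n r(1), of x0]) blast
  have test: "test_function \<Omega> (radial_bump x0 r)"
    by (rule test_function_radial_bump[OF r(1)]) (use e1(2) r(2) in \<open>auto simp: subset_iff\<close>)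
  have pw: "partial j (radial_bump x0 r) x = w x * (x - x0) $ j" for j x
    by (simp add: partial_radial_bump w_def)
  have w0: "w x = 0" if "\<not> dist x0 x < r" for x
  proof -
    have "r \<le> norm (x - x0)" using that by (simp add: dist_norm norm_minus_commute)
    then have "r\<^sup>2 \<le> (x - x0) \<bullet> (x - x0)" using r(1) by (simp add: dot_square_norm power_mono)
    then show ?thesis by (simp add: w_def flat_def)
  qed
  have int: "(LINT x:\<Omega>|lebesgue. partial j (radial_bump x0 r) x *\<^sub>R \<L> j x) = (\<kappa> * n $ j) *\<^sub>R A j + (- \<kappa> * n $ j) *\<^sub>R A' j" for j
  proof -
    let ?m = "\<lambda>x. indicator {x. n \<bullet> (x - x0) < 0} x * (w x * (x - x0) $ j)"
    let ?p = "\<lambda>x. indicator {x. n \<bullet> (x - x0) > 0} x * (w x * (x - x0) $ j)"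
    have "negligible {x. n \<bullet> x = n \<bullet> x0}" using n by (intro negligible_hyperplane) auto
    from AE_not_negligible[OF this]
    have ae: "AE x in lebesgue. ?m x *\<^sub>R A j + ?p x *\<^sub>R A' j =
      indicator \<Omega> x *\<^sub>R (partial j (radial_bump x0 r) x *\<^sub>R \<L> j x)"
    proof eventually_elim
      fix x assume "x \<notin> {x. n \<bullet> x = n \<bullet> x0}"
      then have nz: "n \<bullet> (x - x0) \<noteq> 0" by (simp add: inner_diff_right)
      show "?m x *\<^sub>R A j + ?p x *\<^sub>R A' j = indicator \<Omega> x *\<^sub>R (partial j (radial_bump x0 r) x *\<^sub>R \<L> j x)"
      proof (cases "dist x0 x < r")
        case True
        then have x: "x \<in> \<Omega>" using e1(2) r(2) by (auto simp: subset_iff)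
        consider "n \<bullet> (x - x0) < 0" | "n \<bullet> (x - x0) > 0" using nz by linarith
        then show ?thesis
        proof cases
          case 1
          then have "x \<in> interior K" using e2(2) True r(3) by auto
          then show ?thesis using 1 x A by (simp add: pw)
        next
          case 2
          then have "x \<in> interior K'" using e3(2) True r(4) by auto
          then show ?thesis using 2 x A' by (simp add: pw)
        qed
      qed (simp add: pw w0)
    qed
    have i: "integrable lborel (\<lambda>x. ?m x *\<^sub>R A j)" "integrable lborel (\<lambda>x. ?p x *\<^sub>R A' j)"
      using \<kappa>(2,3) by (auto intro: integrable_scaleR_left)
    have "(LINT x:\<Omega>|lebesgue. partial j (radial_bump x0 r) x *\<^sub>R \<L> j x) =
      (LINT x|lborel. ?m x *\<^sub>R A j + ?p x *\<^sub>R A' j)"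
      unfolding set_lebesgue_integral_def
      by (rule lebesgue_integral_eq_lborel(2)[OF Bochner_Integration.integrable_add[OF i] ae])
    also have "\<dots> = (LINT x|lborel. ?m x *\<^sub>R A j) + (LINT x|lborel. ?p x *\<^sub>R A' j)"
      by (rule Bochner_Integration.integral_add[OF i])
    also have "\<dots> = (LINT x|lborel. ?m x) *\<^sub>R A j + (LINT x|lborel. ?p x) *\<^sub>R A' j"
      using \<kappa>(2,3) by (simp add: integral_scaleR_left)
    finally show ?thesis unfolding \<kappa>(4,5) .
  qed
  have "(\<Sum>j\<in>UNIV. LINT x:\<Omega>|lebesgue. partial j (radial_bump x0 r) x *\<^sub>R \<L> j x) = 0"
    using div test unfolding divergence_free_def by blast
  then have "0 = (\<Sum>j\<in>UNIV. (\<kappa> * n $ j) *\<^sub>R A j + (- \<kappa> * n $ j) *\<^sub>R A' j)"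
    unfolding int by simp
  also have "\<dots> = \<kappa> *\<^sub>R ((\<Sum>j\<in>UNIV. (n $ j) *\<^sub>R A j) - (\<Sum>j\<in>UNIV. (n $ j) *\<^sub>R A' j))"
    by (simp add: sum.distrib sum_subtractf sum_negf scaleR_sum_right scaleR_diff_right)
  finally show ?thesis using \<kappa>(1) by (simp add: n_def)
qed

section \<open>Finite-dimensional function spaces\<close>

text \<open>Vectors are functions, and the space is a set depending on patch and degree rather than
  a type. Orthonormal bases and linear functionals are therefore developed for sets of functions
  closed under pointwise operations.\<close>

locale function_inner_space =
  fixes V :: "('a \<Rightarrow> 'b::real_vector) set" and ip :: "('a \<Rightarrow> 'b) \<Rightarrow> ('a \<Rightarrow> 'b) \<Rightarrow> real"
  assumes zero_mem: "(\<lambda>x. 0) \<in> V"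
    and add_mem: "u \<in> V \<Longrightarrow> v \<in> V \<Longrightarrow> (\<lambda>x. u x + v x) \<in> V"
    and scale_mem: "u \<in> V \<Longrightarrow> (\<lambda>x. c *\<^sub>R u x) \<in> V"
    and ip_add: "u \<in> V \<Longrightarrow> v \<in> V \<Longrightarrow> w \<in> V \<Longrightarrow> ip (\<lambda>x. u x + v x) w = ip u w + ip v w"
    and ip_scale: "u \<in> V \<Longrightarrow> w \<in> V \<Longrightarrow> ip (\<lambda>x. c *\<^sub>R u x) w = c * ip u w"
    and ip_sym: "u \<in> V \<Longrightarrow> w \<in> V \<Longrightarrow> ip u w = ip w u"
    and ip_nonneg: "u \<in> V \<Longrightarrow> 0 \<le> ip u u"
    and ip_definite: "u \<in> V \<Longrightarrow> ip u u = 0 \<Longrightarrow> u = (\<lambda>x. 0)"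
begin

definition functional :: "(('a \<Rightarrow> 'b) \<Rightarrow> real) \<Rightarrow> bool" where
  "functional f \<longleftrightarrow> (\<forall>u\<in>V. \<forall>v\<in>V. f (\<lambda>x. u x + v x) = f u + f v) \<and> (\<forall>c. \<forall>u\<in>V. f (\<lambda>x. c *\<^sub>R u x) = c * f u)"

lemma sum_mem: "(\<And>i. i \<in> I \<Longrightarrow> f i \<in> V) \<Longrightarrow> (\<lambda>x. \<Sum>i\<in>I. c i *\<^sub>R f i x) \<in> V"
proof (induction I rule: infinite_finite_induct)
  case (insert i I)
  have "(\<lambda>x. c i *\<^sub>R f i x) \<in> V" by (rule scale_mem) (use insert.prems in auto)
  moreover have "(\<lambda>x. \<Sum>i\<in>I. c i *\<^sub>R f i x) \<in> V" by (rule insert.IH) (use insert.prems in auto)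
  ultimately have "(\<lambda>x. c i *\<^sub>R f i x + (\<Sum>i\<in>I. c i *\<^sub>R f i x)) \<in> V" by (rule add_mem)
  then show ?case using insert.hyps by simp
qed (simp_all add: zero_mem)

lemma functional_add: "functional f \<Longrightarrow> u \<in> V \<Longrightarrow> v \<in> V \<Longrightarrow> f (\<lambda>x. u x + v x) = f u + f v"
  by (simp add: functional_def)

lemma functional_scale: "functional f \<Longrightarrow> u \<in> V \<Longrightarrow> f (\<lambda>x. c *\<^sub>R u x) = c * f u"
  by (simp add: functional_def)

lemma functional_sum:
  assumes f: "functional f" and g: "\<And>i. i \<in> I \<Longrightarrow> g i \<in> V"
  shows "f (\<lambda>x. \<Sum>i\<in>I. c i *\<^sub>R g i x) = (\<Sum>i\<in>I. c i * f (g i))"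
proof -
  have 0: "f (\<lambda>x. 0) = 0"
  proof -
    have "f (\<lambda>x. 0 *\<^sub>R 0) = 0 * f (\<lambda>x. 0)" by (rule functional_scale[OF f zero_mem])
    then show ?thesis by simp
  qed
  show ?thesis using g
  proof (induction I rule: infinite_finite_induct)
    case (insert i I)
    have "f (\<lambda>x. c i *\<^sub>R g i x + (\<Sum>i\<in>I. c i *\<^sub>R g i x)) = f (\<lambda>x. c i *\<^sub>R g i x) + f (\<lambda>x. \<Sum>i\<in>I. c i *\<^sub>R g i x)"
      by (intro functional_add[OF f] scale_mem sum_mem) (use insert.prems in auto)
    moreover have "f (\<lambda>x. c i *\<^sub>R g i x) = c i * f (g i)" by (rule functional_scale[OF f]) (use insert.prems in auto)
    ultimately show ?case using insert by simp
  qed (simp_all add: 0)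
qed

lemma functional_ip: "w \<in> V \<Longrightarrow> functional (\<lambda>u. ip u w)"
  by (simp add: functional_def ip_add ip_scale)

lemma ip_sum: "(\<And>i. i \<in> I \<Longrightarrow> g i \<in> V) \<Longrightarrow> w \<in> V \<Longrightarrow> ip (\<lambda>x. \<Sum>i\<in>I. c i *\<^sub>R g i x) w = (\<Sum>i\<in>I. c i * ip (g i) w)"
  using functional_sum[OF functional_ip] by blast

definition orthonormal :: "nat \<Rightarrow> (nat \<Rightarrow> 'a \<Rightarrow> 'b) \<Rightarrow> bool" where
  "orthonormal d b \<longleftrightarrow> (\<forall>i<d. b i \<in> V) \<and> (\<forall>i<d. \<forall>j<d. ip (b i) (b j) = of_bool (i = j))"

lemma orthonormal_coeff:
  assumes b: "orthonormal d b" and i: "i < d"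
  shows "ip (\<lambda>x. \<Sum>j<d. c j *\<^sub>R b j x) (b i) = c i"
proof -
  have bV: "b j \<in> V" if "j < d" for j using b that by (simp add: orthonormal_def)
  have "ip (\<lambda>x. \<Sum>j<d. c j *\<^sub>R b j x) (b i) = (\<Sum>j<d. c j * ip (b j) (b i))"
    by (rule ip_sum) (use bV i in auto)
  also have "\<dots> = (\<Sum>j<d. if j = i then c j else 0)"
    by (rule sum.cong) (use b i in \<open>auto simp: orthonormal_def\<close>)
  finally show ?thesis using i by simp
qed

text \<open>One step of Gram-Schmidt. A vanishing residual leaves the family as it is, which
  accommodates linearly dependent spanning functions.\<close>

lemma orthonormal_extend:
  assumes b: "orthonormal d b" and h: "h \<in> V"
  shows "\<exists>d' b'. d \<le> d' \<and> orthonormal d' b' \<and> (\<forall>i<d. b' i = b i) \<and> (\<exists>c. h = (\<lambda>x. \<Sum>i<d'. c i *\<^sub>R b' i x))"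
proof -
  have bV: "b j \<in> V" if "j < d" for j using b that by (simp add: orthonormal_def)
  define c where "c i = ip h (b i)" for i
  define p where "p x = (\<Sum>i<d. c i *\<^sub>R b i x)" for x
  have p: "p \<in> V" unfolding p_def by (rule sum_mem) (use bV in auto)
  define r where "r x = h x + (- 1) *\<^sub>R p x" for x
  have mp: "(\<lambda>x. (- 1) *\<^sub>R p x) \<in> V" by (rule scale_mem[OF p])
  have r: "r \<in> V" unfolding r_def by (rule add_mem[OF h mp])
  have rb: "ip r (b i) = 0" if "i < d" for i
  proof -
    have "ip r (b i) = ip h (b i) + ip (\<lambda>x. (- 1) *\<^sub>R p x) (b i)"
      unfolding r_def by (rule ip_add[OF h mp bV[OF that]])
    also have "ip (\<lambda>x. (- 1) *\<^sub>R p x) (b i) = - 1 * ip p (b i)" by (rule ip_scale[OF p bV[OF that]])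
    also have "ip p (b i) = c i" unfolding p_def by (rule orthonormal_coeff[OF b that])
    finally show ?thesis by (simp add: c_def)
  qed
  show ?thesis
  proof (cases "ip r r = 0")
    case True
    then have "r x = 0" for x using ip_definite[OF r] by metis
    then have "h = p" by (auto simp: r_def fun_eq_iff)
    then show ?thesis using b unfolding p_def by blast
  next
    case False
    define s where "s = sqrt (ip r r)"
    have s: "s > 0" "s * s = ip r r" using False ip_nonneg[OF r] by (auto simp: s_def)
    define e where "e x = (1 / s) *\<^sub>R r x" for x
    have e: "e \<in> V" unfolding e_def by (rule scale_mem[OF r])
    have eb: "ip e (b i) = 0" if "i < d" for i
      unfolding e_def using ip_scale[OF r bV[OF that]] rb[OF that] by simp
    have re: "ip r e = s"
    proof -
      have "ip r e = ip e r" by (rule ip_sym[OF r e])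
      also have "\<dots> = (1 / s) * ip r r" unfolding e_def by (rule ip_scale[OF r r])
      finally have "ip r e = (1 / s) * (s * s)" by (simp only: s(2))
      then show ?thesis using s(1) by simp
    qed
    have ee: "ip e e = 1"
    proof -
      have "ip e e = (1 / s) * ip r e" using ip_scale[OF r e, of "1/s"] by (simp add: e_def[abs_def])
      then show ?thesis using re s by simp
    qed
    define b' where "b' = b(d := e)"
    have "orthonormal (Suc d) b'"
      unfolding orthonormal_def
    proof (intro conjI allI impI)
      show "b' i \<in> V" if "i < Suc d" for i using that bV e by (auto simp: b'_def less_Suc_eq)
      fix i j assume "i < Suc d" "j < Suc d"
      then consider "i < d" "j < d" | "i = d" "j < d" | "i < d" "j = d" | "i = d" "j = d" by linarith
      then show "ip (b' i) (b' j) = of_bool (i = j)"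
      proof cases
        case 1 then show ?thesis using b by (simp add: b'_def orthonormal_def)
      next
        case 2 then show ?thesis using eb by (simp add: b'_def)
      next
        case 3 then show ?thesis using eb ip_sym[OF bV e] by (simp add: b'_def)
      next
        case 4 then show ?thesis using ee by (simp add: b'_def)
      qed
    qed
    moreover have hb: "h = (\<lambda>x. \<Sum>i<Suc d. (c(d := s)) i *\<^sub>R b' i x)"
    proof
      fix x
      have "(\<Sum>i<d. (c(d := s)) i *\<^sub>R b' i x) = p x" unfolding p_def by (rule sum.cong) (auto simp: b'_def)
      then show "h x = (\<Sum>i<Suc d. (c(d := s)) i *\<^sub>R b' i x)"
        using s by (simp add: b'_def e_def r_def)
    qed
    moreover have "\<forall>i<d. b' i = b i" by (simp add: b'_def)
    moreover have "\<exists>c. h = (\<lambda>x. \<Sum>i<Suc d. c i *\<^sub>R b' i x)" using hb by (intro exI[of _ "c(d := s)"])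
    moreover have "d \<le> Suc d" by simp
    ultimately show ?thesis by blast
  qed
qed

lemma orthonormal_basis_exists:
  assumes I: "finite I" and h: "\<And>i. i \<in> I \<Longrightarrow> h i \<in> V"
    and span: "\<And>v. v \<in> V \<Longrightarrow> \<exists>c. v = (\<lambda>x. \<Sum>i\<in>I. c i *\<^sub>R h i x)"
  shows "\<exists>d b. orthonormal d b \<and> (\<forall>v\<in>V. v = (\<lambda>x. \<Sum>i<d. ip v (b i) *\<^sub>R b i x))"
proof -
  have "\<exists>d b. orthonormal d b \<and> (\<forall>j\<in>J. \<exists>c. h j = (\<lambda>x. \<Sum>i<d. c i *\<^sub>R b i x))" if "finite J" "J \<subseteq> I" for J
    using that
  proof induction
    case empty
    show ?case by (intro exI[of _ 0]) (simp add: orthonormal_def)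
  next
    case (insert k J)
    then obtain d b where b: "orthonormal d b" "\<forall>j\<in>J. \<exists>c. h j = (\<lambda>x. \<Sum>i<d. c i *\<^sub>R b i x)" by auto
    have "h k \<in> V" using h insert.prems by auto
    from orthonormal_extend[OF b(1) this] obtain d' b' where b': "d \<le> d'" "orthonormal d' b'"
      "\<And>i. i < d \<Longrightarrow> b' i = b i" "\<exists>c. h k = (\<lambda>x. \<Sum>i<d'. c i *\<^sub>R b' i x)" by blast
    have "\<exists>c. h j = (\<lambda>x. \<Sum>i<d'. c i *\<^sub>R b' i x)" if j: "j \<in> J" for j
    proof -
      obtain c where c: "h j = (\<lambda>x. \<Sum>i<d. c i *\<^sub>R b i x)" using bspec[OF b(2) j] by (elim exE)
      have eq: "(\<Sum>i<d'. (if i < d then c i else 0) *\<^sub>R b' i x) = (\<Sum>i<d. c i *\<^sub>R b i x)" for x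
        using b'(1,3) by (intro sum.mono_neutral_cong_right) auto
      then have "h j = (\<lambda>x. \<Sum>i<d'. (if i < d then c i else 0) *\<^sub>R b' i x)" unfolding c by (simp only: eq)
      then show ?thesis by (intro exI[of _ "\<lambda>i. if i < d then c i else 0"])
    qed
    then have "\<forall>j\<in>insert k J. \<exists>c. h j = (\<lambda>x. \<Sum>i<d'. c i *\<^sub>R b' i x)" using b'(4) by (simp only: ball_simps) simp
    then show ?case using b'(2) by blast
  qed
  from this[OF I order_refl] obtain d b where b: "orthonormal d b"
    "\<forall>j\<in>I. \<exists>c. h j = (\<lambda>x. \<Sum>i<d. c i *\<^sub>R b i x)" by blast
  from bchoice[OF b(2)] obtain c where "\<forall>j\<in>I. h j = (\<lambda>x. \<Sum>i<d. c j i *\<^sub>R b i x)" by (elim exE)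
  then have c: "h j = (\<lambda>x. \<Sum>i<d. c j i *\<^sub>R b i x)" if "j \<in> I" for j using that by (rule bspec)
  have "v = (\<lambda>x. \<Sum>i<d. ip v (b i) *\<^sub>R b i x)" if v_mem: "v \<in> V" for v
  proof -
    obtain a where a: "v = (\<lambda>x. \<Sum>j\<in>I. a j *\<^sub>R h j x)" using span[OF v_mem] by (elim exE)
    have "v x = (\<Sum>i<d. (\<Sum>j\<in>I. a j * c j i) *\<^sub>R b i x)" for x
    proof -
      have "v x = (\<Sum>j\<in>I. \<Sum>i<d. (a j * c j i) *\<^sub>R b i x)"
        unfolding a by (rule sum.cong) (simp_all add: c scaleR_sum_right)
      also have "\<dots> = (\<Sum>i<d. \<Sum>j\<in>I. (a j * c j i) *\<^sub>R b i x)" by (rule sum.swap)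
      finally show ?thesis by (simp add: scaleR_sum_left)
    qed
    then have v: "v = (\<lambda>x. \<Sum>i<d. (\<Sum>j\<in>I. a j * c j i) *\<^sub>R b i x)" by blast
    have "ip v (b i) = (\<Sum>j\<in>I. a j * c j i)" if "i < d" for i
      unfolding v by (rule orthonormal_coeff[OF b(1) that])
    then show ?thesis by (subst v) simp
  qed
  then show ?thesis using b(1) by blast
qed

end

text \<open>
  Eliminating one basis function at a point where it does not vanish reduces the dimension.
\<close>

lemma coefficients_differentiable:
  fixes b :: "nat \<Rightarrow> 'x \<Rightarrow> real" and c :: "nat \<Rightarrow> real \<Rightarrow> real"
  assumes "\<And>a. (\<And>x. (\<Sum>i<d. a i * b i x) = 0) \<Longrightarrow> \<forall>i<d. a i = 0"
    and "\<And>x. \<exists>D. ((\<lambda>t. \<Sum>i<d. c i t * b i x) has_real_derivative D) (at t within S)"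
  shows "\<forall>i<d. \<exists>D. (c i has_real_derivative D) (at t within S)"
  using assms
proof (induction d arbitrary: b)
  case (Suc d)
  have "\<exists>y. b d y \<noteq> 0"
  proof (rule ccontr)
    assume "\<not> ?thesis"
    then have "(\<Sum>i<Suc d. of_bool (i = d) * b i x) = 0" for x by simp
    from Suc.prems(1)[of "\<lambda>i. of_bool (i = d)", OF this] show False by auto
  qed
  then obtain y where y: "b d y \<noteq> 0" by blast
  define b' where "b' i x = b i x - b i y / b d y * b d x" for i x
  have red: "(\<Sum>i<d. a i * b' i x) = (\<Sum>i<Suc d. a i * b i x) - (\<Sum>i<Suc d. a i * b i y) * (b d x / b d y)" for a x
  proof -
    have "(\<Sum>i<d. a i * b' i x) = (\<Sum>i<d. a i * b i x) - (\<Sum>i<d. a i * b i y) * (b d x / b d y)"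
    proof -
      have "a i * b' i x = a i * b i x - a i * b i y * (b d x / b d y)" for i
        by (simp add: b'_def algebra_simps)
      then show ?thesis by (simp only: sum_subtractf sum_distrib_right)
    qed
    then show ?thesis using y by (simp add: algebra_simps)
  qed
  have IH: "\<forall>i<d. \<exists>D. (c i has_real_derivative D) (at t within S)"
  proof (rule Suc.IH)
    fix a assume a: "\<And>x. (\<Sum>i<d. a i * b' i x) = 0"
    define a' where "a' = a(d := - (\<Sum>i<d. a i * b i y) / b d y)"
    have eq: "(\<Sum>i<d. a' i * b i x) = (\<Sum>i<d. a i * b i x)" for x by (rule sum.cong) (auto simp: a'_def)
    have z: "(\<Sum>i<Suc d. a' i * b i x) = 0" for x
    proof -
      have "(\<Sum>i<Suc d. a' i * b i y) = 0" using y by (simp add: eq) (simp add: a'_def)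
      moreover have "(\<Sum>i<d. a' i * b' i x) = (\<Sum>i<d. a i * b' i x)" by (rule sum.cong) (auto simp: a'_def)
      ultimately show ?thesis using red[of a' x] a[of x] by simp
    qed
    have a0: "\<forall>i<Suc d. a' i = 0" by (rule Suc.prems(1)) (rule z)
    show "\<forall>i<d. a i = 0"
    proof (intro allI impI)
      fix i assume i: "i < d"
      then have "a' i = 0" using a0 by simp
      then show "a i = 0" using i by (simp add: a'_def)
    qed
  next
    fix x
    obtain D D' where "((\<lambda>t. \<Sum>i<Suc d. c i t * b i x) has_real_derivative D) (at t within S)"
      "((\<lambda>t. \<Sum>i<Suc d. c i t * b i y) has_real_derivative D') (at t within S)"
      using Suc.prems(2) by meson
    then have "((\<lambda>t. (\<Sum>i<Suc d. c i t * b i x) - (\<Sum>i<Suc d. c i t * b i y) * (b d x / b d y)) has_real_derivative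
       (D - D' * (b d x / b d y))) (at t within S)"
      by (intro DERIV_diff DERIV_cmult_right)
    then show "\<exists>D. ((\<lambda>t. \<Sum>i<d. c i t * b' i x) has_real_derivative D) (at t within S)"
      unfolding red[symmetric] by blast
  qed
  then have "\<forall>i. \<exists>D. i < d \<longrightarrow> (c i has_real_derivative D) (at t within S)" by blast
  from choice[OF this] obtain D where "\<forall>i. i < d \<longrightarrow> (c i has_real_derivative D i) (at t within S)" by (elim exE)
  then have D: "(c i has_real_derivative D i) (at t within S)" if "i < d" for i using that by blast
  obtain E where E: "((\<lambda>t. \<Sum>i<Suc d. c i t * b i y) has_real_derivative E) (at t within S)"
    using Suc.prems(2) by blast
  have "((\<lambda>t. ((\<Sum>i<Suc d. c i t * b i y) - (\<Sum>i<d. c i t * b i y)) / b d y) has_real_derivative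
      ((E - (\<Sum>i<d. D i * b i y)) / b d y)) (at t within S)"
    by (intro DERIV_cdivide DERIV_diff E DERIV_sum DERIV_cmult_right D) auto
  moreover have "((\<Sum>i<Suc d. c i t * b i y) - (\<Sum>i<d. c i t * b i y)) / b d y = c d t" for t
    using y by simp
  ultimately have "(c d has_real_derivative ((E - (\<Sum>i<d. D i * b i y)) / b d y)) (at t within S)" by simp
  then show ?case using IH by (auto simp: less_Suc_eq)
qed simp

section \<open>The broken polynomial space on a patch\<close>

text \<open>An element is the closure of its nonempty interior, so every point of it is a limit
  point of the interior. The \<open>Lim\<close> in \<open>trace_from\<close> then has a unique
  value, given by any continuous extension.\<close>

lemma (in mesh) trace_eq:
  fixes v q :: "real^'n \<Rightarrow> 'b::t2_space"
  assumes K: "K \<in> \<T>" "x \<in> K" and eq: "\<And>y. y \<in> interior K \<Longrightarrow> v y = q y" and q: "continuous_on UNIV q"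
  shows "trace_from K v x = q x"
  unfolding trace_from_def
proof (rule tendsto_Lim)
  have "x islimpt interior K"
  proof (cases "x \<in> interior K")
    case True
    then show ?thesis using interior_limit_point[of x "interior K"] by simp
  next
    case False
    then show ?thesis using K element(7)[OF K(1)] by (metis closure_def UnE mem_Collect_eq)
  qed
  then show "at x within interior K \<noteq> bot" by (simp add: trivial_limit_within)
  have "(q \<longlongrightarrow> q x) (at x within interior K)"
    using q by (meson UNIV_I continuous_on_def subset_UNIV tendsto_within_subset)
  moreover have "\<forall>\<^sub>F y in at x within interior K. q y = v y"
    using eq by (simp add: eventually_at_filter)
  ultimately show "(v \<longlongrightarrow> q x) (at x within interior K)" by (rule Lim_transform_eventually)
qed

locale dg_patch = mesh \<Omega> \<T> for \<Omega> :: "(real^'n::finite) set" and \<T> +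
  fixes \<K> :: "(real^'n) set set" and p :: nat
  assumes sub: "\<K> \<subseteq> \<T>"
begin

lemma finite_patch: "finite \<K>" using sub finite_mesh finite_subset by blast

lemma dg_polynomial:
  fixes v :: "real^'n \<Rightarrow> real^'l::finite"
  assumes "v \<in> dg_space \<K> p" "K \<in> \<K>"
  obtains q where "polynomial_le p q" "\<And>x. x \<in> interior K \<Longrightarrow> v x = q x" "\<And>l. smooth_fun (\<lambda>x. q x $ l)"
    "\<And>S. continuous_on S q"
proof -
  obtain q where q: "polynomial_le p q" "\<And>x. x \<in> interior K \<Longrightarrow> v x = q x"
    using assms unfolding dg_space_def by blast
  have "smooth_fun (\<lambda>x. q x $ l)" for l by (rule smooth_polynomial[OF q(1)])
  moreover from this have "continuous_on S q" for S by (rule smooth_vec(1))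
  ultimately show thesis using that q by blast
qed

lemma dg_zero: "(\<lambda>x. 0) \<in> dg_space \<K> p"
  using polynomial_le_zero by (auto simp: dg_space_def)

lemma dg_add:
  assumes "u \<in> dg_space \<K> p" "v \<in> dg_space \<K> p"
  shows "(\<lambda>x. u x + v x) \<in> dg_space \<K> p"
  unfolding dg_space_def
proof (intro CollectI conjI ballI allI impI)
  fix K assume "K \<in> \<K>"
  then obtain q r where "polynomial_le p q" "polynomial_le p r" "\<forall>x\<in>interior K. u x = q x" "\<forall>x\<in>interior K. v x = r x"
    using assms unfolding dg_space_def by blast
  then show "\<exists>q. polynomial_le p q \<and> (\<forall>x\<in>interior K. u x + v x = q x)"
    by (intro exI[of _ "\<lambda>x. q x + r x"]) (simp add: polynomial_le_add)
qed (use assms in \<open>simp add: dg_space_def\<close>)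

lemma dg_elementwise_linear:
  assumes v: "v \<in> dg_space \<K> p" and f: "\<And>K. K \<in> \<K> \<Longrightarrow> \<exists>g. linear g \<and> (\<forall>x\<in>interior K. f x = g)"
    and f0: "\<And>x. f x 0 = 0"
  shows "(\<lambda>x. f x (v x)) \<in> dg_space \<K> p"
  unfolding dg_space_def
proof (intro CollectI conjI ballI allI impI)
  fix K assume K: "K \<in> \<K>"
  then obtain q where "polynomial_le p q" "\<forall>x\<in>interior K. v x = q x"
    using v unfolding dg_space_def by blast
  moreover obtain g where "linear g" "\<forall>x\<in>interior K. f x = g" using f[OF K] by blast
  ultimately show "\<exists>q. polynomial_le p q \<and> (\<forall>x\<in>interior K. f x (v x) = q x)"
    by (intro exI[of _ "\<lambda>x. g (q x)"]) (simp add: polynomial_le_linear)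
qed (use v f0 in \<open>simp add: dg_space_def\<close>)

lemma dg_scale: "v \<in> dg_space \<K> p \<Longrightarrow> (\<lambda>x. c *\<^sub>R v x) \<in> dg_space \<K> p"
  by (rule dg_elementwise_linear) (auto intro!: exI[of _ "\<lambda>y. c *\<^sub>R y"] bounded_linear.linear bounded_linear_scaleR_right)

lemma dg_matrix:
  fixes v :: "real^'n \<Rightarrow> real^'l::finite" and M :: "real^'n \<Rightarrow> real^'l^'m::finite"
  assumes v: "v \<in> dg_space \<K> p" and M: "elementwise_constant \<K> M"
  shows "(\<lambda>x. M x *v v x) \<in> dg_space \<K> p"
proof (rule dg_elementwise_linear[OF v])
  fix K assume "K \<in> \<K>"
  then obtain A where "\<forall>x\<in>interior K. M x = A" using M by (auto simp: elementwise_constant_def)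
  then show "\<exists>g. linear g \<and> (\<forall>x\<in>interior K. (*v) (M x) = g)"
    by (intro exI[of _ "(*v) A"]) auto
qed simp

lemma open_elements_integral:
  fixes f :: "real^'n \<Rightarrow> 'b::{banach, second_countable_topology}"
  assumes f: "\<And>K. K \<in> \<K> \<Longrightarrow> set_integrable lebesgue (interior K) f"
  shows "set_integrable lebesgue (open_elements \<K>) f"
    and "(LINT x:open_elements \<K>|lebesgue. f x) = (\<Sum>K\<in>\<K>. LINT x:interior K|lebesgue. f x)"
  unfolding open_elements_def
proof -
  have m: "interior K \<in> sets lebesgue" for K :: "(real^'n) set" by (intro sets_completionI_sets) simp
  show "set_integrable lebesgue (\<Union>(interior ` \<K>)) f"
    by (rule set_integrable_UN[OF finite_patch f m])
  have "disjoint_family_on interior \<K>"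
    using interiors_disjoint sub by (auto simp: disjoint_family_on_def)
  then show "(LINT x:\<Union>(interior ` \<K>)|lebesgue. f x) = (\<Sum>K\<in>\<K>. LINT x:interior K|lebesgue. f x)"
    by (intro set_integral_finite_Union finite_patch f m)
qed

lemma patch_element: "K \<in> \<K> \<Longrightarrow> K \<in> \<T>" using sub by blast

lemma dg_inner_integrable:
  fixes u v :: "real^'n \<Rightarrow> real^'l::finite"
  assumes "u \<in> dg_space \<K> p" "v \<in> dg_space \<K> p" "K \<in> \<K>"
  shows "set_integrable lebesgue (interior K) (\<lambda>x. u x \<bullet> v x)"
proof -
  obtain q where q: "\<And>x. x \<in> interior K \<Longrightarrow> u x = q x" "\<And>S. continuous_on S q"
    using dg_polynomial[OF assms(1,3)] by metis
  obtain r where r: "\<And>x. x \<in> interior K \<Longrightarrow> v x = r x" "\<And>S. continuous_on S r"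
    using dg_polynomial[OF assms(2,3)] by metis
  note K = element[OF patch_element[OF assms(3)]]
  show ?thesis
    by (rule interior_integral(1)[OF K(2,3), where g="\<lambda>x. q x \<bullet> r x"]) (auto intro!: continuous_intros q r simp: q(1) r(1))
qed

lemma l2_inner_add:
  fixes u v w :: "real^'n \<Rightarrow> real^'l::finite"
  assumes "\<And>K. K \<in> \<K> \<Longrightarrow> set_integrable lebesgue (interior K) (\<lambda>x. u x \<bullet> w x)"
    "\<And>K. K \<in> \<K> \<Longrightarrow> set_integrable lebesgue (interior K) (\<lambda>x. v x \<bullet> w x)"
  shows "l2_inner \<K> (\<lambda>x. u x + v x) w = l2_inner \<K> u w + l2_inner \<K> v w"
  unfolding l2_inner_def inner_add_left
  by (rule set_integral_add[OF open_elements_integral(1)[OF assms(1)] open_elements_integral(1)[OF assms(2)]])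

lemma l2_inner_scale: "l2_inner \<K> (\<lambda>x. c *\<^sub>R u x) w = c * l2_inner \<K> u w"
  by (simp add: l2_inner_def)

lemma l2_inner_commute: "l2_inner \<K> u w = l2_inner \<K> w u"
  by (simp add: l2_inner_def inner_commute)

lemma l2_inner_nonneg: "0 \<le> l2_inner \<K> u u"
  unfolding l2_inner_def set_lebesgue_integral_def by (rule Bochner_Integration.integral_nonneg) simp

text \<open>Zero norm only gives \<open>v = 0\<close> almost everywhere. On an open element the set
  where the polynomial is nonzero is open and null, hence empty; off the elements the value 0 is
  built into \<open>dg_space\<close>.\<close>

lemma l2_inner_definite:
  fixes v :: "real^'n \<Rightarrow> real^'l::finite"
  assumes v: "v \<in> dg_space \<K> p" and 0: "l2_inner \<K> v v = 0"
  shows "v = (\<lambda>x. 0)"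
proof
  have i: "integrable lebesgue (\<lambda>x. indicator (open_elements \<K>) x *\<^sub>R (v x \<bullet> v x))"
    using open_elements_integral(1)[OF dg_inner_integrable[OF v v]] unfolding set_integrable_def .
  have "AE x in lebesgue. indicator (open_elements \<K>) x *\<^sub>R (v x \<bullet> v x) = 0"
    using integral_nonneg_eq_0_iff_AE[OF i] 0 unfolding l2_inner_def set_lebesgue_integral_def by simp
  then have ae: "AE x in lebesgue. x \<in> open_elements \<K> \<longrightarrow> v x = 0"
    by eventually_elim (auto simp: indicator_def split: if_splits)
  fix x
  show "v x = 0"
  proof (cases "x \<in> open_elements \<K>")
    case False
    then show ?thesis using v by (simp add: dg_space_def)
  next
    case True
    then obtain K where K: "K \<in> \<K>" "x \<in> interior K" by (auto simp: open_elements_def)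
    obtain q where q: "\<And>x. x \<in> interior K \<Longrightarrow> v x = q x" "\<And>S. continuous_on S q"
      using dg_polynomial[OF v K(1)] by metis
    define U where "U = interior K \<inter> {x. q x \<noteq> 0}"
    have "open {x. q x \<noteq> 0}" by (intro open_Collect_neq q continuous_on_const)
    then have "open U" unfolding U_def by (intro open_Int open_interior)
    moreover have "AE x in lebesgue. x \<notin> U"
      using ae by eventually_elim (use K(1) q(1) in \<open>auto simp: U_def open_elements_def\<close>)
    ultimately have "U = {}" by (rule AE_open_empty)
    then show ?thesis using K(2) q(1)[OF K(2)] by (auto simp: U_def)
  qed
qed

text \<open>Finite dimension of the broken space, from monomials times unit vectors cut off to
  single elements. Disjointness of the interiors ensures that at each point only one element
  contributes.\<close>

lemma dg_spanning:
  "\<exists>(I :: ((real^'n) set \<times> ('n \<Rightarrow> nat) \<times> 'l::finite) set) h. finite I \<and> (\<forall>i\<in>I. h i \<in> dg_space \<K> p) \<and>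
     (\<forall>v\<in>dg_space \<K> p. \<exists>c. v = (\<lambda>x :: real^'n. \<Sum>i\<in>I. c i *\<^sub>R (h i x :: real^'l)))"
proof -
  let ?A = "{\<alpha> :: 'n \<Rightarrow> nat. (\<Sum>i\<in>UNIV. \<alpha> i) \<le> p}"
  define I :: "((real^'n) set \<times> ('n \<Rightarrow> nat) \<times> 'l) set" where "I = \<K> \<times> ?A \<times> UNIV"
  define h :: "((real^'n) set \<times> ('n \<Rightarrow> nat) \<times> 'l) \<Rightarrow> real^'n \<Rightarrow> real^'l" where
    "h = (\<lambda>(K, \<alpha>, l) x. if x \<in> interior K then (\<Prod>i\<in>UNIV. (x $ i) ^ \<alpha> i) *\<^sub>R axis l 1 else 0)"
  have fA: "finite ?A" by (rule finite_multi_indices)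
  have fI: "finite I" unfolding I_def using finite_patch fA by simp
  have hV: "h i \<in> dg_space \<K> p" if i: "i \<in> I" for i
  proof -
    obtain K \<alpha> l where i': "i = (K, \<alpha>, l)" "K \<in> \<K>" "\<alpha> \<in> ?A" using i by (auto simp: I_def)
    have "\<exists>q. polynomial_le p q \<and> (\<forall>x\<in>interior K'. h i x = q x)" if K': "K' \<in> \<K>" for K'
    proof (cases "K' = K")
      case True
      have "polynomial_le p (\<lambda>x. (\<Prod>i\<in>UNIV. (x $ i) ^ \<alpha> i) *\<^sub>R (axis l 1 :: real^'l))"
        unfolding polynomial_le_def
      proof (intro exI[of _ "\<lambda>\<beta>. if \<beta> = \<alpha> then axis l 1 else 0"] allI)
        fix x :: "real^'n"
        have "(\<Sum>\<beta> | (\<Sum>i\<in>UNIV. \<beta> i) \<le> p. (\<Prod>i\<in>UNIV. (x $ i) ^ \<beta> i) *\<^sub>R (if \<beta> = \<alpha> then axis l 1 else 0 :: real^'l))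
          = (\<Sum>\<beta>\<in>?A. if \<beta> = \<alpha> then (\<Prod>i\<in>UNIV. (x $ i) ^ \<alpha> i) *\<^sub>R axis l 1 else 0)"
          by (rule sum.cong) auto
        then show "(\<Prod>i\<in>UNIV. (x $ i) ^ \<alpha> i) *\<^sub>R axis l 1 =
          (\<Sum>\<beta> | (\<Sum>i\<in>UNIV. \<beta> i) \<le> p. (\<Prod>i\<in>UNIV. (x $ i) ^ \<beta> i) *\<^sub>R (if \<beta> = \<alpha> then axis l 1 else 0 :: real^'l))"
          using fA i'(3) by simp
      qed
      then show ?thesis using True by (auto simp: h_def i'(1))
    next
      case False
      then have "h i x = 0" if "x \<in> interior K'" for x
        using that interior_unique[of K' K x] K' i'(2) sub by (auto simp: h_def i'(1))
      then show ?thesis using polynomial_le_zero by blast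
    qed
    moreover have "h i x = 0" if "x \<notin> open_elements \<K>" for x
      using that i'(2) by (auto simp: h_def i'(1) open_elements_def)
    ultimately show ?thesis by (simp add: dg_space_def)
  qed
  have "\<exists>c. v = (\<lambda>x. \<Sum>i\<in>I. c i *\<^sub>R h i x)" if v: "v \<in> dg_space \<K> p" for v :: "real^'n \<Rightarrow> real^'l"
  proof -
    have "\<forall>K\<in>\<K>. \<exists>c. \<forall>x\<in>interior K. v x = (\<Sum>\<alpha>\<in>?A. (\<Prod>i\<in>UNIV. (x $ i) ^ \<alpha> i) *\<^sub>R c \<alpha>)"
    proof
      fix K assume "K \<in> \<K>"
      then obtain q where q: "polynomial_le p q" "\<forall>x\<in>interior K. v x = q x" using v unfolding dg_space_def by blast
      from q(1)[unfolded polynomial_le_def] obtain c where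
        "\<forall>x. q x = (\<Sum>\<alpha>\<in>?A. (\<Prod>i\<in>UNIV. (x $ i) ^ \<alpha> i) *\<^sub>R c \<alpha>)" by (elim exE)
      then show "\<exists>c. \<forall>x\<in>interior K. v x = (\<Sum>\<alpha>\<in>?A. (\<Prod>i\<in>UNIV. (x $ i) ^ \<alpha> i) *\<^sub>R c \<alpha>)"
        using q(2) by (intro exI[of _ c]) simp
    qed
    from bchoice[OF this] obtain c where c: "\<forall>K\<in>\<K>. \<forall>x\<in>interior K. v x = (\<Sum>\<alpha>\<in>?A. (\<Prod>i\<in>UNIV. (x $ i) ^ \<alpha> i) *\<^sub>R c K \<alpha>)"
      by (elim exE)
    define d where "d = (\<lambda>(K, \<alpha>, l). c K \<alpha> $ l)"
    have "v x = (\<Sum>i\<in>I. d i *\<^sub>R h i x)" for x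
    proof -
      have "(\<Sum>i\<in>I. d i *\<^sub>R h i x) = (\<Sum>K\<in>\<K>. \<Sum>\<alpha>\<in>?A. \<Sum>l\<in>UNIV. d (K, \<alpha>, l) *\<^sub>R h (K, \<alpha>, l) x)"
        unfolding I_def by (simp add: sum.cartesian_product)
      also have "\<dots> = (\<Sum>K\<in>\<K>. if x \<in> interior K then v x else 0)"
      proof (rule sum.cong[OF refl])
        fix K assume K: "K \<in> \<K>"
        show "(\<Sum>\<alpha>\<in>?A. \<Sum>l\<in>UNIV. d (K, \<alpha>, l) *\<^sub>R h (K, \<alpha>, l) x) = (if x \<in> interior K then v x else 0)"
        proof (cases "x \<in> interior K")
          case True
          have "(\<Sum>l\<in>UNIV. d (K, \<alpha>, l) *\<^sub>R h (K, \<alpha>, l) x) = (\<Prod>i\<in>UNIV. (x $ i) ^ \<alpha> i) *\<^sub>R c K \<alpha>" for \<alpha>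
          proof -
            have "(\<Sum>l\<in>UNIV. d (K, \<alpha>, l) *\<^sub>R h (K, \<alpha>, l) x) =
               (\<Prod>i\<in>UNIV. (x $ i) ^ \<alpha> i) *\<^sub>R (\<Sum>l\<in>UNIV. (c K \<alpha> $ l) *\<^sub>R axis l 1)"
              using True by (simp add: d_def h_def scaleR_sum_right mult.commute)
            also have "(\<Sum>l\<in>UNIV. (c K \<alpha> $ l) *\<^sub>R axis l 1) = c K \<alpha>"
              using basis_expansion[of "c K \<alpha>"] by (simp add: scalar_mult_eq_scaleR)
            finally show ?thesis .
          qed
          then show ?thesis using c K True by simp
        qed (simp add: h_def)
      qed
      also have "\<dots> = v x"
      proof (cases "x \<in> open_elements \<K>")
        case True
        then obtain K where K: "K \<in> \<K>" "x \<in> interior K" by (auto simp: open_elements_def)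
        have "(\<Sum>L\<in>\<K>. if x \<in> interior L then v x else 0) = (\<Sum>L\<in>\<K>. if L = K then v x else 0)"
          using K interior_unique sub by (intro sum.cong) auto
        then show ?thesis using K(1) finite_patch by simp
      next
        case False
        then have "(\<Sum>L\<in>\<K>. if x \<in> interior L then v x else 0) = 0"
          by (intro sum.neutral) (auto simp: open_elements_def)
        then show ?thesis using v False by (simp add: dg_space_def)
      qed
      finally show ?thesis by simp
    qed
    then show ?thesis by (intro exI[of _ d]) blast
  qed
  then show ?thesis using fI hV by (intro exI[of _ I] exI[of _ h]) blast
qed

end

section \<open>Tents\<close>

lemma affine_has_derivative:
  assumes "\<And>x. x \<in> K \<Longrightarrow> f x = b \<bullet> x + a" "x \<in> interior K"
  shows "(f has_derivative (\<lambda>h. b \<bullet> h)) (at x)"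
proof (rule has_derivative_transform_within_open)
  show "((\<lambda>x. b \<bullet> x + a) has_derivative (\<lambda>h. b \<bullet> h)) (at x)" by (auto intro!: derivative_eq_intros)
  show "open (interior K)" "x \<in> interior K" using assms(2) by auto
  show "b \<bullet> y + a = f y" if "y \<in> interior K" for y using assms(1)[of y] that interior_subset[of K] by auto
qed

lemma affine_partial:
  assumes "\<And>x. x \<in> K \<Longrightarrow> f x = b \<bullet> x + a" "x \<in> interior K"
  shows "partial j f x = b $ j"
  using partial_has_derivative[OF affine_has_derivative[OF assms]] by (simp add: inner_axis)

lemma partial_add:
  assumes "u differentiable (at x)" "v differentiable (at x)"
  shows "partial j (\<lambda>x. u x + v x) x = partial j u x + partial j v x"
  using partial_has_derivative[OF has_derivative_add[OF frechet_derivative_works[THEN iffD1, OF assms(1)]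
      frechet_derivative_works[THEN iffD1, OF assms(2)]]] by (simp add: partial_def)

lemma partial_scale:
  assumes "u differentiable (at x)"
  shows "partial j (\<lambda>x. c *\<^sub>R u x) x = c *\<^sub>R partial j u x"
  using partial_has_derivative[OF has_derivative_scaleR_right[OF frechet_derivative_works[THEN iffD1, OF assms]]]
  by (simp add: partial_def)

lemma continuous_matrix_vector_mult [continuous_intros]:
  fixes A :: "'a::topological_space \<Rightarrow> real^'l^'m"
  assumes "continuous_on S A" "continuous_on S v"
  shows "continuous_on S (\<lambda>x. A x *v v x)"
  unfolding matrix_vector_mult_def using assms by (intro continuous_intros)

lemma measurable_matrix_vector_mult:
  fixes A :: "'a \<Rightarrow> real^'l::finite^'m::finite"
  assumes "A \<in> borel_measurable M" "v \<in> borel_measurable M"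
  shows "(\<lambda>x. A x *v v x) \<in> borel_measurable M"
  by (rule borel_measurable_continuous_Pair[OF assms]) (intro continuous_intros)

lemma positive_semidef_symmetrized:
  assumes "positive_semidef (A + transpose A)"
  shows "0 \<le> (A *v e) \<bullet> e"
proof -
  have "(transpose A *v e) \<bullet> e = (A *v e) \<bullet> e"
    using dot_lmul_matrix[of e A e] by (metis inner_commute transpose_matrix_vector)
  then have "((A + transpose A) *v e) \<bullet> e = 2 * ((A *v e) \<bullet> e)"
    by (simp add: matrix_vector_mult_add_rdistrib inner_add_left)
  then show ?thesis using assms unfolding positive_semidef_def by (metis zero_le_mult_iff zero_le_numeral not_numeral_le_zero)
qed

text \<open>The penalty matrices are merely bounded and measurable along a facet. Together with
  continuous extensions of the traces they still give a bounded measurable function on a set of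
  finite surface measure.\<close>

lemma facet_term_integrable:
  fixes F :: "(real^'n::finite) set" and A :: "real^'n \<Rightarrow> real^'l::finite^'l"
  assumes n: "norm n = 1" and F: "compact F"
    and A: "A \<in> borel_measurable borel" "\<And>x. norm (A x) \<le> c"
    and f: "continuous_on UNIV f" "continuous_on UNIV q" "continuous_on UNIV r"
  shows "set_integrable (hyperplane_measure {y. n \<bullet> y = d}) F (\<lambda>x. (f x *\<^sub>R (A x *v q x)) \<bullet> r x)"
proof -
  have bd: "\<exists>b. \<forall>x\<in>F. norm (h x) \<le> b" if "continuous_on UNIV h" for h :: "real^'n \<Rightarrow> 'z::real_normed_vector"
    using compact_imp_bounded[OF compact_continuous_image[OF continuous_on_subset[OF that] F]]
    by (simp add: bounded_iff)
  obtain b1 where b1: "\<And>x. x \<in> F \<Longrightarrow> norm (f x) \<le> b1" using bd[OF f(1)] by blast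
  obtain b2 where b2: "\<And>x. x \<in> F \<Longrightarrow> norm (q x) \<le> b2" using bd[OF f(2)] by blast
  obtain b3 where b3: "\<And>x. x \<in> F \<Longrightarrow> norm (r x) \<le> b3" using bd[OF f(3)] by blast
  have [measurable]: "f \<in> borel_measurable borel" "q \<in> borel_measurable borel" "r \<in> borel_measurable borel"
    using f by (auto intro: borel_measurable_continuous_onI)
  have [measurable]: "(\<lambda>x. A x *v q x) \<in> borel_measurable borel"
    by (rule measurable_matrix_vector_mult[OF A(1)]) measurable
  have mF [measurable]: "F \<in> sets borel" using F by (rule borel_compact)
  show ?thesis
  proof (rule set_integrable_hyperplane[OF n compact_imp_bounded[OF F] mF])
    show "(\<lambda>x. indicator F x *\<^sub>R ((f x *\<^sub>R (A x *v q x)) \<bullet> r x)) \<in> borel_measurable borel" by measurable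
    fix x assume x: "x \<in> F"
    have p: "0 \<le> b1" "0 \<le> b2" "0 \<le> b3" "0 \<le> c"
      using b1[OF x] b2[OF x] b3[OF x] A(2)[of x] norm_ge_zero order_trans by blast+
    have "\<bar>(f x *\<^sub>R (A x *v q x)) \<bullet> r x\<bar> \<le> norm (f x *\<^sub>R (A x *v q x)) * norm (r x)"
      by (rule Cauchy_Schwarz_ineq2)
    also have "\<dots> \<le> (b1 * (real CARD('l) * c * b2)) * b3"
    proof (rule mult_mono)
      have "norm (A x *v q x) \<le> real CARD('l) * norm (A x) * norm (q x)" by (rule matrix_vector_bound)
      also have "\<dots> \<le> real CARD('l) * c * b2"
        using A(2)[of x] b2[OF x] p by (intro mult_mono) auto
      finally have "norm (A x *v q x) \<le> real CARD('l) * c * b2" .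
      then show "norm (f x *\<^sub>R (A x *v q x)) \<le> b1 * (real CARD('l) * c * b2)"
        unfolding norm_scaleR using b1[OF x] p by (intro mult_mono) auto
    qed (use b3[OF x] p in auto)
    finally show "\<bar>(f x *\<^sub>R (A x *v q x)) \<bullet> r x\<bar> \<le> (b1 * (real CARD('l) * c * b2)) * b3" .
  qed
qed

text \<open>\<open>z\<close> is the apex. \<open>delta_zero\<close> expresses that the tent has no
  height on the facets opposite to the apex, and \<open>\<kappa>\<close> is a coercivity constant
  common to all \<open>M t\<close>; both are derived from the data of a layer in
  \<open>tent_at\<close>.\<close>

locale tent = dg_patch \<Omega> \<T> "patch \<T> z" p
  for \<Omega> :: "(real^'n::finite) set" and \<T> z p +
  fixes \<G> :: "real^'n \<Rightarrow> real^'l^'l::finite" and \<L> :: "'n \<Rightarrow> real^'n \<Rightarrow> real^'l^'l"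
    and S B :: "real^'n \<Rightarrow> real^'l^'l" and \<phi>b \<phi>t :: "real^'n \<Rightarrow> real" and \<kappa> :: real
  assumes L_symmetric: "\<And>k x. x \<in> open_elements \<T> \<Longrightarrow> transpose (\<L> k x) = \<L> k x"
    and L_constant: "\<And>k. elementwise_constant \<T> (\<L> k)"
    and L_divergence: "divergence_free \<Omega> \<L>"
    and G_symmetric: "\<And>x. x \<in> open_elements \<T> \<Longrightarrow> transpose (\<G> x) = \<G> x"
    and G_constant: "elementwise_constant \<T> \<G>"
    and S_bounded: "bounded (S ` (skeleton \<T> \<inter> \<Omega>))"
    and S_measurable: "S \<in> borel_measurable (restrict_space borel (skeleton \<T> \<inter> \<Omega>))"
    and S_semidef: "\<And>x. x \<in> skeleton \<T> \<inter> \<Omega> \<Longrightarrow> positive_semidef (S x + transpose (S x))"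
    and B_bounded: "bounded (B ` frontier \<Omega>)"
    and B_measurable: "B \<in> borel_measurable (restrict_space borel (frontier \<Omega>))"
    and B_semidef: "\<And>x. x \<in> frontier \<Omega> \<Longrightarrow> positive_semidef (B x + transpose (B x))"
    and bot_linear: "piecewise_linear \<T> \<phi>b" and top_linear: "piecewise_linear \<T> \<phi>t"
    and delta_nonneg: "\<And>K x. K \<in> patch \<T> z \<Longrightarrow> x \<in> K \<Longrightarrow> \<phi>b x \<le> \<phi>t x"
    and delta_zero: "\<And>K F x. K \<in> patch \<T> z \<Longrightarrow> F facet_of K \<Longrightarrow> z \<notin> F \<Longrightarrow> x \<in> F \<Longrightarrow> \<phi>t x = \<phi>b x"
    and M_pos: "\<kappa> > 0" "\<And>x t e. x \<in> open_elements (patch \<T> z) \<Longrightarrow> t \<in> {0..1} \<Longrightarrow>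
       \<kappa> * (norm e)\<^sup>2 \<le> (M_op \<G> \<L> \<phi>b \<phi>t t x *v e) \<bullet> e"
begin

abbreviation "\<K> \<equiv> patch \<T> z"
abbreviation "\<delta> \<equiv> \<lambda>x. \<phi>t x - \<phi>b x"
abbreviation "dgV \<equiv> dg_space \<K> p :: (real^'n \<Rightarrow> real^'l) set"
abbreviation "num_flux \<equiv> numerical_flux \<Omega> \<K> \<L> S B"

definition element_L :: "(real^'n) set \<Rightarrow> 'n \<Rightarrow> real^'l^'l" where
  "element_L K j = \<L> j (SOME x. x \<in> interior K)"

lemma element_L: assumes "K \<in> \<T>"
  shows "x \<in> interior K \<Longrightarrow> \<L> j x = element_L K j" and "transpose (element_L K j) = element_L K j"
proof -
  have s: "(SOME x. x \<in> interior K) \<in> interior K" using element(6)[OF assms] by (simp add: some_in_eq)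
  obtain a where a: "\<forall>x\<in>interior K. \<L> j x = a" using L_constant assms unfolding elementwise_constant_def by blast
  show "\<L> j x = element_L K j" if "x \<in> interior K" using a s that by (simp add: element_L_def)
  have "(SOME x. x \<in> interior K) \<in> open_elements \<T>" using s assms by (auto simp: open_elements_def)
  then show "transpose (element_L K j) = element_L K j" unfolding element_L_def by (rule L_symmetric)
qed

definition element_D :: "(real^'n) set \<Rightarrow> (real^'n) set \<Rightarrow> real^'l^'l" where
  "element_D K F = (\<Sum>j\<in>UNIV. (outward_normal K F $ j) *\<^sub>R element_L K j)"

lemma element_D_trace:
  assumes "K \<in> \<T>" "x \<in> K"
  shows "trace_from K (normal_matrix \<L> (outward_normal K F)) x = element_D K F"
  by (rule trace_eq[OF assms]) (simp_all add: normal_matrix_def element_D_def element_L(1)[OF assms(1)])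

lemma element_D_inner:
  "(element_D K F *v e) \<bullet> e' = (\<Sum>j\<in>UNIV. outward_normal K F $ j * ((element_L K j *v e) \<bullet> e'))"
proof -
  have "(\<Sum>j\<in>J. (a j) *\<^sub>R A j) *v e = (\<Sum>j\<in>J. a j *\<^sub>R (A j *v e))" if "finite J" for J and a :: "'n \<Rightarrow> real" and A :: "'n \<Rightarrow> real^'l^'l"
    using that by induction (simp_all add: matrix_vector_mult_add_rdistrib scaleR_matrix_vector_assoc)
  then show ?thesis by (simp add: element_D_def inner_sum_left)
qed

lemma element_D_symmetric:
  assumes "K \<in> \<T>" shows "(element_D K F *v e) \<bullet> e' = (element_D K F *v e') \<bullet> e"
  unfolding element_D_inner
  using symmetric_matrix_inner[OF element_L(2)[OF assms]] by (simp add: inner_commute)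

text \<open>The normal changes sign across the facet, while \<open>normal_flux_continuous\<close>
  makes the coefficients of the two sides equivalent in the normal direction.\<close>

lemma element_D_opposite:
  assumes "K \<in> \<T>" "K' \<in> \<T>" "K \<noteq> K'" "F facet_of K" "F facet_of K'" "x \<in> F" "x \<in> \<Omega>"
  shows "element_D K' F = - element_D K F"
proof -
  obtain x0 where x0: "x0 \<in> rel_interior F" "x0 \<in> \<Omega>"
    using rel_interior_in_dom[OF assms(1,4,6,7)] by blast
  have "element_D K F = (\<Sum>j\<in>UNIV. (outward_normal K F $ j) *\<^sub>R element_L K' j)"
    unfolding element_D_def
    by (rule normal_flux_continuous[OF L_divergence assms(1-5) element_L(1)[OF assms(1)] element_L(1)[OF assms(2)] x0])
  then show ?thesis
    unfolding element_D_def opposite_normal[OF assms(1-5)] by (simp add: sum_negf)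
qed

lemma delta_affine:
  assumes "K \<in> \<T>"
  obtains b a where "\<And>x. x \<in> K \<Longrightarrow> \<delta> x = b \<bullet> x + a"
proof -
  obtain b a where 1: "\<forall>x\<in>K. \<phi>b x = b \<bullet> x + a" using bot_linear assms unfolding piecewise_linear_def by blast
  obtain b' a' where 2: "\<forall>x\<in>K. \<phi>t x = b' \<bullet> x + a'" using top_linear assms unfolding piecewise_linear_def by blast
  have "\<delta> x = (b' - b) \<bullet> x + (a' - a)" if "x \<in> K" for x using 1 2 that by (simp add: inner_diff_left)
  then show thesis by (rule that)
qed

text \<open>Measurability of \<open>B\<close> and \<open>S\<close> is given only on the sets where
  they act; extension by zero turns them into Borel functions on the whole space.\<close>

definition matrix_B :: "real^'n \<Rightarrow> real^'l^'l" where "matrix_B x = indicator (frontier \<Omega>) x *\<^sub>R B x"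
definition matrix_S :: "real^'n \<Rightarrow> real^'l^'l" where "matrix_S x = indicator (skeleton \<T> \<inter> \<Omega>) x *\<^sub>R S x"

lemma matrix_BS:
  shows "matrix_B \<in> borel_measurable borel" and "matrix_S \<in> borel_measurable borel"
    and "\<exists>c. \<forall>x. norm (matrix_B x) \<le> c" and "\<exists>c. \<forall>x. norm (matrix_S x) \<le> c"
proof -
  have 1: "frontier \<Omega> \<in> sets borel" by simp
  have "closed (skeleton \<T>)" unfolding skeleton_def using finite_mesh by (intro closed_Union) auto
  then have 2: "skeleton \<T> \<inter> \<Omega> \<in> sets borel" using open_dom by auto
  show "matrix_B \<in> borel_measurable borel" "matrix_S \<in> borel_measurable borel"
    using B_measurable S_measurable 1 2
    by (simp_all add: borel_measurable_restrict_space_iff matrix_B_def[abs_def] matrix_S_def[abs_def])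
  have bd: "\<exists>c. \<forall>x. norm (indicator A x *\<^sub>R X x) \<le> c" if "bounded (X ` A)" for A and X :: "real^'n \<Rightarrow> real^'l^'l"
  proof -
    obtain c where c: "\<And>x. x \<in> A \<Longrightarrow> norm (X x) \<le> c" using \<open>bounded (X ` A)\<close> by (auto simp: bounded_iff)
    have "norm (indicator A x *\<^sub>R X x) \<le> \<bar>c\<bar>" for x using c[of x] by (cases "x \<in> A") auto
    then show ?thesis by blast
  qed
  show "\<exists>c. \<forall>x. norm (matrix_B x) \<le> c" "\<exists>c. \<forall>x. norm (matrix_S x) \<le> c"
    unfolding matrix_B_def matrix_S_def by (rule bd[OF B_bounded], rule bd[OF S_bounded])
qed

definition shared :: "(real^'n) set \<Rightarrow> (real^'n) set \<Rightarrow> bool" where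
  "shared K F \<longleftrightarrow> (\<exists>K'\<in>\<K>. K' \<noteq> K \<and> F facet_of K')"

text \<open>An involution on pairs of element and facet. An unshared facet is paired with its own
  element, so that boundary, rim and interior facets are handled by one reindexing of the
  sum.\<close>

definition mate :: "(real^'n) set \<Rightarrow> (real^'n) set \<Rightarrow> (real^'n) set" where
  "mate K F = (if shared K F then neighbor \<K> K F else K)"

lemma mate:
  assumes K: "K \<in> \<K>" and F: "F facet_of K"
  shows "mate K F \<in> \<K>" and "F facet_of mate K F" and "mate (mate K F) F = K"
    and "shared K F \<Longrightarrow> mate K F \<noteq> K" and "shared (mate K F) F = shared K F"
proof -
  have "mate K F \<in> \<K> \<and> F facet_of mate K F \<and> mate (mate K F) F = K \<and> (shared K F \<longrightarrow> mate K F \<noteq> K) \<and> shared (mate K F) F = shared K F"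
  proof (cases "shared K F")
    case False
    then show ?thesis using K F by (simp add: mate_def)
  next
    case True
    then obtain K' where K': "K' \<in> \<K>" "K' \<noteq> K" "F facet_of K'" by (auto simp: shared_def)
    have 1: "neighbor \<K> K F = K'" by (rule neighbor_eq[OF sub patch_element[OF K] K'(1,2) F K'(3)])
    have 2: "neighbor \<K> K' F = K"
      by (rule neighbor_eq[OF sub patch_element[OF K'(1)] K K'(2)[symmetric] K'(3) F])
    have 3: "shared K' F" using K K' F by (auto simp: shared_def)
    show ?thesis using 1 2 3 True K' by (simp add: mate_def)
  qed
  then show "mate K F \<in> \<K>" "F facet_of mate K F" "mate (mate K F) F = K"
    "shared K F \<Longrightarrow> mate K F \<noteq> K" "shared (mate K F) F = shared K F" by blast+
qed

text \<open>Splits the numerical flux into a matrix acting on the own trace and, in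
  \<open>flux_other\<close>, one acting on the trace of the mate. Linearity becomes visible, and the
  measurable coefficients are separated from the traces, which extend continuously.\<close>

definition flux_own :: "(real^'n) set \<Rightarrow> (real^'n) set \<Rightarrow> real^'n \<Rightarrow> real^'l^'l" where
  "flux_own K F x = (if x \<in> frontier \<Omega> then (1/2) *\<^sub>R (element_D K F + matrix_B x)
     else if shared K F then (1/2) *\<^sub>R element_D K F + matrix_S x else 0)"

definition flux_other :: "(real^'n) set \<Rightarrow> (real^'n) set \<Rightarrow> real^'n \<Rightarrow> real^'l^'l" where
  "flux_other K F x = (if x \<in> frontier \<Omega> then 0
     else if shared K F then (1/2) *\<^sub>R element_D K F - matrix_S x else 0)"

lemma num_flux_eq:
  assumes K: "K \<in> \<K>" and F: "F facet_of K" and x: "x \<in> F"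
  shows "num_flux K F w x = flux_own K F x *v trace_from K w x + flux_other K F x *v trace_from (mate K F) w x"
proof -
  have KT: "K \<in> \<T>" by (rule patch_element[OF K])
  have xK: "x \<in> K" using x facet_subset[OF F] by blast
  have D: "trace_from K (normal_matrix \<L> (outward_normal K F)) x = element_D K F"
    by (rule element_D_trace[OF KT xK])
  have S: "x \<notin> frontier \<Omega> \<Longrightarrow> matrix_S x = S x"
    using frontier_dom[OF xK KT] facet_in_skeleton[OF KT F] x by (auto simp: matrix_S_def)
  have sc: "((1/2) *\<^sub>R A) *v y = (1/2) *\<^sub>R (A *v y)" for A :: "real^'l^'l" and y
    by (simp add: scaleR_matrix_vector_assoc)
  show ?thesis
    unfolding numerical_flux_def Let_def D shared_def[symmetric]
    using S by (auto simp: flux_own_def flux_other_def matrix_B_def mate_def sc matrix_vector_mult_add_rdistrib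
        matrix_vector_mult_diff_rdistrib matrix_vector_right_distrib matrix_vector_mult_diff_distrib matrix_vector_mult_scaleR
        scaleR_add_right simp flip: scaleR_matrix_vector_assoc)
qed

lemma flux_matrices:
  shows "flux_own K F \<in> borel_measurable borel" and "flux_other K F \<in> borel_measurable borel"
    and "\<exists>c. \<forall>x. norm (flux_own K F x) \<le> c" and "\<exists>c. \<forall>x. norm (flux_other K F x) \<le> c"
proof -
  note [measurable] = matrix_BS(1,2)
  have [measurable]: "frontier \<Omega> \<in> sets borel" by simp
  show "flux_own K F \<in> borel_measurable borel" "flux_other K F \<in> borel_measurable borel"
    unfolding flux_own_def[abs_def] flux_other_def[abs_def] by (cases "shared K F"; simp; measurable)+
  obtain c where c: "\<And>x. norm (matrix_B x) \<le> c" using matrix_BS(3) by blast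
  obtain d where d: "\<And>x. norm (matrix_S x) \<le> d" using matrix_BS(4) by blast
  let ?D = "element_D K F"
  have h: "norm ((1/2) *\<^sub>R ?D) \<le> norm ?D" by simp
  have 1: "norm ((1/2) *\<^sub>R (?D + matrix_B x)) \<le> norm ?D + c" for x
  proof -
    have "norm ((1/2) *\<^sub>R (?D + matrix_B x)) = norm (?D + matrix_B x) / 2" by simp
    then show ?thesis
      using norm_triangle_ineq[of ?D "matrix_B x"] c[of x] norm_ge_zero[of ?D] norm_ge_zero[of "matrix_B x"] by linarith
  qed
  have 2: "norm ((1/2) *\<^sub>R ?D + matrix_S x) \<le> norm ?D + d" for x
    using norm_triangle_ineq[of "(1/2) *\<^sub>R ?D" "matrix_S x"] d[of x] h by linarith
  have 3: "norm ((1/2) *\<^sub>R ?D - matrix_S x) \<le> norm ?D + d" for x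
    using norm_triangle_ineq4[of "(1/2) *\<^sub>R ?D" "matrix_S x"] d[of x] h by linarith
  have c0: "0 \<le> norm ?D + \<bar>c\<bar> + \<bar>d\<bar>" by simp
  have "norm (flux_own K F x) \<le> norm ?D + \<bar>c\<bar> + \<bar>d\<bar>" for x
    unfolding flux_own_def using 1[of x] 2[of x] c0 by (auto split: if_splits intro: order_trans)
  then show "\<exists>c. \<forall>x. norm (flux_own K F x) \<le> c" by blast
  have "norm (flux_other K F x) \<le> norm ?D + \<bar>c\<bar> + \<bar>d\<bar>" for x
    unfolding flux_other_def using 3[of x] c0 by (auto split: if_splits intro: order_trans)
  then show "\<exists>c. \<forall>x. norm (flux_other K F x) \<le> c" by blast
qed

lemma dg_trace:
  fixes v :: "real^'n \<Rightarrow> real^'l"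
  assumes v: "v \<in> dgV" and K: "K \<in> \<K>"
  obtains q where "\<And>x. x \<in> interior K \<Longrightarrow> v x = q x" "\<And>l. smooth_fun (\<lambda>x. q x $ l)"
    "\<And>S. continuous_on S q" "\<And>x. x \<in> K \<Longrightarrow> trace_from K v x = q x"
proof -
  obtain q where q: "\<And>x. x \<in> interior K \<Longrightarrow> v x = q x" "\<And>l. smooth_fun (\<lambda>x. q x $ l)"
    "\<And>S. continuous_on S q" using dg_polynomial[OF v K] by metis
  have "trace_from K v x = q x" if "x \<in> K" for x
    by (rule trace_eq[OF patch_element[OF K] that q(1) q(3)])
  then show thesis using that q by blast
qed

lemma trace_add:
  assumes u: "u \<in> dgV" and v: "v \<in> dgV" and K: "K \<in> \<K>" "x \<in> K"
  shows "trace_from K (\<lambda>x. u x + v x) x = trace_from K u x + trace_from K v x"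
proof -
  obtain q where q: "\<And>x. x \<in> interior K \<Longrightarrow> u x = q x" "\<And>S. continuous_on S q" "\<And>x. x \<in> K \<Longrightarrow> trace_from K u x = q x"
    using dg_trace[OF u K(1)] by metis
  obtain r where r: "\<And>x. x \<in> interior K \<Longrightarrow> v x = r x" "\<And>S. continuous_on S r" "\<And>x. x \<in> K \<Longrightarrow> trace_from K v x = r x"
    using dg_trace[OF v K(1)] by metis
  have "trace_from K (\<lambda>x. u x + v x) x = q x + r x"
    by (rule trace_eq[OF patch_element[OF K(1)] K(2)]) (auto intro!: continuous_intros q(2) r(2) simp: q(1) r(1))
  then show ?thesis using q(3) r(3) K(2) by simp
qed

lemma trace_scale:
  assumes u: "u \<in> dgV" and K: "K \<in> \<K>" "x \<in> K"
  shows "trace_from K (\<lambda>x. c *\<^sub>R u x) x = c *\<^sub>R trace_from K u x"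
proof -
  obtain q where q: "\<And>x. x \<in> interior K \<Longrightarrow> u x = q x" "\<And>S. continuous_on S q" "\<And>x. x \<in> K \<Longrightarrow> trace_from K u x = q x"
    using dg_trace[OF u K(1)] by metis
  have "trace_from K (\<lambda>x. c *\<^sub>R u x) x = c *\<^sub>R q x"
    by (rule trace_eq[OF patch_element[OF K(1)] K(2)]) (auto intro!: continuous_intros q(2) simp: q(1))
  then show ?thesis using q(3) K(2) by simp
qed

end

section \<open>Linearity of the spatial form in each argument\<close>

lemma (in function_inner_space) functional_diff_fun:
  "functional f \<Longrightarrow> functional g \<Longrightarrow> functional (\<lambda>u. f u - g u)"
  by (simp add: functional_def algebra_simps)

lemma (in function_inner_space) functional_sum_fun:
  assumes "\<And>i. i \<in> I \<Longrightarrow> functional (f i)"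
  shows "functional (\<lambda>u. \<Sum>i\<in>I. f i u)"
  using assms
proof (induction I rule: infinite_finite_induct)
  case (insert i I)
  then have "functional (f i)" "functional (\<lambda>u. \<Sum>i\<in>I. f i u)" by auto
  then show ?case using insert.hyps by (simp add: functional_def algebra_simps)
qed (simp_all add: functional_def)

context tent
begin

sublocale dgs: function_inner_space dgV "l2_inner \<K>"
proof
  fix u v w :: "real^'n \<Rightarrow> real^'l" and c :: real
  show "(\<lambda>x. 0) \<in> dgV" by (rule dg_zero)
  show "u \<in> dgV \<Longrightarrow> v \<in> dgV \<Longrightarrow> (\<lambda>x. u x + v x) \<in> dgV" by (rule dg_add)
  show "u \<in> dgV \<Longrightarrow> (\<lambda>x. c *\<^sub>R u x) \<in> dgV" by (rule dg_scale)
  show "u \<in> dgV \<Longrightarrow> v \<in> dgV \<Longrightarrow> w \<in> dgV \<Longrightarrow> l2_inner \<K> (\<lambda>x. u x + v x) w = l2_inner \<K> u w + l2_inner \<K> v w"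
    by (intro l2_inner_add dg_inner_integrable)
  show "l2_inner \<K> (\<lambda>x. c *\<^sub>R u x) w = c * l2_inner \<K> u w" by (rule l2_inner_scale)
  show "l2_inner \<K> u w = l2_inner \<K> w u" by (rule l2_inner_commute)
  show "0 \<le> l2_inner \<K> u u" by (rule l2_inner_nonneg)
  show "u \<in> dgV \<Longrightarrow> l2_inner \<K> u u = 0 \<Longrightarrow> u = (\<lambda>x. 0)" by (rule l2_inner_definite)
qed

definition facet_pairing :: "(real^'n) set \<Rightarrow> (real^'n) set \<Rightarrow> (real^'n \<Rightarrow> real^'l) \<Rightarrow> (real^'n \<Rightarrow> real^'l) \<Rightarrow> real^'n \<Rightarrow> real" where
  "facet_pairing K F w v x = (\<delta> x *\<^sub>R num_flux K F w x) \<bullet> trace_from K v x"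

lemma facet_hyperplane:
  assumes "K \<in> \<K>" "F facet_of K"
  obtains n d where "norm n = 1" "affine hull F = {y. n \<bullet> y = d}" "compact F" "F \<in> sets borel"
proof -
  note s = simplex_facet[OF element(1)[OF patch_element[OF assms(1)]] assms(2)]
  obtain x where "x \<in> F" using s(5) rel_interior_subset by blast
  then show thesis using that s(1) s(3) s(4) borel_compact by blast
qed

lemma facet_pairing_integrable:
  assumes K: "K \<in> \<K>" and F: "F facet_of K" and w: "w \<in> dgV" and v: "v \<in> dgV"
  shows "set_integrable (hyperplane_measure (affine hull F)) F (facet_pairing K F w v)"
proof -
  obtain n d where n: "norm n = 1" "affine hull F = {y. n \<bullet> y = d}" "compact F" "F \<in> sets borel"
    by (rule facet_hyperplane[OF K F])
  obtain b a where ba: "\<And>x. x \<in> K \<Longrightarrow> \<delta> x = b \<bullet> x + a" using delta_affine[OF patch_element[OF K]] by blast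
  obtain q where q: "\<And>S. continuous_on S q" "\<And>x. x \<in> K \<Longrightarrow> trace_from K w x = q x" using dg_trace[OF w K] by metis
  obtain q' where q': "\<And>S. continuous_on S q'" "\<And>x. x \<in> mate K F \<Longrightarrow> trace_from (mate K F) w x = q' x"
    using dg_trace[OF w mate(1)[OF K F]] by metis
  obtain r where r: "\<And>S. continuous_on S r" "\<And>x. x \<in> K \<Longrightarrow> trace_from K v x = r x" using dg_trace[OF v K] by metis
  obtain c where c: "\<And>x. norm (flux_own K F x) \<le> c" using flux_matrices(3) by blast
  obtain c' where c': "\<And>x. norm (flux_other K F x) \<le> c'" using flux_matrices(4) by blast
  let ?f = "\<lambda>x. b \<bullet> x + a"
  have cf: "continuous_on UNIV ?f" by (intro continuous_intros)
  have FK: "x \<in> K" "x \<in> mate K F" if "x \<in> F" for x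
    using that facet_subset[OF F] facet_subset[OF mate(2)[OF K F]] by blast+
  have "set_integrable (hyperplane_measure (affine hull F)) F (\<lambda>x. (?f x *\<^sub>R (flux_own K F x *v q x)) \<bullet> r x +
    (?f x *\<^sub>R (flux_other K F x *v q' x)) \<bullet> r x)"
    unfolding n(2)
    by (rule set_integral_add(1)[OF facet_term_integrable[OF n(1,3) flux_matrices(1) c cf q(1) r(1)]
        facet_term_integrable[OF n(1,3) flux_matrices(2) c' cf q'(1) r(1)]])
  moreover have "(?f x *\<^sub>R (flux_own K F x *v q x)) \<bullet> r x + (?f x *\<^sub>R (flux_other K F x *v q' x)) \<bullet> r x = facet_pairing K F w v x"
    if x: "x \<in> F" for x
    unfolding facet_pairing_def num_flux_eq[OF K F x] q(2)[OF FK(1)[OF x]] q'(2)[OF FK(2)[OF x]] r(2)[OF FK(1)[OF x]] ba[OF FK(1)[OF x]]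
    by (simp add: scaleR_add_right inner_add_left distrib_left)
  ultimately show ?thesis
    by (subst set_integrable_cong[OF refl]) (auto)
qed

lemma facet_integral_add:
  assumes "set_integrable (hyperplane_measure (affine hull F)) F f" "set_integrable (hyperplane_measure (affine hull F)) F g"
  shows "facet_integral F (\<lambda>x. f x + g x) = facet_integral F f + facet_integral F g"
  unfolding facet_integral_def using assms by (rule set_integral_add(2))

lemma facet_integral_mult: "facet_integral F (\<lambda>x. c * f x) = c * facet_integral F f" for c :: real
  by (simp add: facet_integral_def)

lemma facet_integral_cong: "(\<And>x. x \<in> F \<Longrightarrow> f x = g x) \<Longrightarrow> facet_integral F f = facet_integral F g"
  unfolding facet_integral_def set_lebesgue_integral_def
  by (rule Bochner_Integration.integral_cong) (auto simp: indicator_def)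

lemma facet_functionals:
  assumes K: "K \<in> \<K>" and F: "F facet_of K"
  shows "v \<in> dgV \<Longrightarrow> dgs.functional (\<lambda>w. facet_integral F (facet_pairing K F w v))"
    and "w \<in> dgV \<Longrightarrow> dgs.functional (\<lambda>v. facet_integral F (facet_pairing K F w v))"
proof -
  have FK: "x \<in> K" "x \<in> mate K F" if "x \<in> F" for x
    using that facet_subset[OF F] facet_subset[OF mate(2)[OF K F]] by blast+
  note M = mate(1)[OF K F]
  show "dgs.functional (\<lambda>w. facet_integral F (facet_pairing K F w v))" if v: "v \<in> dgV"
    unfolding dgs.functional_def
  proof (intro conjI ballI allI)
    fix u w :: "real^'n \<Rightarrow> real^'l" assume u: "u \<in> dgV" and w: "w \<in> dgV"
    have "facet_pairing K F (\<lambda>x. u x + w x) v x = facet_pairing K F u v x + facet_pairing K F w v x" if x: "x \<in> F" for x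
      unfolding facet_pairing_def num_flux_eq[OF K F x] trace_add[OF u w K FK(1)[OF x]] trace_add[OF u w M FK(2)[OF x]]
      by (simp add: matrix_vector_right_distrib scaleR_add_right inner_add_left algebra_simps)
    then show "facet_integral F (facet_pairing K F (\<lambda>x. u x + w x) v) =
        facet_integral F (facet_pairing K F u v) + facet_integral F (facet_pairing K F w v)"
      by (subst facet_integral_add[OF facet_pairing_integrable[OF K F u v] facet_pairing_integrable[OF K F w v], symmetric])
        (rule facet_integral_cong)
  next
    fix c :: real and u :: "real^'n \<Rightarrow> real^'l" assume u: "u \<in> dgV"
    have "facet_pairing K F (\<lambda>x. c *\<^sub>R u x) v x = c * facet_pairing K F u v x" if x: "x \<in> F" for x
      unfolding facet_pairing_def num_flux_eq[OF K F x] trace_scale[OF u K FK(1)[OF x]] trace_scale[OF u M FK(2)[OF x]]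
      by (simp add: matrix_vector_mult_scaleR scaleR_add_right inner_add_left algebra_simps)
    then show "facet_integral F (facet_pairing K F (\<lambda>x. c *\<^sub>R u x) v) = c * facet_integral F (facet_pairing K F u v)"
      by (subst facet_integral_mult[symmetric]) (rule facet_integral_cong)
  qed
  show "dgs.functional (\<lambda>v. facet_integral F (facet_pairing K F w v))" if w: "w \<in> dgV"
    unfolding dgs.functional_def
  proof (intro conjI ballI allI)
    fix u v :: "real^'n \<Rightarrow> real^'l" assume u: "u \<in> dgV" and v: "v \<in> dgV"
    have "facet_pairing K F w (\<lambda>x. u x + v x) x = facet_pairing K F w u x + facet_pairing K F w v x" if x: "x \<in> F" for x
      unfolding facet_pairing_def trace_add[OF u v K FK(1)[OF x]] by (simp add: inner_add_right)
    then show "facet_integral F (facet_pairing K F w (\<lambda>x. u x + v x)) =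
        facet_integral F (facet_pairing K F w u) + facet_integral F (facet_pairing K F w v)"
      by (subst facet_integral_add[OF facet_pairing_integrable[OF K F w u] facet_pairing_integrable[OF K F w v], symmetric])
        (rule facet_integral_cong)
  next
    fix c :: real and u :: "real^'n \<Rightarrow> real^'l" assume u: "u \<in> dgV"
    have "facet_pairing K F w (\<lambda>x. c *\<^sub>R u x) x = c * facet_pairing K F w u x" if x: "x \<in> F" for x
      unfolding facet_pairing_def trace_scale[OF u K FK(1)[OF x]] by simp
    then show "facet_integral F (facet_pairing K F w (\<lambda>x. c *\<^sub>R u x)) = c * facet_integral F (facet_pairing K F w u)"
      by (subst facet_integral_mult[symmetric]) (rule facet_integral_cong)
  qed
qed

definition volume_pairing :: "'n \<Rightarrow> (real^'n \<Rightarrow> real^'l) \<Rightarrow> (real^'n \<Rightarrow> real^'l) \<Rightarrow> real^'n \<Rightarrow> real" where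
  "volume_pairing j w v x = (\<delta> x *\<^sub>R (\<L> j x *v w x)) \<bullet> partial j v x"

lemma dg_differentiable:
  assumes v: "v \<in> dgV" and K: "K \<in> \<K>" and x: "x \<in> interior K"
  shows "v differentiable (at x)"
    and "(\<And>y. y \<in> interior K \<Longrightarrow> v y = q y) \<Longrightarrow> (\<And>l. smooth_fun (\<lambda>x. q x $ l)) \<Longrightarrow> partial j v x = partial j q x"
proof -
  have *: "v differentiable (at x) \<and> partial j v x = partial j q x"
    if q: "\<And>y. y \<in> interior K \<Longrightarrow> v y = q y" "\<And>l. smooth_fun (\<lambda>x. q x $ l)" for q j
  proof -
    obtain q' where q': "(q has_derivative q') (at x)" using smooth_vec(2)[OF q(2)] by (auto simp: differentiable_def)
    have "(v has_derivative q') (at x)"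
      by (rule has_derivative_transform_within_open[OF q' open_interior x]) (simp add: q(1))
    then show ?thesis using partial_has_derivative[OF q'] partial_has_derivative by (auto simp: differentiable_def)
  qed
  show "v differentiable (at x)" using dg_polynomial[OF v K] * by metis
  show "(\<And>y. y \<in> interior K \<Longrightarrow> v y = q y) \<Longrightarrow> (\<And>l. smooth_fun (\<lambda>x. q x $ l)) \<Longrightarrow> partial j v x = partial j q x"
    using * by blast
qed

lemma volume_pairing_integrable:
  assumes K: "K \<in> \<K>" and w: "w \<in> dgV" and v: "v \<in> dgV"
  shows "set_integrable lebesgue (interior K) (volume_pairing j w v)"
proof -
  note KT = patch_element[OF K]
  obtain b a where ba: "\<And>x. x \<in> K \<Longrightarrow> \<delta> x = b \<bullet> x + a" using delta_affine[OF KT] by blast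
  obtain q where q: "\<And>x. x \<in> interior K \<Longrightarrow> w x = q x" "\<And>S. continuous_on S q" using dg_polynomial[OF w K] by metis
  obtain r where r: "\<And>x. x \<in> interior K \<Longrightarrow> v x = r x" "\<And>l. smooth_fun (\<lambda>x. r x $ l)" using dg_polynomial[OF v K] by metis
  have cr: "continuous_on K (partial j r)" by (rule smooth_vec(1)) (rule smooth_vec(4)[OF r(2)])
  show ?thesis
  proof (rule interior_integral(1)[OF element(2,3)[OF KT], where g="\<lambda>x. ((b \<bullet> x + a) *\<^sub>R (element_L K j *v q x)) \<bullet> partial j r x"])
    show "continuous_on K (\<lambda>x. ((b \<bullet> x + a) *\<^sub>R (element_L K j *v q x)) \<bullet> partial j r x)"
      by (intro continuous_intros q(2) cr)
    fix x assume x: "x \<in> interior K"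
    then have "x \<in> K" using interior_subset by blast
    then show "volume_pairing j w v x = ((b \<bullet> x + a) *\<^sub>R (element_L K j *v q x)) \<bullet> partial j r x"
      by (simp add: volume_pairing_def ba element_L(1)[OF KT x] q(1)[OF x] dg_differentiable(2)[OF v K x r])
  qed
qed

lemma volume_functionals:
  assumes K: "K \<in> \<K>"
  shows "v \<in> dgV \<Longrightarrow> dgs.functional (\<lambda>w. LINT x:interior K|lebesgue. volume_pairing j w v x)"
    and "w \<in> dgV \<Longrightarrow> dgs.functional (\<lambda>v. LINT x:interior K|lebesgue. volume_pairing j w v x)"
proof -
  have mK: "interior K \<in> sets lebesgue" by (intro sets_completionI_sets) simp
  show "dgs.functional (\<lambda>w. LINT x:interior K|lebesgue. volume_pairing j w v x)" if v: "v \<in> dgV"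
    unfolding dgs.functional_def
  proof (intro conjI ballI allI)
    fix u w :: "real^'n \<Rightarrow> real^'l" assume u: "u \<in> dgV" and w: "w \<in> dgV"
    have "volume_pairing j (\<lambda>x. u x + w x) v x = volume_pairing j u v x + volume_pairing j w v x" for x
      by (simp add: volume_pairing_def matrix_vector_right_distrib scaleR_add_right inner_add_left algebra_simps)
    then show "(LINT x:interior K|lebesgue. volume_pairing j (\<lambda>x. u x + w x) v x) =
      (LINT x:interior K|lebesgue. volume_pairing j u v x) + (LINT x:interior K|lebesgue. volume_pairing j w v x)"
      using set_integral_add(2)[OF volume_pairing_integrable[OF K u v] volume_pairing_integrable[OF K w v]] by simp
  next
    fix c :: real and u :: "real^'n \<Rightarrow> real^'l"
    have "volume_pairing j (\<lambda>x. c *\<^sub>R u x) v x = c * volume_pairing j u v x" for x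
      by (simp add: volume_pairing_def matrix_vector_mult_scaleR)
    then show "(LINT x:interior K|lebesgue. volume_pairing j (\<lambda>x. c *\<^sub>R u x) v x) = c * (LINT x:interior K|lebesgue. volume_pairing j u v x)"
      by simp
  qed
  show "dgs.functional (\<lambda>v. LINT x:interior K|lebesgue. volume_pairing j w v x)" if w: "w \<in> dgV"
    unfolding dgs.functional_def
  proof (intro conjI ballI allI)
    fix u v :: "real^'n \<Rightarrow> real^'l" assume u: "u \<in> dgV" and v: "v \<in> dgV"
    have "volume_pairing j w (\<lambda>x. u x + v x) x = volume_pairing j w u x + volume_pairing j w v x" if x: "x \<in> interior K" for x
      unfolding volume_pairing_def partial_add[OF dg_differentiable(1)[OF u K x] dg_differentiable(1)[OF v K x]]
      by (simp add: inner_add_right)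
    then have "(LINT x:interior K|lebesgue. volume_pairing j w (\<lambda>x. u x + v x) x) =
      (LINT x:interior K|lebesgue. volume_pairing j w u x + volume_pairing j w v x)"
      using mK by (intro set_lebesgue_integral_cong) auto
    then show "(LINT x:interior K|lebesgue. volume_pairing j w (\<lambda>x. u x + v x) x) =
      (LINT x:interior K|lebesgue. volume_pairing j w u x) + (LINT x:interior K|lebesgue. volume_pairing j w v x)"
      using set_integral_add(2)[OF volume_pairing_integrable[OF K w u] volume_pairing_integrable[OF K w v]] by simp
  next
    fix c :: real and u :: "real^'n \<Rightarrow> real^'l" assume u: "u \<in> dgV"
    have "volume_pairing j w (\<lambda>x. c *\<^sub>R u x) x = c * volume_pairing j w u x" if x: "x \<in> interior K" for x
      unfolding volume_pairing_def partial_scale[OF dg_differentiable(1)[OF u K x]] by simp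
    then have "(LINT x:interior K|lebesgue. volume_pairing j w (\<lambda>x. c *\<^sub>R u x) x) =
      (LINT x:interior K|lebesgue. c * volume_pairing j w u x)"
      using mK by (intro set_lebesgue_integral_cong) auto
    then show "(LINT x:interior K|lebesgue. volume_pairing j w (\<lambda>x. c *\<^sub>R u x) x) = c * (LINT x:interior K|lebesgue. volume_pairing j w u x)"
      by simp
  qed
qed

abbreviation "form \<equiv> dg_form \<Omega> \<K> \<L> S B \<delta>"

lemma form_eq:
  "form w v = (\<Sum>K\<in>\<K>. (\<Sum>j\<in>UNIV. LINT x:interior K|lebesgue. volume_pairing j w v x)
     - (\<Sum>F | F facet_of K. facet_integral F (facet_pairing K F w v)))"
  unfolding dg_form_def volume_pairing_def facet_pairing_def[abs_def] ..

text \<open>Linearity in the second argument allows testing on a basis only; linearity in the first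
  turns the semidiscrete equation into a finite linear system.\<close>

lemma form_functionals:
  shows "v \<in> dgV \<Longrightarrow> dgs.functional (\<lambda>w. form w v)" and "w \<in> dgV \<Longrightarrow> dgs.functional (\<lambda>v. form w v)"
  unfolding form_eq
  by (intro dgs.functional_sum_fun dgs.functional_diff_fun volume_functionals facet_functionals; simp)+

lemma elementwise_M: "elementwise_constant \<K> (M1 \<L> \<delta>)" "elementwise_constant \<K> (M_op \<G> \<L> \<phi>b \<phi>t t)"
proof -
  have *: "(\<exists>A. \<forall>x\<in>interior K. M1 \<L> \<delta> x = A) \<and> (\<exists>A. \<forall>x\<in>interior K. M0 \<G> \<L> \<phi>b x = A)" if K: "K \<in> \<K>" for K
  proof -
    note KT = patch_element[OF K]
    obtain b a where ba: "\<And>x. x \<in> K \<Longrightarrow> \<delta> x = b \<bullet> x + a" using delta_affine[OF KT] by blast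
    obtain b' a' where ba': "\<And>x. x \<in> K \<Longrightarrow> \<phi>b x = b' \<bullet> x + a'" using bot_linear KT unfolding piecewise_linear_def by blast
    obtain G where G: "\<And>x. x \<in> interior K \<Longrightarrow> \<G> x = G" using G_constant KT unfolding elementwise_constant_def by blast
    have "M1 \<L> \<delta> x = (\<Sum>j\<in>UNIV. (b $ j) *\<^sub>R element_L K j)" if "x \<in> interior K" for x
      using affine_partial[of K \<delta> b a x] ba that element_L(1)[OF KT that] by (simp add: M1_def)
    moreover have "M0 \<G> \<L> \<phi>b x = G - (\<Sum>j\<in>UNIV. (b' $ j) *\<^sub>R element_L K j)" if "x \<in> interior K" for x
      using affine_partial[of K \<phi>b b' a' x] ba' that element_L(1)[OF KT that] G[OF that] by (simp add: M0_def)
    ultimately show ?thesis by blast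
  qed
  show "elementwise_constant \<K> (M1 \<L> \<delta>)" using * by (simp add: elementwise_constant_def)
  show "elementwise_constant \<K> (M_op \<G> \<L> \<phi>b \<phi>t t)"
    unfolding elementwise_constant_def
  proof
    fix K assume "K \<in> \<K>"
    then obtain A A' where "\<forall>x\<in>interior K. M1 \<L> \<delta> x = A" "\<forall>x\<in>interior K. M0 \<G> \<L> \<phi>b x = A'" using * by blast
    then show "\<exists>a. \<forall>x\<in>interior K. M_op \<G> \<L> \<phi>b \<phi>t t x = a" by (intro exI[of _ "A' - t *\<^sub>R A"]) (simp add: M_op_def)
  qed
qed

end

section \<open>The energy inequality\<close>

lemma set_integral_sum:
  fixes f :: "'i \<Rightarrow> 'a \<Rightarrow> 'b::{banach, second_countable_topology}"
  assumes "\<And>i. i \<in> I \<Longrightarrow> set_integrable M A (f i)"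
  shows "set_integrable M A (\<lambda>x. \<Sum>i\<in>I. f i x)"
    and "(LINT x:A|M. \<Sum>i\<in>I. f i x) = (\<Sum>i\<in>I. LINT x:A|M. f i x)"
proof -
  have i: "integrable M (\<lambda>x. indicator A x *\<^sub>R f i x)" if "i \<in> I" for i
    using assms[OF that] unfolding set_integrable_def .
  show "set_integrable M A (\<lambda>x. \<Sum>i\<in>I. f i x)"
    unfolding set_integrable_def scaleR_sum_right by (rule Bochner_Integration.integrable_sum) (rule i)
  show "(LINT x:A|M. \<Sum>i\<in>I. f i x) = (\<Sum>i\<in>I. LINT x:A|M. f i x)"
    unfolding set_lebesgue_integral_def scaleR_sum_right by (rule Bochner_Integration.integral_sum) (rule i)
qed

context tent
begin

lemma facet_D_integrable:
  assumes K: "K \<in> \<K>" and F: "F facet_of K" and v: "v \<in> dgV"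
  shows "set_integrable (hyperplane_measure (affine hull F)) F
    (\<lambda>x. \<delta> x * ((A *v trace_from K v x) \<bullet> trace_from K v x))"
proof -
  obtain n d where n: "norm n = 1" "affine hull F = {y. n \<bullet> y = d}" "compact F" "F \<in> sets borel"
    by (rule facet_hyperplane[OF K F])
  obtain b a where ba: "\<And>x. x \<in> K \<Longrightarrow> \<delta> x = b \<bullet> x + a" using delta_affine[OF patch_element[OF K]] by blast
  obtain q where q: "\<And>S. continuous_on S q" "\<And>x. x \<in> K \<Longrightarrow> trace_from K v x = q x" using dg_trace[OF v K] by metis
  have "set_integrable (hyperplane_measure (affine hull F)) F (\<lambda>x. ((b \<bullet> x + a) *\<^sub>R (A *v q x)) \<bullet> q x)"
    unfolding n(2) by (rule facet_term_integrable[OF n(1,3), where c="norm A"]) (auto intro!: continuous_intros q(1))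
  moreover have "((b \<bullet> x + a) *\<^sub>R (A *v q x)) \<bullet> q x = \<delta> x * ((A *v trace_from K v x) \<bullet> trace_from K v x)" if "x \<in> F" for x
  proof -
    have "x \<in> K" using that facet_subset[OF F] by blast
    then show ?thesis using ba q(2) by simp
  qed
  ultimately show ?thesis by (subst set_integrable_cong[OF refl]) auto
qed

text \<open>The divergence theorem is applied, for each \<open>j\<close>, to
  \<open>\<delta> (\<L> j v) \<bullet> v\<close>. As \<open>\<L> j\<close> is symmetric and constant
  on the element, the derivative in direction \<open>j\<close> is twice the volume pairing plus the
  term with the derivative of \<open>\<delta>\<close>; the latter sum to \<open>M1\<close>, the
  boundary terms to the normal matrix.\<close>

lemma element_energy:
  assumes K: "K \<in> \<K>" and v: "v \<in> dgV"
  shows "2 * (\<Sum>j\<in>UNIV. LINT x:interior K|lebesgue. volume_pairing j v v x) +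
      (LINT x:interior K|lebesgue. (M1 \<L> \<delta> x *v v x) \<bullet> v x) =
    (\<Sum>F | F facet_of K. facet_integral F (\<lambda>x. \<delta> x * ((element_D K F *v trace_from K v x) \<bullet> trace_from K v x)))"
proof -
  note KT = patch_element[OF K]
  obtain b a where ba: "\<And>x. x \<in> K \<Longrightarrow> \<delta> x = b \<bullet> x + a" using delta_affine[OF KT] by blast
  obtain q where q: "\<And>x. x \<in> interior K \<Longrightarrow> v x = q x" "\<And>l. smooth_fun (\<lambda>x. q x $ l)"
    "\<And>S. continuous_on S q" "\<And>x. x \<in> K \<Longrightarrow> trace_from K v x = q x" using dg_trace[OF v K] by metis
  let ?A = "element_L K"
  \<comment> \<open>The polynomial \<open>q\<close> and the affine formula for
    \<open>\<delta>\<close> replace the original functions, because the divergence theorem asks for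
    differentiability on the whole space.\<close>
  define X where "X j x = (b \<bullet> x + a) * ((?A j *v q x) \<bullet> q x)" for j x
  have smX: "smooth_fun (X j)" for j
  proof -
    have "smooth_fun (\<lambda>x. ((\<Sum>i\<in>UNIV. b $ i * x $ i) + a) * (\<Sum>i\<in>UNIV. (\<Sum>k\<in>UNIV. ?A j $ i $ k * q x $ k) * q x $ i))"
      by (intro smooth_mult smooth_add smooth_sum smooth_const smooth_nth q(2))
    then show ?thesis by (simp add: X_def[abs_def] inner_vec_def matrix_vector_mult_def)
  qed
  have dX: "grad (X j) x \<bullet> axis j 1 = b $ j * ((?A j *v q x) \<bullet> q x) + 2 * ((b \<bullet> x + a) * ((?A j *v q x) \<bullet> partial j q x))" for j x
  proof -
    obtain q' where q': "(q has_derivative q') (at x)" using smooth_vec(2)[OF q(2)] by (auto simp: differentiable_def)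
    have Aq: "((\<lambda>x. ?A j *v q x) has_derivative (\<lambda>h. ?A j *v q' h)) (at x)"
      by (rule bounded_linear.has_derivative[OF matrix_vector_mul_bounded_linear q'])
    have "((\<lambda>x. b \<bullet> x + a) has_derivative (\<lambda>h. b \<bullet> h)) (at x)" by (auto intro!: derivative_eq_intros)
    from has_derivative_mult[OF this has_derivative_inner[OF Aq q']]
    have "(X j has_derivative (\<lambda>h. (b \<bullet> x + a) * ((?A j *v q x) \<bullet> q' h + (?A j *v q' h) \<bullet> q x) + (b \<bullet> h) * ((?A j *v q x) \<bullet> q x))) (at x)"
      by (simp add: X_def[abs_def])
    from partial_has_derivative[OF this] have "partial j (X j) x =
      (b \<bullet> x + a) * ((?A j *v q x) \<bullet> partial j q x + (?A j *v partial j q x) \<bullet> q x) + b $ j * ((?A j *v q x) \<bullet> q x)"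
      using partial_has_derivative[OF q'] by (simp add: inner_axis)
    moreover have "(?A j *v partial j q x) \<bullet> q x = (?A j *v q x) \<bullet> partial j q x"
      using symmetric_matrix_inner[OF element_L(2)[OF KT]] by (simp add: inner_commute)
    ultimately show ?thesis by (simp add: grad_def inner_axis algebra_simps)
  qed
  have div: "(\<Sum>F | F facet_of K. (outward_normal K F $ j) * facet_integral F (X j)) = (LINT x:K|lborel. grad (X j) x \<bullet> axis j 1)" for j
    using simplex_divergence[OF element(1)[OF KT] smooth_fun_grad(1)[OF smX] smooth_fun_grad(4)[OF smX], where a="axis j 1"]
    by (simp add: inner_axis)
  have cgX: "continuous_on K (\<lambda>x. grad (X j) x \<bullet> axis j 1)" for j
    by (intro continuous_intros continuous_on_subset[OF smooth_fun_grad(4)[OF smX]]) auto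
  have elt: "2 * volume_pairing j v v x + b $ j * ((\<L> j x *v v x) \<bullet> v x) = grad (X j) x \<bullet> axis j 1" if x: "x \<in> interior K" for j x
  proof -
    have "x \<in> K" using x interior_subset by blast
    then show ?thesis unfolding dX
      by (simp add: volume_pairing_def ba element_L(1)[OF KT x] q(1)[OF x] dg_differentiable(2)[OF v K x q(1,2)])
  qed
  have M1v: "(M1 \<L> \<delta> x *v v x) \<bullet> v x = (\<Sum>j\<in>UNIV. b $ j * ((\<L> j x *v v x) \<bullet> v x))" if x: "x \<in> interior K" for x
  proof -
    have "(\<Sum>j\<in>J. (c j) *\<^sub>R A j) *v e = (\<Sum>j\<in>J. c j *\<^sub>R (A j *v e))" if "finite J" for J and c :: "'n \<Rightarrow> real" and A :: "'n \<Rightarrow> real^'l^'l" and e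
      using that by induction (simp_all add: matrix_vector_mult_add_rdistrib scaleR_matrix_vector_assoc)
    then show ?thesis
      using affine_partial[of K \<delta> b a x] ba x by (simp add: M1_def inner_sum_left)
  qed
  have mK: "interior K \<in> sets lebesgue" by (intro sets_completionI_sets) simp
  have iV: "set_integrable lebesgue (interior K) (\<lambda>x. 2 * volume_pairing j v v x)" for j
    using volume_pairing_integrable[OF K v v] by simp
  have iM: "set_integrable lebesgue (interior K) (\<lambda>x. (M1 \<L> \<delta> x *v v x) \<bullet> v x)"
    by (rule dg_inner_integrable[OF dg_matrix[OF v elementwise_M(1)] v K])
  have "2 * (\<Sum>j\<in>UNIV. LINT x:interior K|lebesgue. volume_pairing j v v x) =
     (LINT x:interior K|lebesgue. (\<Sum>j\<in>UNIV. 2 * volume_pairing j v v x))"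
    by (simp add: sum_distrib_left set_integral_sum(2)[OF iV])
  also have "\<dots> + (LINT x:interior K|lebesgue. (M1 \<L> \<delta> x *v v x) \<bullet> v x) =
     (LINT x:interior K|lebesgue. (\<Sum>j\<in>UNIV. 2 * volume_pairing j v v x) + (M1 \<L> \<delta> x *v v x) \<bullet> v x)"
    by (rule set_integral_add(2)[symmetric, OF set_integral_sum(1)[OF iV] iM])
  also have "\<dots> = (LINT x:K|lborel. (\<Sum>j\<in>UNIV. grad (X j) x \<bullet> axis j 1))"
  proof (rule interior_integral(2)[OF element(2,3)[OF KT]])
    show "continuous_on K (\<lambda>x. \<Sum>j\<in>UNIV. grad (X j) x \<bullet> axis j 1)" by (intro continuous_on_sum cgX)
    show "(\<Sum>j\<in>UNIV. 2 * volume_pairing j v v x) + (M1 \<L> \<delta> x *v v x) \<bullet> v x = (\<Sum>j\<in>UNIV. grad (X j) x \<bullet> axis j 1)"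
      if "x \<in> interior K" for x
      unfolding M1v[OF that] elt[OF that, symmetric] by (simp add: sum.distrib)
  qed
  also have "\<dots> = (\<Sum>j\<in>UNIV. LINT x:K|lborel. grad (X j) x \<bullet> axis j 1)"
    using borel_integrable_compact[OF element(3)[OF KT] cgX]
    by (intro set_integral_sum(2)) (auto simp: set_integrable_def)
  also have "\<dots> = (\<Sum>j\<in>UNIV. \<Sum>F | F facet_of K. (outward_normal K F $ j) * facet_integral F (X j))"
    by (simp only: div)
  also have "\<dots> = (\<Sum>F | F facet_of K. \<Sum>j\<in>UNIV. (outward_normal K F $ j) * facet_integral F (X j))"
    by (rule sum.swap)
  also have "\<dots> = (\<Sum>F | F facet_of K. facet_integral F (\<lambda>x. \<delta> x * ((element_D K F *v trace_from K v x) \<bullet> trace_from K v x)))"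
  proof (rule sum.cong[OF refl])
    fix F assume "F \<in> {F. F facet_of K}"
    then have F: "F facet_of K" by simp
    have Xq: "X j x = \<delta> x * ((?A j *v trace_from K v x) \<bullet> trace_from K v x)" if "x \<in> F" for j x
    proof -
      have "x \<in> K" using that facet_subset[OF F] by blast
      then show ?thesis using ba q(4) by (simp add: X_def)
    qed
    have iX: "set_integrable (hyperplane_measure (affine hull F)) F (\<lambda>x. outward_normal K F $ j * X j x)" for j
    proof -
      have "set_integrable (hyperplane_measure (affine hull F)) F (X j)"
        using facet_D_integrable[OF K F v, of "?A j"] Xq by (subst set_integrable_cong[OF refl]) auto
      then show ?thesis by simp
    qed
    have "(\<Sum>j\<in>UNIV. (outward_normal K F $ j) * facet_integral F (X j)) = (\<Sum>j\<in>UNIV. facet_integral F (\<lambda>x. outward_normal K F $ j * X j x))"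
      by (simp only: facet_integral_mult)
    also have "\<dots> = facet_integral F (\<lambda>x. \<Sum>j\<in>UNIV. outward_normal K F $ j * X j x)"
      unfolding facet_integral_def by (rule set_integral_sum(2)[symmetric, OF iX])
    also have "\<dots> = facet_integral F (\<lambda>x. \<delta> x * ((element_D K F *v trace_from K v x) \<bullet> trace_from K v x))"
      by (rule facet_integral_cong) (simp add: Xq element_D_inner sum_distrib_left mult.left_commute)
    finally show "(\<Sum>j\<in>UNIV. (outward_normal K F $ j) * facet_integral F (X j)) =
      facet_integral F (\<lambda>x. \<delta> x * ((element_D K F *v trace_from K v x) \<bullet> trace_from K v x))" .
  qed
  finally show ?thesis .
qed

text \<open>The contribution of one side of a facet to twice the form plus the \<open>M1\<close>
  term: the boundary term of the divergence theorem minus twice the numerical flux.\<close>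

definition facet_energy :: "(real^'n \<Rightarrow> real^'l) \<Rightarrow> (real^'n) set \<Rightarrow> (real^'n) set \<Rightarrow> real^'n \<Rightarrow> real" where
  "facet_energy v K F x = \<delta> x * ((element_D K F *v trace_from K v x) \<bullet> trace_from K v x) + (- 2) * facet_pairing K F v v x"

lemma facet_energy_frontier:
  assumes K: "K \<in> \<K>" and F: "F facet_of K" and x: "x \<in> F" "x \<in> frontier \<Omega>"
  shows "facet_energy v K F x \<le> 0"
proof -
  let ?t = "trace_from K v x"
  have xK: "x \<in> K" using x(1) facet_subset[OF F] by blast
  have "flux_own K F x *v ?t = (1/2) *\<^sub>R (element_D K F *v ?t + B x *v ?t)"
    using x(2) by (simp add: flux_own_def matrix_B_def matrix_vector_mult_add_rdistrib flip: scaleR_matrix_vector_assoc)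
  then have P: "facet_pairing K F v v x = \<delta> x * ((1/2) * ((element_D K F *v ?t) \<bullet> ?t + (B x *v ?t) \<bullet> ?t))"
    using x(2) unfolding facet_pairing_def num_flux_eq[OF K F x(1)]
    by (simp add: flux_other_def inner_add_left)
  have "d * a + (- 2) * (d * ((1/2) * (a + b))) = - d * b" for d a b :: real by (simp add: field_simps)
  then have "facet_energy v K F x = - \<delta> x * ((B x *v ?t) \<bullet> ?t)"
    unfolding facet_energy_def P by blast
  moreover have "0 \<le> \<delta> x" using delta_nonneg[OF K xK] by simp
  moreover have "0 \<le> (B x *v ?t) \<bullet> ?t" by (rule positive_semidef_symmetrized[OF B_semidef[OF x(2)]])
  ultimately show ?thesis using mult_nonneg_nonneg[of "\<delta> x" "(B x *v ?t) \<bullet> ?t"] by linarith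
qed

text \<open>The sign is settled pointwise. On a shared facet through \<open>z\<close> let
  \<open>?t\<close> and \<open>?u\<close> be the two traces: the matrix \<open>?D\<close> is
  symmetric and changes sign for the mate, so its terms cancel, leaving
  \<open>- 2 * \<delta> x\<close> times the form of \<open>S x\<close> at the jump
  \<open>?t - ?u\<close>. Boundary points are estimated on each side, and facets missing
  \<open>z\<close> carry \<open>\<delta> x = 0\<close>.\<close>

lemma facet_energy_pair:
  assumes K: "K \<in> \<K>" and F: "F facet_of K" and x: "x \<in> F"
  shows "facet_energy v K F x + facet_energy v (mate K F) F x \<le> 0"
proof -
  let ?K = "mate K F"
  note KT = patch_element[OF K] and m = mate[OF K F]
  have xK: "x \<in> K" using x facet_subset[OF F] by blast
  consider "x \<in> frontier \<Omega>" | "x \<notin> frontier \<Omega>" "z \<notin> F" | "x \<notin> frontier \<Omega>" "z \<in> F" by blast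
  then show ?thesis
  proof cases
    case 1
    then show ?thesis
      using facet_energy_frontier[OF K F x 1, of v] facet_energy_frontier[OF m(1,2) x 1, of v] by linarith
  next
    case 2
    then have "\<delta> x = 0" using delta_zero[OF K F _ x] by simp
    then show ?thesis by (simp add: facet_energy_def facet_pairing_def)
  next
    case 3
    have x\<Omega>: "x \<in> \<Omega>" using frontier_dom[OF xK KT] 3(1) by blast
    have sh: "shared K F" using shared_facet_patch[OF K F 3(2) x x\<Omega>] by (simp add: shared_def)
    have sh': "shared ?K F" using sh m(5) by simp
    have D': "element_D ?K F = - element_D K F"
      by (rule element_D_opposite[OF KT patch_element[OF m(1)] m(4)[OF sh, symmetric] F m(2) x x\<Omega>])
    let ?t = "trace_from K v x" and ?u = "trace_from ?K v x" and ?D = "element_D K F"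
    have S: "matrix_S x = S x" "x \<in> skeleton \<T> \<inter> \<Omega>"
      using facet_in_skeleton[OF KT F] x x\<Omega> by (auto simp: matrix_S_def)
    have f1: "num_flux K F v x = (1/2) *\<^sub>R (?D *v ?t + ?D *v ?u) + (S x *v ?t - S x *v ?u)"
      unfolding num_flux_eq[OF K F x] using 3(1) sh S(1)
      by (simp add: flux_own_def flux_other_def matrix_vector_mult_add_rdistrib matrix_vector_mult_diff_rdistrib
          scaleR_add_right flip: scaleR_matrix_vector_assoc)
    have neg: "(- A) *v y = - (A *v y)" for A :: "real^'l^'l" and y
      using matrix_vector_mult_diff_rdistrib[of 0 A y] by simp
    have f2: "num_flux ?K F v x = - (1/2) *\<^sub>R (?D *v ?t + ?D *v ?u) + (S x *v ?u - S x *v ?t)"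
      unfolding num_flux_eq[OF m(1,2) x] m(3) using 3(1) sh' S(1)
      by (simp add: flux_own_def flux_other_def D' matrix_vector_mult_add_rdistrib matrix_vector_mult_diff_rdistrib
          scaleR_add_right neg flip: scaleR_matrix_vector_assoc)
    have sym: "(?D *v ?u) \<bullet> ?t = (?D *v ?t) \<bullet> ?u" by (rule element_D_symmetric[OF KT])
    have P1: "facet_pairing K F v v x = \<delta> x * ((1/2) * ((?D *v ?t) \<bullet> ?t + (?D *v ?t) \<bullet> ?u) + ((S x *v ?t) \<bullet> ?t - (S x *v ?u) \<bullet> ?t))"
      unfolding facet_pairing_def f1 by (simp add: inner_add_left inner_diff_left sym)
    have P2: "facet_pairing ?K F v v x = \<delta> x * (- (1/2) * ((?D *v ?t) \<bullet> ?u + (?D *v ?u) \<bullet> ?u) + ((S x *v ?u) \<bullet> ?u - (S x *v ?t) \<bullet> ?u))"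
      unfolding facet_pairing_def f2 by (simp add: inner_add_left inner_diff_left)
    have DE: "(element_D ?K F *v ?u) \<bullet> ?u = - ((?D *v ?u) \<bullet> ?u)" unfolding D' by (simp add: neg)
    have SE: "(S x *v (?t - ?u)) \<bullet> (?t - ?u) = ((S x *v ?t) \<bullet> ?t - (S x *v ?t) \<bullet> ?u) - ((S x *v ?u) \<bullet> ?t - (S x *v ?u) \<bullet> ?u)"
      by (simp add: matrix_vector_mult_diff_distrib inner_diff_left inner_diff_right)
    \<comment> \<open>Scalar identity behind the cancellation: \<open>a\<close>, \<open>c\<close>,
      \<open>e\<close> stand for the products of \<open>?D\<close> with the two traces, and
      \<open>k\<close>, \<open>q\<close>, \<open>r\<close>, \<open>s\<close> for the four products
      of \<open>S x\<close>.\<close>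
    have "d * a + (- 2) * (d * ((1/2) * (a + c) + (k - q))) + (d * (- e) + (- 2) * (d * (- (1/2) * (c + e) + (r - s)))) =
      - 2 * (d * ((k - s) - (q - r)))" for d a c e k q r s :: real by (simp add: field_simps)
    then have "facet_energy v K F x + facet_energy v ?K F x = - 2 * (\<delta> x * ((S x *v (?t - ?u)) \<bullet> (?t - ?u)))"
      unfolding facet_energy_def P1 P2 DE SE by blast
    moreover have "0 \<le> \<delta> x" using delta_nonneg[OF K xK] by simp
    moreover have "0 \<le> (S x *v (?t - ?u)) \<bullet> (?t - ?u)"
      by (rule positive_semidef_symmetrized[OF S_semidef[OF S(2)]])
    ultimately show ?thesis
      using mult_nonneg_nonneg[of "\<delta> x" "(S x *v (?t - ?u)) \<bullet> (?t - ?u)"] by linarith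
  qed
qed

lemma finite_facets: "K \<in> \<K> \<Longrightarrow> finite {F. F facet_of K}"
  by (rule finite_polyhedron_facets[OF simplex_imp_polyhedron[OF element(1)[OF patch_element]]])

theorem energy_inequality:
  assumes v: "v \<in> dgV"
  shows "2 * form v v + l2_inner \<K> (\<lambda>x. M1 \<L> \<delta> x *v v x) v \<le> 0"
proof -
  let ?E = "\<lambda>K F. facet_integral F (facet_energy v K F)"
  let ?P = "Sigma \<K> (\<lambda>K. {F. F facet_of K})"
  have iE: "set_integrable (hyperplane_measure (affine hull F)) F (facet_energy v K F)" if "K \<in> \<K>" "F facet_of K" for K F
    unfolding facet_energy_def[abs_def]
    by (intro set_integral_add(1) facet_D_integrable[OF that v] set_integrable_mult_right facet_pairing_integrable[OF that v v])
  have E: "?E K F = facet_integral F (\<lambda>x. \<delta> x * ((element_D K F *v trace_from K v x) \<bullet> trace_from K v x)) - 2 * facet_integral F (facet_pairing K F v v)"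
    if "K \<in> \<K>" "F facet_of K" for K F
  proof -
    have "?E K F = facet_integral F (\<lambda>x. \<delta> x * ((element_D K F *v trace_from K v x) \<bullet> trace_from K v x)) + facet_integral F (\<lambda>x. (- 2) * facet_pairing K F v v x)"
      unfolding facet_energy_def[abs_def]
      by (rule facet_integral_add[OF facet_D_integrable[OF that v]]) (intro set_integrable_mult_right facet_pairing_integrable[OF that v v])
    then show ?thesis unfolding facet_integral_mult by simp
  qed
  have M: "l2_inner \<K> (\<lambda>x. M1 \<L> \<delta> x *v v x) v = (\<Sum>K\<in>\<K>. LINT x:interior K|lebesgue. (M1 \<L> \<delta> x *v v x) \<bullet> v x)"
    unfolding l2_inner_def
    by (rule open_elements_integral(2)[OF dg_inner_integrable[OF dg_matrix[OF v elementwise_M(1)] v]])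
  have "2 * form v v + l2_inner \<K> (\<lambda>x. M1 \<L> \<delta> x *v v x) v =
    (\<Sum>K\<in>\<K>. (2 * (\<Sum>j\<in>UNIV. LINT x:interior K|lebesgue. volume_pairing j v v x) +
      (LINT x:interior K|lebesgue. (M1 \<L> \<delta> x *v v x) \<bullet> v x)) - 2 * (\<Sum>F | F facet_of K. facet_integral F (facet_pairing K F v v)))"
    unfolding form_eq M by (simp add: sum_distrib_left sum.distrib sum_subtractf algebra_simps)
  also have "\<dots> = (\<Sum>K\<in>\<K>. \<Sum>F | F facet_of K. ?E K F)"
  proof (rule sum.cong[OF refl])
    fix K assume K: "K \<in> \<K>"
    show "(2 * (\<Sum>j\<in>UNIV. LINT x:interior K|lebesgue. volume_pairing j v v x) +
      (LINT x:interior K|lebesgue. (M1 \<L> \<delta> x *v v x) \<bullet> v x)) - 2 * (\<Sum>F | F facet_of K. facet_integral F (facet_pairing K F v v)) =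
      (\<Sum>F | F facet_of K. ?E K F)"
      unfolding element_energy[OF K v] unfolding sum_distrib_left sum_subtractf[symmetric]
      by (rule sum.cong) (simp_all add: E[OF K])
  qed
  also have "\<dots> = (\<Sum>(K, F)\<in>?P. ?E K F)"
    using finite_patch finite_facets by (intro sum.Sigma) auto
  finally have eq: "2 * form v v + l2_inner \<K> (\<lambda>x. M1 \<L> \<delta> x *v v x) v = (\<Sum>(K, F)\<in>?P. ?E K F)" .
  \<comment> \<open>Reindexing by the involution \<open>mate\<close> makes twice the sum a sum over
    pairs. An unmated facet is then paired with itself, which doubles it consistently.\<close>
  have "(\<Sum>(K, F)\<in>?P. ?E K F) = (\<Sum>(K, F)\<in>?P. ?E (mate K F) F)"
    by (rule sum.reindex_bij_witness[where i="\<lambda>(K, F). (mate K F, F)" and j="\<lambda>(K, F). (mate K F, F)"])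
      (auto simp: mate)
  then have "2 * (\<Sum>(K, F)\<in>?P. ?E K F) = (\<Sum>(K, F)\<in>?P. ?E K F + ?E (mate K F) F)"
    by (simp add: sum.distrib case_prod_unfold)
  also have "\<dots> \<le> 0"
  proof (rule sum_nonpos, clarify)
    fix K F assume K: "K \<in> \<K>" and F: "F facet_of K"
    note m = mate[OF K F]
    have "?E K F + ?E (mate K F) F = facet_integral F (\<lambda>x. facet_energy v K F x + facet_energy v (mate K F) F x)"
      by (rule facet_integral_add[symmetric, OF iE[OF K F] iE[OF m(1,2)]])
    moreover have "0 \<le> facet_integral F (\<lambda>x. (- 1) * (facet_energy v K F x + facet_energy v (mate K F) F x))"
      unfolding facet_integral_def set_lebesgue_integral_def
    proof (rule Bochner_Integration.integral_nonneg)
      show "0 \<le> indicator F x *\<^sub>R ((- 1) * (facet_energy v K F x + facet_energy v (mate K F) F x))" for x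
        using facet_energy_pair[OF K F, of x v] by (cases "x \<in> F") simp_all
    qed
    ultimately show "?E K F + ?E (mate K F) F \<le> 0" unfolding facet_integral_mult by simp
  qed
  finally show ?thesis using eq by simp
qed

end

section \<open>The semidiscrete evolution\<close>

lemma posdef_inverse_bound:
  fixes M :: "real^'l::finite^'l"
  assumes \<kappa>: "\<kappa> > 0" "\<And>e. \<kappa> * (norm e)\<^sup>2 \<le> (M *v e) \<bullet> e"
  shows "M *v (matrix_inv M *v y) = y" and "matrix_inv M *v (M *v y) = y"
    and "norm (matrix_inv M *v y) \<le> norm y / \<kappa>"
proof -
  have "e = 0" if "M *v e = 0" for e
  proof -
    have "\<kappa> * (norm e)\<^sup>2 \<le> 0" using \<kappa>(2)[of e] that by simp
    then show ?thesis using \<kappa>(1) by (simp add: mult_le_0_iff)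
  qed
  then have "\<exists>N. N ** M = mat 1" unfolding matrix_left_invertible_ker by blast
  then have inv: "invertible M" by (simp add: invertible_left_inverse)
  then have 1: "M ** matrix_inv M = mat 1" "matrix_inv M ** M = mat 1"
    unfolding invertible_def matrix_inv_def by (metis (mono_tags, lifting) someI_ex)+
  show 2: "M *v (matrix_inv M *v y) = y" for y by (simp add: matrix_vector_mul_assoc 1)
  show "matrix_inv M *v (M *v y) = y" by (simp add: matrix_vector_mul_assoc 1)
  let ?e = "matrix_inv M *v y"
  have "\<kappa> * (norm ?e)\<^sup>2 \<le> y \<bullet> ?e" using \<kappa>(2)[of ?e] by (simp add: 2)
  also have "\<dots> \<le> norm y * norm ?e" by (rule norm_cauchy_schwarz)
  finally have "\<kappa> * norm ?e * norm ?e \<le> norm y * norm ?e" by (simp add: power2_eq_square)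
  then have "\<kappa> * norm ?e \<le> norm y" by (cases "norm ?e = 0") (auto simp: mult_le_cancel_right)
  then show "norm ?e \<le> norm y / \<kappa>" using \<kappa>(1) by (simp add: field_simps)
qed

text \<open>Resolvent identity: \<open>N s - N t\<close> equals \<open>s - t\<close> times the
  product of \<open>N s\<close>, \<open>C\<close> and \<open>N t\<close>. The bound
  \<open>1 / \<kappa>\<close> is uniform in time, so this gives continuity first and then, after
  division by \<open>s - t\<close>, the derivative.\<close>

lemma posdef_inverse_curve:
  fixes A C :: "real^'l::finite^'l"
  assumes \<kappa>: "\<kappa> > 0" "\<And>t e. t \<in> {0..1} \<Longrightarrow> \<kappa> * (norm e)\<^sup>2 \<le> ((A - t *\<^sub>R C) *v e) \<bullet> e"
  defines "N \<equiv> \<lambda>t. matrix_inv (A - t *\<^sub>R C)"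
  shows "continuous_on {0..1} N"
    and "t \<in> {0..1} \<Longrightarrow> ((\<lambda>s. N s *v y) has_vector_derivative N t *v (C *v (N t *v y))) (at t within {0..1})"
proof -
  note inv = posdef_inverse_bound[OF \<kappa>(1) \<kappa>(2)]
  have diff: "N s *v y - N t *v y = (s - t) *\<^sub>R (N s *v (C *v (N t *v y)))" if st: "s \<in> {0..1}" "t \<in> {0..1}" for s t y
  proof -
    have y: "(A - t *\<^sub>R C) *v (N t *v y) = y" unfolding N_def by (rule inv(1)[OF st(2)])
    have "N s *v ((A - s *\<^sub>R C) *v (N t *v y)) = N t *v y" unfolding N_def by (rule inv(2)[OF st(1)])
    moreover have "(A - t *\<^sub>R C) *v e - (A - s *\<^sub>R C) *v e = (s - t) *\<^sub>R (C *v e)" for e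
      by (simp add: matrix_vector_mult_diff_rdistrib scaleR_left_diff_distrib flip: scaleR_matrix_vector_assoc)
    ultimately have "N s *v y - N t *v y = N s *v ((s - t) *\<^sub>R (C *v (N t *v y)))"
      using y by (metis matrix_vector_mult_diff_distrib)
    then show ?thesis by (simp add: matrix_vector_mult_scaleR)
  qed
  have lim: "((\<lambda>s. N s *v y) \<longlongrightarrow> N t *v y) (at t within {0..1})" if t: "t \<in> {0..1}" for t y
  proof -
    let ?b = "norm (C *v (N t *v y)) / \<kappa>"
    have "((\<lambda>s. \<bar>s - t\<bar> * ?b) \<longlongrightarrow> \<bar>t - t\<bar> * ?b) (at t within {0..1})" by (intro tendsto_intros)
    then have 0: "((\<lambda>s. \<bar>s - t\<bar> * ?b) \<longlongrightarrow> 0) (at t within {0..1})" by simp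
    have "\<forall>\<^sub>F s in at t within {0..1}. norm (N s *v y - N t *v y) \<le> \<bar>s - t\<bar> * ?b"
      unfolding eventually_at_filter
    proof (rule eventuallyI, intro impI)
      fix s :: real assume s: "s \<in> {0..1}"
      have "norm (N s *v (C *v (N t *v y))) \<le> ?b" unfolding N_def by (rule inv(3)[OF s])
      then show "norm (N s *v y - N t *v y) \<le> \<bar>s - t\<bar> * ?b"
        unfolding diff[OF s t] norm_scaleR real_norm_def by (intro mult_left_mono) auto
    qed
    then have "((\<lambda>s. N s *v y - N t *v y) \<longlongrightarrow> 0) (at t within {0..1})" by (rule Lim_null_comparison[OF _ 0])
    then show ?thesis by (simp add: LIM_zero_iff)
  qed
  have entry: "N s $ i $ k = (N s *v axis k 1) $ i" for s :: real and i k
    by (simp add: matrix_vector_mult_basis column_def)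
  show "continuous_on {0..1} N"
  proof -
    have c: "continuous_on {0..1} (\<lambda>s. N s *v axis k 1)" for k unfolding continuous_on_def using lim by blast
    have "continuous_on {0..1} (\<lambda>s. \<chi> i k. (N s *v axis k 1) $ i)"
      by (intro continuous_on_vec_lambda continuous_on_component c)
    moreover have "(\<lambda>s. \<chi> i k. (N s *v axis k 1) $ i) = N" by (simp add: fun_eq_iff vec_eq_iff entry)
    ultimately show ?thesis by (simp only:)
  qed
  show "((\<lambda>s. N s *v y) has_vector_derivative N t *v (C *v (N t *v y))) (at t within {0..1})" if t: "t \<in> {0..1}"
  proof -
    let ?D = "N t *v (C *v (N t *v y))"
    have "((\<lambda>s. norm (N s *v (C *v (N t *v y)) - ?D)) \<longlongrightarrow> 0) (at t within {0..1})"
      using lim[OF t] by (simp add: tendsto_norm_zero LIM_zero)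
    moreover have "\<forall>\<^sub>F s in at t within {0..1}. norm (N s *v (C *v (N t *v y)) - ?D) =
        norm (N s *v y - (N t *v y + (s - t) *\<^sub>R ?D)) / norm (s - t)"
      unfolding eventually_at_filter
    proof (rule eventuallyI, intro impI)
      fix s :: real assume s: "s \<noteq> t" "s \<in> {0..1}"
      have "N s *v y - (N t *v y + (s - t) *\<^sub>R ?D) = (s - t) *\<^sub>R (N s *v (C *v (N t *v y)) - ?D)"
        using diff[OF s(2) t, of y] by (simp add: scaleR_diff_right algebra_simps)
      then show "norm (N s *v (C *v (N t *v y)) - ?D) = norm (N s *v y - (N t *v y + (s - t) *\<^sub>R ?D)) / norm (s - t)"
        using s(1) by simp
    qed
    ultimately have "((\<lambda>s. norm (N s *v y - (N t *v y + (s - t) *\<^sub>R ?D)) / norm (s - t)) \<longlongrightarrow> 0) (at t within {0..1})"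
      by (rule Lim_transform_eventually)
    then show ?thesis
      unfolding has_vector_derivative_def has_derivative_iff_norm by (simp add: bounded_linear_scaleR_left diff_diff_eq)
  qed
qed

context tent
begin

abbreviation "Mt \<equiv> M_op \<G> \<L> \<phi>b \<phi>t"

lemma dg_basis:
  obtains d b where "dgs.orthonormal d b" "\<And>v. v \<in> dgV \<Longrightarrow> v = (\<lambda>x. \<Sum>i<d. l2_inner \<K> v (b i) *\<^sub>R b i x)"
proof -
  obtain I :: "((real^'n) set \<times> ('n \<Rightarrow> nat) \<times> 'l) set" and h where
    "finite I" "\<forall>i\<in>I. h i \<in> dgV" "\<forall>v\<in>dgV. \<exists>c. v = (\<lambda>x. \<Sum>i\<in>I. c i *\<^sub>R h i x)"
    using dg_spanning by blast
  then have "\<exists>d b. dgs.orthonormal d b \<and> (\<forall>v\<in>dgV. v = (\<lambda>x. \<Sum>i<d. l2_inner \<K> v (b i) *\<^sub>R b i x))"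
    by (intro dgs.orthonormal_basis_exists[of I h]) auto
  then show thesis using that by blast
qed

lemma functional_matrix:
  assumes A: "elementwise_constant \<K> A" and w: "w \<in> dgV"
  shows "dgs.functional (\<lambda>u. l2_inner \<K> (\<lambda>x. A x *v u x) w)"
  unfolding dgs.functional_def
proof (intro conjI ballI allI)
  fix u v :: "real^'n \<Rightarrow> real^'l" assume "u \<in> dgV" "v \<in> dgV"
  then show "l2_inner \<K> (\<lambda>x. A x *v (u x + v x)) w = l2_inner \<K> (\<lambda>x. A x *v u x) w + l2_inner \<K> (\<lambda>x. A x *v v x) w"
    unfolding matrix_vector_right_distrib by (intro dgs.ip_add dg_matrix A w)
next
  fix c :: real and u :: "real^'n \<Rightarrow> real^'l" assume "u \<in> dgV"
  then show "l2_inner \<K> (\<lambda>x. A x *v (c *\<^sub>R u x)) w = c * l2_inner \<K> (\<lambda>x. A x *v u x) w"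
    unfolding matrix_vector_mult_scaleR by (intro dgs.ip_scale dg_matrix A w)
qed

lemma l2_inner_matrix_sym:
  assumes "\<And>x. x \<in> open_elements \<K> \<Longrightarrow> transpose (A x) = A x"
  shows "l2_inner \<K> (\<lambda>x. A x *v u x) w = l2_inner \<K> (\<lambda>x. A x *v w x) u"
proof -
  have "(A x *v u x) \<bullet> w x = (A x *v w x) \<bullet> u x" if "x \<in> open_elements \<K>" for x
    using symmetric_matrix_inner[OF assms[OF that], of "u x" "w x"] by (simp only: inner_commute)
  then show ?thesis
    unfolding l2_inner_def set_lebesgue_integral_def
    by (intro Bochner_Integration.integral_cong) (auto simp: indicator_def)
qed

lemma open_elements_sub: "open_elements \<K> \<subseteq> open_elements \<T>"
  using sub by (auto simp: open_elements_def)

lemma transpose_M: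
  assumes "x \<in> open_elements \<K>"
  shows "transpose (M0 \<G> \<L> \<phi>b x) = M0 \<G> \<L> \<phi>b x" "transpose (M1 \<L> \<delta> x) = M1 \<L> \<delta> x" "transpose (Mt t x) = Mt t x"
proof -
  have x: "x \<in> open_elements \<T>" using assms open_elements_sub by blast
  have L: "\<L> k x $ i $ j = \<L> k x $ j $ i" for k i j 
    using arg_cong[OF L_symmetric[OF x, of k], of "\<lambda>A. A $ j $ i"] by (simp add: transpose_def)
  have G: "\<G> x $ i $ j = \<G> x $ j $ i" for i j 
    using arg_cong[OF G_symmetric[OF x], of "\<lambda>A. A $ j $ i"] by (simp add: transpose_def)
  have "M0 \<G> \<L> \<phi>b x $ i $ j = M0 \<G> \<L> \<phi>b x $ j $ i" for i j
    by (simp add: M0_def G[of i j] L[of _ i j])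
  then show 1: "transpose (M0 \<G> \<L> \<phi>b x) = M0 \<G> \<L> \<phi>b x" by (simp add: transpose_def vec_eq_iff)
  have "M1 \<L> \<delta> x $ i $ j = M1 \<L> \<delta> x $ j $ i" for i j
    by (simp add: M1_def L[of _ i j])
  then show 2: "transpose (M1 \<L> \<delta> x) = M1 \<L> \<delta> x" by (simp add: transpose_def vec_eq_iff)
  show "transpose (Mt t x) = Mt t x"
    using 1 2 by (simp add: M_op_def transpose_def vec_eq_iff)
qed

lemma elementwise_M0: "elementwise_constant \<K> (M0 \<G> \<L> \<phi>b)"
proof -
  have "M0 \<G> \<L> \<phi>b = Mt 0" by (auto simp: M_op_def)
  then show ?thesis using elementwise_M(2)[of 0] by simp
qed

text \<open>\<open>C1_curve\<close> provides derivatives only pointwise in space. Point evaluations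
  of components separate the basis, so \<open>coefficients_differentiable\<close>, applied on pairs
  of point and component, transfers differentiability to the coordinates.\<close>

lemma curve_coordinates:
  assumes b: "dgs.orthonormal d b" "\<And>v. v \<in> dgV \<Longrightarrow> v = (\<lambda>x. \<Sum>i<d. l2_inner \<K> v (b i) *\<^sub>R b i x)"
    and v: "\<And>t. t \<in> {0..1} \<Longrightarrow> v t \<in> dgV"
    and dv: "\<And>x. ((\<lambda>s. v s x) has_vector_derivative v' x) (at t within {0..1})" and t: "t \<in> {0..1}"
  shows "\<forall>i<d. \<exists>D. ((\<lambda>s. l2_inner \<K> (v s) (b i)) has_real_derivative D) (at t within {0..1})"
proof (rule coefficients_differentiable[where b="\<lambda>i y. b i (fst y) $ snd y"])
  fix a :: "nat \<Rightarrow> real"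
  assume a: "\<And>y :: (real^'n) \<times> 'l. (\<Sum>i<d. a i * b i (fst y) $ snd y) = 0"
  have "(\<lambda>x. \<Sum>i<d. a i *\<^sub>R b i x) = (\<lambda>x. 0)"
  proof
    fix x show "(\<Sum>i<d. a i *\<^sub>R b i x) = 0" using a[of "(x, _)"] by (simp add: vec_eq_iff)
  qed
  then have "l2_inner \<K> (\<lambda>x. \<Sum>i<d. a i *\<^sub>R b i x) (b i) = 0" for i by (simp add: l2_inner_def)
  then have "a i = 0" if "i < d" for i using dgs.orthonormal_coeff[OF b(1) that, of a] by simp
  then show "\<forall>i<d. a i = 0" by blast
next
  fix y :: "(real^'n) \<times> 'l"
  have "((\<lambda>s. v s (fst y) $ snd y) has_real_derivative v' (fst y) $ snd y) (at t within {0..1})"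
    using bounded_linear.has_vector_derivative[OF bounded_linear_vec_nth dv[of "fst y"], of "snd y"]
    by (simp add: has_real_derivative_iff_has_vector_derivative)
  moreover have "v s (fst y) $ snd y = (\<Sum>i<d. l2_inner \<K> (v s) (b i) * b i (fst y) $ snd y)" if "s \<in> {0..1}" for s
    using arg_cong[OF fun_cong[OF b(2)[OF v[OF that]], of "fst y"], of "\<lambda>e. e $ snd y"] by simp
  ultimately have "((\<lambda>s. \<Sum>i<d. l2_inner \<K> (v s) (b i) * b i (fst y) $ snd y) has_real_derivative v' (fst y) $ snd y) (at t within {0..1})"
    by (rule has_field_derivative_transform_within[OF _ zero_less_one t]) 
  then show "\<exists>D. ((\<lambda>s. \<Sum>i<d. l2_inner \<K> (v s) (b i) * b i (fst y) $ snd y) has_real_derivative D) (at t within {0..1})"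
    by blast
qed

end

section \<open>Energy along a semidiscrete solution\<close>

context tent
begin

abbreviation "solution \<equiv> semidiscrete_solution \<Omega> \<K> p \<G> \<L> S B \<phi>b \<phi>t"

lemma matrix_expand:
  assumes A: "elementwise_constant \<K> A" and b: "\<And>i. i < d \<Longrightarrow> b i \<in> dgV"
  shows "l2_inner \<K> (\<lambda>x. A x *v (\<Sum>i<d. c i *\<^sub>R b i x)) (\<lambda>x. \<Sum>j<d. e j *\<^sub>R b j x) =
    (\<Sum>i<d. \<Sum>j<d. c i * e j * l2_inner \<K> (\<lambda>x. A x *v b i x) (b j))"
proof -
  have w: "(\<lambda>x. \<Sum>j<d. e j *\<^sub>R b j x) \<in> dgV" by (rule dgs.sum_mem) (use b in auto)
  have "l2_inner \<K> (\<lambda>x. A x *v (\<Sum>i<d. c i *\<^sub>R b i x)) (\<lambda>x. \<Sum>j<d. e j *\<^sub>R b j x) =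
    (\<Sum>i<d. c i * l2_inner \<K> (\<lambda>x. A x *v b i x) (\<lambda>x. \<Sum>j<d. e j *\<^sub>R b j x))"
    by (rule dgs.functional_sum[OF functional_matrix[OF A w]]) (use b in auto)
  also have "\<dots> = (\<Sum>i<d. c i * (\<Sum>j<d. e j * l2_inner \<K> (\<lambda>x. A x *v b i x) (b j)))"
  proof (rule sum.cong[OF refl])
    fix i assume "i \<in> {..<d}"
    then have Ab: "(\<lambda>x. A x *v b i x) \<in> dgV" using dg_matrix[OF b A] by simp
    have "l2_inner \<K> (\<lambda>x. A x *v b i x) (\<lambda>x. \<Sum>j<d. e j *\<^sub>R b j x) =
      (\<Sum>j<d. e j * l2_inner \<K> (b j) (\<lambda>x. A x *v b i x))"
      unfolding l2_inner_commute[of "\<lambda>x. A x *v b i x"] by (rule dgs.ip_sum[OF _ Ab]) (use b in auto)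
    then show "c i * l2_inner \<K> (\<lambda>x. A x *v b i x) (\<lambda>x. \<Sum>j<d. e j *\<^sub>R b j x) =
      c i * (\<Sum>j<d. e j * l2_inner \<K> (\<lambda>x. A x *v b i x) (b j))"
      by (simp only: l2_inner_commute[of "b _"])
  qed
  also have "\<dots> = (\<Sum>i<d. \<Sum>j<d. c i * e j * l2_inner \<K> (\<lambda>x. A x *v b i x) (b j))"
    by (simp only: sum_distrib_left mult.assoc)
  finally show ?thesis .
qed

text \<open>In basis coordinates the energy is a finite sum with the constant matrices
  \<open>m0\<close> and \<open>m1\<close>; only scalar coefficient functions are
  differentiated.\<close>

theorem energy_decay:
  assumes sol: "solution v0 v" 
  shows "v 1 \<in> dgV" and "l2_inner \<K> (\<lambda>x. Mt 1 x *v v 1 x) (v 1) \<le> l2_inner \<K> (\<lambda>x. Mt 0 x *v v0 x) v0"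
proof -
  obtain v' where v: "\<And>t. t \<in> {0..1} \<Longrightarrow> v t \<in> dgV"
    and dv: "\<And>x t. t \<in> {0..1} \<Longrightarrow> ((\<lambda>s. v s x) has_vector_derivative v' t x) (at t within {0..1})"
    using sol unfolding semidiscrete_solution_def C1_curve_def by blast
  have v00: "v 0 = v0" using sol by (simp add: semidiscrete_solution_def)
  have eqn: "l2_inner \<K> (\<lambda>x. vector_derivative (\<lambda>s. Mt s x *v v s x) (at t within {0..1})) w = form (v t) w"
    if "t \<in> {0<..1}" "w \<in> dgV" for t w
    using sol that unfolding semidiscrete_solution_def by blast
  show "v 1 \<in> dgV" using v by simp
  obtain d b where b: "dgs.orthonormal d b" "\<And>v. v \<in> dgV \<Longrightarrow> v = (\<lambda>x. \<Sum>i<d. l2_inner \<K> v (b i) *\<^sub>R b i x)"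
    by (rule dg_basis) blast
  have bV: "b i \<in> dgV" if "i < d" for i using b(1) that by (simp add: dgs.orthonormal_def)
  define c where "c i t = l2_inner \<K> (v t) (b i)" for i t
  have vc: "v t = (\<lambda>x. \<Sum>i<d. c i t *\<^sub>R b i x)" if "t \<in> {0..1}" for t
    unfolding c_def by (rule b(2)[OF v[OF that]])
  have ex: "\<forall>t\<in>{0..1}. \<forall>i<d. \<exists>D. ((\<lambda>s. c i s) has_real_derivative D) (at t within {0..1})"
  proof
    fix t :: real assume t: "t \<in> {0..1}"
    show "\<forall>i<d. \<exists>D. ((\<lambda>s. c i s) has_real_derivative D) (at t within {0..1})"
      unfolding c_def by (rule curve_coordinates[OF b v dv[OF t] t])
  qed
  define c' where "c' i t = (SOME D. (c i has_real_derivative D) (at t within {0..1}))" for i t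
  have c': "(c i has_real_derivative c' i t) (at t within {0..1})" if "t \<in> {0..1}" "i < d" for i t
    unfolding c'_def by (rule someI_ex) (use ex that in blast)
  define m0 where "m0 i j = l2_inner \<K> (\<lambda>x. M0 \<G> \<L> \<phi>b x *v b i x) (b j)" for i j
  define m1 where "m1 i j = l2_inner \<K> (\<lambda>x. M1 \<L> \<delta> x *v b i x) (b j)" for i j
  have sym: "m0 i j = m0 j i" "m1 i j = m1 j i" for i j
    unfolding m0_def m1_def by (rule l2_inner_matrix_sym, simp add: transpose_M)+
  have Mv: "Mt t x *v e = M0 \<G> \<L> \<phi>b x *v e - t *\<^sub>R (M1 \<L> \<delta> x *v e)" for t x e
    by (simp add: M_op_def matrix_vector_mult_diff_rdistrib flip: scaleR_matrix_vector_assoc)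
  have mt: "l2_inner \<K> (\<lambda>x. Mt t x *v b i x) (b j) = m0 i j - t * m1 i j" if "i < d" "j < d" for i j t
  proof -
    have 1: "(\<lambda>x. M0 \<G> \<L> \<phi>b x *v b i x) \<in> dgV" by (rule dg_matrix[OF bV[OF that(1)] elementwise_M0])
    have 2: "(\<lambda>x. M1 \<L> \<delta> x *v b i x) \<in> dgV" by (rule dg_matrix[OF bV[OF that(1)] elementwise_M(1)])
    have "l2_inner \<K> (\<lambda>x. M0 \<G> \<L> \<phi>b x *v b i x + (- t) *\<^sub>R (M1 \<L> \<delta> x *v b i x)) (b j) =
      l2_inner \<K> (\<lambda>x. M0 \<G> \<L> \<phi>b x *v b i x) (b j) + l2_inner \<K> (\<lambda>x. (- t) *\<^sub>R (M1 \<L> \<delta> x *v b i x)) (b j)"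
      by (rule dgs.ip_add[OF 1 dgs.scale_mem[OF 2] bV[OF that(2)]])
    also have "l2_inner \<K> (\<lambda>x. (- t) *\<^sub>R (M1 \<L> \<delta> x *v b i x)) (b j) = (- t) * m1 i j"
      unfolding m1_def by (rule l2_inner_scale)
    finally show ?thesis unfolding Mv by (simp add: m0_def)
  qed
  define E where "E t = (\<Sum>i<d. \<Sum>j<d. c i t * c j t * (m0 i j - t * m1 i j))" for t
  have E: "E t = l2_inner \<K> (\<lambda>x. Mt t x *v v t x) (v t)" if t: "t \<in> {0..1}" for t
  proof -
    have "l2_inner \<K> (\<lambda>x. Mt t x *v v t x) (v t) =
      (\<Sum>i<d. \<Sum>j<d. c i t * c j t * l2_inner \<K> (\<lambda>x. Mt t x *v b i x) (b j))"
      unfolding vc[OF t] by (rule matrix_expand[OF elementwise_M(2) bV])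
    also have "\<dots> = E t" unfolding E_def by (intro sum.cong refl) (simp add: mt)
    finally show ?thesis by simp
  qed
  define E' where "E' t = (\<Sum>i<d. \<Sum>j<d. (c' i t * c j t + c i t * c' j t) * (m0 i j - t * m1 i j) - c i t * c j t * m1 i j)" for t
  have dE: "(E has_real_derivative E' t) (at t within {0..1})" if t: "t \<in> {0..1}" for t
    unfolding E_def[abs_def] E'_def
    by (intro DERIV_sum) (auto intro!: derivative_eq_intros c'[OF t] simp: algebra_simps)
  have E'le: "E' t \<le> 0" if t: "t \<in> {0<..1}" for t
  proof -
    have t': "t \<in> {0..1}" using t by auto
    let ?a = "\<Sum>i<d. \<Sum>j<d. c' i t * c j t * (m0 i j - t * m1 i j)"
    let ?m = "\<Sum>i<d. \<Sum>j<d. c i t * c j t * m1 i j"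
    \<comment> \<open>Symmetry of \<open>m0\<close> and \<open>m1\<close> identifies the two halves
      of the product rule, which gives the factor 2 needed to match twice the form.\<close>
    have "(\<Sum>i<d. \<Sum>j<d. c i t * c' j t * (m0 i j - t * m1 i j)) = (\<Sum>j<d. \<Sum>i<d. c i t * c' j t * (m0 i j - t * m1 i j))"
      by (rule sum.swap)
    also have "\<dots> = ?a" using sym by (intro sum.cong refl) (simp add: mult.commute)
    finally have E'eq: "E' t = 2 * ?a - ?m"
      unfolding E'_def distrib_right sum_subtractf sum.distrib by simp
    have l1: "l2_inner \<K> (\<lambda>x. M1 \<L> \<delta> x *v v t x) (v t) = ?m"
      unfolding vc[OF t'] m1_def by (rule matrix_expand[OF elementwise_M(1) bV])
    have vd: "vector_derivative (\<lambda>s. Mt s x *v v s x) (at t within {0..1}) =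
      Mt t x *v (\<Sum>i<d. c' i t *\<^sub>R b i x) + (- 1) *\<^sub>R (M1 \<L> \<delta> x *v v t x)" for x
    proof (rule vector_derivative_within_closed_interval[OF zero_less_one t'])
      have 1: "((\<lambda>s. \<Sum>i<d. c i s *\<^sub>R b i x) has_vector_derivative (\<Sum>i<d. c' i t *\<^sub>R b i x)) (at t within {0..1})"
        by (rule has_vector_derivative_sum) (auto intro!: derivative_eq_intros c'[OF t'])
      have 2: "((\<lambda>s. A *v (\<Sum>i<d. c i s *\<^sub>R b i x)) has_vector_derivative A *v (\<Sum>i<d. c' i t *\<^sub>R b i x)) (at t within {0..1})" for A :: "real^'l^'l"
        by (rule bounded_linear.has_vector_derivative[OF matrix_vector_mul_bounded_linear 1])
      have "((\<lambda>s. M0 \<G> \<L> \<phi>b x *v (\<Sum>i<d. c i s *\<^sub>R b i x) - s *\<^sub>R (M1 \<L> \<delta> x *v (\<Sum>i<d. c i s *\<^sub>R b i x)))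
         has_vector_derivative M0 \<G> \<L> \<phi>b x *v (\<Sum>i<d. c' i t *\<^sub>R b i x) -
           (t *\<^sub>R (M1 \<L> \<delta> x *v (\<Sum>i<d. c' i t *\<^sub>R b i x)) + 1 *\<^sub>R (M1 \<L> \<delta> x *v (\<Sum>i<d. c i t *\<^sub>R b i x)))) (at t within {0..1})"
        by (intro has_vector_derivative_diff has_vector_derivative_scaleR 2 DERIV_ident)
      then have 3: "((\<lambda>s. Mt s x *v (\<Sum>i<d. c i s *\<^sub>R b i x)) has_vector_derivative
          Mt t x *v (\<Sum>i<d. c' i t *\<^sub>R b i x) + (- 1) *\<^sub>R (M1 \<L> \<delta> x *v v t x)) (at t within {0..1})"
        unfolding Mv vc[OF t'] by (simp add: algebra_simps)
      show "((\<lambda>s. Mt s x *v v s x) has_vector_derivative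
          Mt t x *v (\<Sum>i<d. c' i t *\<^sub>R b i x) + (- 1) *\<^sub>R (M1 \<L> \<delta> x *v v t x)) (at t within {0..1})"
        by (rule has_vector_derivative_transform[OF t' _ 3]) (simp add: vc)
    qed
    have w: "(\<lambda>x. \<Sum>i<d. c' i t *\<^sub>R b i x) \<in> dgV" by (rule dgs.sum_mem) (use bV in auto)
    have 1: "(\<lambda>x. Mt t x *v (\<Sum>i<d. c' i t *\<^sub>R b i x)) \<in> dgV" by (rule dg_matrix[OF w elementwise_M(2)])
    have 2: "(\<lambda>x. M1 \<L> \<delta> x *v v t x) \<in> dgV" by (rule dg_matrix[OF v[OF t'] elementwise_M(1)])
    have "form (v t) (v t) = l2_inner \<K> (\<lambda>x. Mt t x *v (\<Sum>i<d. c' i t *\<^sub>R b i x) + (- 1) *\<^sub>R (M1 \<L> \<delta> x *v v t x)) (v t)"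
      using eqn[OF t v[OF t']] unfolding vd by simp
    also have "\<dots> = l2_inner \<K> (\<lambda>x. Mt t x *v (\<Sum>i<d. c' i t *\<^sub>R b i x)) (v t) + l2_inner \<K> (\<lambda>x. (- 1) *\<^sub>R (M1 \<L> \<delta> x *v v t x)) (v t)"
      by (rule dgs.ip_add[OF 1 dgs.scale_mem[OF 2] v[OF t']])
    also have "l2_inner \<K> (\<lambda>x. (- 1) *\<^sub>R (M1 \<L> \<delta> x *v v t x)) (v t) = (- 1) * l2_inner \<K> (\<lambda>x. M1 \<L> \<delta> x *v v t x) (v t)"
      by (rule l2_inner_scale)
    also have "l2_inner \<K> (\<lambda>x. Mt t x *v (\<Sum>i<d. c' i t *\<^sub>R b i x)) (v t) =
      (\<Sum>i<d. \<Sum>j<d. c' i t * c j t * l2_inner \<K> (\<lambda>x. Mt t x *v b i x) (b j))"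
      unfolding vc[OF t'] by (rule matrix_expand[OF elementwise_M(2) bV])
    also have "\<dots> = ?a" by (intro sum.cong refl) (simp add: mt)
    finally have "?a = form (v t) (v t) + ?m" unfolding l1 by simp
    then show ?thesis using energy_inequality[OF v[OF t']] unfolding E'eq l1 by simp
  qed
  have "E 1 \<le> E 0"
  \<comment> \<open>The differential equation is imposed for positive times only; at the initial
    time continuity of the energy is enough.\<close>
  proof (rule DERIV_nonpos_imp_decreasing_open[of 0 1 E])
    show "(0::real) \<le> 1" by simp
    show "continuous_on {0..1} E"
      unfolding continuous_on_eq_continuous_within using dE DERIV_continuous by blast
    fix t :: real assume t: "0 < t" "t < 1"
    then have "at t within {0..1} = at t" by (intro at_within_interior) auto
    then have "(E has_real_derivative E' t) (at t)" using dE[of t] t by auto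
    then show "\<exists>y. (E has_real_derivative y) (at t) \<and> y \<le> 0" using E'le[of t] t by auto
  qed
  then show "l2_inner \<K> (\<lambda>x. Mt 1 x *v v 1 x) (v 1) \<le> l2_inner \<K> (\<lambda>x. Mt 0 x *v v0 x) v0"
    using E[of 0] E[of 1] v00 by simp
qed

end

section \<open>Existence of a semidiscrete solution\<close>

context tent
begin

definition "Nt t x = matrix_inv (Mt t x)"

lemma M_affine: "Mt t x = M0 \<G> \<L> \<phi>b x - t *\<^sub>R M1 \<L> \<delta> x"
  by (simp add: M_op_def)

lemma Nt_inverse:
  assumes "x \<in> open_elements \<K>" "t \<in> {0..1}"
  shows "Mt t x *v (Nt t x *v y) = y" and "Nt t x *v (Mt t x *v y) = y"
  unfolding Nt_def using posdef_inverse_bound[OF M_pos(1) M_pos(2)[OF assms]] by blast+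

lemma Nt_curve:
  assumes x: "x \<in> open_elements \<K>"
  shows "continuous_on {0..1} (\<lambda>t. Nt t x)"
    and "t \<in> {0..1} \<Longrightarrow> ((\<lambda>s. Nt s x *v y) has_vector_derivative Nt t x *v (M1 \<L> \<delta> x *v (Nt t x *v y))) (at t within {0..1})"
proof -
  have pos: "\<kappa> * (norm e)\<^sup>2 \<le> ((M0 \<G> \<L> \<phi>b x - t *\<^sub>R M1 \<L> \<delta> x) *v e) \<bullet> e" if "t \<in> {0..1}" for t e
    using M_pos(2)[OF x that] unfolding M_affine .
  note curve = posdef_inverse_curve[OF M_pos(1) pos]
  show "continuous_on {0..1} (\<lambda>t. Nt t x)" unfolding Nt_def M_affine by (rule curve(1))
  show "((\<lambda>s. Nt s x *v y) has_vector_derivative Nt t x *v (M1 \<L> \<delta> x *v (Nt t x *v y))) (at t within {0..1})"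
    if "t \<in> {0..1}" unfolding Nt_def M_affine by (rule curve(2)[OF _ that])
qed

lemma elementwise_N: "elementwise_constant \<K> (Nt t)"
  unfolding elementwise_constant_def
proof
  fix K assume "K \<in> \<K>"
  then obtain A where A: "\<forall>x\<in>interior K. Mt t x = A" using elementwise_M(2)[of t] unfolding elementwise_constant_def by blast
  then show "\<exists>a. \<forall>x\<in>interior K. Nt t x = a" by (intro exI[of _ "matrix_inv A"]) (simp add: Nt_def)
qed

text \<open>On one element \<open>Nt t\<close> does not depend on the point, and the integral is a
  linear function of that single matrix. Continuity in time is thus that of a matrix curve followed
  by a linear map.\<close>

lemma continuous_N_inner:
  assumes u: "u \<in> dgV" and w: "w \<in> dgV"
  shows "continuous_on {0..1} (\<lambda>t. l2_inner \<K> (\<lambda>x. Nt t x *v u x) w)"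
proof -
  have i: "set_integrable lebesgue (interior K) (\<lambda>x. (A *v u x) \<bullet> w x)" if "K \<in> \<K>" for K A
  proof -
    have "elementwise_constant \<K> (\<lambda>x. A)" by (simp add: elementwise_constant_def)
    from dg_inner_integrable[OF dg_matrix[OF u this] w that] show ?thesis .
  qed
  have eq: "l2_inner \<K> (\<lambda>x. Nt t x *v u x) w = (\<Sum>K\<in>\<K>. LINT x:interior K|lebesgue. (Nt t x *v u x) \<bullet> w x)" for t
    unfolding l2_inner_def
    by (rule open_elements_integral(2)[OF dg_inner_integrable[OF dg_matrix[OF u elementwise_N] w]])
  have "continuous_on {0..1} (\<lambda>t. LINT x:interior K|lebesgue. (Nt t x *v u x) \<bullet> w x)" if K: "K \<in> \<K>" for K
  proof -
    obtain x0 where x0: "x0 \<in> interior K" using element(6)[OF patch_element[OF K]] by blast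
    have N0: "Nt t x = Nt t x0" if "x \<in> interior K" for t x
    proof -
      obtain A where "\<forall>x\<in>interior K. Nt t x = A" using elementwise_N[of t] K unfolding elementwise_constant_def by blast
      then show ?thesis using that x0 by simp
    qed
    define f where "f A = (LINT x:interior K|lebesgue. (A *v u x) \<bullet> w x)" for A :: "real^'l^'l"
    have mK: "interior K \<in> sets lebesgue" by (intro sets_completionI_sets) simp
    have "linear f"
    proof (rule linearI)
      fix A A' :: "real^'l^'l" and r :: real
      show "f (A + A') = f A + f A'"
        unfolding f_def matrix_vector_mult_add_rdistrib inner_add_left by (rule set_integral_add(2)[OF i[OF K] i[OF K]])
      show "f (r *\<^sub>R A) = r *\<^sub>R f A" unfolding f_def by (simp flip: scaleR_matrix_vector_assoc)
    qed
    then have "continuous_on UNIV f" by (simp add: linear_continuous_on linear_conv_bounded_linear)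
    moreover have "x0 \<in> open_elements \<K>" using x0 K by (auto simp: open_elements_def)
    ultimately have "continuous_on {0..1} (\<lambda>t. f (Nt t x0))"
      using continuous_on_compose2[OF _ Nt_curve(1)] by blast
    moreover have "(LINT x:interior K|lebesgue. (Nt t x *v u x) \<bullet> w x) = f (Nt t x0)" for t
      unfolding f_def using mK by (intro set_lebesgue_integral_cong) (auto simp: N0)
    ultimately show ?thesis by simp
  qed
  then show ?thesis unfolding eq by (intro continuous_on_sum)
qed

text \<open>For \<open>u = Mt v\<close> the equation says that the coordinates of the derivative of
  \<open>u\<close> are the values of the form at \<open>Nt u\<close>, with coefficients
  \<open>a i j\<close> continuous in time. The inverse is constant on elements, so
  \<open>v = Nt u\<close> stays in the broken space; its derivative follows from that of
  \<open>Nt\<close>.\<close>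

theorem solution_exists:
  assumes v0: "v0 \<in> dgV"
  shows "\<exists>v. semidiscrete_solution \<Omega> \<K> p \<G> \<L> S B \<phi>b \<phi>t v0 v"
proof -
  obtain d b where b: "dgs.orthonormal d b" "\<And>v. v \<in> dgV \<Longrightarrow> v = (\<lambda>x. \<Sum>i<d. l2_inner \<K> v (b i) *\<^sub>R b i x)"
    by (rule dg_basis) blast
  have bV: "b i \<in> dgV" if "i < d" for i using b(1) that by (simp add: dgs.orthonormal_def)
  define a where "a i j t = form (\<lambda>x. Nt t x *v b j x) (b i)" for i j t
  have ca: "continuous_on {0..1} (a i j)" if ij: "i < d" "j < d" for i j
  proof -
    have "a i j t = (\<Sum>k<d. l2_inner \<K> (\<lambda>x. Nt t x *v b j x) (b k) * form (b k) (b i))" for t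
    proof -
      have N: "(\<lambda>x. Nt t x *v b j x) \<in> dgV" by (rule dg_matrix[OF bV[OF ij(2)] elementwise_N])
      have "a i j t = form (\<lambda>x. \<Sum>k<d. l2_inner \<K> (\<lambda>x. Nt t x *v b j x) (b k) *\<^sub>R b k x) (b i)"
        unfolding a_def using arg_cong[OF b(2)[OF N], of "\<lambda>u. form u (b i)"] .
      also have "\<dots> = (\<Sum>k<d. l2_inner \<K> (\<lambda>x. Nt t x *v b j x) (b k) * form (b k) (b i))"
        by (rule dgs.functional_sum[OF form_functionals(1)[OF bV[OF ij(1)]]]) (use bV in auto)
      finally show ?thesis .
    qed
    then have "a i j = (\<lambda>t. \<Sum>k<d. l2_inner \<K> (\<lambda>x. Nt t x *v b j x) (b k) * form (b k) (b i))" by blast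
    moreover have "continuous_on {0..1} (\<lambda>t. \<Sum>k<d. l2_inner \<K> (\<lambda>x. Nt t x *v b j x) (b k) * form (b k) (b i))"
      by (intro continuous_on_sum continuous_on_mult continuous_on_const continuous_N_inner bV ij) auto
    ultimately show ?thesis by simp
  qed
  obtain c where c0: "\<And>i. i < d \<Longrightarrow> c i 0 = l2_inner \<K> (\<lambda>x. Mt 0 x *v v0 x) (b i)"
    and dc: "\<And>i t. i < d \<Longrightarrow> t \<in> {0..1} \<Longrightarrow> (c i has_real_derivative (\<Sum>j<d. a i j t * c j t)) (at t within {0..1})"
    by (rule linear_ode_system_exists[OF ca, of d "\<lambda>i j. i" "\<lambda>i j. j" "\<lambda>i. l2_inner \<K> (\<lambda>x. Mt 0 x *v v0 x) (b i)"]) blast+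
  define c' where "c' i t = (\<Sum>j<d. a i j t * c j t)" for i t
  have cc: "continuous_on {0..1} (c i)" if "i < d" for i
    unfolding continuous_on_eq_continuous_within using dc[OF that] DERIV_continuous by blast
  have cc': "continuous_on {0..1} (c' i)" if "i < d" for i
    unfolding c'_def by (intro continuous_on_sum continuous_on_mult ca cc that) auto
  define u where "u t x = (\<Sum>i<d. c i t *\<^sub>R b i x)" for t x
  define u' where "u' t x = (\<Sum>i<d. c' i t *\<^sub>R b i x)" for t x
  have uV: "u t \<in> dgV" "u' t \<in> dgV" for t
    unfolding u_def u'_def by (rule dgs.sum_mem, use bV in auto)+
  have du: "((\<lambda>s. u s x) has_vector_derivative u' t x) (at t within {0..1})" if t: "t \<in> {0..1}" for t x
    unfolding u_def u'_def c'_def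
    by (rule has_vector_derivative_sum) (auto intro!: derivative_eq_intros dc t)
  have cu: "continuous_on {0..1} (\<lambda>t. u t x)" "continuous_on {0..1} (\<lambda>t. u' t x)" for x
    unfolding u_def u'_def by (intro continuous_on_sum continuous_on_scaleR continuous_on_const cc cc'; simp)+
  define v where "v t x = Nt t x *v u t x" for t x
  define v' where "v' t x = Nt t x *v (M1 \<L> \<delta> x *v v t x) + Nt t x *v u' t x" for t x
  have vV: "v t \<in> dgV" for t unfolding v_def by (rule dg_matrix[OF uV(1) elementwise_N])
  have v'V: "v' t \<in> dgV" for t
    unfolding v'_def by (intro dg_add dg_matrix[OF _ elementwise_N] dg_matrix[OF vV elementwise_M(1)] uV(2))
  \<comment> \<open>Coercivity, and with it the inverse, is available on the open elements only;
    elsewhere all curves vanish because of the representative fixed in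
    \<open>dg_space\<close>.\<close>
  have out: "u t x = 0" "u' t x = 0" "v t x = 0" "v' t x = 0" if "x \<notin> open_elements \<K>" for t x
    using that uV[of t] vV[of t] v'V[of t] by (auto simp: dg_space_def)
  have dv: "((\<lambda>s. v s x) has_vector_derivative v' t x) (at t within {0..1})" if t: "t \<in> {0..1}" for t x
  proof (cases "x \<in> open_elements \<K>")
    case True
    have vs: "v s x = (\<Sum>i<d. c i s *\<^sub>R (Nt s x *v b i x))" for s
      by (simp add: v_def u_def linear_sum[OF matrix_vector_mul_linear] matrix_vector_mult_scaleR)
    have "((\<lambda>s. \<Sum>i<d. c i s *\<^sub>R (Nt s x *v b i x)) has_vector_derivative
       (\<Sum>i<d. c i t *\<^sub>R (Nt t x *v (M1 \<L> \<delta> x *v (Nt t x *v b i x))) + c' i t *\<^sub>R (Nt t x *v b i x))) (at t within {0..1})"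
      unfolding c'_def
      by (rule has_vector_derivative_sum, rule has_vector_derivative_scaleR) (auto intro!: dc t Nt_curve(2)[OF True])
    moreover have "(\<Sum>i<d. c i t *\<^sub>R (Nt t x *v (M1 \<L> \<delta> x *v (Nt t x *v b i x))) + c' i t *\<^sub>R (Nt t x *v b i x)) = v' t x"
      unfolding v'_def vs u'_def
      by (simp add: sum.distrib linear_sum[OF matrix_vector_mul_linear] matrix_vector_mult_scaleR)
    ultimately show ?thesis unfolding vs by simp
  next
    case False
    then show ?thesis by (simp add: out)
  qed
  have cv': "continuous_on {0..1} (\<lambda>t. v' t x)" for x
  proof (cases "x \<in> open_elements \<K>")
    case True
    then show ?thesis unfolding v'_def v_def
      by (intro continuous_intros Nt_curve(1) cu)
  next
    case False
    then show ?thesis by (simp add: out)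
  qed
  have C1: "C1_curve dgV v"
    unfolding C1_curve_def by (intro exI[of _ v']) (use vV v'V dv cv' in blast)
  have Mv: "Mt t x *v v t x = u t x" if "t \<in> {0..1}" for t x
    using Nt_inverse(1)[of x t] that by (cases "x \<in> open_elements \<K>") (auto simp: v_def out)
  have init: "v 0 = v0"
  proof
    fix x
    have M0V: "(\<lambda>x. Mt 0 x *v v0 x) \<in> dgV" by (rule dg_matrix[OF v0 elementwise_M(2)])
    have "u 0 x = (\<Sum>i<d. l2_inner \<K> (\<lambda>x. Mt 0 x *v v0 x) (b i) *\<^sub>R b i x)"
      unfolding u_def by (rule sum.cong) (simp_all add: c0)
    then have u0: "u 0 x = Mt 0 x *v v0 x" using fun_cong[OF b(2)[OF M0V], of x] by simp
    show "v 0 x = v0 x"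
    proof (cases "x \<in> open_elements \<K>")
      case True
      then show ?thesis unfolding v_def u0 using Nt_inverse(2)[OF True, of 0] by simp
    next
      case False
      then show ?thesis using v0 by (simp add: out dg_space_def)
    qed
  qed
  have eqn: "l2_inner \<K> (\<lambda>x. vector_derivative (\<lambda>s. Mt s x *v v s x) (at t within {0..1})) w = form (v t) w"
    if t: "t \<in> {0<..1}" and w: "w \<in> dgV" for t w
  proof -
    have t': "t \<in> {0..1}" using t by auto
    have vd: "vector_derivative (\<lambda>s. Mt s x *v v s x) (at t within {0..1}) = u' t x" for x
    proof (rule vector_derivative_within_closed_interval[OF zero_less_one t'])
      show "((\<lambda>s. Mt s x *v v s x) has_vector_derivative u' t x) (at t within {0..1})"
        by (rule has_vector_derivative_transform[OF t' _ du[OF t']]) (simp add: Mv)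
    qed
    have c'f: "c' i t = form (v t) (b i)" if i: "i < d" for i
    proof -
      have "form (v t) (b i) = form (\<lambda>x. \<Sum>j<d. c j t *\<^sub>R (Nt t x *v b j x)) (b i)"
        by (simp add: v_def[abs_def] u_def linear_sum[OF matrix_vector_mul_linear] matrix_vector_mult_scaleR)
      also have "\<dots> = (\<Sum>j<d. c j t * form (\<lambda>x. Nt t x *v b j x) (b i))"
        by (rule dgs.functional_sum[OF form_functionals(1)[OF bV[OF i]]]) (use bV dg_matrix[OF _ elementwise_N] in auto)
      finally show ?thesis by (simp add: c'_def a_def mult.commute)
    qed
    have "l2_inner \<K> (u' t) w = (\<Sum>i<d. c' i t * l2_inner \<K> (b i) w)"
      unfolding u'_def by (rule dgs.ip_sum[OF _ w]) (use bV in auto)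
    also have "\<dots> = (\<Sum>i<d. l2_inner \<K> w (b i) * form (v t) (b i))"
      by (rule sum.cong) (simp_all add: c'f l2_inner_commute[of w] mult.commute)
    also have "\<dots> = form (v t) (\<lambda>x. \<Sum>i<d. l2_inner \<K> w (b i) *\<^sub>R b i x)"
      by (rule dgs.functional_sum[OF form_functionals(2)[OF vV], symmetric]) (use bV in auto)
    also have "\<dots> = form (v t) w" using arg_cong[OF b(2)[OF w], of "form (v t)"] by simp
    finally show ?thesis unfolding vd .
  qed
  show ?thesis unfolding semidiscrete_solution_def using C1 init eqn by blast
qed

end

section \<open>Projection of square integrable data\<close>

text \<open>A local form of \<open>square_integrable\<close> that restricts to single elements and
  ignores values outside \<open>A\<close>. Measurability of \<open>w\<close> is listed separately,
  because integrability of the squared norm does not imply it.\<close>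

definition l2_on :: "(real^'n::finite) set \<Rightarrow> (real^'n \<Rightarrow> real^'l::finite) \<Rightarrow> bool" where
  "l2_on A w \<longleftrightarrow> (\<lambda>x. indicator A x *\<^sub>R w x) \<in> borel_measurable lebesgue \<and>
     set_integrable lebesgue A (\<lambda>x. (norm (w x))\<^sup>2)"

lemma l2_on_product:
  fixes A :: "(real^'n::finite) set" and M :: "real^'l::finite^'l"
  assumes w: "l2_on A w" and z: "l2_on A z"
  shows "set_integrable lebesgue A (\<lambda>x. (M *v w x) \<bullet> z x)"
proof (rule set_integrable_bound)
  let ?c = "real CARD('l) * norm M"
  show "set_integrable lebesgue A (\<lambda>x. ?c * ((norm (w x))\<^sup>2 + (norm (z x))\<^sup>2))"
    using w z by (intro set_integrable_mult_right set_integral_add(1)) (auto simp: l2_on_def)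
  have [measurable]: "(\<lambda>x. indicator A x *\<^sub>R w x) \<in> borel_measurable lebesgue" "(\<lambda>x. indicator A x *\<^sub>R z x) \<in> borel_measurable lebesgue"
    using w z by (auto simp: l2_on_def)
  have "(\<lambda>x. M *v (indicator A x *\<^sub>R w x)) \<in> borel_measurable lebesgue"
    by (rule measurable_matrix_vector_mult) measurable
  then have m: "(\<lambda>x. (M *v (indicator A x *\<^sub>R w x)) \<bullet> (indicator A x *\<^sub>R z x)) \<in> borel_measurable lebesgue" by measurable
  have eq: "(M *v (indicator A x *\<^sub>R w x)) \<bullet> (indicator A x *\<^sub>R z x) = indicator A x *\<^sub>R ((M *v w x) \<bullet> z x)" for x
    by (simp add: indicator_def)
  show "set_borel_measurable lebesgue A (\<lambda>x. (M *v w x) \<bullet> z x)"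
    using m unfolding set_borel_measurable_def eq .
  show "AE x in lebesgue. x \<in> A \<longrightarrow> norm ((M *v w x) \<bullet> z x) \<le> norm (?c * ((norm (w x))\<^sup>2 + (norm (z x))\<^sup>2))"
  proof (intro AE_I2 impI)
    fix x
    have "norm ((M *v w x) \<bullet> z x) \<le> norm (M *v w x) * norm (z x)" using Cauchy_Schwarz_ineq2 by auto
    also have "\<dots> \<le> (?c * norm (w x)) * norm (z x)" by (intro mult_right_mono matrix_vector_bound) auto
    also have "\<dots> = ?c * (norm (w x) * norm (z x))" by simp
    also have "\<dots> \<le> ?c * ((norm (w x))\<^sup>2 + (norm (z x))\<^sup>2)"
    proof (rule mult_left_mono)
      have "2 * norm (w x) * norm (z x) \<le> (norm (w x))\<^sup>2 + (norm (z x))\<^sup>2" by (rule sum_squares_bound)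
      moreover have "0 \<le> norm (w x) * norm (z x)" by simp
      ultimately show "norm (w x) * norm (z x) \<le> (norm (w x))\<^sup>2 + (norm (z x))\<^sup>2" by linarith
    qed simp
    finally show "norm ((M *v w x) \<bullet> z x) \<le> norm (?c * ((norm (w x))\<^sup>2 + (norm (z x))\<^sup>2))" by simp
  qed
qed

lemma l2_on_inner:
  "l2_on A w \<Longrightarrow> l2_on A z \<Longrightarrow> set_integrable lebesgue A (\<lambda>x. w x \<bullet> z x)"
  using l2_on_product[of A w z "mat 1"] by simp

lemma l2_on_cong: "(\<And>x. x \<in> A \<Longrightarrow> w x = z x) \<Longrightarrow> l2_on A w = l2_on A z"
proof -
  assume eq: "\<And>x. x \<in> A \<Longrightarrow> w x = z x"
  have "(\<lambda>x. indicator A x *\<^sub>R w x) = (\<lambda>x. indicator A x *\<^sub>R z x)"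
    "(\<lambda>x. indicator A x *\<^sub>R (norm (w x))\<^sup>2) = (\<lambda>x. indicator A x *\<^sub>R (norm (z x))\<^sup>2)"
    using eq by (auto simp: fun_eq_iff indicator_def)
  then show ?thesis unfolding l2_on_def set_integrable_def by simp
qed

context tent
begin

lemma dg_l2_on:
  assumes v: "v \<in> dgV" and K: "K \<in> \<K>"
  shows "l2_on (interior K) v"
  unfolding l2_on_def
proof
  obtain q where q: "\<And>x. x \<in> interior K \<Longrightarrow> v x = q x" "\<And>S. continuous_on S q" using dg_polynomial[OF v K] by metis
  have "set_integrable lebesgue (interior K) v"
    by (rule interior_integral(1)[OF element(2,3)[OF patch_element[OF K]] q(2) q(1)])
  then show "(\<lambda>x. indicator (interior K) x *\<^sub>R v x) \<in> borel_measurable lebesgue"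
    unfolding set_integrable_def by (rule borel_measurable_integrable)
  show "set_integrable lebesgue (interior K) (\<lambda>x. (norm (v x))\<^sup>2)"
    using dg_inner_integrable[OF v v K] by (simp add: dot_square_norm)
qed

text \<open>\<open>l2_projection\<close> is a unique description. The Fourier sum of
  \<open>w\<close> in an orthonormal basis satisfies it; the difference of two candidates lies in
  the space and is orthogonal to all of it, hence to itself.\<close>

lemma projection:
  assumes w: "\<And>K. K \<in> \<K> \<Longrightarrow> l2_on (interior K) w"
  shows "l2_projection \<K> p w \<in> dgV"
    and "y \<in> dgV \<Longrightarrow> l2_inner \<K> (\<lambda>x. w x - l2_projection \<K> p w x) y = 0"
proof -
  have wi: "set_integrable lebesgue (interior K) (\<lambda>x. w x \<bullet> z x)" if "K \<in> \<K>" "z \<in> dgV" for K z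
    by (rule l2_on_inner[OF w[OF that(1)] dg_l2_on[OF that(2,1)]])
  have minus: "l2_inner \<K> (\<lambda>x. w x - u x) z = l2_inner \<K> w z - l2_inner \<K> u z" if "u \<in> dgV" "z \<in> dgV" for u z
  proof -
    have "l2_inner \<K> (\<lambda>x. w x + (- 1) *\<^sub>R u x) z = l2_inner \<K> w z + l2_inner \<K> (\<lambda>x. (- 1) *\<^sub>R u x) z"
      by (rule l2_inner_add, erule wi[OF _ that(2)], rule dg_inner_integrable[OF dg_scale[OF that(1)] that(2)])
    also have "l2_inner \<K> (\<lambda>x. (- 1) *\<^sub>R u x) z = (- 1) * l2_inner \<K> u z" by (rule l2_inner_scale)
    finally show ?thesis by simp
  qed
  obtain d b where b: "dgs.orthonormal d b" "\<And>v. v \<in> dgV \<Longrightarrow> v = (\<lambda>x. \<Sum>i<d. l2_inner \<K> v (b i) *\<^sub>R b i x)"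
    by (rule dg_basis) blast
  have bV: "b i \<in> dgV" if "i < d" for i using b(1) that by (simp add: dgs.orthonormal_def)
  define u where "u x = (\<Sum>i<d. l2_inner \<K> w (b i) *\<^sub>R b i x)" for x
  have uV: "u \<in> dgV" unfolding u_def by (rule dgs.sum_mem) (use bV in auto)
  have wf: "dgs.functional (l2_inner \<K> w)"
    unfolding dgs.functional_def
  proof (intro conjI ballI allI)
    fix y z :: "real^'n \<Rightarrow> real^'l" assume "y \<in> dgV" "z \<in> dgV"
    then show "l2_inner \<K> w (\<lambda>x. y x + z x) = l2_inner \<K> w y + l2_inner \<K> w z"
      using l2_inner_add[of y w z] wi by (simp add: l2_inner_commute[of w] inner_commute[of _ "w _"])
  next
    fix c :: real and z :: "real^'n \<Rightarrow> real^'l"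
    show "l2_inner \<K> w (\<lambda>x. c *\<^sub>R z x) = c * l2_inner \<K> w z"
      unfolding l2_inner_commute[of w] by (rule l2_inner_scale)
  qed
  have uw: "l2_inner \<K> u z = l2_inner \<K> w z" if z: "z \<in> dgV" for z
  proof -
    have "l2_inner \<K> u z = (\<Sum>i<d. l2_inner \<K> w (b i) * l2_inner \<K> (b i) z)"
      unfolding u_def by (rule dgs.ip_sum[OF _ z]) (use bV in auto)
    also have "\<dots> = (\<Sum>i<d. l2_inner \<K> z (b i) * l2_inner \<K> w (b i))"
      by (simp only: l2_inner_commute[of _ z] mult.commute)
    also have "\<dots> = l2_inner \<K> w (\<lambda>x. \<Sum>i<d. l2_inner \<K> z (b i) *\<^sub>R b i x)"
      by (rule dgs.functional_sum[OF wf, symmetric]) (use bV in auto)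
    also have "\<dots> = l2_inner \<K> w z" using arg_cong[OF b(2)[OF z], of "l2_inner \<K> w"] by simp
    finally show ?thesis .
  qed
  have "l2_projection \<K> p w = u"
    unfolding l2_projection_def
  proof (rule the_equality)
    show "u \<in> dgV \<and> (\<forall>z\<in>dgV. l2_inner \<K> (\<lambda>x. w x - u x) z = 0)" using uV minus uw by simp
    fix y assume y: "y \<in> dgV \<and> (\<forall>z\<in>dgV. l2_inner \<K> (\<lambda>x. w x - y x) z = 0)"
    define e where "e x = y x + (- 1) *\<^sub>R u x" for x
    have e: "e \<in> dgV" unfolding e_def by (intro dg_add dg_scale uV) (use y in auto)
    have ee: "e = (\<lambda>x. y x + (- 1) *\<^sub>R u x)" by (rule ext) (rule e_def)
    have "l2_inner \<K> e e = l2_inner \<K> (\<lambda>x. y x + (- 1) *\<^sub>R u x) e"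
      by (rule arg_cong[where f="\<lambda>a. l2_inner \<K> a e", OF ee])
    also have "\<dots> = l2_inner \<K> y e + l2_inner \<K> (\<lambda>x. (- 1) *\<^sub>R u x) e"
      by (rule dgs.ip_add[OF conjunct1[OF y] dg_scale[OF uV] e])
    also have "l2_inner \<K> (\<lambda>x. (- 1) *\<^sub>R u x) e = (- 1) * l2_inner \<K> u e" by (rule l2_inner_scale)
    also have "l2_inner \<K> u e = l2_inner \<K> w e" by (rule uw[OF e])
    also have "l2_inner \<K> y e = l2_inner \<K> w e" using y e minus[of y e] by simp
    finally have "l2_inner \<K> e e = 0" by simp
    then have "e x = 0" for x using l2_inner_definite[OF e] by simp
    then show "y = u" by (auto simp: e_def fun_eq_iff)
  qed
  then show "l2_projection \<K> p w \<in> dgV"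
    "y \<in> dgV \<Longrightarrow> l2_inner \<K> (\<lambda>x. w x - l2_projection \<K> p w x) y = 0"
    using uV minus uw by simp_all
qed

text \<open>Pythagoras in the energy of \<open>Mt 0\<close>: the cross term pairs the projection
  error with \<open>Mt 0\<close> applied to the projection, an element of the broken space, and
  vanishes. What remains besides the energy of the projection is the energy of the error.\<close>

lemma projection_energy:
  assumes w: "\<And>K. K \<in> \<K> \<Longrightarrow> l2_on (interior K) w"
  shows "l2_inner \<K> (\<lambda>x. Mt 0 x *v l2_projection \<K> p w x) (l2_projection \<K> p w) \<le>
    (\<Sum>K\<in>\<K>. LINT x:interior K|lebesgue. (Mt 0 x *v w x) \<bullet> w x)"
    and "K \<in> \<K> \<Longrightarrow> set_integrable lebesgue (interior K) (\<lambda>x. (Mt t x *v w x) \<bullet> w x)"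
proof -
  let ?u = "l2_projection \<K> p w"
  note u = projection[OF w]
  have l2diff: "l2_on (interior K) (\<lambda>x. w x - ?u x)" if K: "K \<in> \<K>" for K
    unfolding l2_on_def
  proof
    have m: "(\<lambda>x. indicator (interior K) x *\<^sub>R w x) \<in> borel_measurable lebesgue"
      "(\<lambda>x. indicator (interior K) x *\<^sub>R ?u x) \<in> borel_measurable lebesgue"
      using w[OF K] dg_l2_on[OF u(1) K] by (simp_all add: l2_on_def)
    show "(\<lambda>x. indicator (interior K) x *\<^sub>R (w x - ?u x)) \<in> borel_measurable lebesgue"
      using borel_measurable_diff[OF m] by (simp add: scaleR_diff_right)
    note i = l2_on_inner[OF w[OF K] w[OF K]] l2_on_inner[OF w[OF K] dg_l2_on[OF u(1) K]] l2_on_inner[OF dg_l2_on[OF u(1) K] dg_l2_on[OF u(1) K]]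
    have "set_integrable lebesgue (interior K) (\<lambda>x. (w x \<bullet> w x + ?u x \<bullet> ?u x) - 2 * (w x \<bullet> ?u x))"
      by (intro set_integral_diff(1) set_integral_add(1) set_integrable_mult_right i)
    then show "set_integrable lebesgue (interior K) (\<lambda>x. (norm (w x - ?u x))\<^sup>2)"
      by (simp add: power2_norm_eq_inner inner_diff_left inner_diff_right inner_commute algebra_simps)
  qed
  have prod: "set_integrable lebesgue (interior K) (\<lambda>x. (Mt t x *v y x) \<bullet> y' x)"
    if K: "K \<in> \<K>" and y: "l2_on (interior K) y" "l2_on (interior K) y'" for K y y' t
  proof -
    obtain A where A: "\<forall>x\<in>interior K. Mt t x = A" using elementwise_M(2)[of t] K unfolding elementwise_constant_def by blast
    show ?thesis using l2_on_product[OF y, of A] A by (subst set_integrable_cong[OF refl]) auto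
  qed
  show "set_integrable lebesgue (interior K) (\<lambda>x. (Mt t x *v w x) \<bullet> w x)" if "K \<in> \<K>"
    by (rule prod[OF that w[OF that] w[OF that]])
  have Mu: "(\<lambda>x. Mt 0 x *v ?u x) \<in> dgV" by (rule dg_matrix[OF u(1) elementwise_M(2)])
  let ?e = "\<lambda>x. w x - ?u x"
  have pt: "(Mt 0 x *v w x) \<bullet> w x = (Mt 0 x *v ?u x) \<bullet> ?u x + (2 * (?e x \<bullet> (Mt 0 x *v ?u x)) + (Mt 0 x *v ?e x) \<bullet> ?e x)"
    if x: "x \<in> open_elements \<K>" for x
  proof -
    have "(Mt 0 x *v (?u x + ?e x)) \<bullet> (?u x + ?e x) = (Mt 0 x *v ?u x) \<bullet> ?u x + (Mt 0 x *v ?u x) \<bullet> ?e x + (Mt 0 x *v ?e x) \<bullet> ?u x + (Mt 0 x *v ?e x) \<bullet> ?e x"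
      by (simp only: matrix_vector_right_distrib inner_add_left inner_add_right)
    moreover have "(Mt 0 x *v ?e x) \<bullet> ?u x = ?e x \<bullet> (Mt 0 x *v ?u x)" by (rule symmetric_matrix_inner[OF transpose_M(3)[OF x]])
    moreover have "(Mt 0 x *v ?u x) \<bullet> ?e x = ?e x \<bullet> (Mt 0 x *v ?u x)" by (rule inner_commute)
    ultimately show ?thesis by simp
  qed
  have iw: "set_integrable lebesgue (open_elements \<K>) (\<lambda>x. (Mt 0 x *v w x) \<bullet> w x)"
    by (rule open_elements_integral(1)) (rule prod[OF _ w w])
  have iu: "set_integrable lebesgue (open_elements \<K>) (\<lambda>x. (Mt 0 x *v ?u x) \<bullet> ?u x)"
    by (rule open_elements_integral(1)) (rule dg_inner_integrable[OF Mu u(1)])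
  have ic: "set_integrable lebesgue (open_elements \<K>) (\<lambda>x. 2 * (?e x \<bullet> (Mt 0 x *v ?u x)))"
    by (intro open_elements_integral(1) set_integrable_mult_right l2_on_inner l2diff dg_l2_on Mu)
  have ie: "set_integrable lebesgue (open_elements \<K>) (\<lambda>x. (Mt 0 x *v ?e x) \<bullet> ?e x)"
    by (rule open_elements_integral(1)) (rule prod[OF _ l2diff l2diff])
  have "open (open_elements \<K>)" unfolding open_elements_def by (intro open_UN ballI open_interior)
  then have mO: "open_elements \<K> \<in> sets lebesgue" by (intro sets_completionI_sets) simp
  have "(\<Sum>K\<in>\<K>. LINT x:interior K|lebesgue. (Mt 0 x *v w x) \<bullet> w x) = (LINT x:open_elements \<K>|lebesgue. (Mt 0 x *v w x) \<bullet> w x)"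
    by (rule open_elements_integral(2)[symmetric]) (rule prod[OF _ w w])
  also have "\<dots> = (LINT x:open_elements \<K>|lebesgue. (Mt 0 x *v ?u x) \<bullet> ?u x + (2 * (?e x \<bullet> (Mt 0 x *v ?u x)) + (Mt 0 x *v ?e x) \<bullet> ?e x))"
    using mO pt by (intro set_lebesgue_integral_cong) auto
  also have "\<dots> = (LINT x:open_elements \<K>|lebesgue. (Mt 0 x *v ?u x) \<bullet> ?u x) + ((LINT x:open_elements \<K>|lebesgue. 2 * (?e x \<bullet> (Mt 0 x *v ?u x))) + (LINT x:open_elements \<K>|lebesgue. (Mt 0 x *v ?e x) \<bullet> ?e x))"
    by (simp only: set_integral_add(2)[OF iu set_integral_add(1)[OF ic ie]] set_integral_add(2)[OF ic ie])
  also have "(LINT x:open_elements \<K>|lebesgue. 2 * (?e x \<bullet> (Mt 0 x *v ?u x))) = 2 * l2_inner \<K> ?e (\<lambda>x. Mt 0 x *v ?u x)"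
    by (simp add: l2_inner_def)
  also have "l2_inner \<K> ?e (\<lambda>x. Mt 0 x *v ?u x) = 0" by (rule u(2)[OF _ Mu])
  finally have eq: "(\<Sum>K\<in>\<K>. LINT x:interior K|lebesgue. (Mt 0 x *v w x) \<bullet> w x) =
    l2_inner \<K> (\<lambda>x. Mt 0 x *v ?u x) ?u + (LINT x:open_elements \<K>|lebesgue. (Mt 0 x *v ?e x) \<bullet> ?e x)"
    by (simp add: l2_inner_def)
  have "0 \<le> (LINT x:open_elements \<K>|lebesgue. (Mt 0 x *v ?e x) \<bullet> ?e x)"
    unfolding set_lebesgue_integral_def
  proof (rule Bochner_Integration.integral_nonneg)
    fix x
    have "0 \<le> (Mt 0 x *v ?e x) \<bullet> ?e x" if "x \<in> open_elements \<K>"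
    proof -
      have "0 \<le> \<kappa> * (norm (?e x))\<^sup>2" using M_pos(1) by simp
      also have "\<dots> \<le> (Mt 0 x *v ?e x) \<bullet> ?e x" by (rule M_pos(2)[OF that]) simp
      finally show ?thesis .
    qed
    then show "0 \<le> indicator (open_elements \<K>) x *\<^sub>R ((Mt 0 x *v ?e x) \<bullet> ?e x)" by (simp add: indicator_def)
  qed
  then show "l2_inner \<K> (\<lambda>x. Mt 0 x *v ?u x) ?u \<le> (\<Sum>K\<in>\<K>. LINT x:interior K|lebesgue. (Mt 0 x *v w x) \<bullet> w x)"
    using eq by linarith
qed

theorem tent_stability:
  assumes w: "\<And>K. K \<in> \<K> \<Longrightarrow> l2_on (interior K) w"
  defines "r \<equiv> R_sem \<Omega> \<K> p \<G> \<L> S B \<phi>b \<phi>t 1 (l2_projection \<K> p w)"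
  shows "r \<in> dgV"
    and "(\<Sum>K\<in>\<K>. LINT x:interior K|lebesgue. (Mt 1 x *v r x) \<bullet> r x) \<le>
      (\<Sum>K\<in>\<K>. LINT x:interior K|lebesgue. (Mt 0 x *v w x) \<bullet> w x)"
proof -
  define v where "v = (SOME v. solution (l2_projection \<K> p w) v)"
  \<comment> \<open>Existence is what makes the choice operator inside \<open>R_sem\<close> name an
    actual solution.\<close>
  have sol: "solution (l2_projection \<K> p w) v"
    unfolding v_def by (rule someI_ex[OF solution_exists[OF projection(1)[OF w]]])
  have r: "r = v 1" unfolding r_def R_sem_def v_def ..
  note decay = energy_decay[OF sol]
  show rV: "r \<in> dgV" unfolding r by (rule decay(1))
  have "(\<Sum>K\<in>\<K>. LINT x:interior K|lebesgue. (Mt 1 x *v r x) \<bullet> r x) = l2_inner \<K> (\<lambda>x. Mt 1 x *v r x) r"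
    unfolding l2_inner_def
    by (rule open_elements_integral(2)[symmetric]) (rule dg_inner_integrable[OF dg_matrix[OF rV elementwise_M(2)] rV])
  also have "\<dots> \<le> l2_inner \<K> (\<lambda>x. Mt 0 x *v l2_projection \<K> p w x) (l2_projection \<K> p w)"
    unfolding r by (rule decay(2))
  also have "\<dots> \<le> (\<Sum>K\<in>\<K>. LINT x:interior K|lebesgue. (Mt 0 x *v w x) \<bullet> w x)"
    by (rule projection_energy(1)[OF w])
  finally show "(\<Sum>K\<in>\<K>. LINT x:interior K|lebesgue. (Mt 1 x *v r x) \<bullet> r x) \<le>
      (\<Sum>K\<in>\<K>. LINT x:interior K|lebesgue. (Mt 0 x *v w x) \<bullet> w x)" .
qed

end

section \<open>Propagation through the layers\<close>

lemma simplex_vertices: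
  fixes K :: "(real^'n::finite) set"
  assumes "int CARD('n) simplex K"
  obtains C where "finite C" "K = convex hull C" "\<And>y. y extreme_point_of K \<longleftrightarrow> y \<in> C"
    "\<And>v F. v extreme_point_of K \<Longrightarrow> F facet_of K \<Longrightarrow> v \<notin> F \<Longrightarrow> F = convex hull (C - {v})"
proof -
  obtain C g \<alpha> where C: "simplex_coords C g \<alpha>" "K = convex hull C" by (rule simplex_coords_exists[OF assms])
  interpret simplex_coords C g \<alpha> by (rule C(1))
  have ext: "y extreme_point_of K \<longleftrightarrow> y \<in> C" for y
    unfolding C(2) by (rule extreme_point_of_convex_hull_affine_independent[OF indep])
  have "F = convex hull (C - {v})" if h: "v extreme_point_of K" "F facet_of K" "v \<notin> F" for v F
  proof -
    obtain u where u: "u \<in> C" "F = convex hull (C - {u})" using h(2) facets unfolding C(2) by blast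
    have "v \<in> C" using h(1) ext by simp
    then have "v = u" using h(3) u(2) hull_inc[of v "C - {u}" convex] by blast
    then show ?thesis using u(2) by simp
  qed
  then show thesis using that[OF fin C(2) ext] by blast
qed

lemma affine_zero_on_hull:
  fixes b :: "'a::euclidean_space"
  assumes "\<And>y. y \<in> C \<Longrightarrow> b \<bullet> y + a = 0" "x \<in> convex hull C"
  shows "b \<bullet> x + a = 0"
proof -
  have "convex {x. b \<bullet> x = - a}" by (rule convex_hyperplane)
  moreover have "C \<subseteq> {x. b \<bullet> x = - a}" using assms(1) by (auto simp: eq_neg_iff_add_eq_0)
  ultimately have "convex hull C \<subseteq> {x. b \<bullet> x = - a}" by (rule hull_minimal[rotated])
  then show ?thesis using assms(2) by auto
qed

lemma l2_on_subset:
  assumes \<Omega>: "open \<Omega>" and w: "square_integrable \<Omega> w" and A: "A \<subseteq> \<Omega>" "A \<in> sets lebesgue"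
  shows "l2_on A w"
proof -
  have O: "\<Omega> \<in> sets lebesgue" using \<Omega> by (intro sets_completionI_sets) simp
  then have O': "\<Omega> \<inter> space lebesgue \<in> sets lebesgue" by simp
  have "(\<lambda>x. indicator \<Omega> x *\<^sub>R w x) \<in> borel_measurable lebesgue"
    using w borel_measurable_restrict_space_iff[OF O', of w] by (simp add: square_integrable_def)
  then have "(\<lambda>x. indicator A x *\<^sub>R (indicator \<Omega> x *\<^sub>R w x)) \<in> borel_measurable lebesgue"
    by (rule borel_measurable_scaleR[OF borel_measurable_indicator[OF A(2)]])
  moreover have "(\<lambda>x. indicator A x *\<^sub>R (indicator \<Omega> x *\<^sub>R w x)) = (\<lambda>x. indicator A x *\<^sub>R w x)"
    using A(1) by (auto simp: fun_eq_iff indicator_def)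
  moreover have "set_integrable lebesgue \<Omega> (\<lambda>x. (norm (w x))\<^sup>2)"
    using w integrable_restrict_space[OF O', of "\<lambda>x. (norm (w x))\<^sup>2"] by (simp add: square_integrable_def set_integrable_def)
  ultimately show ?thesis
    unfolding l2_on_def using set_integrable_subset[OF _ A(2,1)] by auto
qed

lemma flux_gradient: "flux \<L> x u *v g = (\<Sum>j\<in>UNIV. (g $ j) *\<^sub>R (\<L> j x *v u))"
  by (simp add: flux_def vec_eq_iff matrix_vector_mult_def mult.commute)

locale fronts = mesh \<Omega> \<T> for \<Omega> :: "(real^'n::finite) set" and \<T> +
  fixes p :: nat and \<G> :: "real^'n \<Rightarrow> real^'l^'l::finite" and \<L> :: "'n \<Rightarrow> real^'n \<Rightarrow> real^'l^'l"
    and S B :: "real^'n \<Rightarrow> real^'l^'l" and \<phi> :: "nat \<Rightarrow> real^'n \<Rightarrow> real"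
    and V :: "nat \<Rightarrow> (real^'n) set" and m :: nat and chat :: real
  assumes L_bounded: "\<And>k. bounded (\<L> k ` open_elements \<T>)"
    and L_symmetric: "\<And>k x. x \<in> open_elements \<T> \<Longrightarrow> transpose (\<L> k x) = \<L> k x"
    and L_constant: "\<And>k. elementwise_constant \<T> (\<L> k)"
    and L_divergence: "divergence_free \<Omega> \<L>"
    and G_symmetric: "\<And>x. x \<in> open_elements \<T> \<Longrightarrow> transpose (\<G> x) = \<G> x"
    and G_constant: "elementwise_constant \<T> \<G>"
    and G_definite: "\<exists>\<gamma>>0. \<forall>x\<in>open_elements \<T>. \<forall>e. \<gamma> * (norm e)\<^sup>2 \<le> (\<G> x *v e) \<bullet> e"
    and S_bounded: "bounded (S ` (skeleton \<T> \<inter> \<Omega>))"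
    and S_measurable: "S \<in> borel_measurable (restrict_space borel (skeleton \<T> \<inter> \<Omega>))"
    and S_semidef: "\<And>x. x \<in> skeleton \<T> \<inter> \<Omega> \<Longrightarrow> positive_semidef (S x + transpose (S x))"
    and B_bounded: "bounded (B ` frontier \<Omega>)"
    and B_measurable: "B \<in> borel_measurable (restrict_space borel (frontier \<Omega>))"
    and B_semidef: "\<And>x. x \<in> frontier \<Omega> \<Longrightarrow> positive_semidef (B x + transpose (B x))"
    and speed: "max_wave_speed \<T> \<G> \<L> < chat"
    and phi_mono: "\<And>k x. k < m \<Longrightarrow> x \<in> \<Omega> \<Longrightarrow> \<phi> k x \<le> \<phi> (Suc k) x"
    and phi_continuous: "\<And>k. k \<le> m \<Longrightarrow> continuous_on (closure \<Omega>) (\<phi> k)"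
    and phi_linear: "\<And>k. k \<le> m \<Longrightarrow> piecewise_linear \<T> (\<phi> k)"
    and phi_causal: "\<And>k x. k \<le> m \<Longrightarrow> x \<in> open_elements \<T> \<Longrightarrow> norm (grad (\<phi> k) x) \<le> 1 / chat"
    and V_vertices: "\<And>k. 1 \<le> k \<Longrightarrow> k \<le> m \<Longrightarrow> V k \<subseteq> mesh_vertices \<T>"
    and V_disjoint: "\<And>k v v'. 1 \<le> k \<Longrightarrow> k \<le> m \<Longrightarrow> v \<in> V k \<Longrightarrow> v' \<in> V k \<Longrightarrow> v \<noteq> v' \<Longrightarrow>
                        patch \<T> v \<inter> patch \<T> v' = {}"
    and phi_pitch: "\<And>k v. 1 \<le> k \<Longrightarrow> k \<le> m \<Longrightarrow> v \<in> mesh_vertices \<T> - V k \<Longrightarrow> \<phi> k v = \<phi> (k - 1) v"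
begin

abbreviation "front_matrix k \<equiv> M0 \<G> \<L> (\<phi> k)"

lemma phi_affine:
  assumes "k \<le> m" "K \<in> \<T>"
  obtains b a where "\<And>x. x \<in> K \<Longrightarrow> \<phi> k x = b \<bullet> x + a"
  using phi_linear[OF assms(1)] assms(2) unfolding piecewise_linear_def by blast

text \<open>The front matrix is \<open>\<G>\<close> minus the normal matrix in the direction of the
  gradient. Causality limits the latter to the fraction \<open>max_wave_speed / chat\<close> of
  \<open>\<G>\<close>, which is strictly below 1; the remaining fraction times
  \<open>\<gamma>\<close> is the coercivity constant.\<close>

lemma front_matrix_bound:
  assumes k: "k \<le> m" and \<gamma>: "\<gamma> > 0" "\<And>x e. x \<in> open_elements \<T> \<Longrightarrow> \<gamma> * (norm e)\<^sup>2 \<le> (\<G> x *v e) \<bullet> e"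
    and x: "x \<in> open_elements \<T>"
  shows "chat > 0" and "(1 - max_wave_speed \<T> \<G> \<L> / chat) * \<gamma> * (norm e)\<^sup>2 \<le> (front_matrix k x *v e) \<bullet> e"
proof -
  let ?c = "max_wave_speed \<T> \<G> \<L>"
  note wave = wave_speed_bound[OF L_bounded L_symmetric G_symmetric \<gamma> x]
  have c0: "0 \<le> ?c" by (rule wave(1))
  then show chat: "chat > 0" using speed by linarith
  have G0: "0 \<le> (\<G> x *v e) \<bullet> e" using \<gamma>(1) \<gamma>(2)[OF x, of e] by (meson mult_nonneg_nonneg less_imp_le order_trans zero_le_power2)
  have "(normal_matrix \<L> (grad (\<phi> k) x) x *v e) \<bullet> e \<le> norm (grad (\<phi> k) x) * ?c * ((\<G> x *v e) \<bullet> e)"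
    by (rule wave(2))
  also have "\<dots> \<le> (1 / chat) * ?c * ((\<G> x *v e) \<bullet> e)"
    using phi_causal[OF k x] c0 G0 by (intro mult_right_mono) auto
  finally have D: "(normal_matrix \<L> (grad (\<phi> k) x) x *v e) \<bullet> e \<le> ?c / chat * ((\<G> x *v e) \<bullet> e)" by simp
  have "(front_matrix k x *v e) \<bullet> e = (\<G> x *v e) \<bullet> e - (normal_matrix \<L> (grad (\<phi> k) x) x *v e) \<bullet> e"
    by (simp add: M0_def normal_matrix_def grad_def matrix_vector_mult_diff_rdistrib inner_diff_left)
  then have "(1 - ?c / chat) * ((\<G> x *v e) \<bullet> e) \<le> (front_matrix k x *v e) \<bullet> e"
    using D by (simp add: algebra_simps)
  moreover have "(1 - ?c / chat) * (\<gamma> * (norm e)\<^sup>2) \<le> (1 - ?c / chat) * ((\<G> x *v e) \<bullet> e)"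
    using \<gamma>(2)[OF x] speed chat by (intro mult_left_mono) (auto simp: field_simps)
  ultimately show "(1 - ?c / chat) * \<gamma> * (norm e)\<^sup>2 \<le> (front_matrix k x *v e) \<bullet> e"
    by (simp add: mult.assoc)
qed

text \<open>Both fronts are affine on \<open>K\<close>, so agreement at the vertices in
  \<open>D\<close> extends to their hull. It is used for the facet opposite to a pitched vertex and
  for all vertices of an element that belongs to no tent.\<close>

lemma delta_zero_off_pitch:
  assumes k: "1 \<le> k" "k \<le> m" and K: "K \<in> \<T>" and C: "K = convex hull C" "\<And>y. y extreme_point_of K \<longleftrightarrow> y \<in> C"
    and D: "D \<subseteq> C" "D \<inter> V k = {}" and x: "x \<in> convex hull D"
  shows "\<phi> k x = \<phi> (k - 1) x"
proof -
  have k1: "k - 1 \<le> m" using k by simp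
  obtain b a where b: "\<And>x. x \<in> K \<Longrightarrow> \<phi> k x = b \<bullet> x + a" using phi_affine[OF k(2) K] by blast
  obtain b' a' where b': "\<And>x. x \<in> K \<Longrightarrow> \<phi> (k - 1) x = b' \<bullet> x + a'" using phi_affine[OF k1 K] by blast
  have "(b - b') \<bullet> y + (a - a') = 0" if y: "y \<in> D" for y
  proof -
    have yC: "y \<in> C" using y D(1) by blast
    then have yK: "y \<in> K" unfolding C(1) by (rule hull_inc)
    have "y \<in> mesh_vertices \<T> - V k" using yC C(2) K D(2) y by (auto simp: mesh_vertices_def)
    then have "\<phi> k y = \<phi> (k - 1) y" by (rule phi_pitch[OF k])
    then show ?thesis using b[OF yK] b'[OF yK] by (simp add: inner_diff_left)
  qed
  then have "(b - b') \<bullet> x + (a - a') = 0" using x by (rule affine_zero_on_hull)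
  moreover have "x \<in> K" using x hull_mono[OF D(1), of convex] C(1) by blast
  ultimately show ?thesis using b b' by (simp add: inner_diff_left)
qed

lemma front_matrix_partial:
  assumes k: "k \<le> m" "k' \<le> m" and K: "K \<in> \<T>" and x: "x \<in> interior K"
  shows "partial j (\<lambda>y. \<phi> k y - \<phi> k' y) x = partial j (\<phi> k) x - partial j (\<phi> k') x"
proof -
  obtain b a where b: "\<And>x. x \<in> K \<Longrightarrow> \<phi> k x = b \<bullet> x + a" using phi_affine[OF k(1) K] by blast
  obtain b' a' where b': "\<And>x. x \<in> K \<Longrightarrow> \<phi> k' x = b' \<bullet> x + a'" using phi_affine[OF k(2) K] by blast
  have "\<phi> k y - \<phi> k' y = (b - b') \<bullet> y + (a - a')" if "y \<in> K" for y
    using b[OF that] b'[OF that] by (simp add: inner_diff_left)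
  from affine_partial[of K "\<lambda>y. \<phi> k y - \<phi> k' y", OF this x, of j] show ?thesis
    using affine_partial[OF b x, of j] affine_partial[OF b' x, of j] by simp
qed

text \<open>Interpolation between the two fronts: it identifies the matrices at the two end times
  and lets the coercivity on both fronts pass to all times in between by convexity.\<close>

lemma M_op_fronts:
  assumes k: "1 \<le> k" "k \<le> m" and x: "x \<in> open_elements \<T>"
  shows "M_op \<G> \<L> (\<phi> (k - 1)) (\<phi> k) t x = (1 - t) *\<^sub>R front_matrix (k - 1) x + t *\<^sub>R front_matrix k x"
proof -
  obtain K where K: "K \<in> \<T>" "x \<in> interior K" using x by (auto simp: open_elements_def)
  have k1: "k - 1 \<le> m" using k by simp
  have eq: "M1 \<L> (\<lambda>y. \<phi> k y - \<phi> (k - 1) y) x = front_matrix (k - 1) x - front_matrix k x"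
    unfolding M1_def M0_def front_matrix_partial[OF k(2) k1 K] by (simp add: scaleR_left_diff_distrib sum_subtractf)
  show ?thesis unfolding M_op_def eq by (simp add: algebra_simps)
qed

lemma finite_vertices: "finite (mesh_vertices \<T>)"
proof -
  have "finite {v. v extreme_point_of K}" if KT: "K \<in> \<T>" for K
  proof -
    obtain C where "finite C" "\<And>y. y extreme_point_of K \<longleftrightarrow> y \<in> C" using simplex_vertices[OF element(1)[OF KT]] by metis
    then show ?thesis by simp
  qed
  moreover have "mesh_vertices \<T> = (\<Union>K\<in>\<T>. {v. v extreme_point_of K})" by (auto simp: mesh_vertices_def)
  ultimately show ?thesis using finite_mesh by simp
qed

lemma tent_at:
  assumes k: "1 \<le> k" "k \<le> m" and z: "z \<in> V k"
  shows "\<exists>\<kappa>. tent \<Omega> \<T> z \<G> \<L> S B (\<phi> (k - 1)) (\<phi> k) \<kappa>"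
proof -
  have k1: "k - 1 \<le> m" using k by simp
  obtain \<gamma> where \<gamma>: "\<gamma> > 0" "\<And>x e. x \<in> open_elements \<T> \<Longrightarrow> \<gamma> * (norm e)\<^sup>2 \<le> (\<G> x *v e) \<bullet> e" using G_definite by blast
  let ?c = "max_wave_speed \<T> \<G> \<L>"
  define \<kappa> where "\<kappa> = (1 - ?c / chat) * \<gamma>"
  obtain K0 where K0: "K0 \<in> \<T>" using z V_vertices[OF k] by (auto simp: mesh_vertices_def)
  then obtain x0 where x0: "x0 \<in> open_elements \<T>" using element(6)[OF K0] by (auto simp: open_elements_def)
  have chat: "chat > 0" by (rule front_matrix_bound(1)[OF k1 \<gamma> x0])
  then have \<kappa>: "\<kappa> > 0" unfolding \<kappa>_def using \<gamma>(1) speed by (simp add: field_simps)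
  have "tent \<Omega> \<T> z \<G> \<L> S B (\<phi> (k - 1)) (\<phi> k) \<kappa>"
  proof
    show "patch \<T> z \<subseteq> \<T>" by (auto simp: patch_def)
    show "piecewise_linear \<T> (\<phi> (k - 1))" "piecewise_linear \<T> (\<phi> k)" using phi_linear k k1 by auto
    show "\<kappa> > 0" by (rule \<kappa>)
    show "\<phi> (k - 1) x \<le> \<phi> k x" if "K \<in> patch \<T> z" "x \<in> K" for K x
    proof -
      \<comment> \<open>Ordering of the fronts is given on the open domain only; boundary points of
        elements are reached by continuity.\<close>
      have "x \<in> closure \<Omega>" using that element(5) by (auto simp: patch_def)
      moreover have "continuous_on (closure \<Omega>) (\<lambda>x. \<phi> k x - \<phi> (k - 1) x)"
        by (intro continuous_intros phi_continuous k k1)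
      moreover have "0 \<le> \<phi> k y - \<phi> (k - 1) y" if "y \<in> \<Omega>" for y using phi_mono[of "k - 1" y] k that by simp
      ultimately have "0 \<le> \<phi> k x - \<phi> (k - 1) x"
        using continuous_ge_on_closure[of \<Omega> "\<lambda>x. \<phi> k x - \<phi> (k - 1) x" x 0] by blast
      then show ?thesis by simp
    qed
    show "\<phi> k x = \<phi> (k - 1) x" if K: "K \<in> patch \<T> z" and F: "F facet_of K" "z \<notin> F" "x \<in> F" for K F x
    proof -
      have KT: "K \<in> \<T>" and zK: "z extreme_point_of K" using K by (auto simp: patch_def)
      obtain C where C: "K = convex hull C" "\<And>y. y extreme_point_of K \<longleftrightarrow> y \<in> C"
        and FC: "\<And>v F. v extreme_point_of K \<Longrightarrow> F facet_of K \<Longrightarrow> v \<notin> F \<Longrightarrow> F = convex hull (C - {v})"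
        using simplex_vertices[OF element(1)[OF KT]] by metis
      have x: "x \<in> convex hull (C - {z})" using FC[OF zK F(1,2)] F(3) by blast
      \<comment> \<open>A second pitched vertex of \<open>K\<close> would put \<open>K\<close> into
        two patches that share no element; so \<open>z\<close> is its only one.\<close>
      have "y \<notin> V k" if y: "y \<in> C - {z}" for y
      proof
        assume "y \<in> V k"
        then have "patch \<T> y \<inter> patch \<T> z = {}" using V_disjoint[OF k _ z] y by blast
        moreover have "K \<in> patch \<T> y" using y C(2) KT by (auto simp: patch_def)
        ultimately show False using K by blast
      qed
      then show ?thesis by (intro delta_zero_off_pitch[OF k KT C _ _ x]) blast+
    qed
    show "\<kappa> * (norm e)\<^sup>2 \<le> (M_op \<G> \<L> (\<phi> (k - 1)) (\<phi> k) t x *v e) \<bullet> e"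
      if x: "x \<in> open_elements (patch \<T> z)" and t: "t \<in> {0..1}" for x t e
    proof -
      have xT: "x \<in> open_elements \<T>" using x by (auto simp: open_elements_def patch_def)
      have b: "\<kappa> * (norm e)\<^sup>2 \<le> (front_matrix l x *v e) \<bullet> e" if "l \<le> m" for l
        unfolding \<kappa>_def by (rule front_matrix_bound(2)[OF that \<gamma> xT])
      have "(1 - t) * (\<kappa> * (norm e)\<^sup>2) + t * (\<kappa> * (norm e)\<^sup>2) \<le>
        (1 - t) * ((front_matrix (k - 1) x *v e) \<bullet> e) + t * ((front_matrix k x *v e) \<bullet> e)"
        using t by (intro add_mono mult_left_mono b k1 k(2)) auto
      also have "\<dots> = (M_op \<G> \<L> (\<phi> (k - 1)) (\<phi> k) t x *v e) \<bullet> e"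
        unfolding M_op_fronts[OF k xT]
        by (simp add: matrix_vector_mult_add_rdistrib inner_add_left flip: scaleR_matrix_vector_assoc)
      finally show ?thesis by (simp add: algebra_simps)
    qed
  qed (use L_symmetric L_constant L_divergence G_symmetric G_constant S_bounded S_measurable S_semidef B_bounded B_measurable B_semidef in blast)+
  then show ?thesis by blast
qed

sublocale all_elements: dg_patch \<Omega> \<T> \<T> p
  by unfold_locales simp

section \<open>Element energies and the step across one layer\<close>

definition element_energy :: "nat \<Rightarrow> (real^'n \<Rightarrow> real^'l) \<Rightarrow> (real^'n) set \<Rightarrow> real" where
  "element_energy k w K = (LINT x:interior K|lebesgue. (front_matrix k x *v w x) \<bullet> w x)"

lemma element_energy_integrable:
  assumes k: "k \<le> m" and K: "K \<in> \<T>" and w: "l2_on (interior K) w"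
  shows "set_integrable lebesgue (interior K) (\<lambda>x. (front_matrix k x *v w x) \<bullet> w x)"
proof -
  obtain b a where b: "\<And>x. x \<in> K \<Longrightarrow> \<phi> k x = b \<bullet> x + a" using phi_affine[OF k K] by blast
  obtain G where G: "\<And>x. x \<in> interior K \<Longrightarrow> \<G> x = G" using G_constant K unfolding elementwise_constant_def by blast
  have "\<forall>j. \<exists>A. \<forall>x\<in>interior K. \<L> j x = A" using L_constant K unfolding elementwise_constant_def by blast
  from choice[OF this] obtain A where A: "\<And>j x. x \<in> interior K \<Longrightarrow> \<L> j x = A j" by blast
  have "front_matrix k x = G - (\<Sum>j\<in>UNIV. b $ j *\<^sub>R A j)" if "x \<in> interior K" for x
    using affine_partial[OF b that] G[OF that] A[OF that] by (simp add: M0_def)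
  then show ?thesis
    using l2_on_product[OF w w, of "G - (\<Sum>j\<in>UNIV. b $ j *\<^sub>R A j)"] by (subst set_integrable_cong[OF refl]) auto
qed

lemma AE_open_elements: "AE x in lebesgue. x \<in> \<Omega> \<longleftrightarrow> x \<in> open_elements \<T>"
  using AE_not_negligible[OF negligible_skeleton]
proof eventually_elim
  fix x assume "x \<notin> skeleton \<T>"
  then show "x \<in> \<Omega> \<longleftrightarrow> x \<in> open_elements \<T>"
    using dom_minus_open_elements element(4) by (auto simp: open_elements_def)
qed

lemma dom_integral:
  fixes f :: "real^'n \<Rightarrow> real"
  assumes f: "\<And>K. K \<in> \<T> \<Longrightarrow> set_integrable lebesgue (interior K) f"
  shows "set_integrable lebesgue \<Omega> f" and "(LINT x:\<Omega>|lebesgue. f x) = (\<Sum>K\<in>\<T>. LINT x:interior K|lebesgue. f x)"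
proof -
  note o = all_elements.open_elements_integral[OF f]
  have i: "integrable lebesgue (\<lambda>x. indicator (open_elements \<T>) x *\<^sub>R f x)" using o(1) by (simp add: set_integrable_def)
  have ae: "AE x in lebesgue. indicator (open_elements \<T>) x *\<^sub>R f x = indicator \<Omega> x *\<^sub>R f x"
    using AE_open_elements by eventually_elim (simp add: indicator_def)
  have ae': "AE x in lebesgue. indicator \<Omega> x *\<^sub>R f x = indicator (open_elements \<T>) x *\<^sub>R f x"
    using AE_open_elements by eventually_elim (simp add: indicator_def)
  have m: "(\<lambda>x. indicator \<Omega> x *\<^sub>R f x) \<in> borel_measurable lebesgue"
    by (rule borel_measurable_AE[OF borel_measurable_integrable[OF i] ae])
  show "set_integrable lebesgue \<Omega> f"
    unfolding set_integrable_def by (rule integrable_cong_AE_imp[OF i m ae])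
  have "(LINT x:\<Omega>|lebesgue. f x) = (LINT x:open_elements \<T>|lebesgue. f x)"
    unfolding set_lebesgue_integral_def
    by (rule integral_cong_AE[OF m borel_measurable_integrable[OF i] ae'])
  then show "(LINT x:\<Omega>|lebesgue. f x) = (\<Sum>K\<in>\<T>. LINT x:interior K|lebesgue. f x)" using o(2) by simp
qed

text \<open>The skeleton is null, so the norm splits over open elements. This form allows the
  comparison of successive fronts patch by patch.\<close>

lemma front_norm_eq:
  assumes k: "k \<le> m" and w: "\<And>K. K \<in> \<T> \<Longrightarrow> l2_on (interior K) w"
  shows "front_norm \<Omega> \<G> \<L> (\<phi> k) w = sqrt (\<Sum>K\<in>\<T>. element_energy k w K)"
proof -
  have "\<G> x *v w x - flux \<L> x (w x) *v grad (\<phi> k) x = front_matrix k x *v w x" for x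
  proof -
    have "(\<Sum>j\<in>J. (a j) *\<^sub>R A j) *v e = (\<Sum>j\<in>J. a j *\<^sub>R (A j *v e))" if "finite J" for J and a :: "'n \<Rightarrow> real" and A :: "'n \<Rightarrow> real^'l^'l" and e
      using that by induction (simp_all add: matrix_vector_mult_add_rdistrib scaleR_matrix_vector_assoc)
    then show ?thesis by (simp add: flux_gradient M0_def grad_def matrix_vector_mult_diff_rdistrib)
  qed
  then show ?thesis
    unfolding front_norm_def element_energy_def
    using dom_integral(2)[OF element_energy_integrable[OF k _ w]] by simp
qed

text \<open>The mesh is the disjoint union of the patches at the pitched vertices and the rest
  \<open>R\<close>. On \<open>R\<close> neither the data nor the front changes, on each patch
  \<open>tent_stability\<close> applies, and the contributions are added.\<close>

lemma layer_step:
  assumes k: "1 \<le> k" "k \<le> m" and w: "\<And>K. K \<in> \<T> \<Longrightarrow> l2_on (interior K) w"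
  defines "w' \<equiv> layer_propagator \<Omega> \<T> p \<G> \<L> S B (\<phi> (k - 1)) (\<phi> k) (V k) w"
  shows "K \<in> \<T> \<Longrightarrow> l2_on (interior K) w'"
    and "(\<Sum>K\<in>\<T>. element_energy k w' K) \<le> (\<Sum>K\<in>\<T>. element_energy (k - 1) w K)"
proof -
  have k1: "k - 1 \<le> m" using k by simp
  let ?r = "\<lambda>v. R_sem \<Omega> (patch \<T> v) p \<G> \<L> S B (\<phi> (k - 1)) (\<phi> k) 1 (l2_projection (patch \<T> v) p w)"
  have inK: "K \<in> patch \<T> v" if "x \<in> interior K" "K \<in> \<T>" "x \<in> open_elements (patch \<T> v)" for x K v
  proof -
    obtain L where L: "L \<in> patch \<T> v" "x \<in> interior L" using \<open>x \<in> open_elements (patch \<T> v)\<close> by (auto simp: open_elements_def)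
    then have "L = K" using interior_unique[OF that(2) _ that(1), of L] by (auto simp: patch_def)
    then show ?thesis using L by simp
  qed
  have w'_in: "w' x = ?r v x" if v: "v \<in> V k" and K: "K \<in> patch \<T> v" and x: "x \<in> interior K" for v K x
  proof -
    have KT: "K \<in> \<T>" using K by (simp add: patch_def)
    have xo: "x \<in> open_elements (patch \<T> v)" using K x by (auto simp: open_elements_def)
    \<comment> \<open>A point of an open element determines that element, and disjoint patches then
      determine the pitched vertex.\<close>
    have "(THE u. u \<in> V k \<and> x \<in> open_elements (patch \<T> u)) = v"
    proof (rule the_equality)
      show "v \<in> V k \<and> x \<in> open_elements (patch \<T> v)" using v xo by blast
      fix u assume u: "u \<in> V k \<and> x \<in> open_elements (patch \<T> u)"
      then have "K \<in> patch \<T> u" using inK[OF x KT] by blast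
      then show "u = v" using V_disjoint[OF k, of u v] u v K by blast
    qed
    then show ?thesis using v xo unfolding w'_def layer_propagator_def by auto
  qed
  define R where "R = \<T> - (\<Union>v\<in>V k. patch \<T> v)"
  have w'_out: "w' x = w x" if K: "K \<in> R" and x: "x \<in> interior K" for K x
  proof -
    have "\<not> (\<exists>v\<in>V k. x \<in> open_elements (patch \<T> v))" using inK[OF x] K by (auto simp: R_def)
    then show ?thesis unfolding w'_def layer_propagator_def by auto
  qed
  have split: "\<T> = R \<union> (\<Union>v\<in>V k. patch \<T> v)" by (auto simp: R_def patch_def)
  have tent: "(\<forall>K\<in>patch \<T> v. l2_on (interior K) (?r v)) \<and>
      (\<Sum>K\<in>patch \<T> v. element_energy k (?r v) K) \<le> (\<Sum>K\<in>patch \<T> v. element_energy (k - 1) w K)" if v: "v \<in> V k" for v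
  proof -
    obtain \<kappa> where t: "tent \<Omega> \<T> v \<G> \<L> S B (\<phi> (k - 1)) (\<phi> k) \<kappa>" using tent_at[OF k v] by blast
    interpret t: tent \<Omega> \<T> v p \<G> \<L> S B "\<phi> (k - 1)" "\<phi> k" \<kappa> by (rule t)
    have wt: "l2_on (interior K) w" if "K \<in> patch \<T> v" for K using w that by (simp add: patch_def)
    note st = t.tent_stability[OF wt]
    have mK: "interior K \<in> sets lebesgue" for K :: "(real^'n) set" by (intro sets_completionI_sets) simp
    have xT: "x \<in> open_elements \<T>" if "K \<in> patch \<T> v" "x \<in> interior K" for K x
      using that by (auto simp: open_elements_def patch_def)
    have ends: "M_op \<G> \<L> (\<phi> (k - 1)) (\<phi> k) 1 x = front_matrix k x" "M_op \<G> \<L> (\<phi> (k - 1)) (\<phi> k) 0 x = front_matrix (k - 1) x"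
      if "K \<in> patch \<T> v" "x \<in> interior K" for K x unfolding M_op_fronts[OF k xT[OF that]] by simp_all
    have "(LINT x:interior K|lebesgue. (M_op \<G> \<L> (\<phi> (k - 1)) (\<phi> k) 1 x *v ?r v x) \<bullet> ?r v x) = element_energy k (?r v) K"
      if "K \<in> patch \<T> v" for K
      unfolding element_energy_def by (intro set_lebesgue_integral_cong mK allI impI) (simp only: ends[OF that])
    moreover have "(LINT x:interior K|lebesgue. (M_op \<G> \<L> (\<phi> (k - 1)) (\<phi> k) 0 x *v w x) \<bullet> w x) = element_energy (k - 1) w K"
      if "K \<in> patch \<T> v" for K
      unfolding element_energy_def by (intro set_lebesgue_integral_cong mK allI impI) (simp only: ends[OF that])
    ultimately show ?thesis using st t.dg_l2_on[OF st(1)] by simp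
  qed
  have cong: "element_energy k w' K = element_energy k y K" if "\<And>x. x \<in> interior K \<Longrightarrow> w' x = y x" for K y
  proof -
    have "interior K \<in> sets lebesgue" by (intro sets_completionI_sets) simp
    then show ?thesis unfolding element_energy_def using that by (intro set_lebesgue_integral_cong) auto
  qed
  show "l2_on (interior K) w'" if K: "K \<in> \<T>"
  proof (cases "K \<in> R")
    case True
    then show ?thesis using l2_on_cong[of "interior K" w' w] w'_out w[OF K] by blast
  next
    case False
    then obtain v where v: "v \<in> V k" "K \<in> patch \<T> v" using K split by blast
    then show ?thesis using l2_on_cong[of "interior K" w' "?r v"] w'_in[OF v] tent[OF v(1)] by blast
  qed
  have out: "element_energy k w' K = element_energy (k - 1) w K" if K: "K \<in> R" for K
  proof -
    have KT: "K \<in> \<T>" using K by (simp add: R_def)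
    obtain C where C: "K = convex hull C" "\<And>y. y extreme_point_of K \<longleftrightarrow> y \<in> C"
      using simplex_vertices[OF element(1)[OF KT]] by metis
    have "C \<inter> V k = {}"
    proof (rule ccontr)
      assume "C \<inter> V k \<noteq> {}"
      then obtain y where "y \<in> C" "y \<in> V k" by blast
      then show False using K KT C(2) by (auto simp: R_def patch_def)
    qed
    then have eq: "\<phi> k x = \<phi> (k - 1) x" if "x \<in> K" for x
      using delta_zero_off_pitch[OF k KT C order_refl] that C(1) by blast
    obtain b a where b: "\<And>x. x \<in> K \<Longrightarrow> \<phi> k x = b \<bullet> x + a" using phi_affine[OF k(2) KT] by blast
    then have b': "\<And>x. x \<in> K \<Longrightarrow> \<phi> (k - 1) x = b \<bullet> x + a" using eq by simp
    have "front_matrix k x = front_matrix (k - 1) x" if "x \<in> interior K" for x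
      using affine_partial[OF b that] affine_partial[OF b' that] by (simp add: M0_def)
    moreover have "interior K \<in> sets lebesgue" by (intro sets_completionI_sets) simp
    ultimately have "element_energy k w K = element_energy (k - 1) w K"
      unfolding element_energy_def by (intro set_lebesgue_integral_cong) auto
    then show ?thesis using cong[of K w] w'_out[OF K] by simp
  qed
  have fV: "finite (V k)" using V_vertices[OF k] finite_vertices finite_subset by blast
  have fp: "finite (patch \<T> v)" for v using finite_mesh by (simp add: patch_def)
  have sums: "(\<Sum>K\<in>\<T>. f K) = (\<Sum>K\<in>R. f K) + (\<Sum>v\<in>V k. \<Sum>K\<in>patch \<T> v. f K)" for f :: "(real^'n) set \<Rightarrow> real"
  proof -
    have "(\<Sum>K\<in>\<T>. f K) = (\<Sum>K\<in>R \<union> (\<Union>v\<in>V k. patch \<T> v). f K)" using split by metis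
    also have "\<dots> = (\<Sum>K\<in>R. f K) + (\<Sum>K\<in>(\<Union>v\<in>V k. patch \<T> v). f K)"
      using finite_mesh fV fp by (intro sum.union_disjoint) (auto simp: R_def)
    also have "(\<Sum>K\<in>(\<Union>v\<in>V k. patch \<T> v). f K) = (\<Sum>v\<in>V k. \<Sum>K\<in>patch \<T> v. f K)"
      using fV fp V_disjoint[OF k] by (intro sum.UNION_disjoint) auto
    finally show ?thesis .
  qed
  have patches: "(\<Sum>K\<in>patch \<T> v. element_energy k w' K) \<le> (\<Sum>K\<in>patch \<T> v. element_energy (k - 1) w K)" if v: "v \<in> V k" for v
  proof -
    have "(\<Sum>K\<in>patch \<T> v. element_energy k w' K) = (\<Sum>K\<in>patch \<T> v. element_energy k (?r v) K)"
      by (intro sum.cong refl cong) (rule w'_in[OF v])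
    then show ?thesis using tent[OF v] by simp
  qed
  show "(\<Sum>K\<in>\<T>. element_energy k w' K) \<le> (\<Sum>K\<in>\<T>. element_energy (k - 1) w K)"
    unfolding sums
  proof (rule add_mono)
    show "(\<Sum>K\<in>R. element_energy k w' K) \<le> (\<Sum>K\<in>R. element_energy (k - 1) w K)"
      by (intro sum_mono eq_refl out)
    show "(\<Sum>v\<in>V k. \<Sum>K\<in>patch \<T> v. element_energy k w' K) \<le> (\<Sum>v\<in>V k. \<Sum>K\<in>patch \<T> v. element_energy (k - 1) w K)"
      by (intro sum_mono[of "V k"] patches)
  qed
qed

lemma propagator_step:
  assumes "j \<le> k"
  shows "propagator \<Omega> \<T> p \<G> \<L> S B \<phi> V (Suc k) j w =
    layer_propagator \<Omega> \<T> p \<G> \<L> S B (\<phi> k) (\<phi> (Suc k)) (V (Suc k)) (propagator \<Omega> \<T> p \<G> \<L> S B \<phi> V k j w)"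
proof -
  have "[j + 1..<Suc k + 1] = [j + 1..<k + 1] @ [Suc k]" using assms by simp
  then show ?thesis unfolding propagator_def by simp
qed

lemma propagator_stability:
  assumes w: "\<And>K. K \<in> \<T> \<Longrightarrow> l2_on (interior K) w" and "j \<le> i" "i \<le> m"
  shows "front_norm \<Omega> \<G> \<L> (\<phi> i) (propagator \<Omega> \<T> p \<G> \<L> S B \<phi> V i j w) \<le> front_norm \<Omega> \<G> \<L> (\<phi> j) w"
proof -
  let ?P = "\<lambda>k. propagator \<Omega> \<T> p \<G> \<L> S B \<phi> V k j w"
  \<comment> \<open>Square integrability on elements is carried through the induction together with
    the energy bound, since the projection in the next layer requires it.\<close>
  have "(\<forall>K\<in>\<T>. l2_on (interior K) (?P i)) \<and> (\<Sum>K\<in>\<T>. element_energy i (?P i) K) \<le> (\<Sum>K\<in>\<T>. element_energy j w K)"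
    using \<open>j \<le> i\<close> \<open>i \<le> m\<close>
  proof (induction rule: dec_induct)
    case base
    show ?case using w by (simp add: propagator_def)
  next
    case (step k)
    then have IH: "\<And>K. K \<in> \<T> \<Longrightarrow> l2_on (interior K) (?P k)" "(\<Sum>K\<in>\<T>. element_energy k (?P k) K) \<le> (\<Sum>K\<in>\<T>. element_energy j w K)"
      by auto
    have k: "1 \<le> Suc k" "Suc k \<le> m" using step.prems by auto
    show ?case
      using layer_step[OF k IH(1)] IH(2) unfolding propagator_step[OF step.hyps(1)] by auto
  qed
  then show ?thesis
    using front_norm_eq[of i "?P i"] front_norm_eq[of j w] w assms(2,3) by simp
qed

end

theorem lemma3p11:
  fixes \<Omega> :: "(real^'n::finite) set"
    and \<T> :: "(real^'n) set set"
    and \<G> :: "real^'n \<Rightarrow> real^'l^'l::finite"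
    and \<L> :: "'n \<Rightarrow> real^'n \<Rightarrow> real^'l^'l"
    and S B :: "real^'n \<Rightarrow> real^'l^'l"
    and \<phi> :: "nat \<Rightarrow> real^'n \<Rightarrow> real"
    and V :: "nat \<Rightarrow> (real^'n) set"
    and m p i j :: nat
    and T chat :: real
    and w :: "real^'n \<Rightarrow> real^'l"
  assumes "open \<Omega>" and "bounded \<Omega>" and "conforming_mesh \<Omega> \<T>"
    and L_bounded: "\<And>k. bounded (\<L> k ` open_elements \<T>)"
    and L_symmetric: "\<And>k x. x \<in> open_elements \<T> \<Longrightarrow> transpose (\<L> k x) = \<L> k x"
    and L_constant: "\<And>k. elementwise_constant \<T> (\<L> k)"
    and L_divergence: "divergence_free \<Omega> \<L>"
    and G_bounded: "bounded (\<G> ` open_elements \<T>)"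
    and G_symmetric: "\<And>x. x \<in> open_elements \<T> \<Longrightarrow> transpose (\<G> x) = \<G> x"
    and G_constant: "elementwise_constant \<T> \<G>"
    and G_definite: "\<exists>\<gamma>>0. \<forall>x\<in>open_elements \<T>. \<forall>e. \<gamma> * (norm e)\<^sup>2 \<le> (\<G> x *v e) \<bullet> e"
    and S_bounded: "bounded (S ` (skeleton \<T> \<inter> \<Omega>))"
    and S_measurable: "S \<in> borel_measurable (restrict_space borel (skeleton \<T> \<inter> \<Omega>))"
    and S_semidef: "\<And>x. x \<in> skeleton \<T> \<inter> \<Omega> \<Longrightarrow> positive_semidef (S x + transpose (S x))"
    and B_bounded: "bounded (B ` frontier \<Omega>)"
    and B_measurable: "B \<in> borel_measurable (restrict_space borel (frontier \<Omega>))"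
    and B_semidef: "\<And>x. x \<in> frontier \<Omega> \<Longrightarrow> positive_semidef (B x + transpose (B x))"
    and speed: "max_wave_speed \<T> \<G> \<L> < chat"
    and phi_first: "\<And>x. x \<in> \<Omega> \<Longrightarrow> \<phi> 0 x = 0"
    and phi_last: "\<And>x. x \<in> \<Omega> \<Longrightarrow> \<phi> m x = T"
    and phi_mono: "\<And>k x. k < m \<Longrightarrow> x \<in> \<Omega> \<Longrightarrow> \<phi> k x \<le> \<phi> (Suc k) x"
    and phi_continuous: "\<And>k. k \<le> m \<Longrightarrow> continuous_on (closure \<Omega>) (\<phi> k)"
    and phi_linear: "\<And>k. k \<le> m \<Longrightarrow> piecewise_linear \<T> (\<phi> k)"
    and phi_causal: "\<And>k x. k \<le> m \<Longrightarrow> x \<in> open_elements \<T> \<Longrightarrow> norm (grad (\<phi> k) x) \<le> 1 / chat"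
    and V_vertices: "\<And>k. 1 \<le> k \<Longrightarrow> k \<le> m \<Longrightarrow> V k \<subseteq> mesh_vertices \<T>"
    and V_disjoint: "\<And>k v v'. 1 \<le> k \<Longrightarrow> k \<le> m \<Longrightarrow> v \<in> V k \<Longrightarrow> v' \<in> V k \<Longrightarrow> v \<noteq> v' \<Longrightarrow>
                        patch \<T> v \<inter> patch \<T> v' = {}"
    and phi_pitch: "\<And>k v. 1 \<le> k \<Longrightarrow> k \<le> m \<Longrightarrow> v \<in> mesh_vertices \<T> - V k \<Longrightarrow> \<phi> k v = \<phi> (k - 1) v"
    and "j < i" and "i \<le> m"
    and "square_integrable \<Omega> w"
  shows "front_norm \<Omega> \<G> \<L> (\<phi> i) (propagator \<Omega> \<T> p \<G> \<L> S B \<phi> V i j w)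
         \<le> front_norm \<Omega> \<G> \<L> (\<phi> j) w"
proof -
  interpret fronts \<Omega> \<T> p \<G> \<L> S B \<phi> V m chat
    using assms by unfold_locales
  have "l2_on (interior K) w" if "K \<in> \<T>" for K
    using \<open>square_integrable \<Omega> w\<close> element(4)[OF that]
    by (intro l2_on_subset[OF \<open>open \<Omega>\<close>]) (auto intro: sets_completionI_sets)
  then show ?thesis
    using \<open>j < i\<close> \<open>i \<le> m\<close> by (intro propagator_stability) auto
qed

end
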